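(* Let $\Omega\subset\mathbb{R}^d$ be open and bounded with smooth boundary, let $\gamma>1$, and let $k\in\mathbb{N}$ be fixed with $2k>\frac d2+2$. Let $V,\phi,h\in C^\infty(\overline\Omega)$, $g\in C^\infty([0,\infty))$, $H\in C^\infty(\overline\Omega\times\mathbb{R}^d)$, with $g$ increasing, $\phi\geq 0$ in $\Omega$, and $\int_\Omega\phi\,dx=1$. Suppose that: (1) there is $C_1>0$ such that for all $(x,p)\in\Omega\times\mathbb{R}^d$: $-H(x,p)+D_pH(x,p)\cdot p\geq\frac1{C_1}|p|^\gamma-C_1$; (2) there is $C_2>0$ such that for all $(x,p)\in\Omega\times\mathbb{R}^d$: $H(x,p)\geq\frac1{C_2}|p|^\gamma-C_2$; (3) there is $C_3>0$ such that for all $(x,p)\in\Omega\times\mathbb{R}^d$: $|D_pH(x,p)|\leq C_3|p|^{\gamma-1}+C_3$; (4) for all $\delta>0$ there is $C_\delta>0$ such that for all $m\in L^1(\Omega)$ with $m\ge0$: $\max\{\int_\Omega|g(m)|\,dx,\int_\Omega m\,dx\}\leq\delta\int_\Omega m g(m)\,dx+C_\delta$; (5) there is $C_5>0$ such that for all $m\in L^1(\Omega)$ with $m\ge0$: $\int_\Omega m g(m)\,dx\geq -C_5$; (6) every sequence $\{m_j\}_{j\ge1}\subset L^1(\Omega)$ of nonnegative functions with $\sup_j\int_\Omega m_jg(m_j)\,dx<+\infty$ has a subsequence converging weakly in $L^1(\Omega)$; (7) for all $(\eta_1,v_1),(\eta_2,v_2)\in\mathcal{A}\times H^{2k}_h(\Omega)$,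 $$\big\langle F[\eta_1,v_1]-F[\eta_2,v_2],\,(\eta_1,v_1)-(\eta_2,v_2)\big\rangle\geq0 .$$ Then there exists a weak solution $(m,u)\in L^1(\Omega)\times W^{1,\gamma}(\Omega)$ of the mean-field game $$\begin{cases}-u-H(x,Du)+g(m)-V(x)=0&\text{in }\Omega,\\ m-\operatorname{div}\big(mD_pH(x,Du)\big)-\phi=0&\text{in }\Omega,\\ u=h&\text{on }\partial\Omega,\end{cases}$$ that is, a pair $(m,u)\in L^1(\Omega)\times W^{1,\gamma}(\Omega)$ such that $u=h$ on $\partial\Omega$ in the sense of traces, $m\geq0$ in $\Omega$, and $$\big\langle F[\eta,v],\,(\eta,v)-(m,u)\big\rangle\geq0\quad\text{for all }(\eta,v)\in\mathcal{A}\times H^{2k}_h(\Omega).$$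
   Context: $\mathcal{A}:=\{m\in H^{2k}(\Omega): m\geq0\}$ and $H^{2k}_h(\Omega):=\{w\in H^{2k}(\Omega): w-h\in H^{2k}_0(\Omega)\}$. Since $2k>\frac d2+2$, $H^{2k}(\Omega)$ embeds in $C^2(\overline\Omega)$. For fixed $(\eta,v)\in H^{2k}(\Omega)\times H^{2k}(\Omega)$ (with $\eta\ge 0$ so that $g(\eta)$ is defined), $F[\eta,v]:L^1(\Omega)\times L^1(\Omega)\to\mathbb{R}$ is the linear functional $$\big\langle F[\eta,v],(w_1,w_2)\big\rangle:=\int_\Omega\big(-v-H(x,Dv)+g(\eta)-V\big)w_1\,dx+\int_\Omega\Big(\eta-\operatorname{div}\big(\eta D_pH(x,Dv)\big)-\phi\Big)w_2\,dx.$$ $D_pH$ is the gradient of $H$ in its second variable. *)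

theory Defs
  imports "HOL-Analysis.Analysis"
begin

section \<open>Smooth functions and smooth domains\<close>

text \<open>A multi-index is encoded as a list of basis vectors: \<open>[i\<^sub>1, \<dots>, i\<^sub>r]\<close> stands for
  \<open>\<partial>\<^bsub>i\<^sub>1\<^esub> \<dots> \<partial>\<^bsub>i\<^sub>r\<^esub>\<close>, an operator of order \<open>r\<close>.\<close>

definition multi_indices :: "'a::euclidean_space list set" where
  "multi_indices = {\<alpha>. set \<alpha> \<subseteq> Basis}"

primrec iter_partial ::
  "'a::euclidean_space list \<Rightarrow> ('a \<Rightarrow> real) \<Rightarrow> 'a \<Rightarrow> real" where
  "iter_partial [] f = f"
| "iter_partial (i # \<alpha>) f = (\<lambda>x. frechet_derivative (iter_partial \<alpha> f) (at x) i)"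

definition gradient :: "('a::euclidean_space \<Rightarrow> real) \<Rightarrow> 'a \<Rightarrow> 'a" where
  "gradient f x = (\<Sum>i\<in>Basis. frechet_derivative f (at x) i *\<^sub>R i)"

text \<open>\<open>C\<^sup>\<infinity>(S)\<close>, for open \<open>S\<close>.\<close>

definition smooth_on :: "'a::euclidean_space set \<Rightarrow> ('a \<Rightarrow> real) \<Rightarrow> bool" where
  "smooth_on S f \<longleftrightarrow>
     (\<forall>\<alpha>\<in>multi_indices. \<forall>x\<in>S. iter_partial \<alpha> f differentiable (at x))"

text \<open>\<open>C\<^sup>\<infinity>\<close> of the closure of the open set \<open>S\<close>: all derivatives in \<open>S\<close> extend continuously to
  the closure, and the values of \<open>f\<close> itself on the boundary are those of its extension.\<close>

definition smooth_on_closure :: "'a::euclidean_space set \<Rightarrow> ('a \<Rightarrow> real) \<Rightarrow> bool" where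
  "smooth_on_closure S f \<longleftrightarrow> smooth_on S f \<and> continuous_on (closure S) f \<and>
     (\<forall>\<alpha>\<in>multi_indices. \<exists>G. continuous_on (closure S) G \<and> (\<forall>x\<in>S. G x = iter_partial \<alpha> f x))"

text \<open>Near each boundary point the set is the strict epigraph, in some direction \<open>e\<close>, of a smooth
  function of the component orthogonal to \<open>e\<close>.\<close>

definition smooth_boundary :: "'a::euclidean_space set \<Rightarrow> bool" where
  "smooth_boundary S \<longleftrightarrow>
     (\<forall>x0\<in>frontier S. \<exists>r>0. \<exists>e \<psi>. norm e = 1 \<and> smooth_on UNIV \<psi> \<and>
        S \<inter> ball x0 r = {x \<in> ball x0 r. x \<bullet> e > \<psi> (x - (x \<bullet> e) *\<^sub>R e)})"

definition test_function :: "'a::euclidean_space set \<Rightarrow> ('a \<Rightarrow> real) \<Rightarrow> bool" where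
  "test_function S \<psi> \<longleftrightarrow> smooth_on UNIV \<psi> \<and>
     compact (closure {x. \<psi> x \<noteq> 0}) \<and> closure {x. \<psi> x \<noteq> 0} \<subseteq> S"


section \<open>Lebesgue and Sobolev spaces\<close>

text \<open>Elements of these spaces are functions, not equivalence classes; everything below is
  insensitive to changes on null sets of the open set \<open>S\<close>.\<close>

definition Lp_space :: "real \<Rightarrow> 'a measure \<Rightarrow> ('a \<Rightarrow> real) set" where
  "Lp_space p M = {f \<in> borel_measurable M. integrable M (\<lambda>x. \<bar>f x\<bar> powr p)}"

definition L1_space :: "'a measure \<Rightarrow> ('a \<Rightarrow> real) set" where
  "L1_space M = {f. integrable M f}"

definition locally_integrable ::
  "'a::euclidean_space set \<Rightarrow> ('a \<Rightarrow> 'b::euclidean_space) \<Rightarrow> bool" where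
  "locally_integrable S f \<longleftrightarrow> (\<forall>K. compact K \<and> K \<subseteq> S \<longrightarrow> integrable (lebesgue_on K) f)"

definition is_weak_deriv ::
  "'a::euclidean_space set \<Rightarrow> 'a list \<Rightarrow> ('a \<Rightarrow> real) \<Rightarrow> ('a \<Rightarrow> real) \<Rightarrow> bool" where
  "is_weak_deriv S \<alpha> f f' \<longleftrightarrow> locally_integrable S f \<and> locally_integrable S f' \<and>
     (\<forall>\<psi>. test_function S \<psi> \<longrightarrow>
        (\<integral>x. f x * iter_partial \<alpha> \<psi> x \<partial>lebesgue_on S) =
        (- 1) ^ length \<alpha> * (\<integral>x. f' x * \<psi> x \<partial>lebesgue_on S))"

definition weak_deriv ::
  "'a::euclidean_space set \<Rightarrow> 'a list \<Rightarrow> ('a \<Rightarrow> real) \<Rightarrow> 'a \<Rightarrow> real" where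
  "weak_deriv S \<alpha> f = (SOME f'. is_weak_deriv S \<alpha> f f')"

definition weak_gradient :: "'a::euclidean_space set \<Rightarrow> ('a \<Rightarrow> real) \<Rightarrow> 'a \<Rightarrow> 'a" where
  "weak_gradient S f x = (\<Sum>i\<in>Basis. weak_deriv S [i] f x *\<^sub>R i)"

definition is_weak_div ::
  "'a::euclidean_space set \<Rightarrow> ('a \<Rightarrow> 'a) \<Rightarrow> ('a \<Rightarrow> real) \<Rightarrow> bool" where
  "is_weak_div S X f \<longleftrightarrow> locally_integrable S X \<and> locally_integrable S f \<and>
     (\<forall>\<psi>. test_function S \<psi> \<longrightarrow>
        (\<integral>x. X x \<bullet> gradient \<psi> x \<partial>lebesgue_on S) = - (\<integral>x. f x * \<psi> x \<partial>lebesgue_on S))"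

text \<open>For a field that agrees almost everywhere with a \<open>C\<^sup>1\<close> field this is, almost everywhere, the
  classical divergence of the latter.\<close>

definition weak_div :: "'a::euclidean_space set \<Rightarrow> ('a \<Rightarrow> 'a) \<Rightarrow> 'a \<Rightarrow> real" where
  "weak_div S X = (SOME f. is_weak_div S X f)"

text \<open>\<open>W\<^sup>l\<^sup>,\<^sup>p(S)\<close>\<close>

definition sobolev :: "'a::euclidean_space set \<Rightarrow> nat \<Rightarrow> real \<Rightarrow> ('a \<Rightarrow> real) set" where
  "sobolev S l p = {f \<in> Lp_space p (lebesgue_on S).
     \<forall>\<alpha>\<in>multi_indices. length \<alpha> \<le> l \<longrightarrow>
       (\<exists>f'\<in>Lp_space p (lebesgue_on S). is_weak_deriv S \<alpha> f f')}"

text \<open>Mixed derivatives are counted once for each ordering, which gives an equivalent norm.\<close>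

definition sobolev_norm ::
  "'a::euclidean_space set \<Rightarrow> nat \<Rightarrow> real \<Rightarrow> ('a \<Rightarrow> real) \<Rightarrow> real" where
  "sobolev_norm S l p f =
     (\<Sum>\<alpha> | \<alpha> \<in> multi_indices \<and> length \<alpha> \<le> l.
        \<integral>x. \<bar>weak_deriv S \<alpha> f x\<bar> powr p \<partial>lebesgue_on S) powr (1 / p)"

definition H_space :: "'a::euclidean_space set \<Rightarrow> nat \<Rightarrow> ('a \<Rightarrow> real) set" where
  "H_space S l = sobolev S l 2"

definition H0_space :: "'a::euclidean_space set \<Rightarrow> nat \<Rightarrow> ('a \<Rightarrow> real) set" where
  "H0_space S l = {f \<in> H_space S l. \<exists>\<psi>. (\<forall>n::nat. test_function S (\<psi> n)) \<and>
     (\<lambda>n. sobolev_norm S l 2 (\<lambda>x. \<psi> n x - f x)) \<longlonglongrightarrow> 0}"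

definition H_affine ::
  "'a::euclidean_space set \<Rightarrow> nat \<Rightarrow> ('a \<Rightarrow> real) \<Rightarrow> ('a \<Rightarrow> real) set" where
  "H_affine S l h = {w \<in> H_space S l. (\<lambda>x. w x - h x) \<in> H0_space S l}"

definition H_nonneg :: "'a::euclidean_space set \<Rightarrow> nat \<Rightarrow> ('a \<Rightarrow> real) set" where
  "H_nonneg S l = {m \<in> H_space S l. AE x in lebesgue_on S. m x \<ge> 0}"


section \<open>Surface measure and traces\<close>

text \<open>The normalisation is the one for which the \<open>s\<close>-dimensional measure of an \<open>s\<close>-dimensional
  surface is its area. The exponent is a natural number so that \<open>0 ^ 0 = 1\<close>, i.e. a point has
  zero-dimensional measure one. The diameter is only meaningful for bounded sets.\<close>

definition hausdorff_gauge :: "nat \<Rightarrow> 'a::euclidean_space set \<Rightarrow> ennreal" where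
  "hausdorff_gauge s A =
     (if A = {} then 0 else ennreal (unit_ball_vol (real s) * (diameter A / 2) ^ s))"

definition hausdorff_outer :: "nat \<Rightarrow> 'a::euclidean_space set \<Rightarrow> ennreal" where
  "hausdorff_outer s A =
     (SUP \<delta>\<in>{0<..}. INF C\<in>{C :: nat \<Rightarrow> 'a set.
         A \<subseteq> (\<Union>i. C i) \<and> (\<forall>i. bounded (C i) \<and> diameter (C i) \<le> \<delta>)}.
       \<Sum>i. hausdorff_gauge s (C i))"

definition hausdorff_measure :: "nat \<Rightarrow> 'a::euclidean_space measure" where
  "hausdorff_measure s = measure_of UNIV (sets borel) (hausdorff_outer s)"

definition surface_measure :: "'a::euclidean_space set \<Rightarrow> 'a measure" where
  "surface_measure S = restrict_space (hausdorff_measure (DIM('a) - 1)) (frontier S)"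

text \<open>\<open>u \<in> W\<^sup>1\<^sup>,\<^sup>p(S)\<close> has trace \<open>\<tau>\<close> on the boundary: the trace operator
  \<open>W\<^sup>1\<^sup>,\<^sup>p(S) \<rightarrow> L\<^sup>p(\<partial>S)\<close> is the continuous extension of the restriction operator, defined on
  functions that are smooth up to the boundary.\<close>

definition has_trace ::
  "'a::euclidean_space set \<Rightarrow> real \<Rightarrow> ('a \<Rightarrow> real) \<Rightarrow> ('a \<Rightarrow> real) \<Rightarrow> bool" where
  "has_trace S p u \<tau> \<longleftrightarrow> u \<in> sobolev S 1 p \<and> \<tau> \<in> Lp_space p (surface_measure S) \<and>
     (\<exists>w. (\<forall>n::nat. smooth_on_closure S (w n)) \<and>
        (\<lambda>n. sobolev_norm S 1 p (\<lambda>x. w n x - u x)) \<longlonglongrightarrow> 0 \<and>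
        (\<lambda>n. \<integral>x. \<bar>w n x - \<tau> x\<bar> powr p \<partial>surface_measure S) \<longlonglongrightarrow> 0)"


section \<open>Integrals and weak convergence in \<open>L\<^sup>1\<close>\<close>

text \<open>The integral with values in the extended reals, for integrands such as \<open>m g(m)\<close> whose
  negative part is integrable but whose positive part may not be. (The Bochner integral would be
  0 in that case.)\<close>

definition ext_integral :: "'a measure \<Rightarrow> ('a \<Rightarrow> real) \<Rightarrow> ereal" where
  "ext_integral M f =
     enn2ereal (\<integral>\<^sup>+x. ennreal (f x) \<partial>M) - enn2ereal (\<integral>\<^sup>+x. ennreal (- f x) \<partial>M)"

definition bounded_functional_L1 :: "'a measure \<Rightarrow> (('a \<Rightarrow> real) \<Rightarrow> real) \<Rightarrow> bool" where
  "bounded_functional_L1 M \<Lambda> \<longleftrightarrow>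
     (\<forall>f\<in>L1_space M. \<forall>g\<in>L1_space M. \<Lambda> (\<lambda>x. f x + g x) = \<Lambda> f + \<Lambda> g) \<and>
     (\<forall>c. \<forall>f\<in>L1_space M. \<Lambda> (\<lambda>x. c * f x) = c * \<Lambda> f) \<and>
     (\<exists>C. \<forall>f\<in>L1_space M. \<bar>\<Lambda> f\<bar> \<le> C * (\<integral>x. \<bar>f x\<bar> \<partial>M))"

definition weakly_converges_L1 ::
  "'a measure \<Rightarrow> (nat \<Rightarrow> 'a \<Rightarrow> real) \<Rightarrow> ('a \<Rightarrow> real) \<Rightarrow> bool" where
  "weakly_converges_L1 M f f0 \<longleftrightarrow> (\<forall>j. f j \<in> L1_space M) \<and> f0 \<in> L1_space M \<and>
     (\<forall>\<Lambda>. bounded_functional_L1 M \<Lambda> \<longrightarrow> (\<lambda>j. \<Lambda> (f j)) \<longlonglongrightarrow> \<Lambda> f0)"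


section \<open>The mean-field game operator\<close>

text \<open>\<open>mfg_F S H g V \<phi> \<eta> v w1 w2\<close> is the pairing of \<open>F[\<eta>, v]\<close> with \<open>(w1, w2)\<close>; the gradient of
  \<open>H\<close> in its second variable is \<open>gradient (H x)\<close>.\<close>

definition mfg_F ::
  "'a::euclidean_space set \<Rightarrow> ('a \<Rightarrow> 'a \<Rightarrow> real) \<Rightarrow> (real \<Rightarrow> real) \<Rightarrow> ('a \<Rightarrow> real) \<Rightarrow> ('a \<Rightarrow> real)
    \<Rightarrow> ('a \<Rightarrow> real) \<Rightarrow> ('a \<Rightarrow> real) \<Rightarrow> ('a \<Rightarrow> real) \<Rightarrow> ('a \<Rightarrow> real) \<Rightarrow> real" where
  "mfg_F S H g V \<phi> \<eta> v w1 w2 =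
     (\<integral>x. (- v x - H x (weak_gradient S v x) + g (\<eta> x) - V x) * w1 x \<partial>lebesgue_on S) +
     (\<integral>x. (\<eta> x - weak_div S (\<lambda>y. \<eta> y *\<^sub>R gradient (H y) (weak_gradient S v y)) x - \<phi> x) * w2 x
        \<partial>lebesgue_on S)"

end

theory Submission
 imports Defs
begin

text \<open>Elements of \<open>H\<^sup>2\<^sup>k\<close> and their weak derivatives up to order \<open>2\<close> are essentially bounded, so on
 test pairs \<open>z = (\<eta>, v)\<close> the operator \<open>F\<close> is given by bounded functions, and monotonicity is only used on the
 convex hulls of finitely many pairs: on each simplex a minimax argument yields a Minty solution of the
 variational inequality. Moving that solution slightly towards the reference pair \<open>(1, h)\<close> turns the
 Minty inequality into \<open>F[z](1 - \<eta>, h - v) \<ge> 0\<close> at the new point \<open>z\<close> without any continuity of \<open>F\<close>,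
 and at such points (1)-(5) bound \<open>\<integral> \<eta> g(\<eta>)\<close> and \<open>\<integral> |Dv|\<^sup>\<gamma>\<close>.

 The inequality for a fixed test pair is affine in the unknown, with bounded coefficients, and these
 coefficients form a separable set in \<open>L\<^sup>1\<close>; hence countably many test pairs suffice. The densities
 converge weakly in \<open>L\<^sup>1\<close> by (6). For the value functions, near-minimisers of the uniformly convex energy
 \<open>\<Sum>\<^sub>i \<integral> |D\<^sub>i u|\<^sup>\<gamma>\<close> over the nested convex sets of approximate solutions form a Cauchy sequence; this gives
 strong convergence in \<open>W\<^sup>1\<^sup>,\<^sup>\<gamma>\<close> and the trace \<open>h\<close> without reflexivity.\<close>

text \<open>Order 2 is the right order because the divergence differentiates
  \<open>D_pH(x, Dv)\<close> once more; this is where \<open>2k > d/2 + 2\<close> is spent. Passing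
  to the limit is harmless since only the test pair enters \<open>F\<close> nonlinearly: neither
  \<open>g(m_j)\<close> nor \<open>Du_j\<close> has to converge inside a nonlinearity. The obstacle
  is the estimate. A Minty inequality evaluates \<open>F\<close> at the competitor, whereas the
  coercivity in \<open>A1\<close> and \<open>A2\<close> is visible only when \<open>F\<close> is
  evaluated at the unknown itself. On the segment from the Minty solution to the reference pair the
  displacements to its two ends are parallel, so one inequality yields the other by rescaling; the
  price is an error in the inequalities for the other test pairs, made to vanish by letting the step
  shrink as more pairs are imposed. In the reference pair, \<open>1\<close> splits
  \<open>(1 - \<eta>) g(\<eta>)\<close> into a coercive part and a part that \<open>A4\<close>
  absorbs, and \<open>h\<close> keeps the direction \<open>h - v\<close> in \<open>H0\<close>. Weak
  derivatives and divergences are fixed by \<open>SOME\<close>, so identities about them hold almost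
  everywhere and rest on the fundamental lemma.\<close>

abbreviation "pdiff f x \<equiv> frechet_derivative f (at x)"

section \<open>Smooth functions\<close>

text \<open>\<open>iter_partial\<close> differentiates the function as it is given, while a member
  of \<open>F\<close> is only known to agree with it on \<open>S\<close>; openness of
  \<open>S\<close> transfers each derivative to the representative in \<open>F\<close>. Proving
  smoothness of a composite thus reduces to exhibiting a family of differentiable functions stable
  under partial derivatives.\<close>

lemma iter_partial_family:
 assumes "open S"
  and diff: "\<And>f x. f \<in> F ==> x \<in> S ==> f differentiable (at x)"
  and part: "\<And>f i. f \<in> F ==> i \<in> Basis ==> \<exists>f'\<in>F. \<forall>x\<in>S. pdiff f x i = f' x"
  and "f \<in> F" and "a \<in> multi_indices"
 shows "\<exists>f'\<in>F. \<forall>x\<in>S. iter_partial a f x = f' x"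
 using `a \<in> multi_indices`
proof (induction a)
 case Nil
 then show ?case using `f \<in> F` by auto
next
 case (Cons i a)
 then have i: "i \<in> Basis" and "a \<in> multi_indices" by (auto simp: multi_indices_def)
 with Cons.IH obtain f1 where f1: "f1 \<in> F" "\<And>x. x \<in> S ==> iter_partial a f x = f1 x" by auto
 obtain f2 where f2: "f2 \<in> F" "\<And>x. x \<in> S ==> pdiff f1 x i = f2 x"
  using part[OF f1(1) i] by auto
 have "pdiff (iter_partial a f) x = pdiff f1 x" if "x \<in> S" for x
  using frechet_derivative_transform_within_open[OF diff[OF f1(1) that] `open S` that] f1(2)
  by metis
 then show ?case using f2 by auto
qed

lemma smooth_on_family:
 assumes "open S"
  and diff: "\<And>f x. f \<in> F ==> x \<in> S ==> f differentiable (at x)"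
  and part: "\<And>f i. f \<in> F ==> i \<in> Basis ==> \<exists>f'\<in>F. \<forall>x\<in>S. pdiff f x i = f' x"
  and "f \<in> F"
 shows "smooth_on S f"
 unfolding smooth_on_def
proof (intro ballI)
 fix a :: "'a list" and x
 assume a: "a \<in> multi_indices" and x: "x \<in> S"
 obtain f' where f': "f' \<in> F" "\<And>x. x \<in> S ==> iter_partial a f x = f' x"
  using iter_partial_family[OF assms a] by auto
 obtain D where "(f' has_derivative D) (at x)" using diff[OF f'(1) x] by (auto simp: differentiable_def)
 then have "(iter_partial a f has_derivative D) (at x)"
  by (rule has_derivative_transform_within_open[OF _ `open S` x]) (use f'(2) in auto)
 then show "iter_partial a f differentiable (at x)" by (auto simp: differentiable_def)
qed

lemma smooth_on_subset: "smooth_on T f ==> S \<subseteq> T ==> smooth_on S f"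
 by (auto simp: smooth_on_def)

lemma smooth_on_imp_differentiable: "smooth_on S f ==> x \<in> S ==> f differentiable (at x)"
 unfolding smooth_on_def multi_indices_def by (drule bspec[where x="[]"]) auto

lemma smooth_on_imp_continuous_on: "smooth_on S f ==> continuous_on S f"
 by (meson continuous_at_imp_continuous_on differentiable_imp_continuous_within smooth_on_imp_differentiable)

lemma iter_partial_append: "iter_partial (a @ \<beta>) f = iter_partial a (iter_partial \<beta> f)"
 by (induction a) auto

lemma smooth_on_iter_partial:
 assumes "smooth_on S f" "\<beta> \<in> multi_indices"
 shows "smooth_on S (iter_partial \<beta> f)"
 unfolding smooth_on_def
proof (intro ballI)
 fix a :: "'a list" and x assume "a \<in> multi_indices" "x \<in> S"
 then show "iter_partial a (iter_partial \<beta> f) differentiable at x"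
  using assms unfolding smooth_on_def iter_partial_append[symmetric] multi_indices_def by auto
qed

lemma smooth_on_partial:
 "smooth_on S f ==> i \<in> Basis ==> smooth_on S (\<lambda>x. pdiff f x i)"
 using smooth_on_iter_partial[of S f "[i]"] by (auto simp: multi_indices_def)

section \<open>Sums, products and affine substitutions of smooth functions\<close>

lemma frechet_derivative_add_at:
 assumes "f differentiable (at x)" "g differentiable (at x)"
 shows "pdiff (\<lambda>x. f x + g x) x = (\<lambda>h. pdiff f x h + pdiff g x h)"
 by (rule frechet_derivative_at[symmetric]) (intro derivative_intros assms[THEN iffD1[OF frechet_derivative_works]])

lemma frechet_derivative_mult_at:
 fixes f g :: "'a::euclidean_space \<Rightarrow> real"
 assumes "f differentiable (at x)" "g differentiable (at x)"
 shows "pdiff (\<lambda>x. f x * g x) x = (\<lambda>h. f x * pdiff g x h + pdiff f x h * g x)"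
 by (rule frechet_derivative_at[symmetric]) (intro derivative_intros assms[THEN iffD1[OF frechet_derivative_works]])

text \<open>A partial derivative of a product is no longer a single product, but sums of products
  are reproduced; the generated algebra is therefore a family to which
  \<open>smooth_on_family\<close> applies.\<close>

inductive_set smooth_algebra :: "'a::euclidean_space set \<Rightarrow> ('a \<Rightarrow> real) set" for S where
 base: "smooth_on S f ==> f \<in> smooth_algebra S"
| add: "f \<in> smooth_algebra S ==> g \<in> smooth_algebra S ==> (\<lambda>x. f x + g x) \<in> smooth_algebra S"
| mult: "f \<in> smooth_algebra S ==> g \<in> smooth_algebra S ==> (\<lambda>x. f x * g x) \<in> smooth_algebra S"

lemma smooth_algebra_differentiable:
 "f \<in> smooth_algebra S ==> x \<in> S ==> f differentiable (at x)"
 by (induction rule: smooth_algebra.induct) (auto intro: smooth_on_imp_differentiable derivative_intros)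

lemma smooth_algebra_partial:
 assumes "f \<in> smooth_algebra S" "i \<in> Basis"
 shows "\<exists>f'\<in>smooth_algebra S. \<forall>x\<in>S. pdiff f x i = f' x"
 using assms
proof (induction rule: smooth_algebra.induct)
 case (base f)
 then show ?case by (intro bexI[of _ "\<lambda>x. pdiff f x i"] smooth_algebra.base smooth_on_partial) auto
next
 case (add f g)
 then obtain f' g' where "f'\<in>smooth_algebra S" "\<forall>x\<in>S. pdiff f x i = f' x"
  "g'\<in>smooth_algebra S" "\<forall>x\<in>S. pdiff g x i = g' x" by auto
 then show ?case using add.hyps
  by (intro bexI[of _ "\<lambda>x. f' x + g' x"])
   (auto simp: frechet_derivative_add_at smooth_algebra_differentiable intro: smooth_algebra.intros)
next
 case (mult f g)
 then obtain f' g' where "f'\<in>smooth_algebra S" "\<forall>x\<in>S. pdiff f x i = f' x"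
  "g'\<in>smooth_algebra S" "\<forall>x\<in>S. pdiff g x i = g' x" by auto
 then show ?case using mult.hyps
  by (intro bexI[of _ "\<lambda>x. f x * g' x + f' x * g x"])
   (auto simp: frechet_derivative_mult_at smooth_algebra_differentiable intro: smooth_algebra.intros)
qed

lemma smooth_algebra_smooth: "open S ==> f \<in> smooth_algebra S ==> smooth_on S f"
 by (rule smooth_on_family[where F="smooth_algebra S"])
  (auto intro: smooth_algebra_differentiable smooth_algebra_partial)

lemma smooth_on_add: "open S ==> smooth_on S f ==> smooth_on S g ==> smooth_on S (\<lambda>x. f x + g x)"
 by (rule smooth_algebra_smooth[OF _ smooth_algebra.add[OF smooth_algebra.base smooth_algebra.base]])

lemma smooth_on_mult: "open S ==> smooth_on S f ==> smooth_on S g ==> smooth_on S (\<lambda>x. f x * g x)"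
 by (rule smooth_algebra_smooth[OF _ smooth_algebra.mult[OF smooth_algebra.base smooth_algebra.base]])

lemma smooth_on_inner_const: "open S ==> smooth_on S (\<lambda>x::'a::euclidean_space. x \<bullet> a + c)"
proof (rule smooth_on_family[where F="{(\<lambda>x. x \<bullet> a + c) |a c. True}"])
 fix f :: "'a \<Rightarrow> real" and x assume "f \<in> {(\<lambda>x. x \<bullet> a + c) |a c. True}"
 then show "f differentiable at x" by (auto intro!: derivative_intros)
next
 fix f :: "'a \<Rightarrow> real" and i :: 'a assume "f \<in> {(\<lambda>x. x \<bullet> a + c) |a c. True}" "i \<in> Basis"
 then obtain a c where f: "f = (\<lambda>x. x \<bullet> a + c)" by auto
 have "(f has_derivative (\<lambda>h. h \<bullet> a)) (at x)" for x
  unfolding f by (auto intro!: derivative_eq_intros)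
 then have *: "pdiff f x = (\<lambda>h. h \<bullet> a)" for x
  by (rule frechet_derivative_at[symmetric])
 show "\<exists>f'\<in>{(\<lambda>x. x \<bullet> a + c) |a c. True}. \<forall>x\<in>S. pdiff f x i = f' x"
  by (intro bexI[of _ "\<lambda>x. x \<bullet> 0 + i \<bullet> a"]) (auto simp: *, metis inner_zero_right add_0)
qed auto

lemma smooth_on_const: "open S ==> smooth_on S (\<lambda>x::'a::euclidean_space. c)"
 using smooth_on_inner_const[of S 0 c] by simp

lemma smooth_on_cmult: "open S ==> smooth_on S f ==> smooth_on S (\<lambda>x. c * f x)"
 by (intro smooth_on_mult smooth_on_const)

lemma smooth_on_diff: "open S ==> smooth_on S f ==> smooth_on S g ==> smooth_on S (\<lambda>x. f x - g x)"
 using smooth_on_add[of S f "\<lambda>x. (-1) * g x"] smooth_on_cmult[of S g "-1"] by simp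

lemma smooth_on_sum:
 "open S ==> (\<And>i. i \<in> I ==> smooth_on S (f i)) ==> smooth_on S (\<lambda>x. \<Sum>i\<in>I. f i x)"
 by (induction I rule: infinite_finite_induct) (auto intro: smooth_on_const smooth_on_add)

lemma frechet_derivative_affine:
 fixes f :: "'a::euclidean_space \<Rightarrow> real"
 assumes "f differentiable (at (c *\<^sub>R x + b))"
 shows "((\<lambda>z. f (c *\<^sub>R z + b)) has_derivative (\<lambda>h. c * pdiff f (c *\<^sub>R x + b) h)) (at x)"
proof -
 note D = iffD1[OF frechet_derivative_works, OF assms]
 have "((\<lambda>z. c *\<^sub>R z + b) has_derivative (\<lambda>h. c *\<^sub>R h)) (at x)"
  by (auto intro!: derivative_eq_intros)
 from has_derivative_compose[OF this D] show ?thesis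
  using has_derivative_bounded_linear[OF D] by (simp add: linear_simps)
qed

text \<open>The scalar \<open>k\<close> in the family absorbs the factor \<open>c\<close> that each
  differentiation brings out.\<close>

lemma smooth_on_affine:
 fixes f :: "'a::euclidean_space \<Rightarrow> real"
 assumes "smooth_on UNIV f"
 shows "smooth_on UNIV (\<lambda>z. f (c *\<^sub>R z + b))"
proof (rule smooth_on_family[where F="{(\<lambda>z. k * f (c *\<^sub>R z + b)) |k f. smooth_on UNIV f}"])
 fix g :: "'a \<Rightarrow> real" and x assume "g \<in> {(\<lambda>z. k * f (c *\<^sub>R z + b)) |k f. smooth_on UNIV f}"
 then obtain k f where "g = (\<lambda>z. k * f (c *\<^sub>R z + b))" and f: "smooth_on UNIV f" by blast
 moreover have "(\<lambda>z. f (c *\<^sub>R z + b)) differentiable at x"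
  using frechet_derivative_affine[OF smooth_on_imp_differentiable[OF f UNIV_I]]
  unfolding differentiable_def by blast
 ultimately show "g differentiable at x" by (auto intro!: derivative_intros)
next
 fix g :: "'a \<Rightarrow> real" and i :: 'a assume "g \<in> {(\<lambda>z. k * f (c *\<^sub>R z + b)) |k f. smooth_on UNIV f}" and i: "i \<in> Basis"
 then obtain k f where g: "g = (\<lambda>z. k * f (c *\<^sub>R z + b))" and f: "smooth_on UNIV f" by blast
 have "(g has_derivative (\<lambda>h. k * (c * pdiff f (c *\<^sub>R x + b) h))) (at x)" for x
  unfolding g by (intro derivative_intros frechet_derivative_affine smooth_on_imp_differentiable[OF f UNIV_I])
 then have *: "pdiff g x = (\<lambda>h. k * (c * pdiff f (c *\<^sub>R x + b) h))" for x
  by (rule frechet_derivative_at[symmetric])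
 show "\<exists>f'\<in>{(\<lambda>z. k * f (c *\<^sub>R z + b)) |k f. smooth_on UNIV f}. \<forall>x\<in>UNIV. pdiff g x i = f' x"
  using smooth_on_partial[OF f i]
  by (intro bexI[of _ "\<lambda>z. (k * c) * pdiff f (c *\<^sub>R z + b) i"]) (auto simp: *)
next
 show "(\<lambda>z. f (c *\<^sub>R z + b)) \<in> {(\<lambda>z. k * f (c *\<^sub>R z + b)) |k f. smooth_on UNIV f}"
  using assms by (intro CollectI exI[of _ 1] exI[of _ f]) auto
qed auto

lemma iter_partial_add:
 assumes "open S" "smooth_on S f" "smooth_on S g" "a \<in> multi_indices" "x \<in> S"
 shows "iter_partial a (\<lambda>x. f x + g x) x = iter_partial a f x + iter_partial a g x"
 using assms(4,5)
proof (induction a arbitrary: x)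
 case (Cons i a)
 then have a: "a \<in> multi_indices" by (auto simp: multi_indices_def)
 have d: "iter_partial a f differentiable at x" "iter_partial a g differentiable at x"
  using assms(2,3) a Cons.prems by (auto simp: smooth_on_def)
 then have "(\<lambda>x. iter_partial a f x + iter_partial a g x) differentiable at x"
  by (auto intro: derivative_intros)
 from frechet_derivative_transform_within_open[OF this `open S` `x \<in> S`, of "iter_partial a (\<lambda>x. f x + g x)"]
 have "pdiff (iter_partial a (\<lambda>x. f x + g x)) x = pdiff (\<lambda>x. iter_partial a f x + iter_partial a g x) x"
  using Cons.IH[OF a] by auto
 then show ?case using frechet_derivative_add_at[OF d] by simp
qed auto

lemma iter_partial_eq_0:
 assumes "open S" "\<And>x. x \<in> S ==> f x = 0" "x \<in> S"
 shows "iter_partial a f x = 0"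
 using assms(3)
proof (induction a arbitrary: x)
 case (Cons i a)
 have "((\<lambda>x. 0) has_derivative (\<lambda>h. 0)) (at x)" by auto
 then have "(iter_partial a f has_derivative (\<lambda>h. 0)) (at x)"
  by (rule has_derivative_transform_within_open[OF _ `open S` `x \<in> S`]) (use Cons.IH in auto)
 then show ?case by (auto dest!: frechet_derivative_at[symmetric])
qed (use assms in auto)

subsection \<open>A bump function\<close>

text \<open>The factor \<open>1 / t ^ n\<close> closes the family under differentiation: the
  derivative of a member is a combination of those of index \<open>n + 1\<close> and
  \<open>n + 2\<close>.\<close>

definition flat_exp :: "nat \<Rightarrow> real \<Rightarrow> real" where
 "flat_exp n t = (if t > 0 then exp (- 1 / t) / t ^ n else 0)"

lemma power_le_fact_exp:
 fixes s :: real assumes "s \<ge> 0" shows "s ^ k \<le> fact k * exp s"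
proof -
 have "s ^ k / fact k \<le> (\<Sum>n. s ^ n /\<^sub>R fact n)"
  using sum_le_suminf[OF summable_exp_generic[of s], of "{k}"] assms
  by (auto simp: divide_inverse mult.commute)
 then show ?thesis by (simp add: exp_def field_simps)
qed

text \<open>A single term of the exponential series at \<open>1 / t\<close>, the one of degree
  \<open>n + 2\<close>, already dominates \<open>1 / t ^ n\<close> with two powers of
  \<open>t\<close> to spare. The quadratic bound is what makes the derivative at \<open>0\<close>
  vanish, from both sides at once.\<close>

lemma flat_exp_bound: "\<bar>flat_exp n t\<bar> \<le> fact (n + 2) * t\<^sup>2"
proof (cases "t > 0")
 case True
 have "(1 / t) ^ (n + 2) \<le> fact (n + 2) * exp (1 / t)"
  using True by (intro power_le_fact_exp) auto
 moreover have "(1 / t) ^ (n + 2) = 1 / (t ^ n * t\<^sup>2)"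
  by (simp add: power_one_over power_add power2_eq_square mult_ac)
 ultimately have "1 / (t ^ n * t\<^sup>2) \<le> fact (n + 2) * exp (1 / t)" by metis
 then have "exp (- 1 / t) / t ^ n \<le> fact (n + 2) * t\<^sup>2"
  using True by (simp add: field_simps exp_minus)
 then show ?thesis using True by (simp add: flat_exp_def)
qed (simp add: flat_exp_def)

lemma flat_exp_deriv:
 "(flat_exp n has_real_derivative flat_exp (n + 2) t - real n * flat_exp (n + 1) t) (at t)"
proof -
 consider "t > 0" | "t < 0" | "t = 0" by linarith
 then show ?thesis
 proof cases
  case 1
  have "((\<lambda>t. exp (- 1 / t) / t ^ n) has_real_derivative exp (- 1 / t) / t ^ (n + 2) - real n * (exp (- 1 / t) / t ^ (n + 1))) (at t)"
  proof -
   have "((\<lambda>t. exp (- 1 / t)) has_real_derivative exp (- 1 / t) / t\<^sup>2) (at t)"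
    using 1 by (auto intro!: derivative_eq_intros simp: power2_eq_square)
   from DERIV_divide[OF this DERIV_pow[of n t UNIV]]
   have "((\<lambda>t. exp (- 1 / t) / t ^ n) has_real_derivative
     (exp (- 1 / t) / t\<^sup>2 * t ^ n - exp (- 1 / t) * (real n * t ^ (n - Suc 0))) / (t ^ n * t ^ n)) (at t)"
    using 1 by simp
   moreover have "(exp (- 1 / t) / t\<^sup>2 * t ^ n - exp (- 1 / t) * (real n * t ^ (n - Suc 0))) / (t ^ n * t ^ n)
     = exp (- 1 / t) / t ^ (n + 2) - real n * (exp (- 1 / t) / t ^ (n + 1))"
    using 1 by (cases n) (simp_all add: field_simps power2_eq_square)
   ultimately show ?thesis by simp
  qed
  then have "((\<lambda>t. exp (- 1 / t) / t ^ n) has_real_derivative flat_exp (n + 2) t - real n * flat_exp (n + 1) t) (at t)"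
   using 1 by (simp add: flat_exp_def)
  then show ?thesis
   by (rule DERIV_cong_ev[THEN iffD1, rotated 3])
    (use 1 in \<open>auto simp: flat_exp_def eventually_nhds intro!: exI[of _ "{0<..}"]\<close>)
 next
  case 2
  have "((\<lambda>t. 0) has_real_derivative flat_exp (n + 2) t - real n * flat_exp (n + 1) t) (at t)"
   using 2 by (simp add: flat_exp_def)
  then show ?thesis
   by (rule DERIV_cong_ev[THEN iffD1, rotated 3])
    (use 2 in \<open>auto simp: flat_exp_def eventually_nhds intro!: exI[of _ "{..<0}"]\<close>)
 next
  case 3
  have "(flat_exp n has_real_derivative 0) (at 0)"
   unfolding has_field_derivative_iff
  proof (rule Lim_null_comparison)
   show "\<forall>\<^sub>F h in at 0. norm ((flat_exp n h - flat_exp n 0) / (h - 0)) \<le> fact (n + 2) * \<bar>h\<bar>"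
   proof (rule eventually_at_filter[THEN iffD2], rule always_eventually, safe)
    fix h :: real assume "h \<noteq> 0"
    then show "norm ((flat_exp n h - flat_exp n 0) / (h - 0)) \<le> fact (n + 2) * \<bar>h\<bar>"
     using flat_exp_bound[of n h]
     by (simp add: flat_exp_def[of n 0] field_simps power2_eq_square abs_mult del: fact_Suc)
   qed
   show "(\<lambda>h. fact (n + 2) * \<bar>h\<bar>) \<midarrow>0\<rightarrow> (0::real)" by (auto intro!: tendsto_eq_intros)
  qed
  then show ?thesis using 3 by (simp add: flat_exp_def)
 qed
qed

text \<open>The coefficients \<open>p\<close> range over all smooth functions because the chain rule
  brings out partial derivatives of \<open>s\<close>.\<close>

inductive_set flat_compositions :: "('a::euclidean_space \<Rightarrow> real) \<Rightarrow> ('a \<Rightarrow> real) set" for s where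
 base: "smooth_on UNIV p ==> (\<lambda>x. p x * flat_exp n (s x)) \<in> flat_compositions s"
| add: "f \<in> flat_compositions s ==> g \<in> flat_compositions s ==> (\<lambda>x. f x + g x) \<in> flat_compositions s"

lemma smooth_on_flat_exp:
 fixes s :: "'a::euclidean_space \<Rightarrow> real"
 assumes s: "smooth_on UNIV s"
 shows "smooth_on UNIV (\<lambda>x. flat_exp n (s x))"
proof -
 have D: "((\<lambda>x. p x * flat_exp n (s x)) has_derivative
   (\<lambda>h. p x * ((flat_exp (n + 2) (s x) - real n * flat_exp (n + 1) (s x)) * pdiff s x h)
    + pdiff p x h * flat_exp n (s x))) (at x)"
  if "smooth_on UNIV p" for p x and n
 proof -
  have "((\<lambda>x. flat_exp n (s x)) has_derivative
   (\<lambda>h. (flat_exp (n + 2) (s x) - real n * flat_exp (n + 1) (s x)) * pdiff s x h)) (at x)"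
   using has_derivative_compose[OF iffD1[OF frechet_derivative_works, OF smooth_on_imp_differentiable[OF s UNIV_I]]
     flat_exp_deriv[of n "s x", unfolded has_field_derivative_def]] by simp
  then show ?thesis
   by (intro derivative_intros iffD1[OF frechet_derivative_works, OF smooth_on_imp_differentiable[OF that UNIV_I]])
 qed
 have diff: "f differentiable (at x)" if "f \<in> flat_compositions s" for f x
  using that by induction (auto intro: derivative_intros D differentiableI)
 have part: "\<exists>f'\<in>flat_compositions s. \<forall>x\<in>UNIV. pdiff f x i = f' x"
  if "f \<in> flat_compositions s" "i \<in> Basis" for f i
  using that
 proof induction
  case (base p n)
  let ?s = "\<lambda>x. pdiff s x i"
  have "smooth_on UNIV ?s" "smooth_on UNIV (\<lambda>x. pdiff p x i)"
   using s base by (auto intro: smooth_on_partial)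
  then have "(\<lambda>x. (p x * ?s x) * flat_exp (n + 2) (s x) + (- real n * (p x * ?s x)) * flat_exp (n + 1) (s x)
    + pdiff p x i * flat_exp n (s x)) \<in> flat_compositions s"
   using base by (intro flat_compositions.intros smooth_on_mult smooth_on_const) auto
  then show ?case
   using frechet_derivative_at[OF D[OF base(1)], symmetric]
   by (intro bexI) (auto simp: algebra_simps)
 next
  case (add f g)
  then obtain f' g' where "f'\<in>flat_compositions s" "\<forall>x. pdiff f x i = f' x"
   "g'\<in>flat_compositions s" "\<forall>x. pdiff g x i = g' x" by auto
  then show ?case using add.hyps
   by (intro bexI[of _ "\<lambda>x. f' x + g' x"])
    (auto simp: frechet_derivative_add_at diff intro: flat_compositions.intros)
 qed
 have "smooth_on UNIV (\<lambda>x. 1 * flat_exp n (s x))"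
  by (rule smooth_on_family[where F="flat_compositions s"])
   (auto intro: diff part[simplified] flat_compositions.base[of "\<lambda>x. 1", simplified] smooth_on_const)
 then show ?thesis by simp
qed

text \<open>The squared radius minus the squared distance is a polynomial in the coordinates, hence
  smooth, and it is positive exactly on the ball; \<open>flat_exp 0\<close> flattens it to zero
  outside.\<close>

lemma bump_exists:
 fixes a :: "'a::euclidean_space"
 assumes "r > 0"
 obtains rh where "smooth_on UNIV rh" "\<And>x. rh x \<ge> 0" "\<And>x. rh x > 0 \<longleftrightarrow> x \<in> ball a r"
proof
 define s where "s = (\<lambda>x. r\<^sup>2 - (\<Sum>i\<in>Basis. (x \<bullet> i + - (a \<bullet> i)) * (x \<bullet> i + - (a \<bullet> i))))"
 have s_eq: "s x = r\<^sup>2 - (dist a x)\<^sup>2" for x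
 proof -
  have "(dist a x)\<^sup>2 = (\<Sum>i\<in>Basis. ((x - a) \<bullet> i) * ((x - a) \<bullet> i))"
   by (simp only: dist_norm norm_minus_commute[of a x] power2_norm_eq_inner flip: euclidean_inner)
  then show ?thesis by (simp add: s_def inner_diff_left)
 qed
 have "smooth_on UNIV s"
  unfolding s_def by (intro smooth_on_diff smooth_on_sum smooth_on_mult smooth_on_const smooth_on_inner_const) auto
 then show "smooth_on UNIV (\<lambda>x. flat_exp 0 (s x))" by (rule smooth_on_flat_exp)
 show "flat_exp 0 (s x) \<ge> 0" for x by (simp add: flat_exp_def)
 have "s x > 0 \<longleftrightarrow> x \<in> ball a r" for x
  using assms power2_less_imp_less[of "dist a x" r] power_strict_mono[of "dist a x" r 2] by (auto simp: s_eq)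
 then show "flat_exp 0 (s x) > 0 \<longleftrightarrow> x \<in> ball a r" for x by (simp add: flat_exp_def)
qed

section \<open>Integration on Euclidean space\<close>

lemma integrable_of_AE_bound:
 fixes f :: "'a \<Rightarrow> real"
 assumes "f \<in> borel_measurable M" "integrable M g" "AE x in M. \<bar>f x\<bar> \<le> g x"
 shows "integrable M f" "\<bar>\<integral>x. f x \<partial>M\<bar> \<le> (LINT x|M. g x)"
proof -
 show i: "integrable M f"
  using assms(3) by (intro Bochner_Integration.integrable_bound[OF assms(2,1)]) (auto elim!: eventually_mono)
 have "\<bar>\<integral>x. f x \<partial>M\<bar> \<le> (LINT x|M. \<bar>f x\<bar>)" by (rule integral_abs_bound)
 also have "\<dots> \<le> (LINT x|M. g x)"
  using i assms by (intro integral_mono_AE) auto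
 finally show "\<bar>\<integral>x. f x \<partial>M\<bar> \<le> (LINT x|M. g x)" .
qed

section \<open>Translations and dilations of the Lebesgue integral\<close>

lemma nn_integral_lborel_shift:
 fixes g :: "'a::euclidean_space \<Rightarrow> ennreal"
 assumes [measurable]: "g \<in> borel_measurable borel"
 shows "(\<integral>\<^sup>+x. g (x + a) \<partial>lborel) = (\<integral>\<^sup>+x. g x \<partial>lborel)"
 using nn_integral_distr[of "(+) a" lborel borel g] by (simp add: lborel_distr_plus add.commute)

lemma integral_lborel_shift:
 fixes g :: "'a::euclidean_space \<Rightarrow> real"
 assumes [measurable]: "g \<in> borel_measurable borel"
 shows "(LINT x|lborel. g (x + a)) = (LINT x|lborel. g x)"
 using integral_distr[of "(+) a" lborel borel g] by (simp add: lborel_distr_plus add.commute)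

lemma integrable_lborel_shift:
 fixes g :: "'a::euclidean_space \<Rightarrow> real"
 assumes "integrable lborel g"
 shows "integrable lborel (\<lambda>x. g (x + a))"
proof -
 have [measurable]: "g \<in> borel_measurable borel" using assms by auto
 show ?thesis
  using integrable_distr_eq[of "(+) a" lborel borel g] assms by (simp add: lborel_distr_plus add.commute)
qed

lemma integral_lborel_affine:
 fixes g :: "'a::euclidean_space \<Rightarrow> real"
 assumes [measurable]: "g \<in> borel_measurable borel" and "c > 0"
 shows "(LINT z|lborel. g z) = c ^ DIM('a) * (LINT y|lborel. g (x + c *\<^sub>R y))"
proof -
 have "(LINT z|lborel. g z) = (\<integral>z. g z \<partial>density (distr lborel borel (\<lambda>y. x + c *\<^sub>R y)) (\<lambda>_. ennreal (\<bar>c\<bar> ^ DIM('a))))"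
  using lborel_affine[of c x] `c > 0` by simp
 also have "\<dots> = (LINT y|lborel. c ^ DIM('a) * g (x + c *\<^sub>R y))"
  using `c > 0` by (subst integral_density) (auto simp: integral_distr)
 finally show ?thesis by simp
qed

lemma integrable_lborel_affine:
 fixes g :: "'a::euclidean_space \<Rightarrow> real"
 assumes g: "integrable lborel g" and "c > 0"
 shows "integrable lborel (\<lambda>y. g (x + c *\<^sub>R y))"
proof -
 have [measurable]: "g \<in> borel_measurable borel" using g by auto
 have "integrable (density (distr lborel borel (\<lambda>y. x + c *\<^sub>R y)) (\<lambda>_. ennreal (\<bar>c\<bar> ^ DIM('a)))) g"
  using lborel_affine[of c x] `c > 0` g by simp
 then have "integrable lborel (\<lambda>y. c ^ DIM('a) * g (x + c *\<^sub>R y))"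
  using `c > 0` by (subst (asm) integrable_density) (auto simp: integrable_distr_eq)
 then show ?thesis using `c > 0` by simp
qed

text \<open>Difference quotients of \<open>F\<close> have integral zero by translation invariance,
  and the bound on \<open>F'\<close> with the compact support lets dominated convergence carry this
  to \<open>F'\<close>. Only the derivative in one direction is required, which suits integrands
  built from absolute values and mollifications.\<close>

lemma integral_directional_derivative:
 fixes F F' :: "'a::euclidean_space \<Rightarrow> real"
 assumes cont: "continuous_on UNIV F"
  and deriv: "\<And>x. ((\<lambda>s. F (x + s *\<^sub>R e)) has_real_derivative F' x) (at 0)"
  and bound: "\<And>x. \<bar>F' x\<bar> \<le> C"
  and K: "compact K" "\<And>x. x \<notin> K ==> F x = 0"
 shows "integrable lborel F'" "(LINT x|lborel. F' x) = 0"
proof -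
 have Fm[measurable]: "F \<in> borel_measurable borel"
  using cont by (rule borel_measurable_continuous_onI)
 obtain R where R: "K \<subseteq> cball 0 R"
  using compact_imp_bounded[OF K(1)] unfolding bounded_iff by (auto simp: subset_iff)
 \<comment> \<open>All steps used are at most \<open>1\<close>, so this ball contains the support of
   every difference quotient.\<close>
 define B where "B = cball (0::'a) (R + norm e)"
 define D where "D = (\<lambda>n x. (F (x + (1 / real (Suc n)) *\<^sub>R e) - F x) * real (Suc n))"
 have deriv': "((\<lambda>s. F (x + s *\<^sub>R e)) has_real_derivative F' (x + s *\<^sub>R e)) (at s)" for x s
 proof -
  have "((\<lambda>r. F ((x + s *\<^sub>R e) + r *\<^sub>R e)) has_real_derivative F' (x + s *\<^sub>R e)) (at (s + - s))"
   using deriv[of "x + s *\<^sub>R e"] by simp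
  then have "((\<lambda>r. F ((x + s *\<^sub>R e) + (r + - s) *\<^sub>R e)) has_real_derivative F' (x + s *\<^sub>R e)) (at s)"
   by (subst (asm) DERIV_shift)
  moreover have "(\<lambda>r. F ((x + s *\<^sub>R e) + (r + - s) *\<^sub>R e)) = (\<lambda>r. F (x + r *\<^sub>R e))"
   by (auto simp: algebra_simps)
  ultimately show ?thesis by simp
 qed
 have lip: "\<bar>F (x + s *\<^sub>R e) - F x\<bar> \<le> C * s" if "s > 0" for x s
 proof -
  have "\<exists>z. 0 < z \<and> z < s \<and> F (x + s *\<^sub>R e) - F (x + 0 *\<^sub>R e) = (s - 0) * F' (x + z *\<^sub>R e)"
   by (rule MVT2[OF that]) (rule deriv')
  then obtain z where "F (x + s *\<^sub>R e) - F x = s * F' (x + z *\<^sub>R e)" by auto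
  then show ?thesis using bound[of "x + z *\<^sub>R e"] that by (simp add: abs_mult mult.commute)
 qed
 have D_lim: "(\<lambda>n. D n x) \<longlonglongrightarrow> F' x" for x
 proof -
  have "((\<lambda>h. (F (x + h *\<^sub>R e) - F x) / h) \<longlongrightarrow> F' x) (at 0)"
   using deriv[of x] by (simp add: has_field_derivative_iff)
  moreover have "filterlim (\<lambda>n. 1 / real (Suc n)) (at 0) sequentially"
   unfolding filterlim_at using LIMSEQ_inverse_real_of_nat by (auto simp: inverse_eq_divide)
  ultimately have "(\<lambda>n. (F (x + (1 / real (Suc n)) *\<^sub>R e) - F x) / (1 / real (Suc n))) \<longlonglongrightarrow> F' x"
   by (rule filterlim_compose)
  then show ?thesis by (simp add: D_def)
 qed
 have D_bound: "\<bar>D n x\<bar> \<le> C * indicator B x" for n x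
 proof (cases "x \<in> B")
  case True
  have "\<bar>F (x + (1 / real (Suc n)) *\<^sub>R e) - F x\<bar> * real (Suc n) \<le> (C * (1 / real (Suc n))) * real (Suc n)"
   by (intro mult_right_mono lip) auto
  with True show ?thesis by (simp add: D_def abs_mult)
 next
  case False
  have "F x = 0" using False R K(2) by (auto simp: B_def add_increasing2 subset_iff)
    (metis add_increasing2 norm_ge_zero)
  moreover have "norm x \<le> norm (x + (1 / real (Suc n)) *\<^sub>R e) + norm ((1 / real (Suc n)) *\<^sub>R e)"
   by (metis add_diff_cancel_right' norm_triangle_ineq4)
  then have "norm x \<le> norm (x + (1 / real (Suc n)) *\<^sub>R e) + norm e"
   using mult_right_mono[of "1 / real (Suc n)" 1 "norm e"] by simp
  with False have "x + (1 / real (Suc n)) *\<^sub>R e \<notin> cball 0 R" by (auto simp: B_def)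
  then have "F (x + (1 / real (Suc n)) *\<^sub>R e) = 0" using R K(2) by blast
  ultimately show ?thesis using False by (simp add: D_def)
 qed
 have Dm[measurable]: "D n \<in> borel_measurable borel" for n unfolding D_def by measurable
 have F'm[measurable]: "F' \<in> borel_measurable borel"
  by (rule borel_measurable_LIMSEQ_real[OF D_lim]) simp
 have B: "integrable lborel (\<lambda>x. C * indicator B x)"
  unfolding B_def using emeasure_lborel_cball_finite[of "0::'a" "R + norm e"]
  by (intro integrable_mult_right integrable_real_indicator) auto
 have "integrable lborel F'" and lim: "(\<lambda>n. \<integral>x. D n x \<partial>lborel) \<longlonglongrightarrow> (LINT x|lborel. F' x)"
 proof -
  have ae: "AE x in lborel. norm (D n x) \<le> C * indicator B x" for n using D_bound[of n] by simp
  show "integrable lborel F'"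
   by (rule integrable_dominated_convergence[where s=D, OF _ _ B _ ae]) (auto intro: D_lim)
  show "(\<lambda>n. \<integral>x. D n x \<partial>lborel) \<longlonglongrightarrow> (LINT x|lborel. F' x)"
   by (rule integral_dominated_convergence[where s=D, OF _ _ B _ ae]) (auto intro: D_lim)
 qed
 then show "integrable lborel F'" by simp
 have "integrable lborel (\<lambda>x. indicator K x *\<^sub>R F x)"
  using cont by (intro borel_integrable_compact K(1)) (auto intro: continuous_on_subset)
 moreover have "(\<lambda>x. indicator K x *\<^sub>R F x) = F" using K(2) by (auto simp: fun_eq_iff split: split_indicator)
 ultimately have iF: "integrable lborel F" by simp
 have "(LINT x|lborel. D n x) = 0" for n
  unfolding D_def using integrable_lborel_shift[OF iF, of "(1 / real (Suc n)) *\<^sub>R e"] iF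
   integral_lborel_shift[OF Fm, of "(1 / real (Suc n)) *\<^sub>R e"] by simp
 then show "(LINT x|lborel. F' x) = 0" using lim by (simp add: LIMSEQ_const_iff)
qed

section \<open>A countable dense set of step functions\<close>

lemma sets_lebesgue_open: "open S ==> S \<in> sets lebesgue"
 by auto

lemma emeasure_exhaust:
 assumes V: "incseq V" "\<And>n. V n \<in> sets M" "(\<Union>n. V n) = U" and U: "emeasure M U < \<infinity>" and "e > 0"
 shows "\<exists>n. emeasure M (U - V n) < ennreal e"
proof -
 have "(\<Union>n. V n) \<in> sets M" using V(2) by auto
 then have Us: "U \<in> sets M" using V(3) by simp
 have "(\<lambda>n. emeasure M (U - V n)) \<longlonglongrightarrow> emeasure M (\<Inter>n. U - V n)"
 proof (rule Lim_emeasure_decseq)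
  show "decseq (\<lambda>n. U - V n)" using V(1) by (auto simp: decseq_def incseq_def)
  show "emeasure M (U - V n) \<noteq> \<infinity>" for n
   using emeasure_mono[of "U - V n" U M] U Us by (auto simp: top_unique)
 qed (use V(2) Us in auto)
 also have "(\<Inter>n. U - V n) = {}" using V(3) by auto
 finally have "\<forall>\<^sub>F n in sequentially. emeasure M (U - V n) < ennreal e"
  by (rule order_tendstoD) (use assms in auto)
 then show ?thesis by (auto simp: eventually_sequentially)
qed

text \<open>The family consists of the finite unions of members of a countable basis that have
  finite measure. Outer regularity puts an open set around \<open>A\<close>, and continuity of the
  measure from above exhausts that open set by such unions.\<close>

lemma countable_open_approx:
 "\<exists>\<F> :: 'a::euclidean_space set set. countable \<F> \<and> (\<forall>F\<in>\<F>. open F \<and> emeasure lborel F < \<infinity>) \<and>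
  (\<forall>A\<in>sets lebesgue. emeasure lebesgue A < \<infinity> \<longrightarrow> (\<forall>e>0. \<exists>F\<in>\<F>. emeasure lebesgue ((A - F) \<union> (F - A)) < ennreal e))"
proof -
 obtain B :: "'a set set" where B: "countable B" "topological_basis B" using ex_countable_basis by blast
 have oB: "open b" if "b \<in> B" for b using that B(2) by (rule topological_basis_open[rotated])
 define \<F> where "\<F> = {F. F \<in> Union ` {F. finite F \<and> F \<subseteq> B} \<and> emeasure lborel F < \<infinity>}"
 have "countable \<F>"
  by (rule countable_subset[OF _ countable_image[OF countable_Collect_finite_subset[OF B(1)], of Union]]) (auto simp: \<F>_def)
 moreover have "\<forall>F\<in>\<F>. open F \<and> emeasure lborel F < \<infinity>" using oB by (auto simp: \<F>_def)
 moreover have "\<exists>F\<in>\<F>. emeasure lebesgue ((A - F) \<union> (F - A)) < ennreal e"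
  if A: "A \<in> sets lebesgue" "emeasure lebesgue A < \<infinity>" and "e > 0" for A and e :: real
 proof -
  obtain U where U: "open U" "A \<subseteq> U" "U - A \<in> lmeasurable" "emeasure lebesgue (U - A) < ennreal (e / 2)"
   using sets_lebesgue_outer_open[OF A(1), of "e / 2"] `e > 0` by auto
  have "A \<in> lmeasurable" using A by (simp add: fmeasurable_def)
  from fmeasurable.Un[OF this U(3)] have Ul: "U \<in> lmeasurable" using U(2) by (simp add: Un_absorb1)
  obtain B' where B': "B' \<subseteq> B" "\<Union> B' = U" using B(2) U(1) by (meson topological_basis_def)
  \<comment> \<open>Adding the empty set makes the subfamily nonempty, so that it is the range of a
    sequence.\<close>
  obtain b where b: "insert {} B' = range (b :: nat \<Rightarrow> 'a set)"
   using countable_subset[OF B'(1) B(1)] by (metis countable_insert insert_not_empty range_from_nat_into)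
  define V where "V = (\<lambda>n. \<Union>i\<le>n. b i)"
  have "open (b i)" for i using b oB B'(1) by (metis insertE open_empty rangeI subsetD)
  then have Vb: "V n \<in> sets lborel" for n unfolding V_def by auto
  then have Vm: "V n \<in> sets lebesgue" for n by simp
  have "(\<Union>n. V n) = (\<Union>n. b n)" unfolding V_def by auto
  also have "\<dots> = U" using b B'(2) by (metis Un_empty_left Union_insert)
  finally have VU: "(\<Union>n. V n) = U" .
  have "incseq V" unfolding V_def incseq_def by (auto intro: order_trans)
  from emeasure_exhaust[OF this Vm VU, of "e / 2"] Ul `e > 0`
  obtain n where n: "emeasure lebesgue (U - V n) < ennreal (e / 2)" by (auto simp: fmeasurable_def)
  have VnU: "V n \<subseteq> U" using VU by blast
  then have "emeasure lborel (V n) < \<infinity>"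
   using fmeasurableI2[OF Ul _ Vm, of n] Vb[of n] by (simp add: fmeasurable_def main_part_sets)
  moreover have "b ` {..n} \<subseteq> insert {} B'" using b by auto
  then have "V n = \<Union> (b ` {..n} \<inter> B')" unfolding V_def by blast
  ultimately have Vn: "V n \<in> \<F>" unfolding \<F>_def using B'(1) Vb[of n] by auto
  have "emeasure lebesgue ((A - V n) \<union> (V n - A)) \<le> emeasure lebesgue ((U - V n) \<union> (U - A))"
   using VnU U(2,3) Ul Vm[of n] by (intro emeasure_mono) (auto simp: fmeasurable_def)
  also have "\<dots> \<le> emeasure lebesgue (U - V n) + emeasure lebesgue (U - A)"
   using U(3) Ul Vm[of n] by (intro emeasure_subadditive) (auto simp: fmeasurable_def)
  also have "\<dots> < ennreal (e / 2) + ennreal (e / 2)" using n U(4) by (rule add_strict_mono)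
  also have "\<dots> = ennreal e" using `e > 0` by (simp flip: ennreal_plus)
  finally show ?thesis using Vn by blast
 qed
 ultimately show ?thesis by (intro exI[of _ \<F>] conjI) blast+
qed

text \<open>Lists make countability of the whole collection immediate and turn addition of step
  functions into concatenation.\<close>

definition step_sum :: "(real \<times> 'a set) list \<Rightarrow> 'a \<Rightarrow> real" where
 "step_sum xs x = (\<Sum>(q, F)\<leftarrow>xs. q * indicator F x)"

lemma step_sum_simps: "step_sum [] = (\<lambda>x. 0)" "step_sum ((q, F) # xs) = (\<lambda>x. q * indicator F x + step_sum xs x)"
 "step_sum (xs @ ys) = (\<lambda>x. step_sum xs x + step_sum ys x)"
 by (auto simp: step_sum_def)

lemma step_sum_measurable: "xs \<in> lists (Q \<times> \<F>) ==> (\<And>F. F \<in> \<F> ==> F \<in> sets M) ==> step_sum xs \<in> borel_measurable M"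
 by (induction xs) (auto simp: step_sum_simps)

lemma nn_integral_abs_triangle:
 fixes f u w :: "'a \<Rightarrow> real"
 assumes [measurable]: "f \<in> borel_measurable M" "u \<in> borel_measurable M" "w \<in> borel_measurable M"
  and "(\<integral>\<^sup>+x. ennreal \<bar>f x - u x\<bar> \<partial>M) < ennreal (e / 2)" "(\<integral>\<^sup>+x. ennreal \<bar>u x - w x\<bar> \<partial>M) < ennreal (e / 2)" "e > 0"
 shows "(\<integral>\<^sup>+x. ennreal \<bar>f x - w x\<bar> \<partial>M) < ennreal e"
proof -
 have "(\<integral>\<^sup>+x. ennreal \<bar>f x - w x\<bar> \<partial>M) \<le> (\<integral>\<^sup>+x. ennreal \<bar>f x - u x\<bar> + ennreal \<bar>u x - w x\<bar> \<partial>M)"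
  by (intro nn_integral_mono) (simp flip: ennreal_plus)
 also have "\<dots> = (\<integral>\<^sup>+x. ennreal \<bar>f x - u x\<bar> \<partial>M) + (\<integral>\<^sup>+x. ennreal \<bar>u x - w x\<bar> \<partial>M)"
  by (rule nn_integral_add) measurable
 also have "\<dots> < ennreal (e / 2) + ennreal (e / 2)" using assms by (intro add_strict_mono)
 also have "\<dots> = ennreal e" using `e > 0` by (simp flip: ennreal_plus)
 finally show ?thesis .
qed

lemma step_sums_dense:
 fixes f :: "'a::euclidean_space \<Rightarrow> real"
 assumes \<F>: "\<And>F. F \<in> \<F> ==> open F"
  "\<And>A e. A \<in> sets lebesgue ==> emeasure lebesgue A < \<infinity> ==> e > 0 ==> \<exists>F\<in>\<F>. emeasure lebesgue ((A - F) \<union> (F - A)) < ennreal e"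
  and "integrable lebesgue f" "e > 0"
 shows "\<exists>xs\<in>lists (\<rat> \<times> \<F>). (\<integral>\<^sup>+x. ennreal \<bar>f x - step_sum xs x\<bar> \<partial>lebesgue) < ennreal e"
 using assms(3,4)
proof (induction f arbitrary: e rule: integrable_induct)
 case (base A c)
 \<comment> \<open>The summands \<open>1\<close> in \<open>m\<close> and \<open>r\<close> keep both
   divisors positive. Rounding the height to a rational costs \<open>e / 2\<close> and replacing the
   set costs \<open>e / 4\<close>, which leaves room for a strict inequality.\<close>
 define m where "m = measure lebesgue A + 1"
 have m: "m > 0" "emeasure lebesgue A \<le> ennreal m"
  using base by (auto simp: m_def emeasure_eq_ennreal_measure intro: ennreal_leI add_nonneg_pos)
 have "c < c + e / 2 / m" using m base by simp
 from Rats_dense_in_real[OF this] obtain q where q: "q \<in> \<rat>" "\<bar>c - q\<bar> < e / 2 / m" by auto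
 define r where "r = \<bar>q\<bar> + 1"
 have r: "r > 0" by (simp add: r_def)
 obtain F where F: "F \<in> \<F>" "emeasure lebesgue ((A - F) \<union> (F - A)) < ennreal (e / 4 / r)"
  using \<F>(2)[OF base(1,2), of "e / 4 / r"] base(3) r by auto
 have Fm: "F \<in> sets lebesgue" using \<F>(1)[OF F(1)] by auto
 have "(\<integral>\<^sup>+x. ennreal \<bar>indicator A x *\<^sub>R c - step_sum [(q, F)] x\<bar> \<partial>lebesgue)
   \<le> (\<integral>\<^sup>+x. ennreal \<bar>c - q\<bar> * indicator A x + ennreal r * indicator ((A - F) \<union> (F - A)) x \<partial>lebesgue)"
  by (intro nn_integral_mono) (auto simp: step_sum_simps r_def split: split_indicator simp flip: ennreal_plus intro!: ennreal_leI)
 also have "\<dots> = ennreal \<bar>c - q\<bar> * emeasure lebesgue A + ennreal r * emeasure lebesgue ((A - F) \<union> (F - A))"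
  using base Fm by (subst nn_integral_add) (auto simp: nn_integral_cmult_indicator)
 also have "\<dots> \<le> ennreal (e / 2 / m) * ennreal m + ennreal r * ennreal (e / 4 / r)"
  using q m F by (intro add_mono mult_mono) (auto intro: ennreal_leI)
 also have "\<dots> = ennreal (e / 2 + e / 4)" using m r base(3) by (simp flip: ennreal_mult' ennreal_plus)
 also have "\<dots> < ennreal e" using base(3) by (intro ennreal_lessI) auto
 finally have "(\<integral>\<^sup>+x. ennreal \<bar>indicator A x *\<^sub>R c - step_sum [(q, F)] x\<bar> \<partial>lebesgue) < ennreal e" .
 moreover have "[(q, F)] \<in> lists (\<rat> \<times> \<F>)" using q F by auto
 ultimately show ?case by blast
next
 case (add f g)
 have "e / 2 > 0" using add.prems by simp
 from add.IH(1)[OF this] add.IH(2)[OF this] obtain xs ys where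
  xs: "xs \<in> lists (\<rat> \<times> \<F>)" "(\<integral>\<^sup>+x. ennreal \<bar>f x - step_sum xs x\<bar> \<partial>lebesgue) < ennreal (e / 2)"
  and ys: "ys \<in> lists (\<rat> \<times> \<F>)" "(\<integral>\<^sup>+x. ennreal \<bar>g x - step_sum ys x\<bar> \<partial>lebesgue) < ennreal (e / 2)" by blast
 have m: "step_sum zs \<in> borel_measurable lebesgue" if "zs \<in> lists (\<rat> \<times> \<F>)" for zs
  by (rule step_sum_measurable[OF that sets_lebesgue_open[OF \<F>(1)]])
 note [measurable] = m[OF xs(1)] m[OF ys(1)] borel_measurable_integrable[OF add.hyps(1)] borel_measurable_integrable[OF add.hyps(2)]
 have "(\<integral>\<^sup>+x. ennreal \<bar>(f x + g x) - step_sum (xs @ ys) x\<bar> \<partial>lebesgue) < ennreal e"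
 proof (rule nn_integral_abs_triangle[where u="\<lambda>x. step_sum xs x + g x"])
  show "(\<integral>\<^sup>+x. ennreal \<bar>f x + g x - (step_sum xs x + g x)\<bar> \<partial>lebesgue) < ennreal (e / 2)" using xs(2) by simp
  show "(\<integral>\<^sup>+x. ennreal \<bar>step_sum xs x + g x - step_sum (xs @ ys) x\<bar> \<partial>lebesgue) < ennreal (e / 2)"
   using ys(2) by (simp add: step_sum_simps(3))
 qed (use add.prems in \<open>simp_all add: step_sum_simps(3)\<close>)
 moreover have "xs @ ys \<in> lists (\<rat> \<times> \<F>)" using xs ys by auto
 ultimately show ?case by blast
next
 case (lim f s)
 have [measurable]: "f \<in> borel_measurable lebesgue" "s i \<in> borel_measurable lebesgue" for i using lim.hyps by auto
 have "(\<lambda>i. \<integral>\<^sup>+x. norm (f x - s i x) \<partial>lebesgue) \<longlonglongrightarrow> 0"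
 proof (rule nn_integral_dominated_convergence_norm[where w="\<lambda>x. 2 * norm (f x)"])
  show "(\<integral>\<^sup>+x. ennreal (2 * norm (f x)) \<partial>lebesgue) < \<infinity>"
   using lim.hyps(4) by (simp add: nn_integral_cmult ennreal_mult integrable_iff_bounded ennreal_mult_less_top)
 qed (use lim in auto)
 then have "\<forall>\<^sub>F i in sequentially. (\<integral>\<^sup>+x. norm (f x - s i x) \<partial>lebesgue) < ennreal (e / 2)"
  using lim.prems by (intro order_tendstoD) auto
 then obtain i where i: "(\<integral>\<^sup>+x. norm (f x - s i x) \<partial>lebesgue) < ennreal (e / 2)" by (auto simp: eventually_sequentially)
 obtain xs where xs: "xs \<in> lists (\<rat> \<times> \<F>)" "(\<integral>\<^sup>+x. ennreal \<bar>s i x - step_sum xs x\<bar> \<partial>lebesgue) < ennreal (e / 2)"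
  using lim.IH[of "e / 2" i] lim.prems by auto
 have "step_sum xs \<in> borel_measurable lebesgue" by (rule step_sum_measurable[OF xs(1) sets_lebesgue_open[OF \<F>(1)]])
 with i xs(2) lim.prems have "(\<integral>\<^sup>+x. ennreal \<bar>f x - step_sum xs x\<bar> \<partial>lebesgue) < ennreal e"
  by - (rule nn_integral_abs_triangle[where u="s i"], simp_all)
 then show ?case using xs(1) by blast
qed

section \<open>Continuity of translations in \<open>L1\<close>\<close>

lemma nn_integral_shift_indicator_open:
 fixes U :: "'a::euclidean_space set"
 assumes "open U" "emeasure lborel U < \<infinity>" "e > 0"
 shows "\<exists>d>0. \<forall>a. norm a < d \<longrightarrow> (\<integral>\<^sup>+x. ennreal \<bar>indicator U (x + a) - indicator U x\<bar> \<partial>lborel) \<le> ennreal e"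
proof -
 have [measurable]: "U \<in> sets borel" using assms by auto
 obtain C where C: "\<And>n::nat. compact (C n)" "\<And>n. C n \<subseteq> U" "\<And>n. C n \<subseteq> interior (C (Suc n))" "\<Union> (range C) = U"
  using open_Union_compact_subsets[OF assms(1)] by metis
 have "incseq C" using C(3) interior_subset by (intro incseq_SucI) blast
 moreover have "C n \<in> sets lborel" for n using C(1) by (auto intro: borel_closed compact_imp_closed)
 ultimately obtain n where n: "emeasure lborel (U - C n) < ennreal (e / 2)"
  using emeasure_exhaust[of C lborel U "e / 2"] C(4) assms by auto
 define K where "K = C n"
 have K: "compact K" "K \<subseteq> U" "emeasure lborel (U - K) < ennreal (e / 2)" using C n by (auto simp: K_def)
 have [measurable]: "K \<in> sets borel" using K by (intro borel_closed compact_imp_closed)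
 obtain d where d: "d > 0" "\<And>x y. x \<in> K ==> y \<in> - U ==> d \<le> dist x y"
 proof -
  have "closed (- U)" "K \<inter> - U = {}" using K assms(1) by auto
  from separate_compact_closed[OF K(1) this] show ?thesis using that by blast
 qed
 have "(\<integral>\<^sup>+x. ennreal \<bar>indicator U (x + a) - indicator U x\<bar> \<partial>lborel) \<le> ennreal e" if "norm a < d" for a
 proof -
  \<comment> \<open>If exactly one of \<open>x\<close> and \<open>x + a\<close> lies in
    \<open>U\<close>, that point cannot lie in \<open>K\<close>, since the other is in the
    complement of \<open>U\<close> and closer than \<open>d\<close>.\<close>
  have *: "ennreal \<bar>indicator U (x + a) - indicator U x\<bar> \<le> indicator (U - K) x + indicator (U - K) (x + a)" for x
   using d(2)[of x "x + a"] d(2)[of "x + a" x] that by (auto simp: dist_norm split: split_indicator)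
  have "(\<integral>\<^sup>+x. ennreal \<bar>indicator U (x + a) - indicator U x\<bar> \<partial>lborel) \<le> (\<integral>\<^sup>+x. indicator (U - K) x + indicator (U - K) (x + a) \<partial>lborel)"
   by (intro nn_integral_mono *)
  also have "\<dots> = emeasure lborel (U - K) + emeasure lborel (U - K)"
   using nn_integral_lborel_shift[of "indicator (U - K)" a] by (simp add: nn_integral_add)
  also have "\<dots> \<le> ennreal (e / 2) + ennreal (e / 2)" using K(3) by (intro add_mono) auto
  also have "\<dots> = ennreal e" using `e > 0` by (simp flip: ennreal_plus)
  finally show ?thesis .
 qed
 then show ?thesis using d(1) by blast
qed

lemma shift_continuous_transfer:
 fixes f s :: "'a::euclidean_space \<Rightarrow> real"
 assumes [measurable]: "f \<in> borel_measurable borel" "s \<in> borel_measurable borel"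
  and close: "(\<integral>\<^sup>+x. ennreal \<bar>f x - s x\<bar> \<partial>lborel) \<le> ennreal e" and "e \<ge> 0"
  and s: "(\<integral>\<^sup>+x. ennreal \<bar>s (x + a) - s x\<bar> \<partial>lborel) \<le> ennreal e"
 shows "(\<integral>\<^sup>+x. ennreal \<bar>f (x + a) - f x\<bar> \<partial>lborel) \<le> ennreal (3 * e)"
proof -
 have "(\<integral>\<^sup>+x. ennreal \<bar>f (x + a) - f x\<bar> \<partial>lborel)
   \<le> (\<integral>\<^sup>+x. ennreal \<bar>f (x + a) - s (x + a)\<bar> + (ennreal \<bar>s (x + a) - s x\<bar> + ennreal \<bar>f x - s x\<bar>) \<partial>lborel)"
  by (intro nn_integral_mono) (simp flip: ennreal_plus)
 also have "\<dots> = (\<integral>\<^sup>+x. ennreal \<bar>f (x + a) - s (x + a)\<bar> \<partial>lborel)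
   + ((\<integral>\<^sup>+x. ennreal \<bar>s (x + a) - s x\<bar> \<partial>lborel) + (\<integral>\<^sup>+x. ennreal \<bar>f x - s x\<bar> \<partial>lborel))"
  by (simp add: nn_integral_add)
 also have "(\<integral>\<^sup>+x. ennreal \<bar>f (x + a) - s (x + a)\<bar> \<partial>lborel) = (\<integral>\<^sup>+x. ennreal \<bar>f x - s x\<bar> \<partial>lborel)"
  using nn_integral_lborel_shift[of "\<lambda>x. ennreal \<bar>f x - s x\<bar>" a] by simp
 also have "(\<integral>\<^sup>+x. ennreal \<bar>f x - s x\<bar> \<partial>lborel) + ((\<integral>\<^sup>+x. ennreal \<bar>s (x + a) - s x\<bar> \<partial>lborel) + (\<integral>\<^sup>+x. ennreal \<bar>f x - s x\<bar> \<partial>lborel))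
   \<le> ennreal e + (ennreal e + ennreal e)"
  by (intro add_mono close s)
 also have "\<dots> = ennreal (3 * e)" using `e \<ge> 0` by (simp flip: ennreal_plus)
 finally show ?thesis .
qed

lemma shift_continuous_step_sum:
 fixes xs :: "(real \<times> 'a::euclidean_space set) list"
 assumes "\<And>q F. (q, F) \<in> set xs ==> open F \<and> emeasure lborel F < \<infinity>" "e > 0"
 shows "\<exists>d>0. \<forall>a. norm a < d \<longrightarrow> (\<integral>\<^sup>+x. ennreal \<bar>step_sum xs (x + a) - step_sum xs x\<bar> \<partial>lborel) \<le> ennreal e"
 using assms
proof (induction xs arbitrary: e)
 case Nil
 then show ?case by (intro exI[of _ 1]) (simp add: step_sum_simps)
next
 case (Cons y xs)
 obtain q F where y: "y = (q, F)" by (cases y)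
 define r where "r = \<bar>q\<bar> + 1"
 have r: "r > 0" by (simp add: r_def)
 have F: "open F" "emeasure lborel F < \<infinity>" using Cons.prems(1) y by auto
 obtain d1 where d1: "d1 > 0" "\<And>a. norm a < d1 ==> (\<integral>\<^sup>+x. ennreal \<bar>indicator F (x + a) - indicator F x\<bar> \<partial>lborel) \<le> ennreal (e / 2 / r)"
  using nn_integral_shift_indicator_open[OF F, of "e / 2 / r"] Cons.prems r by auto
 obtain d2 where d2: "d2 > 0" "\<And>a. norm a < d2 ==> (\<integral>\<^sup>+x. ennreal \<bar>step_sum xs (x + a) - step_sum xs x\<bar> \<partial>lborel) \<le> ennreal (e / 2)"
  using Cons.IH[of "e / 2"] Cons.prems by force
 have [measurable]: "F \<in> sets borel" "step_sum xs \<in> borel_measurable borel"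
  using F Cons.prems(1) step_sum_measurable[of xs UNIV "snd ` set xs" borel] by (force simp: in_lists_conv_set)+
 have "(\<integral>\<^sup>+x. ennreal \<bar>step_sum (y # xs) (x + a) - step_sum (y # xs) x\<bar> \<partial>lborel) \<le> ennreal e" if a: "norm a < min d1 d2" for a
 proof -
  have "(\<integral>\<^sup>+x. ennreal \<bar>step_sum (y # xs) (x + a) - step_sum (y # xs) x\<bar> \<partial>lborel)
    \<le> (\<integral>\<^sup>+x. ennreal r * ennreal \<bar>indicator F (x + a) - indicator F x\<bar> + ennreal \<bar>step_sum xs (x + a) - step_sum xs x\<bar> \<partial>lborel)"
   by (intro nn_integral_mono) (auto simp: y step_sum_simps r_def split: split_indicator simp flip: ennreal_plus ennreal_mult' intro!: ennreal_leI)
  also have "\<dots> = ennreal r * (\<integral>\<^sup>+x. ennreal \<bar>indicator F (x + a) - indicator F x\<bar> \<partial>lborel) + (\<integral>\<^sup>+x. ennreal \<bar>step_sum xs (x + a) - step_sum xs x\<bar> \<partial>lborel)"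
   by (simp add: nn_integral_add nn_integral_cmult)
  also have "\<dots> \<le> ennreal r * ennreal (e / 2 / r) + ennreal (e / 2)"
   using a by (intro add_mono mult_left_mono d1 d2) auto
  also have "\<dots> = ennreal e" using r Cons.prems(2) by (simp flip: ennreal_mult' ennreal_plus)
  finally show ?thesis .
 qed
 then show ?case using d1(1) d2(1) by (intro exI[of _ "min d1 d2"]) auto
qed

lemma shift_continuous_L1:
 fixes f :: "'a::euclidean_space \<Rightarrow> real"
 assumes "integrable lborel f" "e > 0"
 shows "\<exists>d>0. \<forall>a. norm a < d \<longrightarrow> (\<integral>\<^sup>+x. ennreal \<bar>f (x + a) - f x\<bar> \<partial>lborel) \<le> ennreal e"
proof -
 have [measurable]: "f \<in> borel_measurable borel" using assms by auto
 obtain \<F> :: "'a set set" where \<F>: "\<And>F. F \<in> \<F> ==> open F \<and> emeasure lborel F < \<infinity>"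
  "\<And>A e. A \<in> sets lebesgue ==> emeasure lebesgue A < \<infinity> ==> e > 0 ==> \<exists>F\<in>\<F>. emeasure lebesgue ((A - F) \<union> (F - A)) < ennreal e"
  using countable_open_approx by metis
 have "integrable lebesgue f" using assms by (simp add: integrable_completion)
 then obtain xs where xs: "xs \<in> lists (\<rat> \<times> \<F>)" "(\<integral>\<^sup>+x. ennreal \<bar>f x - step_sum xs x\<bar> \<partial>lebesgue) < ennreal (e / 3)"
  using step_sums_dense[of \<F> f "e / 3"] \<F> assms(2) by auto
 have m[measurable]: "step_sum xs \<in> borel_measurable borel"
  by (rule step_sum_measurable[OF xs(1)]) (simp add: \<F>(1))
 have "(\<integral>\<^sup>+x. ennreal \<bar>f x - step_sum xs x\<bar> \<partial>lborel) \<le> ennreal (e / 3)"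
  using xs(2) by (subst (asm) nn_integral_completion) auto
 moreover obtain d where "d > 0" "\<And>a. norm a < d ==> (\<integral>\<^sup>+x. ennreal \<bar>step_sum xs (x + a) - step_sum xs x\<bar> \<partial>lborel) \<le> ennreal (e / 3)"
  using shift_continuous_step_sum[of xs "e / 3"] xs(1) \<F>(1) assms(2) by (auto simp: in_lists_conv_set)
 ultimately show ?thesis
  using shift_continuous_transfer[of f "step_sum xs" "e / 3"] assms(2) m by (auto intro!: exI[of _ d])
qed

section \<open>Mollification\<close>

lemma integrable_lebesgue_borel_version:
 fixes f :: "'a::euclidean_space \<Rightarrow> real"
 assumes "integrable lebesgue f"
 obtains g where "integrable lborel g" "AE x in lborel. f x = g x"
proof -
 have "f \<in> borel_measurable (completion lborel)" using assms by auto
 from completion_ex_borel_measurable_real[OF this]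
 obtain g where g: "g \<in> borel_measurable lborel" "AE x in lborel. f x = g x" by auto
 then have "AE x in lebesgue. f x = g x" by (intro AE_completion)
 then have "integrable lebesgue g" using assms g(1)
  by (subst integrable_cong_AE[symmetric, of f]) (auto simp: measurable_completion)
 then have "integrable lborel g" using g(1) by (simp add: integrable_completion)
 with that g show ?thesis by blast
qed

text \<open>With the kernel evaluated at \<open>(z - x) / t\<close> this is the average of
  \<open>f (x + t y)\<close> against \<open>r y\<close>, so it samples \<open>f\<close> on
  \<open>x + t\<close> times the support of \<open>r\<close>. Neither symmetry of \<open>r\<close>
  nor a support around the origin is built in.\<close>

definition mollify :: "('a::euclidean_space \<Rightarrow> real) \<Rightarrow> ('a \<Rightarrow> real) \<Rightarrow> real \<Rightarrow> 'a \<Rightarrow> real" where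
 "mollify r f t x = (LINT z|lebesgue. f z * (r ((z - x) /\<^sub>R t) / t ^ DIM('a)))"

definition mollifier :: "('a::euclidean_space \<Rightarrow> real) \<Rightarrow> bool" where
 "mollifier r \<longleftrightarrow> smooth_on UNIV r \<and> (\<forall>x. r x \<ge> 0) \<and> bounded {x. r x \<noteq> 0} \<and> (LINT x|lborel. r x) = 1"

lemma mollifier_continuous: "mollifier r ==> continuous_on UNIV r"
 by (auto simp: mollifier_def intro: smooth_on_imp_continuous_on)

lemma mollifier_measurable: "mollifier r ==> r \<in> borel_measurable borel"
 by (intro borel_measurable_continuous_onI mollifier_continuous)

lemma continuous_bounded_support_integrable:
 fixes f :: "'a::euclidean_space \<Rightarrow> real"
 assumes "continuous_on UNIV f" "bounded {x. f x \<noteq> 0}"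
 shows "integrable lborel f"
proof -
 have "integrable lborel (\<lambda>x. indicator (closure {x. f x \<noteq> 0}) x *\<^sub>R f x)"
  using assms by (intro borel_integrable_compact) (auto intro: continuous_on_subset)
 moreover have "(\<lambda>x. indicator (closure {x. f x \<noteq> 0}) x *\<^sub>R f x) = f"
  using closure_subset[of "{x. f x \<noteq> 0}"] by (auto simp: fun_eq_iff split: split_indicator)
 ultimately show ?thesis by simp
qed

lemma continuous_bounded_support_bounded:
 fixes f :: "'a::euclidean_space \<Rightarrow> real"
 assumes "continuous_on UNIV f" "bounded {x. f x \<noteq> 0}"
 obtains B where "B > 0" "\<And>x. \<bar>f x\<bar> \<le> B"
proof -
 have "bounded (f ` closure {x. f x \<noteq> 0})"
  using assms by (intro compact_imp_bounded compact_continuous_image) (auto intro: continuous_on_subset)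
 then obtain B where B: "B > 0" "\<And>x. x \<in> closure {x. f x \<noteq> 0} ==> \<bar>f x\<bar> \<le> B"
  unfolding bounded_pos by auto
 have "\<bar>f x\<bar> \<le> B" for x
  using B closure_subset[of "{x. f x \<noteq> 0}"] by (cases "f x = 0") auto
 with B that show ?thesis by blast
qed

lemma mollifier_exists:
 assumes "r > 0"
 obtains rh where "mollifier rh" "\<And>x. rh x \<noteq> 0 ==> x \<in> ball (a::'a::euclidean_space) r"
proof -
 obtain \<beta> where \<beta>: "smooth_on UNIV \<beta>" "\<And>x. \<beta> x \<ge> 0" "\<And>x. \<beta> x > 0 \<longleftrightarrow> x \<in> ball a r"
  using bump_exists[OF assms] by metis
 have nz: "\<beta> x \<noteq> 0 ==> x \<in> ball a r" for x using \<beta>(2,3)[of x] by (metis less_eq_real_def)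
 then have bdd: "bounded {x. \<beta> x \<noteq> 0}" by (intro bounded_subset[OF bounded_ball[of a r]]) auto
 have int: "integrable lborel \<beta>"
  using \<beta>(1) bdd by (intro continuous_bounded_support_integrable smooth_on_imp_continuous_on)
 have "(LINT x|lborel. \<beta> x) \<noteq> 0"
 proof
  assume "(LINT x|lborel. \<beta> x) = 0"
  then have "AE x in lborel. \<beta> x = 0"
   using integral_nonneg_eq_0_iff_AE[OF int] \<beta>(2) by auto
  then have "AE x in lborel. x \<notin> ball a r" using \<beta>(3) by (auto elim!: eventually_mono) (metis less_irrefl)
  then have "ball a r \<in> null_sets lborel" by (subst AE_iff_null_sets) auto
  then have "negligible (ball a r)" by (simp add: negligible_iff_null_sets null_sets_completionI)
  then show False using open_not_negligible[of "ball a r"] assms by auto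
 qed
 moreover have "(LINT x|lborel. \<beta> x) \<ge> 0" using \<beta>(2) by simp
 ultimately have pos: "(LINT x|lborel. \<beta> x) > 0" by simp
 define rh where "rh = (\<lambda>x. (1 / (LINT x|lborel. \<beta> x)) * \<beta> x)"
 have "mollifier rh"
  unfolding mollifier_def rh_def using \<beta>(2) pos bdd
  using smooth_on_cmult[OF open_UNIV \<beta>(1), of "1 / (LINT x|lborel. \<beta> x)"] by auto
 moreover have "rh x \<noteq> 0 ==> x \<in> ball a r" for x using nz[of x] by (auto simp: rh_def)
 ultimately show ?thesis using that by blast
qed

lemma mollify_eq:
 fixes f :: "'a::euclidean_space \<Rightarrow> real"
 assumes g[measurable]: "g \<in> borel_measurable borel" and fg: "AE x in lborel. f x = g x"
  and f: "f \<in> borel_measurable lebesgue"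
  and r[measurable]: "r \<in> borel_measurable borel" and "t > 0"
 shows "mollify r f t x = (LINT y|lborel. g (x + t *\<^sub>R y) * r y)"
proof -
 define k where "k = (\<lambda>z. r ((z - x) /\<^sub>R t) / t ^ DIM('a))"
 have k_apply: "r ((z - x) /\<^sub>R t) / t ^ DIM('a) = k z" for z by (simp add: k_def)
 have kb[measurable]: "k \<in> borel_measurable borel" unfolding k_def by measurable
 have [measurable]: "k \<in> borel_measurable lebesgue" "g \<in> borel_measurable lebesgue"
  by (auto intro!: measurable_completion)
 note f[measurable]
 have "mollify r f t x = (LINT z|lebesgue. g z * k z)"
  unfolding mollify_def k_apply using AE_completion[OF fg]
  by (intro integral_cong_AE) (auto elim: eventually_mono)
 also have "\<dots> = (LINT z|lborel. g z * k z)" by (rule integral_completion) measurable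
 also have "\<dots> = t ^ DIM('a) * (LINT y|lborel. g (x + t *\<^sub>R y) * k (x + t *\<^sub>R y))"
  by (rule integral_lborel_affine) (use `t > 0` in measurable)
 also have "\<dots> = (LINT y|lborel. t ^ DIM('a) * (g (x + t *\<^sub>R y) * k (x + t *\<^sub>R y)))" by simp
 also have "\<dots> = (LINT y|lborel. g (x + t *\<^sub>R y) * r y)"
  using `t > 0` by (intro Bochner_Integration.integral_cong) (auto simp: k_def)
 finally show ?thesis .
qed

lemma mollify_measurable:
 fixes f :: "'a::euclidean_space \<Rightarrow> real"
 assumes f: "integrable lebesgue f" and r[measurable]: "r \<in> borel_measurable borel" and "t > 0"
 shows "mollify r f t \<in> borel_measurable borel"
proof -
 obtain g where g: "integrable lborel g" "AE x in lborel. f x = g x"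
  using integrable_lebesgue_borel_version[OF f] by blast
 then have [measurable]: "g \<in> borel_measurable borel" by auto
 have "mollify r f t = (\<lambda>x. \<integral>y. g (x + t *\<^sub>R y) * r y \<partial>lborel)"
  using mollify_eq[OF _ g(2) _ r `t > 0`] f by auto
 then show ?thesis by simp
qed

lemma mollify_bound:
 fixes f :: "'a::euclidean_space \<Rightarrow> real"
 assumes f: "integrable lebesgue f" and r: "mollifier r" and "t > 0"
  and C: "AE x in lebesgue. \<bar>f x\<bar> \<le> C"
 shows "\<bar>mollify r f t x\<bar> \<le> C"
proof -
 note [measurable] = mollifier_measurable[OF r]
 define k where "k = (\<lambda>z. r ((z - x) /\<^sub>R t) / t ^ DIM('a))"
 have k_apply: "r ((z - x) /\<^sub>R t) / t ^ DIM('a) = k z" for z by (simp add: k_def)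
 have k: "k z \<ge> 0" for z using r `t > 0` by (auto simp: mollifier_def k_def)
 have int_r: "integrable lborel r"
  using r by (intro continuous_bounded_support_integrable mollifier_continuous) (auto simp: mollifier_def)
 have kb[measurable]: "k \<in> borel_measurable borel" unfolding k_def by measurable
 have meas_k[measurable]: "k \<in> borel_measurable lebesgue" by (auto intro!: measurable_completion)
 have "integrable lborel (\<lambda>z. r ((-(1/t)) *\<^sub>R x + (1 / t) *\<^sub>R z))"
  by (rule integrable_lborel_affine[OF int_r]) (use `t > 0` in auto)
 moreover have "(\<lambda>z. r ((-(1/t)) *\<^sub>R x + (1 / t) *\<^sub>R z)) = (\<lambda>z. r ((z - x) /\<^sub>R t))"
  by (auto simp: algebra_simps divide_inverse)
 ultimately have int_k: "integrable lborel k" by (simp add: k_def)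
 have "(LINT z|lborel. k z) = t ^ DIM('a) * (LINT y|lborel. k (x + t *\<^sub>R y))"
  by (rule integral_lborel_affine) (use `t > 0` in measurable)
 also have "\<dots> = 1" using `t > 0` r by (simp add: mollifier_def k_def)
 finally have k1: "(LINT z|lebesgue. k z) = 1" by (subst integral_completion) auto
 have int_k': "integrable lebesgue k" using int_k by (subst integrable_completion) auto
 have "\<bar>mollify r f t x\<bar> \<le> (LINT z|lebesgue. C * k z)"
  unfolding mollify_def k_apply
 proof (rule integrable_of_AE_bound(2))
  show "AE z in lebesgue. \<bar>f z * k z\<bar> \<le> C * k z"
   using C by eventually_elim (use k in \<open>auto simp: abs_mult intro!: mult_right_mono\<close>)
 qed (use f int_k' in auto)
 also have "\<dots> = C" using k1 by simp
 finally show ?thesis .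
qed

text \<open>By Fubini the error is at most an average over \<open>y\<close> of the \<open>L1\<close>
  distances between \<open>f\<close> and its translates by \<open>t y\<close>. On the support of
  \<open>r\<close> one has \<open>norm y \<le> R\<close>, so \<open>t < d / R\<close> makes all
  these translations shorter than \<open>d\<close>.\<close>

lemma mollify_L1:
 fixes f :: "'a::euclidean_space \<Rightarrow> real"
 assumes f: "integrable lebesgue f" and r: "mollifier r" and "e > 0"
 shows "\<exists>d>0. \<forall>t. 0 < t \<and> t < d \<longrightarrow> (\<integral>\<^sup>+x. ennreal \<bar>mollify r f t x - f x\<bar> \<partial>lebesgue) \<le> ennreal e"
proof -
 obtain g where g: "integrable lborel g" "AE x in lborel. f x = g x"
  using integrable_lebesgue_borel_version[OF f] by blast
 then have [measurable]: "g \<in> borel_measurable borel" by auto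
 note rm[measurable] = mollifier_measurable[OF r]
 have r0: "r x \<ge> 0" for x using r by (auto simp: mollifier_def)
 have int_r: "integrable lborel r"
  using r by (intro continuous_bounded_support_integrable mollifier_continuous) (auto simp: mollifier_def)
 obtain B where B: "\<And>x. \<bar>r x\<bar> \<le> B"
  using continuous_bounded_support_bounded[OF mollifier_continuous[OF r]] r unfolding mollifier_def by metis
 obtain R where R: "R > 0" "\<And>x. r x \<noteq> 0 ==> norm x \<le> R"
  using r unfolding mollifier_def bounded_pos by auto
 obtain d where d: "d > 0" "\<And>a. norm a < d ==> (\<integral>\<^sup>+x. ennreal \<bar>g (x + a) - g x\<bar> \<partial>lborel) \<le> ennreal e"
  using shift_continuous_L1[OF g(1) `e > 0`] by blast
 have "(\<integral>\<^sup>+x. ennreal \<bar>mollify r f t x - f x\<bar> \<partial>lebesgue) \<le> ennreal e" if t: "0 < t" "t < d / R" for t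
 proof -
  have pt: "ennreal \<bar>mollify r f t x - g x\<bar> \<le> (\<integral>\<^sup>+y. ennreal (\<bar>g (x + t *\<^sub>R y) - g x\<bar> * r y) \<partial>lborel)" for x
  proof -
   have i1: "integrable lborel (\<lambda>y. g (x + t *\<^sub>R y) * r y)"
   proof (rule integrable_of_AE_bound(1))
    show "integrable lborel (\<lambda>y. B * \<bar>g (x + t *\<^sub>R y)\<bar>)"
     using integrable_lborel_affine[OF g(1) t(1)] by auto
    show "AE y in lborel. \<bar>g (x + t *\<^sub>R y) * r y\<bar> \<le> B * \<bar>g (x + t *\<^sub>R y)\<bar>"
     using B by (auto simp: abs_mult mult.commute intro!: mult_right_mono)
   qed measurable
   have "mollify r f t x - g x = (LINT y|lborel. g (x + t *\<^sub>R y) * r y) - g x * (LINT y|lborel. r y)"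
    using mollify_eq[OF _ g(2) _ rm t(1)] f r by (simp add: mollifier_def)
   also have "\<dots> = (LINT y|lborel. (g (x + t *\<^sub>R y) - g x) * r y)"
    using i1 int_r by (simp add: left_diff_distrib)
   finally have eq: "mollify r f t x - g x = (LINT y|lborel. (g (x + t *\<^sub>R y) - g x) * r y)" .
   have "integrable lborel (\<lambda>y. (g (x + t *\<^sub>R y) - g x) * r y)"
    using i1 int_r by (simp add: left_diff_distrib)
   from integral_norm_bound_ennreal[OF this] show ?thesis
    unfolding eq using r0 by (simp add: abs_mult)
  qed
  have "AE x in lebesgue. f x = g x" using g(2) by (rule AE_completion)
  then have "(\<integral>\<^sup>+x. ennreal \<bar>mollify r f t x - f x\<bar> \<partial>lebesgue) = (\<integral>\<^sup>+x. ennreal \<bar>mollify r f t x - g x\<bar> \<partial>lebesgue)"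
   by (intro nn_integral_cong_AE) (auto elim: eventually_mono)
  also have "\<dots> = (\<integral>\<^sup>+x. ennreal \<bar>mollify r f t x - g x\<bar> \<partial>lborel)"
   by (rule nn_integral_completion)
  also have "\<dots> \<le> (\<integral>\<^sup>+x. (\<integral>\<^sup>+y. ennreal (\<bar>g (x + t *\<^sub>R y) - g x\<bar> * r y) \<partial>lborel) \<partial>lborel)"
   by (intro nn_integral_mono pt)
  also have "\<dots> = (\<integral>\<^sup>+y. (\<integral>\<^sup>+x. ennreal (\<bar>g (x + t *\<^sub>R y) - g x\<bar> * r y) \<partial>lborel) \<partial>lborel)"
   by (rule lborel_pair.Fubini') measurable
  also have "\<dots> \<le> (\<integral>\<^sup>+y. ennreal e * ennreal (r y) \<partial>lborel)"
  proof (rule nn_integral_mono)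
   fix y :: 'a
   show "(\<integral>\<^sup>+x. ennreal (\<bar>g (x + t *\<^sub>R y) - g x\<bar> * r y) \<partial>lborel) \<le> ennreal e * ennreal (r y)"
   proof (cases "r y = 0")
    case False
    have "norm (t *\<^sub>R y) \<le> t * R" using R(2)[OF False] t by simp
    also have "\<dots> < d" using t R(1) by (simp add: field_simps)
    finally have "(\<integral>\<^sup>+x. ennreal \<bar>g (x + t *\<^sub>R y) - g x\<bar> \<partial>lborel) \<le> ennreal e" by (rule d(2))
    then show ?thesis using r0[of y]
     by (simp add: ennreal_mult' nn_integral_multc ennreal_mult mult_right_mono)
   qed simp
  qed
  also have "\<dots> = ennreal e * (\<integral>\<^sup>+y. ennreal (r y) \<partial>lborel)" by (rule nn_integral_cmult) measurable
  also have "(\<integral>\<^sup>+y. ennreal (r y) \<partial>lborel) = ennreal 1"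
   using nn_integral_eq_integral[OF int_r] r0 r by (simp add: mollifier_def)
  finally show ?thesis by simp
 qed
 then show ?thesis using d(1) R(1) by (intro exI[of _ "d / R"]) auto
qed

text \<open>Passing to the sum \<open>S\<close> of the finitely many errors yields one subsequence
  that serves all functions of the family simultaneously.\<close>

lemma mollify_AE_subseq:
 fixes f :: "'j \<Rightarrow> 'a::euclidean_space \<Rightarrow> real"
 assumes J: "finite J" and f: "\<And>j. j \<in> J ==> integrable lebesgue (f j)" and rh: "mollifier rh"
 shows "\<exists>r. strict_mono r \<and> (AE x in lebesgue. \<forall>j\<in>J. (\<lambda>n. mollify rh (f j) (1 / real (Suc (r n))) x) \<longlonglongrightarrow> f j x)"
proof -
 define D where "D = (\<lambda>n j x. \<bar>mollify rh (f j) (1 / real (Suc n)) x - f j x\<bar>)"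
 define S where "S = (\<lambda>n x. \<Sum>j\<in>J. D n j x)"
 have Dm: "D n j \<in> borel_measurable lebesgue" if "j \<in> J" for n j
 proof -
  have "mollify rh (f j) (1 / real (Suc n)) \<in> borel_measurable lborel"
   using mollify_measurable[OF f[OF that] mollifier_measurable[OF rh], of "1 / real (Suc n)"] by simp
  from measurable_completion[OF this] show ?thesis
   unfolding D_def by (intro borel_measurable_abs borel_measurable_diff borel_measurable_integrable[OF f[OF that]])
 qed
 have D_lim: "(\<lambda>n. \<integral>\<^sup>+x. ennreal (D n j x) \<partial>lebesgue) \<longlonglongrightarrow> 0" if j: "j \<in> J" for j
 proof (rule order_tendstoI)
  fix e :: ennreal assume "0 < e"
  then obtain e' where "0 < e'" "e' < e" using dense by blast
  then obtain eps where eps: "eps > 0" "ennreal eps < e"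
   by (cases e') auto
  obtain d where d: "d > 0" "\<And>t. 0 < t \<and> t < d ==> (\<integral>\<^sup>+x. ennreal \<bar>mollify rh (f j) t x - f j x\<bar> \<partial>lebesgue) \<le> ennreal eps"
   using mollify_L1[OF f[OF j] rh eps(1)] by blast
  have "\<forall>\<^sub>F n in sequentially. 1 / real (Suc n) < d"
   using order_tendstoD(2)[OF LIMSEQ_inverse_real_of_nat d(1)] by (simp add: inverse_eq_divide)
  then show "\<forall>\<^sub>F n in sequentially. (\<integral>\<^sup>+x. ennreal (D n j x) \<partial>lebesgue) < e"
  proof eventually_elim
   case (elim n)
   with d(2)[of "1 / real (Suc n)"] eps(2) show ?case by (auto simp: D_def intro: le_less_trans)
  qed
 qed simp
 have S_eq: "(\<integral>\<^sup>+x. ennreal (S n x) \<partial>lebesgue) = (\<Sum>j\<in>J. \<integral>\<^sup>+x. ennreal (D n j x) \<partial>lebesgue)" for n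
  unfolding S_def using Dm by (simp add: sum_ennreal[symmetric] D_def nn_integral_sum del: sum_ennreal)
 have "(\<lambda>n. \<integral>\<^sup>+x. ennreal (S n x) \<partial>lebesgue) \<longlonglongrightarrow> (\<Sum>j\<in>J. 0)"
  unfolding S_eq by (intro tendsto_sum D_lim)
 then have lim: "(\<lambda>n. \<integral>\<^sup>+x. ennreal (S n x) \<partial>lebesgue) \<longlonglongrightarrow> 0" by simp
 have Sm: "S n \<in> borel_measurable lebesgue" for n
  unfolding S_def using Dm by (intro borel_measurable_sum)
 have S0: "S n x \<ge> 0" for n x unfolding S_def D_def by (intro sum_nonneg) auto
 have "\<forall>\<^sub>F n in sequentially. (\<integral>\<^sup>+x. ennreal (S n x) \<partial>lebesgue) < 1"
  by (rule order_tendstoD(2)[OF lim]) simp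
 \<comment> \<open>Integrability of \<open>S n\<close> is read off from the smallness of its
   integral, hence only from \<open>N\<close> on; the subsequence is shifted by \<open>N\<close>
   accordingly.\<close>
 then obtain N where N: "\<And>n. n \<ge> N ==> (\<integral>\<^sup>+x. ennreal (S n x) \<partial>lebesgue) < 1"
  by (auto simp: eventually_sequentially)
 have Si: "integrable lebesgue (S (n + N))" for n
  using N[of "n + N"] Sm S0 by (intro integrableI_nonneg) (auto simp: less_top intro: less_trans)
 have "(\<lambda>n. \<integral>x. norm (S (n + N) x) \<partial>lebesgue) \<longlonglongrightarrow> 0"
 proof -
  have "ennreal (LINT x|lebesgue. norm (S (n + N) x)) = (\<integral>\<^sup>+x. ennreal (S (n + N) x) \<partial>lebesgue)" for n
   using nn_integral_eq_integral[OF Si] S0 by simp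
  then have "(\<lambda>n. ennreal (LINT x|lebesgue. norm (S (n + N) x))) \<longlonglongrightarrow> ennreal 0"
   using LIMSEQ_ignore_initial_segment[OF lim, of N] by simp
  then show ?thesis by (subst (asm) tendsto_ennreal_iff) auto
 qed
 from tendsto_L1_AE_subseq[OF Si this]
 obtain r where r: "strict_mono r" "AE x in lebesgue. (\<lambda>n. S (r n + N) x) \<longlonglongrightarrow> 0" by blast
 show ?thesis
 proof (intro exI conjI)
  show "strict_mono (\<lambda>n. r n + N)" using r(1) by (auto simp: strict_mono_def)
  show "AE x in lebesgue. \<forall>j\<in>J. (\<lambda>n. mollify rh (f j) (1 / real (Suc (r n + N))) x) \<longlonglongrightarrow> f j x"
   using r(2)
  proof eventually_elim
   case (elim x)
   show ?case
   proof
    fix j assume "j \<in> J"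
    then have "\<bar>mollify rh (f j) (1 / real (Suc (r n + N))) x - f j x\<bar> \<le> S (r n + N) x" for n
     unfolding S_def using J by (subst sum.remove[of J j]) (auto simp: D_def intro!: sum_nonneg)
    then have "(\<lambda>n. mollify rh (f j) (1 / real (Suc (r n + N))) x - f j x) \<longlonglongrightarrow> 0"
     by (intro Lim_null_comparison[OF _ elim]) auto
    then show "(\<lambda>n. mollify rh (f j) (1 / real (Suc (r n + N))) x) \<longlonglongrightarrow> f j x"
     by (rule LIM_zero_cancel)
   qed
  qed
 qed
qed

text \<open>The mean value inequality bounds the difference quotients of \<open>\<Psi>\<close> by
  \<open>C\<close>, so \<open>C * \<bar>f z\<bar>\<close> dominates; measurability of
  \<open>\<Psi>'\<close> at \<open>s0\<close> follows because it is a pointwise limit of difference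
  quotients.\<close>

lemma has_real_derivative_under_integral:
 fixes \<Psi> \<Psi>' :: "real \<Rightarrow> 'a \<Rightarrow> real"
 assumes f: "integrable M f" and meas: "\<And>s. \<Psi> s \<in> borel_measurable M" and "d > 0"
  and deriv: "\<And>s z. \<bar>s - s0\<bar> < d ==> ((\<lambda>s. \<Psi> s z) has_real_derivative \<Psi>' s z) (at s)"
  and bound: "\<And>s z. \<bar>s - s0\<bar> < d ==> \<bar>\<Psi>' s z\<bar> \<le> C"
  and bound0: "\<And>s z. \<bar>s - s0\<bar> < d ==> \<bar>\<Psi> s z\<bar> \<le> C0"
 shows "((\<lambda>s. \<integral>z. f z * \<Psi> s z \<partial>M) has_real_derivative (LINT z|M. f z * \<Psi>' s0 z)) (at s0)"
proof -
 note [measurable] = meas f[THEN borel_measurable_integrable]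
 have int: "integrable M (\<lambda>z. f z * \<Psi> s z)" if "\<bar>s - s0\<bar> < d" for s
 proof (rule integrable_of_AE_bound(1))
  show "integrable M (\<lambda>z. C0 * \<bar>f z\<bar>)" using f by auto
  show "AE z in M. \<bar>f z * \<Psi> s z\<bar> \<le> C0 * \<bar>f z\<bar>"
   using bound0[OF that] by (intro AE_I2) (auto simp: abs_mult mult.commute[of C0] intro!: mult_left_mono)
 qed measurable
 \<comment> \<open>Increments are confined to \<open>ball 0 d\<close>, where the hypotheses on
   \<open>\<Psi>\<close> hold; as this ball is open, the limit at \<open>0\<close> is
   unaffected.\<close>
 have "((\<lambda>h. ((LINT z|M. f z * \<Psi> (s0 + h) z) - (LINT z|M. f z * \<Psi> s0 z)) / h) \<longlongrightarrow> (LINT z|M. f z * \<Psi>' s0 z)) (at 0 within ball 0 d)"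
  unfolding tendsto_at_iff_sequentially comp_def
 proof (intro allI impI)
  fix X :: "nat \<Rightarrow> real" assume X: "\<forall>i. X i \<in> ball 0 d - {0}" "X \<longlonglongrightarrow> 0"
  have lim: "(\<lambda>n. (\<Psi> (s0 + X n) z - \<Psi> s0 z) / X n) \<longlonglongrightarrow> \<Psi>' s0 z" for z
  proof -
   have "((\<lambda>h. (\<Psi> (s0 + h) z - \<Psi> s0 z) / h) \<longlongrightarrow> \<Psi>' s0 z) (at 0)"
    using deriv[of s0 z] `d > 0` by (simp add: DERIV_def)
   moreover have "filterlim X (at 0) sequentially"
    using X unfolding filterlim_at by auto
   ultimately show ?thesis by (rule filterlim_compose)
  qed
  have quot: "\<bar>(\<Psi> (s0 + X n) z - \<Psi> s0 z) / X n\<bar> \<le> C" for n z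
  proof -
   have "norm (\<Psi> (s0 + X n) z - \<Psi> s0 z) \<le> C * norm (s0 + X n - s0)"
    using deriv bound X(1) `d > 0`
    by (intro field_differentiable_bound[of "ball s0 d" "\<lambda>s. \<Psi> s z" "\<lambda>s. \<Psi>' s z"])
     (auto simp: dist_real_def abs_minus_commute intro: has_field_derivative_at_within)
   then show ?thesis using X(1) by (simp add: field_simps abs_divide)
  qed
  have [measurable]: "\<Psi>' s0 \<in> borel_measurable M"
   by (rule borel_measurable_LIMSEQ_real[OF lim]) measurable
  have "(\<lambda>n. \<integral>z. f z * ((\<Psi> (s0 + X n) z - \<Psi> s0 z) / X n) \<partial>M) \<longlonglongrightarrow> (LINT z|M. f z * \<Psi>' s0 z)"
  proof (rule integral_dominated_convergence[where w="\<lambda>z. C * \<bar>f z\<bar>"])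
   show "integrable M (\<lambda>z. C * \<bar>f z\<bar>)" using f by auto
   show "AE z in M. (\<lambda>n. f z * ((\<Psi> (s0 + X n) z - \<Psi> s0 z) / X n)) \<longlonglongrightarrow> f z * \<Psi>' s0 z"
    by (intro AE_I2 tendsto_mult_left lim)
   show "AE z in M. norm (f z * ((\<Psi> (s0 + X n) z - \<Psi> s0 z) / X n)) \<le> C * \<bar>f z\<bar>" for n
   proof (intro AE_I2)
    fix z show "norm (f z * ((\<Psi> (s0 + X n) z - \<Psi> s0 z) / X n)) \<le> C * \<bar>f z\<bar>"
     unfolding real_norm_def abs_mult using quot[of n z] by (subst mult.commute) (intro mult_right_mono, auto)
   qed
  qed measurable
  moreover have "(LINT z|M. f z * ((\<Psi> (s0 + X n) z - \<Psi> s0 z) / X n))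
    = ((LINT z|M. f z * \<Psi> (s0 + X n) z) - (LINT z|M. f z * \<Psi> s0 z)) / X n" for n
   using int[of "s0 + X n"] int[of s0] X(1) `d > 0`
   by (subst Bochner_Integration.integral_diff[symmetric]) (auto simp: dist_real_def algebra_simps diff_divide_distrib)
  ultimately show "(\<lambda>n. ((LINT z|M. f z * \<Psi> (s0 + X n) z) - (LINT z|M. f z * \<Psi> s0 z)) / X n) \<longlonglongrightarrow> (LINT z|M. f z * \<Psi>' s0 z)"
   by (simp only:)
 qed
 then show ?thesis
  using `d > 0` by (simp add: DERIV_def at_within_open[of 0 "ball 0 d"])
qed

section \<open>Test functions and weak derivatives\<close>

lemma sets_lebesgue_compact: "compact K ==> K \<in> sets lebesgue"
 using borel_compact[of K] by simp

lemma integral_lebesgue_on: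
 fixes f :: "'a::euclidean_space \<Rightarrow> real"
 assumes "S \<in> sets lebesgue"
 shows "(LINT x|lebesgue_on S. f x) = (LINT x|lebesgue. indicator S x * f x)"
  "integrable (lebesgue_on S) f \<longleftrightarrow> integrable lebesgue (\<lambda>x. indicator S x * f x)"
 using assms by (auto simp: integral_restrict_space integrable_restrict_space)

lemma AE_lebesgue_on: "S \<in> sets lebesgue ==> (AE x in lebesgue_on S. P x) \<longleftrightarrow> (AE x in lebesgue. x \<in> S \<longrightarrow> P x)"
 by (subst AE_restrict_space_iff) auto

text \<open>By Lindelof countably many of the balls cover \<open>S\<close>, and countably many null
  sets may be united.\<close>

lemma AE_lebesgue_on_local:
 assumes "open S" and loc: "\<And>x. x \<in> S ==> \<exists>r>0. AE y in lebesgue. y \<in> ball x r \<longrightarrow> P y"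
 shows "AE y in lebesgue_on S. P y"
proof -
 obtain r where r: "\<And>x. x \<in> S ==> r x > 0 \<and> (AE y in lebesgue. y \<in> ball x (r x) \<longrightarrow> P y)"
  using loc by metis
 obtain F where F: "F \<subseteq> (\<lambda>x. ball x (r x)) ` S" "countable F" "\<Union> F = \<Union> ((\<lambda>x. ball x (r x)) ` S)"
  using Lindelof[of "(\<lambda>x. ball x (r x)) ` S"] by auto
 have "AE y in lebesgue. \<forall>B\<in>F. y \<in> B \<longrightarrow> P y"
  using F(1,2) r by (subst AE_ball_countable) auto
 moreover have "S \<subseteq> \<Union> F" using F(3) r by auto
 ultimately have "AE y in lebesgue. y \<in> S \<longrightarrow> P y" by (elim eventually_mono) blast
 then show ?thesis using assms(1) by (simp add: AE_lebesgue_on)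
qed

lemma test_functionD:
 assumes "test_function S \<psi>"
 shows "smooth_on UNIV \<psi>" "continuous_on UNIV \<psi>" "bounded {x. \<psi> x \<noteq> 0}" "\<psi> differentiable (at x)"
  "compact (closure {x. \<psi> x \<noteq> 0})" "closure {x. \<psi> x \<noteq> 0} \<subseteq> S" "x \<notin> closure {x. \<psi> x \<noteq> 0} ==> \<psi> x = 0"
  "x \<notin> S ==> \<psi> x = 0"
proof -
 let ?K = "closure {x. \<psi> x \<noteq> 0}"
 have *: "smooth_on UNIV \<psi>" "compact ?K" "?K \<subseteq> S" using assms unfolding test_function_def by auto
 have sub: "{x. \<psi> x \<noteq> 0} \<subseteq> ?K" by (rule closure_subset)
 show "smooth_on UNIV \<psi>" "continuous_on UNIV \<psi>" "bounded {x. \<psi> x \<noteq> 0}" "\<psi> differentiable (at x)"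
  "compact ?K" "?K \<subseteq> S"
  using * sub by (auto intro: smooth_on_imp_continuous_on smooth_on_imp_differentiable bounded_subset[OF compact_imp_bounded])
 show "x \<notin> ?K ==> \<psi> x = 0" using sub by blast
 show "x \<notin> S ==> \<psi> x = 0" using sub *(3) by blast
qed

lemma test_function_bounded:
 assumes "test_function S \<psi>"
 obtains B where "B > 0" "\<And>x. \<bar>\<psi> x\<bar> \<le> B"
 using continuous_bounded_support_bounded[OF test_functionD(2,3)[OF assms]] by blast

lemma test_functionI:
 assumes "smooth_on UNIV \<psi>" "compact K" "K \<subseteq> S" "\<And>x. x \<notin> K ==> \<psi> x = 0"
 shows "test_function S \<psi>"
proof -
 have "closure {x. \<psi> x \<noteq> 0} \<subseteq> K"
  using assms by (intro closure_minimal compact_imp_closed) auto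
 then show ?thesis
  using assms compact_Int_closed[OF assms(2) closed_closure[of "{x. \<psi> x \<noteq> 0}"]]
  by (auto simp: test_function_def Int_absorb1)
qed

lemma iter_partial_outside_support:
 assumes "x \<notin> closure {x. \<psi> x \<noteq> 0}"
 shows "iter_partial a \<psi> x = 0"
proof (rule iter_partial_eq_0[of "- closure {x. \<psi> x \<noteq> 0}"])
 show "\<psi> y = 0" if "y \<in> - closure {x. \<psi> x \<noteq> 0}" for y
  using that closure_subset[of "{x. \<psi> x \<noteq> 0}"] by blast
qed (use assms in auto)

lemma test_function_iter_partial:
 assumes "test_function S \<psi>" "a \<in> multi_indices"
 shows "test_function S (iter_partial a \<psi>)"
 by (rule test_functionI[OF smooth_on_iter_partial[OF test_functionD(1)[OF assms(1)] assms(2)] test_functionD(5,6)[OF assms(1)]])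
  (rule iter_partial_outside_support)

lemma test_function_partial:
 assumes "test_function S \<psi>" "i \<in> Basis"
 shows "test_function S (\<lambda>x. pdiff \<psi> x i)"
 using test_function_iter_partial[of S \<psi> "[i]"] assms by (auto simp: multi_indices_def)

lemma test_function_add:
 assumes "test_function S \<psi>" "test_function S \<phi>"
 shows "test_function S (\<lambda>x. \<psi> x + \<phi> x)"
proof (rule test_functionI)
 show "smooth_on UNIV (\<lambda>x. \<psi> x + \<phi> x)"
  by (rule smooth_on_add[OF open_UNIV test_functionD(1)[OF assms(1)] test_functionD(1)[OF assms(2)]])
 show "compact (closure {x. \<psi> x \<noteq> 0} \<union> closure {x. \<phi> x \<noteq> 0})"
  by (rule compact_Un[OF test_functionD(5)[OF assms(1)] test_functionD(5)[OF assms(2)]])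
 show "closure {x. \<psi> x \<noteq> 0} \<union> closure {x. \<phi> x \<noteq> 0} \<subseteq> S"
  using test_functionD(6)[OF assms(1)] test_functionD(6)[OF assms(2)] by blast
 show "\<psi> x + \<phi> x = 0" if "x \<notin> closure {x. \<psi> x \<noteq> 0} \<union> closure {x. \<phi> x \<noteq> 0}" for x
 proof -
  have "\<psi> x = 0" by (rule test_functionD(7)[OF assms(1)]) (use that in blast)
  moreover have "\<phi> x = 0" by (rule test_functionD(7)[OF assms(2)]) (use that in blast)
  ultimately show ?thesis by (simp only: add_0)
 qed
qed

lemma test_function_cmult:
 assumes "test_function S \<psi>"
 shows "test_function S (\<lambda>x. c * \<psi> x)"
proof (rule test_functionI[OF smooth_on_cmult[OF open_UNIV test_functionD(1)[OF assms]] test_functionD(5,6)[OF assms]])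
 fix x assume "x \<notin> closure {x. \<psi> x \<noteq> 0}"
 from test_functionD(7)[OF assms this] show "c * \<psi> x = 0" by (simp only: mult_zero_right)
qed

lemma test_function_zero: "test_function S (\<lambda>x. 0)"
 by (rule test_functionI[of _ "{}"]) (auto intro: smooth_on_const)

lemma test_function_affine:
 fixes r :: "'a::euclidean_space \<Rightarrow> real"
 assumes "smooth_on UNIV r" "compact A" "\<And>y. r y \<noteq> 0 ==> y \<in> A" "\<And>y. y \<in> A ==> x + t *\<^sub>R y \<in> S" "t > 0"
 shows "test_function S (\<lambda>z. r ((z - x) /\<^sub>R t) / c)"
proof (rule test_functionI[of _ "(\<lambda>y. x + t *\<^sub>R y) ` A"])
 have "smooth_on UNIV (\<lambda>z. (1 / c) * r ((1 / t) *\<^sub>R z + (- (x /\<^sub>R t))))"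
  by (intro smooth_on_cmult smooth_on_affine assms) auto
 then show "smooth_on UNIV (\<lambda>z. r ((z - x) /\<^sub>R t) / c)" by (simp add: scaleR_diff_right inverse_eq_divide)
 show "compact ((\<lambda>y. x + t *\<^sub>R y) ` A)"
  by (intro compact_continuous_image assms continuous_intros)
 show "(\<lambda>y. x + t *\<^sub>R y) ` A \<subseteq> S" using assms by auto
 fix z assume "z \<notin> (\<lambda>y. x + t *\<^sub>R y) ` A"
 then have "(z - x) /\<^sub>R t \<notin> A" using `t > 0` by (auto simp: image_iff dest: bspec[where x="(z - x) /\<^sub>R t"])
 then show "r ((z - x) /\<^sub>R t) / c = 0" using assms(3) by auto
qed

section \<open>Local integrability and the fundamental lemma\<close>

lemma locally_integrable_of_integrable:
 fixes f :: "'a::euclidean_space \<Rightarrow> real"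
 assumes "open S" "integrable (lebesgue_on S) f"
 shows "locally_integrable S f"
 unfolding locally_integrable_def
proof (intro allI impI)
 fix K assume K: "compact K \<and> K \<subseteq> S"
 then have Kl: "K \<in> sets lebesgue" by (simp add: sets_lebesgue_compact)
 have "integrable lebesgue (\<lambda>x. indicator K x * (indicator S x * f x))"
  by (rule integrable_real_mult_indicator[OF Kl, unfolded mult.commute[of _ "indicator K _"]])
   (use assms in \<open>simp add: integral_lebesgue_on\<close>)
 moreover have "(\<lambda>x. indicator K x * (indicator S x * f x)) = (\<lambda>x. indicator K x * f x)"
  using K by (auto simp: fun_eq_iff split: split_indicator)
 ultimately show "integrable (lebesgue_on K) f" using Kl by (simp add: integral_lebesgue_on)
qed

lemma integrable_mult_test:
 fixes f :: "'a::euclidean_space \<Rightarrow> real"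
 assumes "open S" "locally_integrable S f" "test_function S \<psi>"
 shows "integrable (lebesgue_on S) (\<lambda>x. f x * \<psi> x)"
proof -
 let ?K = "closure {x. \<psi> x \<noteq> 0}"
 have m: "\<psi> \<in> borel_measurable lebesgue"
  using borel_measurable_continuous_onI[OF test_functionD(2)[OF assms(3)]] by (auto intro: measurable_completion)
 obtain B where B: "\<And>x. \<bar>\<psi> x\<bar> \<le> B" using test_function_bounded[OF assms(3)] by metis
 have i: "integrable lebesgue (\<lambda>x. indicator ?K x * f x)"
  using assms(2) test_functionD(5,6)[OF assms(3)] integral_lebesgue_on(2)[OF sets_lebesgue_compact[OF test_functionD(5)[OF assms(3)]], of f]
  unfolding locally_integrable_def by simp
 have "integrable lebesgue (\<lambda>x. (indicator ?K x * f x) * \<psi> x)"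
 proof (rule integrable_of_AE_bound(1)[where g="\<lambda>x. B * \<bar>indicator ?K x * f x\<bar>"])
  show "AE x in lebesgue. \<bar>(indicator ?K x * f x) * \<psi> x\<bar> \<le> B * \<bar>indicator ?K x * f x\<bar>"
   using B by (intro AE_I2) (auto simp: abs_mult mult.commute[of B] intro!: mult_left_mono)
 qed (use m i borel_measurable_integrable[OF i] in auto)
 moreover have "(\<lambda>x. (indicator ?K x * f x) * \<psi> x) = (\<lambda>x. indicator S x * (f x * \<psi> x))"
 proof
  fix x show "(indicator ?K x * f x) * \<psi> x = indicator S x * (f x * \<psi> x)"
   using test_functionD(6)[OF assms(3)] test_functionD(7)[OF assms(3), of x]
   by (cases "x \<in> ?K") (auto split: split_indicator)
 qed
 ultimately show ?thesis using assms(1) by (simp add: integral_lebesgue_on)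
qed

text \<open>Near an interior point the mollification kernels are themselves test functions, so the
  hypothesis says that the mollifications vanish; along a subsequence they converge almost
  everywhere to \<open>f\<close>.\<close>

lemma fundamental_lemma:
 fixes f :: "'a::euclidean_space \<Rightarrow> real"
 assumes "open S" "locally_integrable S f"
  and zero: "\<And>\<psi>. test_function S \<psi> ==> (LINT x|lebesgue_on S. f x * \<psi> x) = 0"
 shows "AE x in lebesgue_on S. f x = 0"
proof (rule AE_lebesgue_on_local[OF `open S`])
 fix x0 assume "x0 \<in> S"
 then obtain e where e: "e > 0" "cball x0 e \<subseteq> S" using `open S` open_contains_cball by blast
 \<comment> \<open>Cutting off at radius \<open>2 * r\<close> leaves room for kernels of width
   \<open>t < r\<close> centred in \<open>ball x0 r\<close>: there the cut-off does not alter the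
   integral.\<close>
 define r where "r = e / 2"
 then have r: "r > 0" "cball x0 (2 * r) \<subseteq> S" using e by auto
 define F where "F = (\<lambda>x. indicator (cball x0 (2 * r)) x * f x)"
 have F: "integrable lebesgue F"
  using assms(2) r(2) integral_lebesgue_on(2)[OF sets_lebesgue_compact[OF compact_cball], of x0 "2 * r" f]
  unfolding locally_integrable_def F_def by simp
 obtain rh where rh: "mollifier rh" "\<And>x. rh x \<noteq> 0 ==> x \<in> ball (0::'a) 1"
  using mollifier_exists[of 1 "0::'a"] by auto
 have m0: "mollify rh F t x = 0" if t: "0 < t" "t < r" and x: "x \<in> ball x0 r" for x t
 proof -
  let ?k = "\<lambda>z. rh ((z - x) /\<^sub>R t) / t ^ DIM('a)"
  have sub: "x + t *\<^sub>R y \<in> cball x0 (2 * r)" if "y \<in> cball 0 1" for y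
  proof -
   have "dist x0 (x + t *\<^sub>R y) \<le> dist x0 x + norm (t *\<^sub>R y)"
    by (metis add_diff_cancel_left' dist_norm dist_triangle norm_minus_commute)
   moreover have "norm (t *\<^sub>R y) \<le> t" using that t by (simp add: mult_left_le)
   ultimately show ?thesis using x t unfolding mem_cball mem_ball by linarith
  qed
  have "test_function S ?k"
   by (rule test_function_affine[of _ "cball 0 1"])
    (use rh sub r t in \<open>auto simp: mollifier_def less_imp_le\<close>)
  from zero[OF this] have "(LINT z|lebesgue. indicator S z * (f z * ?k z)) = 0"
   using assms(1) by (simp add: integral_lebesgue_on)
  moreover have "indicator S z * (f z * ?k z) = F z * ?k z" for z
  proof (cases "?k z = 0")
   case False
   then have "(z - x) /\<^sub>R t \<in> cball 0 1" using rh(2)[of "(z - x) /\<^sub>R t"] by auto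
   from sub[OF this] have "z \<in> cball x0 (2 * r)" using t by simp
   then show ?thesis using r by (auto simp: F_def)
  next
   case True
   then show ?thesis by (simp only: mult_zero_right)
  qed
  ultimately show ?thesis by (simp only: mollify_def)
 qed
 obtain q where q: "strict_mono q" "AE x in lebesgue. \<forall>j\<in>{()}. (\<lambda>n. mollify rh F (1 / real (Suc (q n))) x) \<longlonglongrightarrow> F x"
  using mollify_AE_subseq[of "{()}" "\<lambda>_. F" rh] F rh(1) by blast
 have "AE y in lebesgue. y \<in> ball x0 r \<longrightarrow> f y = 0"
  using q(2)
 proof eventually_elim
  case (elim y)
  show ?case
  proof
   assume y: "y \<in> ball x0 r"
   have "(\<lambda>n. 1 / real (Suc (q n))) \<longlonglongrightarrow> 0"
    using LIMSEQ_subseq_LIMSEQ[OF LIMSEQ_inverse_real_of_nat q(1)] by (simp add: o_def inverse_eq_divide)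
   then have "\<forall>\<^sub>F n in sequentially. 1 / real (Suc (q n)) < r" by (rule order_tendstoD) (use r in auto)
   then have "\<forall>\<^sub>F n in sequentially. mollify rh F (1 / real (Suc (q n))) y = 0"
    by eventually_elim (use m0 y in auto)
   then have "(\<lambda>n. mollify rh F (1 / real (Suc (q n))) y) \<longlonglongrightarrow> 0" by (rule tendsto_eventually)
   then have "F y = 0" using elim LIMSEQ_unique by blast
   then show "f y = 0" using y r(1) by (auto simp: F_def indicator_def split: if_splits)
  qed
 qed
 then show "\<exists>r>0. AE y in lebesgue. y \<in> ball x0 r \<longrightarrow> f y = 0" using r by blast
qed

lemma locally_integrable_diff:
 fixes f g :: "'a::euclidean_space \<Rightarrow> real"
 shows "locally_integrable S f ==> locally_integrable S g ==> locally_integrable S (\<lambda>x. f x - g x)"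
 by (auto simp: locally_integrable_def)

lemma locally_integrable_add:
 fixes f g :: "'a::euclidean_space \<Rightarrow> real"
 shows "locally_integrable S f ==> locally_integrable S g ==> locally_integrable S (\<lambda>x. f x + g x)"
 by (auto simp: locally_integrable_def)

lemma locally_integrable_cmult:
 fixes f :: "'a::euclidean_space \<Rightarrow> real"
 shows "locally_integrable S f ==> locally_integrable S (\<lambda>x. c * f x)"
 by (auto simp: locally_integrable_def)

lemma weak_deriv_unique:
 assumes "open S" "is_weak_deriv S a f f1" "is_weak_deriv S a f f2"
 shows "AE x in lebesgue_on S. f1 x = f2 x"
proof -
 have l: "locally_integrable S f1" "locally_integrable S f2" using assms by (auto simp: is_weak_deriv_def)
 have "AE x in lebesgue_on S. f1 x - f2 x = 0"
 proof (rule fundamental_lemma[OF assms(1) locally_integrable_diff[OF l]])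
  fix \<psi> assume \<psi>: "test_function S \<psi>"
  have "(- 1) ^ length a * (LINT x|lebesgue_on S. f1 x * \<psi> x) = (- 1) ^ length a * (LINT x|lebesgue_on S. f2 x * \<psi> x)"
  proof -
   have "(LINT x|lebesgue_on S. f x * iter_partial a \<psi> x) = (- 1) ^ length a * (LINT x|lebesgue_on S. f1 x * \<psi> x)"
    using assms(2) \<psi> unfolding is_weak_deriv_def by blast
   moreover have "(LINT x|lebesgue_on S. f x * iter_partial a \<psi> x) = (- 1) ^ length a * (LINT x|lebesgue_on S. f2 x * \<psi> x)"
    using assms(3) \<psi> unfolding is_weak_deriv_def by blast
   ultimately show ?thesis by (simp only:)
  qed
  then have "(LINT x|lebesgue_on S. f1 x * \<psi> x) = (LINT x|lebesgue_on S. f2 x * \<psi> x)"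
   by simp
  then show "(LINT x|lebesgue_on S. (f1 x - f2 x) * \<psi> x) = 0"
   using integrable_mult_test[OF assms(1) l(1) \<psi>] integrable_mult_test[OF assms(1) l(2) \<psi>]
   by (simp add: left_diff_distrib)
 qed
 then show ?thesis by auto
qed

lemma weak_deriv_AE:
 assumes "open S" "is_weak_deriv S a f f'"
 shows "AE x in lebesgue_on S. weak_deriv S a f x = f' x"
 using weak_deriv_unique[OF assms(1) _ assms(2)] someI[of "is_weak_deriv S a f", OF assms(2)]
 by (simp add: weak_deriv_def)

lemma weak_deriv_is:
 "is_weak_deriv S a f f' ==> is_weak_deriv S a f (weak_deriv S a f)"
 unfolding weak_deriv_def by (rule someI[of "is_weak_deriv S a f"])

section \<open>Calculus of weak derivatives\<close>

lemma is_weak_deriv_add: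
 assumes "open S" "a \<in> multi_indices" "is_weak_deriv S a f f'" "is_weak_deriv S a g g'"
 shows "is_weak_deriv S a (\<lambda>x. f x + g x) (\<lambda>x. f' x + g' x)"
proof -
 have l: "locally_integrable S f" "locally_integrable S f'" "locally_integrable S g" "locally_integrable S g'"
  using assms by (auto simp: is_weak_deriv_def)
 have "(LINT x|lebesgue_on S. (f x + g x) * iter_partial a \<psi> x) =
    (- 1) ^ length a * (LINT x|lebesgue_on S. (f' x + g' x) * \<psi> x)" if \<psi>: "test_function S \<psi>" for \<psi>
  using l[THEN integrable_mult_test[OF assms(1) _ \<psi>]] l[THEN integrable_mult_test[OF assms(1) _ test_function_iter_partial[OF \<psi> assms(2)]]]
   assms(3,4) \<psi>
  by (simp add: distrib_right is_weak_deriv_def distrib_left)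
 with l show ?thesis by (auto simp: is_weak_deriv_def intro: locally_integrable_add)
qed

lemma is_weak_deriv_cmult:
 assumes "is_weak_deriv S a f f'"
 shows "is_weak_deriv S a (\<lambda>x. c * f x) (\<lambda>x. c * f' x)"
 using assms by (auto simp: is_weak_deriv_def mult.assoc intro: locally_integrable_cmult)

lemma is_weak_deriv_diff:
 assumes "open S" "a \<in> multi_indices" "is_weak_deriv S a f f'" "is_weak_deriv S a g g'"
 shows "is_weak_deriv S a (\<lambda>x. f x - g x) (\<lambda>x. f' x - g' x)"
 using is_weak_deriv_add[OF assms(1-3) is_weak_deriv_cmult[OF assms(4), of "-1"]] by simp

lemma is_weak_deriv_Nil: "locally_integrable S f ==> is_weak_deriv S [] f f"
 by (simp add: is_weak_deriv_def)

text \<open>In \<open>iter_partial\<close> the head of the list acts last on the test function;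
  moved to \<open>f\<close> by parts it acts first. This is why the list is reversed in
  \<open>smooth_is_weak_deriv\<close>.\<close>

lemma is_weak_deriv_Cons:
 assumes "is_weak_deriv S [i] f f1" "a \<in> multi_indices"
 shows "is_weak_deriv S (i # a) f f2 \<longleftrightarrow> is_weak_deriv S a f1 f2"
proof -
 have "(LINT x|lebesgue_on S. f x * iter_partial (i # a) \<psi> x) = - (LINT x|lebesgue_on S. f1 x * iter_partial a \<psi> x)"
  if "test_function S \<psi>" for \<psi>
  using assms test_function_iter_partial[OF that assms(2)] by (auto simp: is_weak_deriv_def)
 then show ?thesis using assms(1) unfolding is_weak_deriv_def by force
qed

lemma continuous_locally_integrable:
 fixes f :: "'a::euclidean_space \<Rightarrow> real"
 assumes "continuous_on S f"
 shows "locally_integrable S f"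
 unfolding locally_integrable_def
proof (intro allI impI)
 fix K assume K: "compact K \<and> K \<subseteq> S"
 then have "integrable lborel (\<lambda>x. indicator K x *\<^sub>R f x)"
  using assms by (intro borel_integrable_compact) (auto intro: continuous_on_subset)
 then have "integrable lebesgue (\<lambda>x. indicator K x *\<^sub>R f x)"
  by (subst integrable_completion) auto
 then show "integrable (lebesgue_on K) f" using K by (subst integral_lebesgue_on) (auto simp: sets_lebesgue_compact)
qed

text \<open>As \<open>f\<close> is controlled only inside \<open>S\<close>, the product
  \<open>f * \<psi>\<close> is extended by zero. Off the support of \<open>\<psi>\<close> the
  extension vanishes locally, so it is differentiable everywhere with compact support, and the
  integral of its derivative is zero.\<close>

lemma smooth_is_weak_deriv1:
 fixes f :: "'a::euclidean_space \<Rightarrow> real"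
 assumes "open S" "smooth_on S f" "i \<in> Basis"
 shows "is_weak_deriv S [i] f (\<lambda>x. pdiff f x i)"
proof -
 let ?f' = "\<lambda>x. pdiff f x i"
 have f': "smooth_on S ?f'" by (rule smooth_on_partial[OF assms(2,3)])
 note cont = smooth_on_imp_continuous_on[OF assms(2)] smooth_on_imp_continuous_on[OF f']
 note l = cont[THEN continuous_locally_integrable]
 have "(LINT x|lebesgue_on S. f x * pdiff \<psi> x i) = - (LINT x|lebesgue_on S. ?f' x * \<psi> x)"
  if \<psi>: "test_function S \<psi>" for \<psi>
 proof -
  let ?\<psi>' = "\<lambda>x. pdiff \<psi> x i"
  note \<psi>' = test_function_partial[OF \<psi> assms(3)]
  let ?K = "closure {x. \<psi> x \<noteq> 0}"
  define F where "F = (\<lambda>x. indicator S x * (f x * \<psi> x))"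
  define F' where "F' = (\<lambda>x. indicator S x * (f x * ?\<psi>' x + ?f' x * \<psi> x))"
  have \<psi>'0: "?\<psi>' x = 0" if "x \<notin> ?K" for x
   using iter_partial_outside_support[OF that, of "[i]"] by simp
  have D_in: "(F has_derivative (\<lambda>h. f x * pdiff \<psi> x h + pdiff f x h * \<psi> x)) (at x)"
   if x: "x \<in> S" for x
  proof -
   have "((\<lambda>x. f x * \<psi> x) has_derivative (\<lambda>h. f x * pdiff \<psi> x h + pdiff f x h * \<psi> x)) (at x)"
    using smooth_on_imp_differentiable[OF assms(2) x] test_functionD(4)[OF \<psi>, of x]
    by (intro derivative_intros) (auto simp: frechet_derivative_works[symmetric])
   then show ?thesis
    by (rule has_derivative_transform_within_open[OF _ `open S` x]) (auto simp: F_def)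
  qed
  have D_out: "(F has_derivative (\<lambda>h. 0)) (at x)" if x: "x \<notin> ?K" for x
  proof -
   have "((\<lambda>x. 0) has_derivative (\<lambda>h. 0)) (at x)" by auto
   then show ?thesis
   proof (rule has_derivative_transform_within_open[of _ _ _ _ "- ?K"])
    fix y assume "y \<in> - ?K"
    then have "\<psi> y = 0" by (intro test_functionD(7)[OF \<psi>]) simp
    then show "0 = F y" by (simp add: F_def)
   qed (use x in auto)
  qed
  have KS: "?K \<subseteq> S" by (rule test_functionD(6)[OF \<psi>])
  have dir: "((\<lambda>s. F (x + s *\<^sub>R i)) has_real_derivative F' x) (at 0)" for x
  proof -
   have "\<exists>D. (F has_derivative D) (at x) \<and> D i = F' x"
   proof (cases "x \<in> ?K")
    case True
    then show ?thesis using KS D_in[of x] by (intro exI conjI) (auto simp: F'_def)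
   next
    case False
    then have "F' x = 0" unfolding F'_def \<psi>'0[OF False] test_functionD(7)[OF \<psi> False] by simp
    then show ?thesis using D_out[OF False] by (intro exI[of _ "\<lambda>h. 0"]) simp
   qed
   then obtain D where D: "(F has_derivative D) (at x)" "D i = F' x" by blast
   have "((\<lambda>s. x + s *\<^sub>R i) has_derivative (\<lambda>s. s *\<^sub>R i)) (at 0)"
    by (auto intro!: derivative_eq_intros)
   from has_derivative_compose[OF this, of F D] D(1)
   have "((\<lambda>s. F (x + s *\<^sub>R i)) has_derivative (\<lambda>s. D (s *\<^sub>R i))) (at 0)" by simp
   moreover have "D (s *\<^sub>R i) = F' x * s" for s
    using has_derivative_bounded_linear[OF D(1)] D(2) by (simp add: linear_simps)
   ultimately show ?thesis by (simp add: has_field_derivative_def)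
  qed
  have contF: "continuous_on UNIV F"
  proof (rule continuous_at_imp_continuous_on, rule ballI)
   fix x show "isCont F x"
   proof (cases "x \<in> ?K")
    case True then show ?thesis using KS D_in[of x] by (auto intro: has_derivative_continuous)
   next
    case False then show ?thesis using D_out[of x] by (auto intro: has_derivative_continuous)
   qed
  qed
  have "bounded ((\<lambda>x. f x * ?\<psi>' x + ?f' x * \<psi> x) ` ?K)"
   using continuous_on_subset[OF cont(1) KS] continuous_on_subset[OF cont(2) KS]
    continuous_on_subset[OF test_functionD(2)[OF \<psi>], of ?K] continuous_on_subset[OF test_functionD(2)[OF \<psi>'], of ?K]
   by (intro compact_imp_bounded compact_continuous_image test_functionD(5)[OF \<psi>] continuous_intros) auto
  then obtain C where C: "C > 0" "\<And>x. x \<in> ?K ==> \<bar>f x * ?\<psi>' x + ?f' x * \<psi> x\<bar> \<le> C"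
   unfolding bounded_pos by auto
  have F'C: "\<bar>F' x\<bar> \<le> C" for x
  proof (cases "x \<in> ?K")
   case True then show ?thesis using C KS by (auto simp: F'_def split: split_indicator)
  next
   case False
   show ?thesis unfolding F'_def \<psi>'0[OF False] test_functionD(7)[OF \<psi> False] using C(1) by simp
  qed
  have F0: "F x = 0" if "x \<notin> ?K" for x
   unfolding F_def test_functionD(7)[OF \<psi> that] by simp
  note zero = integral_directional_derivative[OF contF dir F'C test_functionD(5)[OF \<psi>] F0]
  have "F' \<in> borel_measurable lborel" using zero(1) by auto
  then have "(LINT x|lebesgue. F' x) = 0" using zero(2) by (simp add: integral_completion)
  then have "(LINT x|lebesgue_on S. f x * ?\<psi>' x + ?f' x * \<psi> x) = 0"
   using assms(1) by (simp add: integral_lebesgue_on F'_def)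
  then show ?thesis
   using integrable_mult_test[OF assms(1) l(1) \<psi>'] integrable_mult_test[OF assms(1) l(2) \<psi>] by simp
 qed
 with l show ?thesis by (simp add: is_weak_deriv_def)
qed

lemma smooth_is_weak_deriv:
 fixes f :: "'a::euclidean_space \<Rightarrow> real"
 assumes "open S" "smooth_on S f" "a \<in> multi_indices"
 shows "is_weak_deriv S a f (iter_partial (rev a) f)"
 using assms(2,3)
proof (induction a arbitrary: f)
 case Nil
 then show ?case by (auto intro: is_weak_deriv_Nil continuous_locally_integrable smooth_on_imp_continuous_on)
next
 case (Cons i a)
 then have i: "i \<in> Basis" and a: "a \<in> multi_indices" by (auto simp: multi_indices_def)
 have "is_weak_deriv S a (iter_partial [i] f) (iter_partial (rev a) (iter_partial [i] f))"
  using Cons.IH[OF _ a, of "iter_partial [i] f"] smooth_on_partial[OF Cons.prems(1) i] by simp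
 then show ?case
  using is_weak_deriv_Cons[OF smooth_is_weak_deriv1[OF assms(1) Cons.prems(1) i] a]
  by (simp add: iter_partial_append)
qed

section \<open>Derivatives of mollifications\<close>

lemma frechet_derivative_bounded_support:
 fixes r :: "'a::euclidean_space \<Rightarrow> real"
 assumes "smooth_on UNIV r" "bounded {x. r x \<noteq> 0}" "i \<in> Basis"
 shows "smooth_on UNIV (\<lambda>x. pdiff r x i)"
  "bounded {x. pdiff r x i \<noteq> 0}"
proof -
 have "test_function UNIV r" using assms by (auto simp: test_function_def)
 from test_function_partial[OF this assms(3)]
 show "smooth_on UNIV (\<lambda>x. pdiff r x i)" "bounded {x. pdiff r x i \<noteq> 0}"
  by (rule test_functionD)+
qed

lemma rescale_eq: "(z - x) /\<^sub>R t = (1 / t) *\<^sub>R z + - (x /\<^sub>R t)"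
 for z x :: "'a::real_vector"
 by (simp add: scaleR_diff_right inverse_eq_divide)

lemma frechet_derivative_rescale:
 fixes f :: "'a::euclidean_space \<Rightarrow> real"
 assumes "f differentiable (at ((z - x) /\<^sub>R t))"
 shows "pdiff (\<lambda>z. f ((z - x) /\<^sub>R t) / c) z = (\<lambda>h. pdiff f ((z - x) /\<^sub>R t) h / (t * c))"
proof -
 have "((\<lambda>z. f ((1 / t) *\<^sub>R z + - (x /\<^sub>R t))) has_derivative (\<lambda>h. (1 / t) * pdiff f ((1 / t) *\<^sub>R z + - (x /\<^sub>R t)) h)) (at z)"
  by (rule frechet_derivative_affine) (use assms in \<open>simp only: rescale_eq\<close>)
 then have "((\<lambda>z. f ((z - x) /\<^sub>R t) / c) has_derivative (\<lambda>h. (1 / t) * pdiff f ((z - x) /\<^sub>R t) h / c)) (at z)"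
  unfolding rescale_eq[symmetric] by (rule bounded_linear.has_derivative[OF bounded_linear_divide])
 from frechet_derivative_at[OF this, symmetric] show ?thesis by simp
qed

text \<open>The derivative in \<open>x\<close> falls on the kernel, where it is minus the derivative
  in \<open>z\<close>; since \<open>cball x t\<close> fits into \<open>S\<close> the kernel is a
  test function, and the definition of the weak derivative moves the derivative back to
  \<open>f\<close>.\<close>

lemma mollify_directional_derivative:
 fixes f f1 :: "'a::euclidean_space \<Rightarrow> real"
 assumes S: "open S" and f: "integrable (lebesgue_on S) f" and w: "is_weak_deriv S [i] f f1" and i: "i \<in> Basis"
  and r: "smooth_on UNIV r" "\<And>y. r y \<noteq> 0 ==> y \<in> cball 0 1" and t: "t > 0" and x: "cball x t \<subseteq> S"
 shows "((\<lambda>s. mollify r (\<lambda>z. indicator S z * f z) t (x + s *\<^sub>R i)) has_real_derivative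
  mollify r (\<lambda>z. indicator S z * f1 z) t x) (at 0)"
proof -
 let ?d = "t ^ DIM('a)"
 define F where "F = (\<lambda>z. indicator S z * f z)"
 have Sl: "S \<in> sets lebesgue" using S by auto
 have F: "integrable lebesgue F" using f Sl by (simp add: F_def integral_lebesgue_on)
 have bdd: "bounded {x. r x \<noteq> 0}" using r(2) by (intro bounded_subset[OF bounded_cball[of 0 1]]) auto
 let ?r' = "\<lambda>y. pdiff r y i"
 note r' = frechet_derivative_bounded_support[OF r(1) bdd i]
 note cont = smooth_on_imp_continuous_on[OF r(1)] smooth_on_imp_continuous_on[OF r'(1)]
 obtain B where B: "\<And>y. \<bar>r y\<bar> \<le> B" using continuous_bounded_support_bounded[OF cont(1) bdd] by metis
 obtain B' where B': "\<And>y. \<bar>?r' y\<bar> \<le> B'" using continuous_bounded_support_bounded[OF cont(2) r'(2)] by metis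
 define \<Psi> where "\<Psi> = (\<lambda>s z. r ((z - (x + s *\<^sub>R i)) /\<^sub>R t) / ?d)"
 define \<Psi>' where "\<Psi>' = (\<lambda>s z. - (?r' ((z - (x + s *\<^sub>R i)) /\<^sub>R t) / (t * ?d)))"
 have [measurable]: "r \<in> borel_measurable borel" using cont(1) by (rule borel_measurable_continuous_onI)
 have "((\<lambda>s. \<integral>z. F z * \<Psi> s z \<partial>lebesgue) has_real_derivative (LINT z|lebesgue. F z * \<Psi>' 0 z)) (at 0)"
 proof (rule has_real_derivative_under_integral[OF F, where d=1 and C="B' / (t * ?d)" and ?C0.0="B / ?d"])
  show "\<Psi> s \<in> borel_measurable lebesgue" for s
  proof -
   have "\<Psi> s \<in> borel_measurable lborel" unfolding \<Psi>_def by measurable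
   then show ?thesis by (rule measurable_completion)
  qed
  show "\<bar>\<Psi>' s z\<bar> \<le> B' / (t * ?d)" for s z
   using B' t by (simp add: \<Psi>'_def abs_divide divide_right_mono)
  show "\<bar>\<Psi> s z\<bar> \<le> B / ?d" for s z
   using B t by (simp add: \<Psi>_def abs_divide divide_right_mono)
  fix s z
  have "((\<lambda>s. (z - (x + s *\<^sub>R i)) /\<^sub>R t) has_derivative (\<lambda>h. - (h / t) *\<^sub>R i)) (at s)"
   by (auto intro!: derivative_eq_intros simp: inverse_eq_divide)
  from has_derivative_compose[OF this iffD1[OF frechet_derivative_works smooth_on_imp_differentiable[OF r(1) UNIV_I]]]
  have "((\<lambda>s. r ((z - (x + s *\<^sub>R i)) /\<^sub>R t)) has_derivative (\<lambda>h. pdiff r ((z - (x + s *\<^sub>R i)) /\<^sub>R t) (- (h / t) *\<^sub>R i))) (at s)" .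
  moreover have "pdiff r y (- (h / t) *\<^sub>R i) = (- (?r' y / t)) * h" for y h
   using linear_cmul[OF linear_frechet_derivative[OF smooth_on_imp_differentiable[OF r(1) UNIV_I]], of y "- (h / t)" i]
   by simp
  ultimately have "((\<lambda>s. r ((z - (x + s *\<^sub>R i)) /\<^sub>R t)) has_real_derivative - (?r' ((z - (x + s *\<^sub>R i)) /\<^sub>R t) / t)) (at s)"
   by (simp only: has_field_derivative_def)
  from DERIV_cdivide[OF this, of ?d] show "((\<lambda>s. \<Psi> s z) has_real_derivative \<Psi>' s z) (at s)"
   by (simp add: \<Psi>_def \<Psi>'_def)
 qed simp
 moreover have "(LINT z|lebesgue. F z * \<Psi>' 0 z) = mollify r (\<lambda>z. indicator S z * f1 z) t x"
 proof -
  let ?k = "\<lambda>z. r ((z - x) /\<^sub>R t) / ?d"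
  have "test_function S ?k"
  proof (rule test_function_affine[OF r(1) compact_cball r(2) _ t])
   fix y :: 'a assume "y \<in> cball 0 1"
   then have "x + t *\<^sub>R y \<in> cball x t" using t by (simp add: dist_norm mult_left_le)
   then show "x + t *\<^sub>R y \<in> S" using x by blast
  qed
  then have "(LINT z|lebesgue_on S. f z * pdiff ?k z i) = - (LINT z|lebesgue_on S. f1 z * ?k z)"
   using w by (simp add: is_weak_deriv_def)
  moreover have "pdiff ?k z i = - \<Psi>' 0 z" for z
   using frechet_derivative_rescale[OF smooth_on_imp_differentiable[OF r(1) UNIV_I], where z=z and x=x and t=t and c="?d"] by (simp add: \<Psi>'_def)
  ultimately have "(LINT z|lebesgue_on S. f z * - \<Psi>' 0 z) = - (LINT z|lebesgue_on S. f1 z * ?k z)" by (simp only:)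
  then show ?thesis using Sl by (simp add: integral_lebesgue_on mollify_def F_def mult.assoc)
 qed
 ultimately show ?thesis by (simp add: mollify_def \<Psi>_def F_def)
qed

section \<open>The Sobolev embedding\<close>

text \<open>Here \<open>r\<close> need not be centred at the origin: moving the mollification scale \<open>t\<close> from \<open>1\<close> to \<open>0\<close>
 sweeps a cone with vertex \<open>x\<close>, and each \<open>t\<close>-derivative costs one weak derivative of \<open>f\<close> but only a
 different weight \<open>r\<close>.\<close>

lemma mollify_scale_derivative:
 fixes f :: "'a::euclidean_space \<Rightarrow> real"
 assumes S: "open S" and f: "integrable (lebesgue_on S) f"
  and w: "\<And>i. i \<in> Basis ==> is_weak_deriv S [i] f (f1 i)"
  and r: "smooth_on UNIV r" "compact A" "\<And>y. r y \<noteq> 0 ==> y \<in> A" and t: "t > 0"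
  and x: "\<And>y. y \<in> A ==> x + t *\<^sub>R y \<in> S"
 shows "((\<lambda>t. mollify r (\<lambda>z. indicator S z * f z) t x) has_real_derivative
  (\<Sum>i\<in>Basis. mollify (\<lambda>y. (y \<bullet> i) * r y) (\<lambda>z. indicator S z * f1 i z) t x)) (at t)"
proof -
 let ?d = "DIM('a)"
 define F where "F = (\<lambda>z. indicator S z * f z)"
 have Sl: "S \<in> sets lebesgue" using S by auto
 have F: "integrable lebesgue F" using f Sl by (simp add: F_def integral_lebesgue_on)
 have bdd: "bounded {x. r x \<noteq> 0}" using r(3) by (intro bounded_subset[OF compact_imp_bounded[OF r(2)]]) auto
 define D where "D = (\<lambda>y. \<Sum>i\<in>Basis. (y \<bullet> i) * pdiff r y i)"
 have Dr: "pdiff r y y = D y" for y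
 proof -
  have "linear (pdiff r y)"
   using smooth_on_imp_differentiable[OF r(1) UNIV_I] by (rule linear_frechet_derivative)
  then have "pdiff r y (\<Sum>i\<in>Basis. (y \<bullet> i) *\<^sub>R i) = D y"
   by (simp add: linear_sum linear_cmul D_def)
  then show ?thesis by (simp add: euclidean_representation)
 qed
 have Dc: "continuous_on UNIV D"
  unfolding D_def by (intro continuous_intros smooth_on_imp_continuous_on frechet_derivative_bounded_support[OF r(1) bdd])
 have "bounded {y. D y \<noteq> 0}"
 proof (rule bounded_subset[OF compact_imp_bounded[OF r(2)]], safe, rule ccontr)
  fix y assume "D y \<noteq> 0" "y \<notin> A"
  have "closure {y. r y \<noteq> 0} \<subseteq> A" using r(2,3) by (intro closure_minimal compact_imp_closed) auto
  then have "y \<notin> closure {y. r y \<noteq> 0}" using `y \<notin> A` by blast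
  from iter_partial_outside_support[OF this, of "[_]"] have "D y = 0" by (simp add: D_def)
  with `D y \<noteq> 0` show False by simp
 qed
 from continuous_bounded_support_bounded[OF Dc this] obtain B' where B': "B' > 0" "\<And>y. \<bar>D y\<bar> \<le> B'" by metis
 have cont: "continuous_on UNIV r" by (rule smooth_on_imp_continuous_on[OF r(1)])
 obtain B where B: "B > 0" "\<And>y. \<bar>r y\<bar> \<le> B" using continuous_bounded_support_bounded[OF cont bdd] by metis
 have [measurable]: "r \<in> borel_measurable borel" using cont by (rule borel_measurable_continuous_onI)
 define \<Psi> where "\<Psi> = (\<lambda>t z. r ((z - x) /\<^sub>R t) / t ^ ?d)"
 \<comment> \<open>\<open>- \<Psi>'\<close> is the divergence in \<open>z\<close> of the kernels
   with the weights \<open>(y \<bullet> i) * r y\<close>, which is the content of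
   \<open>sumk\<close>; this is what makes integration by parts against \<open>f\<close> possible.
   The term with \<open>D\<close> comes from differentiating the argument of \<open>r\<close>, the
   other one from the power of \<open>t\<close>.\<close>
 define \<Psi>' where "\<Psi>' = (\<lambda>t z. - (D ((z - x) /\<^sub>R t) + real ?d * r ((z - x) /\<^sub>R t)) / (t * t ^ ?d))"
 have half: "t / 2 \<le> s" if "\<bar>s - t\<bar> < t / 2" for s using that unfolding abs_less_iff by linarith
 have pw: "(t / 2) ^ n \<le> s ^ n" if "\<bar>s - t\<bar> < t / 2" for s n
  using half[OF that] t by (intro power_mono) auto
 have "((\<lambda>t. \<integral>z. F z * \<Psi> t z \<partial>lebesgue) has_real_derivative (LINT z|lebesgue. F z * \<Psi>' t z)) (at t)"
 proof (rule has_real_derivative_under_integral[OF F, where d="t / 2" and C="(B' + real ?d * B) / ((t / 2) * (t / 2) ^ ?d)" and ?C0.0="B / (t / 2) ^ ?d"])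
  show "t / 2 > 0" using t by simp
  show "\<Psi> s \<in> borel_measurable lebesgue" for s
  proof -
   have "\<Psi> s \<in> borel_measurable lborel" unfolding \<Psi>_def by measurable
   then show ?thesis by (rule measurable_completion)
  qed
  fix s z assume s: "\<bar>s - t\<bar> < t / 2"
  then have s0: "s > 0" using half[OF s] t by simp
  let ?y = "(z - x) /\<^sub>R s"
  have "\<bar>D ?y + real ?d * r ?y\<bar> \<le> \<bar>D ?y\<bar> + real ?d * \<bar>r ?y\<bar>"
   by (metis abs_mult abs_of_nat abs_triangle_ineq)
  also have "\<dots> \<le> B' + real ?d * B" using B' B by (intro add_mono mult_left_mono) auto
  finally have "\<bar>D ?y + real ?d * r ?y\<bar> / (s * s ^ ?d) \<le> (B' + real ?d * B) / ((t / 2) * (t / 2) ^ ?d)"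
   using half[OF s] pw[OF s, of ?d] t by (intro frac_le mult_mono) auto
  then show "\<bar>\<Psi>' s z\<bar> \<le> (B' + real ?d * B) / ((t / 2) * (t / 2) ^ ?d)"
   using s0 unfolding \<Psi>'_def abs_divide abs_minus_cancel by (simp add: abs_mult)
  have "\<bar>r ?y\<bar> / s ^ ?d \<le> B / (t / 2) ^ ?d"
   using B pw[OF s, of ?d] t by (intro frac_le) auto
  then show "\<bar>\<Psi> s z\<bar> \<le> B / (t / 2) ^ ?d" using s0 by (simp add: \<Psi>_def abs_divide)
  have "((\<lambda>s. (z - x) /\<^sub>R s) has_derivative (\<lambda>h. (- (h / s)) *\<^sub>R ?y)) (at s)"
   using s0 by (auto intro!: derivative_eq_intros simp: field_simps power2_eq_square inverse_eq_divide)
  from has_derivative_compose[OF this iffD1[OF frechet_derivative_works smooth_on_imp_differentiable[OF r(1) UNIV_I]]]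
  have "((\<lambda>s. r ((z - x) /\<^sub>R s)) has_derivative (\<lambda>h. pdiff r ?y ((- (h / s)) *\<^sub>R ?y))) (at s)" .
  moreover have "pdiff r ?y ((- (h / s)) *\<^sub>R ?y) = (- (D ?y / s)) * h" for h
   using linear_cmul[OF linear_frechet_derivative[OF smooth_on_imp_differentiable[OF r(1) UNIV_I]], of ?y "- (h / s)" ?y]
   by (simp add: Dr)
  ultimately have "((\<lambda>s. r ((z - x) /\<^sub>R s)) has_real_derivative - (D ?y / s)) (at s)"
   by (simp only: has_field_derivative_def)
  from DERIV_divide[OF this DERIV_pow[of ?d]]
  have "((\<lambda>s. \<Psi> s z) has_real_derivative (- (D ?y / s) * s ^ ?d - r ?y * (real ?d * s ^ (?d - Suc 0))) / (s ^ ?d * s ^ ?d)) (at s)"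
   using s0 by (simp add: \<Psi>_def)
  moreover have "(- (D ?y / s) * s ^ ?d - r ?y * (real ?d * s ^ (?d - Suc 0))) / (s ^ ?d * s ^ ?d) = \<Psi>' s z"
  proof -
   obtain m where m: "?d = Suc m" using DIM_positive[where 'a='a] by (cases "?d") auto
   show ?thesis using s0 unfolding \<Psi>'_def m by (simp add: field_simps)
  qed
  ultimately show "((\<lambda>s. \<Psi> s z) has_real_derivative \<Psi>' s z) (at s)" by simp
 qed
 moreover have "(LINT z|lebesgue. F z * \<Psi>' t z) = (\<Sum>i\<in>Basis. mollify (\<lambda>y. (y \<bullet> i) * r y) (\<lambda>z. indicator S z * f1 i z) t x)"
 proof -
  define k where "k = (\<lambda>i z. (\<lambda>y. (y \<bullet> i) * r y) ((z - x) /\<^sub>R t) / t ^ ?d)"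
  have smooth: "smooth_on UNIV (\<lambda>y. (y \<bullet> i) * r y)" for i
   using smooth_on_mult[OF open_UNIV smooth_on_inner_const[of UNIV i 0] r(1)] by simp
  have k: "test_function S (k i)" for i
   unfolding k_def by (rule test_function_affine[OF smooth r(2) _ x t]) (use r(3) in auto)
  define k' where "k' = (\<lambda>i z. pdiff (k i) z i)"
  have eq1: "(LINT z|lebesgue_on S. f z * k' i z) = - (LINT z|lebesgue_on S. f1 i z * k i z)" if "i \<in> Basis" for i
   using w[OF that] k by (simp add: is_weak_deriv_def k'_def)
  have sumk: "(\<Sum>i\<in>Basis. k' i z) = - \<Psi>' t z" for z
  proof -
   let ?y = "(z - x) /\<^sub>R t"
   have "pdiff (\<lambda>y. (y \<bullet> i) * r y) ?y i = (?y \<bullet> i) * pdiff r ?y i + r ?y" if i: "i \<in> Basis" for i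
   proof -
    have "((\<lambda>y. (y \<bullet> i) * r y) has_derivative (\<lambda>h. (?y \<bullet> i) * pdiff r ?y h + (h \<bullet> i) * r ?y)) (at ?y)"
     by (rule has_derivative_mult[OF bounded_linear.has_derivative[OF bounded_linear_inner_left has_derivative_ident] iffD1[OF frechet_derivative_works smooth_on_imp_differentiable[OF r(1) UNIV_I]]])
    from frechet_derivative_at[OF this, symmetric] show ?thesis using i by simp
   qed
   then have "k' i z = ((?y \<bullet> i) * pdiff r ?y i + r ?y) / (t * t ^ ?d)" if "i \<in> Basis" for i
    using frechet_derivative_rescale[OF smooth_on_imp_differentiable[OF smooth UNIV_I], where z=z and x=x and t=t and c="t ^ ?d"] that
    by (simp add: k'_def k_def)
   then have "(\<Sum>i\<in>Basis. k' i z) = (\<Sum>i\<in>Basis. ((?y \<bullet> i) * pdiff r ?y i + r ?y)) / (t * t ^ ?d)"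
    by (simp add: sum_divide_distrib)
   also have "\<dots> = - \<Psi>' t z" by (simp only: sum.distrib sum_constant D_def \<Psi>'_def minus_divide_left minus_minus)
   finally show ?thesis .
  qed
  have int: "integrable (lebesgue_on S) (\<lambda>z. f z * k' i z)" if "i \<in> Basis" for i
   unfolding k'_def by (rule integrable_mult_test[OF S locally_integrable_of_integrable[OF S f] test_function_partial[OF k that]])
  have "(LINT z|lebesgue_on S. f z * - \<Psi>' t z) = (\<Sum>i\<in>Basis. \<integral>z. f z * k' i z \<partial>lebesgue_on S)"
   unfolding sumk[symmetric] sum_distrib_left using int by (rule Bochner_Integration.integral_sum)
  also have "\<dots> = - (\<Sum>i\<in>Basis. \<integral>z. f1 i z * k i z \<partial>lebesgue_on S)"
   using eq1 by (simp add: sum_negf)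
  finally show ?thesis using Sl by (simp add: integral_lebesgue_on mollify_def F_def k_def mult.assoc)
 qed
 ultimately show ?thesis by (simp add: mollify_def \<Psi>_def F_def)
qed

text \<open>The recursion mirrors the induction of the embedding: each derivative is again a
  function of the same kind with one order less. Existence of suitable derivatives is asked for, so
  that no particular choice of \<open>weak_deriv\<close> interferes.\<close>

primrec sobolev_unit :: "'a::euclidean_space set \<Rightarrow> nat \<Rightarrow> ('a \<Rightarrow> real) \<Rightarrow> bool" where
 "sobolev_unit S 0 f \<longleftrightarrow> f \<in> borel_measurable (lebesgue_on S) \<and> integrable (lebesgue_on S) (\<lambda>x. (f x)\<^sup>2) \<and>
  (LINT x|lebesgue_on S. (f x)\<^sup>2) \<le> 1"
| "sobolev_unit S (Suc l) f \<longleftrightarrow> (f \<in> borel_measurable (lebesgue_on S) \<and> integrable (lebesgue_on S) (\<lambda>x. (f x)\<^sup>2) \<and>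
  (LINT x|lebesgue_on S. (f x)\<^sup>2) \<le> 1) \<and> (\<forall>i\<in>Basis. \<exists>f'. is_weak_deriv S [i] f f' \<and> sobolev_unit S l f')"

lemma sobolev_unit_0: "sobolev_unit S l f ==> sobolev_unit S 0 f"
 by (cases l) auto

lemma bounded_open_finite_measure:
 assumes "open S" "bounded S"
 shows "finite_measure (lebesgue_on S)"
 by (rule finite_measure_lebesgue_on[OF lmeasurable_open[OF assms(2,1)]])

lemma sobolev_unit_integrable:
 assumes "open S" "bounded S" "sobolev_unit S l f"
 shows "integrable (lebesgue_on S) f"
proof -
 interpret finite_measure "lebesgue_on S" using assms by (intro bounded_open_finite_measure)
 have "f \<in> borel_measurable (lebesgue_on S)" "integrable (lebesgue_on S) (\<lambda>x. (f x)\<^sup>2)"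
  using sobolev_unit_0[OF assms(3)] by auto
 then show ?thesis by (rule square_integrable_imp_integrable)
qed

text \<open>At scale \<open>t\<close> the kernel has \<open>T\<^sup>2\<close> times the squared
  \<open>L2\<close> norm of \<open>r\<close>, where \<open>T = t powr - (d / 2)\<close>. Young's
  inequality with weight \<open>T\<close> balances this against the unit bound on \<open>f\<close>,
  and both terms come out proportional to \<open>T\<close>.\<close>

lemma mollify_L2_bound:
 fixes f :: "'a::euclidean_space \<Rightarrow> real"
 assumes S: "open S" "bounded S" and f: "sobolev_unit S 0 f"
  and r: "continuous_on UNIV r" "bounded {y. r y \<noteq> 0}" and t: "t > 0"
 shows "\<bar>mollify r (\<lambda>z. indicator S z * f z) t x\<bar> \<le> (1 + (LINT y|lborel. (r y)\<^sup>2)) * t powr - (real DIM('a) / 2)"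
proof -
 let ?d = "DIM('a)"
 define T where "T = t powr - (real ?d / 2)"
 have T: "T > 0" and T2: "t ^ ?d * T\<^sup>2 = 1" using t
  by (auto simp: T_def powr_realpow[symmetric] powr_power powr_add[symmetric] power2_eq_square)
 define k where "k = (\<lambda>z. r ((z - x) /\<^sub>R t) / t ^ ?d)"
 define F where "F = (\<lambda>z. indicator S z * f z)"
 have Sl: "S \<in> sets lebesgue" using S by auto
 have F: "integrable lebesgue F" using sobolev_unit_integrable[OF S f] Sl by (simp add: F_def integral_lebesgue_on)
 have F2: "integrable lebesgue (\<lambda>z. (F z)\<^sup>2)" "(LINT z|lebesgue. (F z)\<^sup>2) \<le> 1"
 proof -
  have "(\<lambda>z. (F z)\<^sup>2) = (\<lambda>z. indicator S z * (f z)\<^sup>2)"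
   by (auto simp: F_def fun_eq_iff split: split_indicator)
  then show "integrable lebesgue (\<lambda>z. (F z)\<^sup>2)" "(LINT z|lebesgue. (F z)\<^sup>2) \<le> 1"
   using f Sl by (auto simp: integral_lebesgue_on)
 qed
 have [measurable]: "r \<in> borel_measurable borel" using r(1) by (rule borel_measurable_continuous_onI)
 have kb[measurable]: "k \<in> borel_measurable borel" unfolding k_def by measurable
 have kl: "k \<in> borel_measurable lebesgue" using kb by (auto intro: measurable_completion)
 have r2: "integrable lborel (\<lambda>y. (r y)\<^sup>2)"
  by (rule continuous_bounded_support_integrable) (use r in \<open>auto intro!: continuous_intros\<close>)
 have k2_eq: "(\<lambda>z. (k z)\<^sup>2) = (\<lambda>z. (r (- (x /\<^sub>R t) + (1 / t) *\<^sub>R z))\<^sup>2 / (t ^ ?d)\<^sup>2)"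
  unfolding k_def rescale_eq by (simp add: power_divide add.commute)
 have k2b: "integrable lborel (\<lambda>z. (k z)\<^sup>2)"
  unfolding k2_eq by (intro integrable_divide integrable_lborel_affine[OF r2]) (use t in auto)
 have "(LINT z|lborel. (k z)\<^sup>2) = t ^ ?d * (LINT y|lborel. (k (x + t *\<^sub>R y))\<^sup>2)"
  by (rule integral_lborel_affine) (use t in measurable)
 also have "(\<lambda>y. (k (x + t *\<^sub>R y))\<^sup>2) = (\<lambda>y. (r y)\<^sup>2 / (t ^ ?d)\<^sup>2)"
  using t by (simp add: k_def power_divide)
 also have "t ^ ?d * (LINT y|lborel. (r y)\<^sup>2 / (t ^ ?d)\<^sup>2) = (LINT y|lborel. (r y)\<^sup>2) * T\<^sup>2"
 proof -
  have "t ^ ?d / (t ^ ?d)\<^sup>2 = T\<^sup>2" using t T2 by (simp add: field_simps power2_eq_square)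
  moreover have "t ^ ?d * (LINT y|lborel. (r y)\<^sup>2 / (t ^ ?d)\<^sup>2) = (t ^ ?d / (t ^ ?d)\<^sup>2) * (LINT y|lborel. (r y)\<^sup>2)"
   by simp
  ultimately show ?thesis by (simp only: mult.commute)
 qed
 finally have k2: "(LINT z|lebesgue. (k z)\<^sup>2) = (LINT y|lborel. (r y)\<^sup>2) * T\<^sup>2"
  by (subst integral_completion) auto
 have k2i: "integrable lebesgue (\<lambda>z. (k z)\<^sup>2)" using k2b by (subst integrable_completion) auto
 have "\<bar>\<integral>z. F z * k z \<partial>lebesgue\<bar> \<le> (LINT z|lebesgue. T * (F z)\<^sup>2 + (k z)\<^sup>2 / T)"
 proof (rule integrable_of_AE_bound(2))
  show "AE z in lebesgue. \<bar>F z * k z\<bar> \<le> T * (F z)\<^sup>2 + (k z)\<^sup>2 / T"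
  proof (rule AE_I2)
   fix z
   have "0 \<le> (T * \<bar>F z\<bar> - \<bar>k z\<bar>)\<^sup>2" by simp
   then have "2 * T * \<bar>F z\<bar> * \<bar>k z\<bar> \<le> T\<^sup>2 * (F z)\<^sup>2 + (k z)\<^sup>2"
    by (simp add: power2_diff power_mult_distrib mult.assoc)
   moreover have "T * \<bar>F z\<bar> * \<bar>k z\<bar> \<ge> 0" using T by simp
   moreover have "T * (T * (F z)\<^sup>2 + (k z)\<^sup>2 / T) = T\<^sup>2 * (F z)\<^sup>2 + (k z)\<^sup>2"
    using T by (simp add: distrib_left power2_eq_square)
   ultimately have "T * (\<bar>F z\<bar> * \<bar>k z\<bar>) \<le> T * (T * (F z)\<^sup>2 + (k z)\<^sup>2 / T)"
    by (simp only: mult.assoc)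
   then show "\<bar>F z * k z\<bar> \<le> T * (F z)\<^sup>2 + (k z)\<^sup>2 / T"
    using T by (simp add: abs_mult)
  qed
  show "(\<lambda>z. F z * k z) \<in> borel_measurable lebesgue" using F kl by auto
 qed (use F2 k2i in auto)
 also have "\<dots> = T * (LINT z|lebesgue. (F z)\<^sup>2) + (LINT y|lborel. (r y)\<^sup>2) * T\<^sup>2 / T"
  using F2 k2i k2 by simp
 also have "\<dots> \<le> (1 + (LINT y|lborel. (r y)\<^sup>2)) * T"
  using F2(2) T by (simp add: field_simps power2_eq_square)
 finally show ?thesis by (simp add: mollify_def F_def k_def T_def)
qed

text \<open>With \<open>G\<close> an antiderivative of \<open>s powr - b\<close>, both
  \<open>D * G - E\<close> and \<open>D * G + E\<close> are nondecreasing; comparing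
  \<open>t\<close> with \<open>1\<close> integrates the bound on \<open>E'\<close> without forming
  an integral.\<close>

lemma bound_by_power_derivative:
 fixes E E' :: "real \<Rightarrow> real"
 assumes deriv: "\<And>s. 0 < s ==> s \<le> 1 ==> (E has_real_derivative E' s) (at s)"
  and bound: "\<And>s. 0 < s ==> s \<le> 1 ==> \<bar>E' s\<bar> \<le> D * s powr - b"
  and "b \<noteq> 1" "\<bar>E 1\<bar> \<le> C" and t: "0 < t" "t \<le> 1"
 shows "\<bar>E t\<bar> \<le> C + D * ((1 - t powr (1 - b)) / (1 - b))"
proof -
 define G where "G = (\<lambda>s::real. s powr (1 - b) / (1 - b))"
 have G: "(G has_real_derivative s powr - b) (at s)" if "s > 0" for s
  unfolding G_def using that `b \<noteq> 1` by (auto intro!: derivative_eq_intros)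
 have "D * G t - E t \<le> D * G 1 - E 1"
 proof (rule DERIV_nonneg_imp_nondecreasing[OF t(2)])
  fix s assume s: "t \<le> s" "s \<le> 1"
  have "((\<lambda>s. D * G s - E s) has_real_derivative D * s powr - b - E' s) (at s)"
   using s t by (intro DERIV_diff DERIV_cmult G deriv) auto
  moreover have "D * s powr - b - E' s \<ge> 0" using bound[of s] s t by auto
  ultimately show "\<exists>y. ((\<lambda>s. D * G s - E s) has_real_derivative y) (at s) \<and> 0 \<le> y" by blast
 qed
 moreover have "D * G t + E t \<le> D * G 1 + E 1"
 proof (rule DERIV_nonneg_imp_nondecreasing[OF t(2)])
  fix s assume s: "t \<le> s" "s \<le> 1"
  have "((\<lambda>s. D * G s + E s) has_real_derivative D * s powr - b + E' s) (at s)"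
   using s t by (intro DERIV_add DERIV_cmult G deriv) auto
  moreover have "D * s powr - b + E' s \<ge> 0" using bound[of s] s t by auto
  ultimately show "\<exists>y. ((\<lambda>s. D * G s + E s) has_real_derivative y) (at s) \<and> 0 \<le> y" by blast
 qed
 moreover have "D * ((1 - t powr (1 - b)) / (1 - b)) = D * G 1 - D * G t"
  by (simp add: G_def right_diff_distrib diff_divide_distrib)
 ultimately show ?thesis using assms(4) by linarith
qed

text \<open>The offset \<open>1 / 4\<close> keeps the exponent away from \<open>1\<close>, where integration in \<open>t\<close> would produce a
 logarithm.\<close>

definition scale_exponent :: "nat \<Rightarrow> nat \<Rightarrow> real" where
 "scale_exponent d l = max 0 (real d / 2 + 1 / 4 - real l)"

text \<open>Parity: multiplied by four, the equation would read
  \<open>2 * d + 1 = 4 * l + 4\<close>.\<close>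

lemma scale_exponent_neq_1: "scale_exponent d l \<noteq> 1"
proof
 assume "scale_exponent d l = 1"
 then have "real d / 2 + 1 / 4 - real l = 1" by (auto simp: scale_exponent_def max_def split: if_splits)
 then have "real (2 * d + 1) = real (4 * l + 4)" by simp
 then have "2 * d + 1 = 4 * l + 4" by (simp only: of_nat_eq_iff)
 then show False by presburger
qed

text \<open>Each additional weak derivative improves the exponent in \<open>t\<close> by one until
  it reaches zero: the scale derivative obeys the induction hypothesis for the weights
  \<open>(y \<bullet> i) * r y\<close>, which have the same support set \<open>A\<close>, and is
  integrated between \<open>t\<close> and \<open>1\<close>. Since all intermediate scales occur, the
  whole truncated cone at \<open>x\<close> must lie in \<open>S\<close>.\<close>

lemma mollify_sobolev_bound:
 fixes S :: "'a::euclidean_space set"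
 assumes S: "open S" "bounded S" and A: "compact A"
  and r: "smooth_on UNIV r" "\<And>y. r y \<noteq> 0 ==> y \<in> A"
 shows "\<exists>C\<ge>0. \<forall>f x t. sobolev_unit S l f \<longrightarrow> (\<forall>y\<in>A. \<forall>t. 0 < t \<and> t \<le> 1 \<longrightarrow> x + t *\<^sub>R y \<in> S) \<longrightarrow> 0 < t \<longrightarrow> t \<le> 1 \<longrightarrow>
  \<bar>mollify r (\<lambda>z. indicator S z * f z) t x\<bar> \<le> C * t powr - scale_exponent DIM('a) l"
 using r
proof (induction l arbitrary: r)
 case 0
 have bdd: "bounded {y. r y \<noteq> 0}" using 0 by (intro bounded_subset[OF compact_imp_bounded[OF A]]) auto
 have cont: "continuous_on UNIV r" by (rule smooth_on_imp_continuous_on[OF 0(1)])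
 let ?C = "1 + (LINT y|lborel. (r y)\<^sup>2)"
 have C: "?C \<ge> 0" by (simp add: add_nonneg_nonneg)
 have "\<bar>mollify r (\<lambda>z. indicator S z * f z) t x\<bar> \<le> ?C * t powr - scale_exponent DIM('a) 0"
  if f: "sobolev_unit S 0 f" and t: "0 < t" "t \<le> 1" for f t x
 proof -
  have "t powr - (real DIM('a) / 2) \<le> t powr - scale_exponent DIM('a) 0"
   using t by (intro powr_mono') (auto simp: scale_exponent_def)
  from mult_left_mono[OF this C] show ?thesis
   using mollify_L2_bound[OF S f cont bdd t(1), of x] by linarith
 qed
 then show ?case using C by blast
next
 case (Suc l)
 let ?b = "scale_exponent DIM('a) l"
 have sm: "smooth_on UNIV (\<lambda>y. (y \<bullet> i) * r y)" for i
  using smooth_on_mult[OF open_UNIV smooth_on_inner_const[of UNIV i 0] Suc.prems(1)] by simp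
 define P where "P = (\<lambda>i C. \<forall>f x t. sobolev_unit S l f \<longrightarrow> (\<forall>y\<in>A. \<forall>t. 0 < t \<and> t \<le> 1 \<longrightarrow> x + t *\<^sub>R y \<in> S) \<longrightarrow> 0 < t \<longrightarrow> t \<le> 1 \<longrightarrow>
  \<bar>mollify (\<lambda>y. (y \<bullet> i) * r y) (\<lambda>z. indicator S z * f z) t x\<bar> \<le> C * t powr - ?b)"
 have "\<exists>C\<ge>0. P i C" for i
  unfolding P_def by (rule Suc.IH[OF sm]) (use Suc.prems(2) in auto)
 then obtain c where c0: "\<And>i. c i \<ge> 0" and cP: "\<And>i. P i (c i)" by metis
 have c: "\<bar>mollify (\<lambda>y. (y \<bullet> i) * r y) (\<lambda>z. indicator S z * f z) t x\<bar> \<le> c i * t powr - ?b"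
  if "sobolev_unit S l f" "\<forall>y\<in>A. \<forall>t. 0 < t \<and> t \<le> 1 \<longrightarrow> x + t *\<^sub>R y \<in> S" "0 < t" "t \<le> 1" for i f x t
  using cP[of i] that unfolding P_def by blast
 have bdd: "bounded {y. r y \<noteq> 0}" using Suc.prems by (intro bounded_subset[OF compact_imp_bounded[OF A]]) auto
 have cont: "continuous_on UNIV r" by (rule smooth_on_imp_continuous_on[OF Suc.prems(1)])
 define D where "D = (\<Sum>i\<in>Basis. c i)"
 have D0: "D \<ge> 0" unfolding D_def by (intro sum_nonneg c0)
 define C1 where "C1 = 1 + (LINT y|lborel. (r y)\<^sup>2)"
 have C1: "C1 \<ge> 0" unfolding C1_def by (simp add: add_nonneg_nonneg)
 \<comment> \<open>\<open>C1\<close> bounds the mollification at scale \<open>1\<close>; the other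
   summand is the cost of integrating down to scale \<open>t\<close>.\<close>
 define C where "C = C1 + D / \<bar>1 - ?b\<bar>"
 have C: "C \<ge> 0" using C1 D0 by (simp add: C_def)
 have "\<bar>mollify r (\<lambda>z. indicator S z * f z) t x\<bar> \<le> C * t powr - scale_exponent DIM('a) (Suc l)"
  if f: "sobolev_unit S (Suc l) f" and x: "\<forall>y\<in>A. \<forall>t. 0 < t \<and> t \<le> 1 \<longrightarrow> x + t *\<^sub>R y \<in> S" and t: "0 < t" "t \<le> 1" for f t x
 proof -
  define E where "E = (\<lambda>t. mollify r (\<lambda>z. indicator S z * f z) t x)"
  obtain f1 where f1: "\<And>i. i \<in> Basis ==> is_weak_deriv S [i] f (f1 i)" "\<And>i. i \<in> Basis ==> sobolev_unit S l (f1 i)"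
   using f by simp metis
  define E' where "E' = (\<lambda>t. \<Sum>i\<in>Basis. mollify (\<lambda>y. (y \<bullet> i) * r y) (\<lambda>z. indicator S z * f1 i z) t x)"
  have deriv: "(E has_real_derivative E' s) (at s)" if s: "0 < s" "s \<le> 1" for s
   unfolding E_def E'_def
   by (rule mollify_scale_derivative[OF S(1) sobolev_unit_integrable[OF S f] f1(1) Suc.prems(1) A Suc.prems(2) s(1)])
    (use x s in auto)
  have E'b: "\<bar>E' s\<bar> \<le> D * s powr - ?b" if s: "0 < s" "s \<le> 1" for s
  proof -
   have "\<bar>E' s\<bar> \<le> (\<Sum>i\<in>Basis. \<bar>mollify (\<lambda>y. (y \<bullet> i) * r y) (\<lambda>z. indicator S z * f1 i z) s x\<bar>)"
    unfolding E'_def by (rule sum_abs)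
   also have "\<dots> \<le> (\<Sum>i\<in>Basis. c i * s powr - ?b)"
    by (intro sum_mono c[OF f1(2) x s])
   finally show ?thesis by (simp add: D_def sum_distrib_right)
  qed
  have E1: "\<bar>E 1\<bar> \<le> C1"
   using mollify_L2_bound[OF S sobolev_unit_0[OF f] cont bdd, of 1 x] by (simp add: E_def C1_def)
  have main: "\<bar>E t\<bar> \<le> C1 + D * ((1 - t powr (1 - ?b)) / (1 - ?b))"
   by (rule bound_by_power_derivative[OF deriv E'b scale_exponent_neq_1 E1 t])
  \<comment> \<open>An exponent below \<open>1\<close> is integrable at scale zero and gives a bound
    uniform in \<open>t\<close>; an exponent above \<open>1\<close> drops by one.\<close>
  have "C1 + D * ((1 - t powr (1 - ?b)) / (1 - ?b)) \<le> C * t powr - scale_exponent DIM('a) (Suc l)"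
  proof (cases "?b < 1")
   case True
   then have "scale_exponent DIM('a) (Suc l) = 0" by (auto simp: scale_exponent_def)
   moreover have "D * ((1 - t powr (1 - ?b)) / (1 - ?b)) \<le> D * (1 / (1 - ?b))"
    using True D0 by (intro mult_left_mono divide_right_mono) auto
   ultimately show ?thesis using True t by (simp add: C_def)
  next
   case False
   with scale_exponent_neq_1[of "DIM('a)" l] have b: "?b > 1" by simp
   then have e: "scale_exponent DIM('a) (Suc l) = ?b - 1" by (auto simp: scale_exponent_def max_def split: if_splits)
   have T: "t powr (1 - ?b) \<ge> 1"
    using t b powr_mono'[of "1 - ?b" 0 t] by simp
   have "(1 - t powr (1 - ?b)) / (1 - ?b) = (t powr (1 - ?b) - 1) / (?b - 1)"
    using b by (simp add: divide_simps) (simp add: algebra_simps)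
   also have "\<dots> \<le> t powr (1 - ?b) / (?b - 1)" using b by (intro divide_right_mono) auto
   finally have "D * ((1 - t powr (1 - ?b)) / (1 - ?b)) \<le> D * (t powr (1 - ?b) / (?b - 1))"
    using D0 by (rule mult_left_mono)
   moreover have "C1 \<le> C1 * t powr (1 - ?b)" using T C1 mult_left_mono[of 1 "t powr (1 - ?b)" C1] by simp
   ultimately have "C1 + D * ((1 - t powr (1 - ?b)) / (1 - ?b)) \<le> C1 * t powr (1 - ?b) + D * (t powr (1 - ?b) / (?b - 1))" by linarith
   also have "\<dots> = C * t powr (1 - ?b)" using b by (simp add: C_def field_simps)
   finally show ?thesis using e by simp
  qed
  with main show ?thesis by (simp add: E_def)
 qed
 then show ?case using C by blast
qed

text \<open>Near each point of the closure the cones are translates of one another, spanned by the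
  same ball \<open>cball y0 r0\<close>. One weight supported in that ball therefore serves all
  vertices \<open>x\<close> nearby.\<close>

definition cone_condition :: "'a::euclidean_space set \<Rightarrow> bool" where
 "cone_condition S \<longleftrightarrow> (\<forall>x0\<in>closure S. \<exists>r>0. \<exists>y0. \<exists>r0>0. \<forall>x\<in>S \<inter> ball x0 r. \<forall>y\<in>cball y0 r0. \<forall>t. 0 < t \<and> t \<le> 1 \<longrightarrow> x + t *\<^sub>R y \<in> S)"

text \<open>Once the exponent is zero the mollifications are bounded independently of the scale, and
  they converge to \<open>f\<close> almost everywhere.\<close>

lemma local_sobolev_embedding:
 fixes S :: "'a::euclidean_space set"
 assumes S: "open S" "bounded S" and l: "real l > real DIM('a) / 2" and "r0 > 0"
  and cone: "\<And>x y t. x \<in> S \<inter> U ==> y \<in> cball y0 r0 ==> 0 < t ==> t \<le> 1 ==> x + t *\<^sub>R y \<in> S"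
 shows "\<exists>C\<ge>0. \<forall>f. sobolev_unit S l f \<longrightarrow> (AE x in lebesgue. x \<in> S \<inter> U \<longrightarrow> \<bar>f x\<bar> \<le> C)"
proof -
 obtain r where r: "mollifier r" "\<And>y. r y \<noteq> 0 ==> y \<in> ball y0 r0"
  using mollifier_exists[OF `r0 > 0`, of y0] by metis
 have "r y \<noteq> 0 ==> y \<in> cball y0 r0" for y using r(2)[of y] by auto
 then obtain C where C: "C \<ge> 0" "\<And>f x t. sobolev_unit S l f ==> (\<forall>y\<in>cball y0 r0. \<forall>t. 0 < t \<and> t \<le> 1 \<longrightarrow> x + t *\<^sub>R y \<in> S) ==> 0 < t ==> t \<le> 1 ==>
  \<bar>mollify r (\<lambda>z. indicator S z * f z) t x\<bar> \<le> C * t powr - scale_exponent DIM('a) l"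
  using mollify_sobolev_bound[OF S compact_cball[of y0 r0], of r l] r(1) unfolding mollifier_def by blast
 \<comment> \<open>As \<open>2 * l\<close> and the dimension are integers, \<open>l\<close> exceeds
   half the dimension by at least \<open>1 / 2\<close>, more than the offset
   \<open>1 / 4\<close>.\<close>
 have e0: "scale_exponent DIM('a) l = 0"
 proof -
  have "2 * l > DIM('a)" using l by linarith
  then have "2 * l \<ge> DIM('a) + 1" by simp
  then have "2 * real l \<ge> real DIM('a) + 1" by linarith
  then show ?thesis by (simp add: scale_exponent_def)
 qed
 have "AE x in lebesgue. x \<in> S \<inter> U \<longrightarrow> \<bar>f x\<bar> \<le> C" if f: "sobolev_unit S l f" for f
 proof -
  define F where "F = (\<lambda>z. indicator S z * f z)"
  have F: "integrable lebesgue F" using sobolev_unit_integrable[OF S f] S by (simp add: F_def integral_lebesgue_on)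
  obtain q where q: "strict_mono q" "AE x in lebesgue. \<forall>j\<in>{()}. (\<lambda>n. mollify r F (1 / real (Suc (q n))) x) \<longlonglongrightarrow> F x"
   using mollify_AE_subseq[of "{()}" "\<lambda>_. F" r] F r(1) by blast
  show ?thesis using q(2)
  proof eventually_elim
   case (elim x)
   show ?case
   proof
    assume x: "x \<in> S \<inter> U"
    have "\<bar>mollify r F (1 / real (Suc (q n))) x\<bar> \<le> C" for n
     using C(2)[OF f, of x "1 / real (Suc (q n))"] cone[OF x] e0 by (auto simp: F_def)
    then have "\<bar>F x\<bar> \<le> C"
     using elim by (intro LIMSEQ_le_const2[OF tendsto_rabs]) auto
    then show "\<bar>f x\<bar> \<le> C" using x by (simp add: F_def)
   qed
  qed
 qed
 with C(1) show ?thesis by blast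
qed

text \<open>The local constants are merged through a finite subcover of the compact set
  \<open>closure S\<close>; points of the boundary are covered too, which makes the constant uniform
  up to the boundary.\<close>

theorem sobolev_embedding:
 fixes S :: "'a::euclidean_space set"
 assumes S: "open S" "bounded S" "cone_condition S" and l: "real l > real DIM('a) / 2"
 shows "\<exists>C>0. \<forall>f. sobolev_unit S l f \<longrightarrow> (AE x in lebesgue_on S. \<bar>f x\<bar> \<le> C)"
proof -
 obtain r where r: "\<And>x0. x0 \<in> closure S ==> r x0 > 0"
  "\<And>x0. x0 \<in> closure S ==> \<exists>y0. \<exists>r0>0. \<forall>x\<in>S \<inter> ball x0 (r x0). \<forall>y\<in>cball y0 r0. \<forall>t. 0 < t \<and> t \<le> 1 \<longrightarrow> x + t *\<^sub>R y \<in> S"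
  using S(3) unfolding cone_condition_def by metis
 have "\<exists>C\<ge>0. \<forall>f. sobolev_unit S l f \<longrightarrow> (AE x in lebesgue. x \<in> S \<inter> ball x0 (r x0) \<longrightarrow> \<bar>f x\<bar> \<le> C)" if x0: "x0 \<in> closure S" for x0
 proof -
  obtain y0 r0 where "r0 > 0" "\<And>x y t. x \<in> S \<inter> ball x0 (r x0) ==> y \<in> cball y0 r0 ==> 0 < t ==> t \<le> 1 ==> x + t *\<^sub>R y \<in> S"
   using r(2)[OF x0] by blast
  then show ?thesis by (rule local_sobolev_embedding[OF S(1,2) l])
 qed
 then obtain c where c: "\<And>x0. x0 \<in> closure S ==> c x0 \<ge> 0"
  "\<And>x0 f. x0 \<in> closure S ==> sobolev_unit S l f ==> (AE x in lebesgue. x \<in> S \<inter> ball x0 (r x0) \<longrightarrow> \<bar>f x\<bar> \<le> c x0)"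
  by metis
 have "compact (closure S)" using S(2) by simp
 then obtain T where T: "T \<subseteq> closure S" "finite T" "closure S \<subseteq> (\<Union>x\<in>T. ball x (r x))"
  by (rule compactE_image[of _ "closure S" "\<lambda>x. ball x (r x)"]) (use r(1) in auto)
 define C where "C = 1 + (\<Sum>x\<in>T. c x)"
 have cC: "c x \<le> C" if "x \<in> T" for x
  using member_le_sum[of x T c] c(1) T that unfolding C_def by force
 have "C > 0" unfolding C_def using T c(1) by (auto intro!: add_pos_nonneg sum_nonneg)
 moreover have "AE x in lebesgue_on S. \<bar>f x\<bar> \<le> C" if f: "sobolev_unit S l f" for f
 proof -
  have "AE x in lebesgue. \<forall>x0\<in>T. x \<in> S \<inter> ball x0 (r x0) \<longrightarrow> \<bar>f x\<bar> \<le> c x0"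
   using T c(2)[OF _ f] by (intro AE_finite_allI) auto
  then have "AE x in lebesgue. x \<in> S \<longrightarrow> \<bar>f x\<bar> \<le> C"
  proof eventually_elim
   case (elim x)
   show ?case
   proof
    assume x: "x \<in> S"
    then obtain x0 where "x0 \<in> T" "x \<in> ball x0 (r x0)" using T(3) closure_subset[of S] by blast
    then show "\<bar>f x\<bar> \<le> C" using elim x cC[of x0] by force
   qed
  qed
  then show ?thesis using S by (simp add: AE_lebesgue_on)
 qed
 ultimately show ?thesis by blast
qed

section \<open>The cone condition for smooth domains\<close>

lemma smooth_on_lipschitz_cball:
 fixes f :: "'a::euclidean_space \<Rightarrow> real"
 assumes "smooth_on UNIV f"
 obtains L where "L > 0" "\<And>x y. x \<in> cball a r ==> y \<in> cball a r ==> \<bar>f x - f y\<bar> \<le> L * norm (x - y)"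
proof -
 have "\<exists>B. \<forall>x\<in>cball a r. \<bar>pdiff f x i\<bar> \<le> B" if "i \<in> Basis" for i
 proof -
  have "bounded ((\<lambda>x. pdiff f x i) ` cball a r)"
   using smooth_on_imp_continuous_on[OF smooth_on_partial[OF assms that]]
   by (intro compact_imp_bounded compact_continuous_image compact_cball) (auto intro: continuous_on_subset)
  then show ?thesis by (auto simp: bounded_iff)
 qed
 then obtain B where B: "\<And>i x. i \<in> Basis ==> x \<in> cball a r ==> \<bar>pdiff f x i\<bar> \<le> B i" by metis
 define L where "L = 1 + (\<Sum>i\<in>Basis. \<bar>B i\<bar>)"
 have "onorm (pdiff f x) \<le> L" if x: "x \<in> cball a r" for x
 proof (rule onorm_le)
  fix h
  have "linear (pdiff f x)"
   using smooth_on_imp_differentiable[OF assms UNIV_I] by (rule linear_frechet_derivative)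
  then have "pdiff f x (\<Sum>i\<in>Basis. (h \<bullet> i) *\<^sub>R i) = (\<Sum>i\<in>Basis. (h \<bullet> i) * pdiff f x i)"
   by (simp add: linear_sum linear_cmul)
  then have "pdiff f x h = (\<Sum>i\<in>Basis. (h \<bullet> i) * pdiff f x i)"
   by (simp add: euclidean_representation)
  then have "norm (pdiff f x h) \<le> (\<Sum>i\<in>Basis. \<bar>(h \<bullet> i) * pdiff f x i\<bar>)"
   by (simp add: sum_abs)
  also have "\<dots> \<le> (\<Sum>i\<in>Basis. norm h * \<bar>B i\<bar>)"
  proof (rule sum_mono)
   fix i :: 'a assume i: "i \<in> Basis"
   have "\<bar>pdiff f x i\<bar> \<le> \<bar>B i\<bar>" using B[OF i x] by linarith
   then show "\<bar>(h \<bullet> i) * pdiff f x i\<bar> \<le> norm h * \<bar>B i\<bar>"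
    unfolding abs_mult using Basis_le_norm[OF i, of h] by (intro mult_mono) auto
  qed
  also have "\<dots> \<le> L * norm h" by (simp add: L_def sum_distrib_left[symmetric] algebra_simps)
  finally show "norm (pdiff f x h) \<le> L * norm h" .
 qed
 then have "norm (f x - f y) \<le> L * norm (x - y)" if "x \<in> cball a r" "y \<in> cball a r" for x y
  using smooth_on_imp_differentiable[OF assms UNIV_I] that
  by (intro differentiable_bound[of "cball a r" f "\<lambda>x. pdiff f x"])
   (auto simp: frechet_derivative_works intro: has_derivative_at_withinI)
 moreover have "L > 0" unfolding L_def by (simp add: add_pos_nonneg sum_nonneg)
 ultimately show ?thesis using that by auto
qed

lemma norm_project_le: "norm e = 1 ==> norm (w - (w \<bullet> e) *\<^sub>R e) \<le> 2 * norm w"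
proof -
 assume "norm e = 1"
 then have "norm ((w \<bullet> e) *\<^sub>R e) \<le> norm w" using Cauchy_Schwarz_ineq2[of w e] by simp
 then show ?thesis using norm_triangle_ineq4[of w "(w \<bullet> e) *\<^sub>R e"] by linarith
qed

text \<open>At a boundary point the domain lies locally above the graph of a function that is
  Lipschitz near the point, so it contains translates of a cone around the direction
  \<open>e\<close> that is narrow relative to the Lipschitz constant.\<close>

lemma smooth_boundary_cone_condition:
 assumes "open S" "smooth_boundary S"
 shows "cone_condition S"
 unfolding cone_condition_def
proof
 fix x0 assume x0: "x0 \<in> closure S"
 show "\<exists>r>0. \<exists>y0. \<exists>r0>0. \<forall>x\<in>S \<inter> ball x0 r. \<forall>y\<in>cball y0 r0. \<forall>t. 0 < t \<and> t \<le> 1 \<longrightarrow> x + t *\<^sub>R y \<in> S"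
 proof (cases "x0 \<in> S")
  case True
  then obtain e where e: "e > 0" "ball x0 e \<subseteq> S" using assms(1) open_contains_ball by blast
  have "x + t *\<^sub>R y \<in> S" if "x \<in> ball x0 (e / 2)" "y \<in> cball 0 (e / 2)" "0 < t" "t \<le> 1" for x y t
  proof -
   have "norm (t *\<^sub>R y) \<le> 1 * (e / 2)" unfolding norm_scaleR using that by (intro mult_mono) auto
   moreover have "dist x0 (x + t *\<^sub>R y) \<le> dist x0 x + norm (t *\<^sub>R y)"
    by (metis add_diff_cancel_left' dist_norm dist_triangle norm_minus_commute)
   ultimately have "x + t *\<^sub>R y \<in> ball x0 e" using that(1) unfolding mem_ball by linarith
   then show ?thesis using e by blast
  qed
  then have cone: "\<forall>x\<in>S \<inter> ball x0 (e / 2). \<forall>y\<in>cball 0 (e / 2). \<forall>t. 0 < t \<and> t \<le> 1 \<longrightarrow> x + t *\<^sub>R y \<in> S"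
   by blast
  show ?thesis
   by (rule exI[of _ "e / 2"], rule conjI, use e(1) in simp, rule exI[of _ 0], rule exI[of _ "e / 2"],
    rule conjI, use e(1) in simp, rule cone)
 next
  case False
  then have "x0 \<in> frontier S" using x0 assms(1) by (simp add: frontier_def interior_open)
  then obtain r e \<psi> where r: "r > 0" "norm e = 1" "smooth_on UNIV \<psi>"
   and eq: "S \<inter> ball x0 r = {x \<in> ball x0 r. x \<bullet> e > \<psi> (x - (x \<bullet> e) *\<^sub>R e)}"
   using assms(2) unfolding smooth_boundary_def by blast
  define P where "P = (\<lambda>x. x - (x \<bullet> e) *\<^sub>R e)"
  have P_lin: "P (x + t *\<^sub>R y) = P x + t *\<^sub>R P y" for x y t
   by (simp add: P_def algebra_simps inner_add_left)
  have P_le: "norm (P w) \<le> 2 * norm w" for w unfolding P_def using norm_project_le[OF r(2)] .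
  have P_ball: "P x \<in> cball (P x0) (2 * r)" if "x \<in> ball x0 r" for x
  proof -
   have "P x0 - P x = P (x0 - x)" by (simp add: P_def algebra_simps inner_diff_left)
   then show ?thesis using P_le[of "x0 - x"] that by (simp add: dist_norm)
  qed
  obtain L where L: "L > 0" "\<And>x y. x \<in> cball (P x0) (2 * r) ==> y \<in> cball (P x0) (2 * r) ==> \<bar>\<psi> x - \<psi> y\<bar> \<le> L * norm (x - y)"
   using smooth_on_lipschitz_cball[OF r(3)] by metis
  \<comment> \<open>A step \<open>t y\<close> raises the height over the hyperplane by at least
    \<open>t * s * (1 - \<theta>)\<close> and the graph by at most
    \<open>t * s * 2 * L * \<theta>\<close>; the factor \<open>2\<close> stems from
    \<open>norm_project_le\<close>. The choice makes the first exceed the second.\<close>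
  define \<theta> where "\<theta> = 1 / (2 + 2 * L)"
  have \<theta>: "\<theta> > 0" "\<theta> < 1" "\<theta> + 2 * L * \<theta> < 1" using L(1) by (auto simp: \<theta>_def field_simps)
  \<comment> \<open>Directions in the cone then have norm at most \<open>2 * s = r / 2\<close>, so
    from \<open>ball x0 (r / 2)\<close> they stay inside \<open>ball x0 r\<close>.\<close>
  define s where "s = r / 4"
  have s: "s > 0" using r by (simp add: s_def)
  have "x + t *\<^sub>R y \<in> S" if x: "x \<in> S \<inter> ball x0 (r / 2)" and y: "y \<in> cball (s *\<^sub>R e) (s * \<theta>)" and t: "0 < t" "t \<le> 1" for x y t
  proof -
   define w where "w = y - s *\<^sub>R e"
   have w: "norm w \<le> s * \<theta>" "y = s *\<^sub>R e + w" using y by (auto simp: w_def dist_norm norm_minus_commute)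
   have ee: "e \<bullet> e = 1" using r(2) by (simp add: dot_square_norm)
   have we: "\<bar>w \<bullet> e\<bar> \<le> s * \<theta>" using Cauchy_Schwarz_ineq2[of w e] w(1) r(2) by simp
   have ye: "y \<bullet> e \<ge> s - s * \<theta>" using we by (simp add: w(2) inner_add_left ee)
   have "P y = P w" by (simp add: P_def w(2) inner_add_left ee algebra_simps)
   then have Py: "norm (P y) \<le> 2 * (s * \<theta>)" using P_le[of w] w(1) by simp
   have "norm y \<le> s + s * \<theta>" using norm_triangle_ineq[of "s *\<^sub>R e" w] w s r(2) by simp
   also have "\<dots> \<le> s + s * 1" using \<theta> s by (intro add_left_mono mult_left_mono) auto
   finally have ny: "norm y \<le> r / 2" by (simp add: s_def)
   then have "norm (t *\<^sub>R y) \<le> 1 * (r / 2)" unfolding norm_scaleR using t by (intro mult_mono) auto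
   moreover have "dist x0 (x + t *\<^sub>R y) \<le> dist x0 x + norm (t *\<^sub>R y)"
    by (metis add_diff_cancel_left' dist_norm dist_triangle norm_minus_commute)
   ultimately have b: "x + t *\<^sub>R y \<in> ball x0 r" using x unfolding mem_ball Int_iff by linarith
   have xb: "x \<in> ball x0 r" using x r(1) by auto
   have "x \<in> S \<inter> ball x0 r" using x xb by blast
   then have xe: "x \<bullet> e > \<psi> (P x)" unfolding eq P_def by blast
   have "\<bar>\<psi> (P (x + t *\<^sub>R y)) - \<psi> (P x)\<bar> \<le> L * norm (P (x + t *\<^sub>R y) - P x)"
    by (rule L(2)[OF P_ball[OF b] P_ball[OF xb]])
   also have "\<dots> = t * (L * norm (P y))" using t by (simp add: P_lin)
   also have "\<dots> \<le> t * (L * (2 * (s * \<theta>)))" using t L(1) Py by (intro mult_left_mono) auto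
   also have "\<dots> = t * (s * (2 * L * \<theta>))" by (simp add: algebra_simps)
   also have "\<dots> \<le> t * (s * (1 - \<theta>))" using t s \<theta>(3) by (intro mult_left_mono) auto
   also have "\<dots> \<le> t * (y \<bullet> e)" using t ye by (intro mult_left_mono) (auto simp: algebra_simps)
   finally have "\<psi> (P (x + t *\<^sub>R y)) < x \<bullet> e + t * (y \<bullet> e)" using xe by linarith
   then have "(x + t *\<^sub>R y) \<bullet> e > \<psi> (P (x + t *\<^sub>R y))" by (simp add: inner_add_left)
   then have "x + t *\<^sub>R y \<in> S \<inter> ball x0 r" unfolding eq P_def using b by blast
   then show ?thesis by blast
  qed
  then have cone: "\<forall>x\<in>S \<inter> ball x0 (r / 2). \<forall>y\<in>cball (s *\<^sub>R e) (s * \<theta>). \<forall>t. 0 < t \<and> t \<le> 1 \<longrightarrow> x + t *\<^sub>R y \<in> S"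
   by blast
  show ?thesis
   by (rule exI[of _ "r / 2"], rule conjI, use r(1) in simp, rule exI[of _ "s *\<^sub>R e"], rule exI[of _ "s * \<theta>"],
    rule conjI, use s \<theta>(1) in simp, rule cone)
 qed
qed

section \<open>Essentially bounded functions and the chain rule\<close>

definition ess_bounded :: "'a measure \<Rightarrow> ('a \<Rightarrow> real) \<Rightarrow> bool" where
 "ess_bounded M f \<longleftrightarrow> f \<in> borel_measurable M \<and> (\<exists>C. AE x in M. \<bar>f x\<bar> \<le> C)"

lemma ess_boundedI: "f \<in> borel_measurable M ==> AE x in M. \<bar>f x\<bar> \<le> C ==> ess_bounded M f"
 by (auto simp: ess_bounded_def)

lemma ess_boundedE:
 assumes "ess_bounded M f"
 obtains C where "C > 0" "AE x in M. \<bar>f x\<bar> \<le> C"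
proof -
 obtain C where C: "AE x in M. \<bar>f x\<bar> \<le> C" using assms by (auto simp: ess_bounded_def)
 have "AE x in M. \<bar>f x\<bar> \<le> \<bar>C\<bar> + 1" using C by eventually_elim linarith
 with that[of "\<bar>C\<bar> + 1"] show ?thesis by linarith
qed

lemma ess_bounded_measurable: "ess_bounded M f ==> f \<in> borel_measurable M"
 by (simp add: ess_bounded_def)

lemma ess_bounded_const: "ess_bounded M (\<lambda>x. c)"
 by (rule ess_boundedI[of _ _ "\<bar>c\<bar>"]) auto

lemma ess_bounded_add:
 assumes "ess_bounded M f" "ess_bounded M g"
 shows "ess_bounded M (\<lambda>x. f x + g x)"
proof -
 obtain C D where "AE x in M. \<bar>f x\<bar> \<le> C" "AE x in M. \<bar>g x\<bar> \<le> D" using assms by (auto simp: ess_bounded_def)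
 then have "AE x in M. \<bar>f x + g x\<bar> \<le> C + D" by eventually_elim linarith
 then show ?thesis
  by (rule ess_boundedI[OF borel_measurable_add[OF assms[THEN ess_bounded_measurable]]])
qed

lemma ess_bounded_mult:
 assumes "ess_bounded M f" "ess_bounded M g"
 shows "ess_bounded M (\<lambda>x. f x * g x)"
proof -
 obtain C where C: "C > 0" "AE x in M. \<bar>f x\<bar> \<le> C" by (rule ess_boundedE[OF assms(1)])
 obtain D where D: "D > 0" "AE x in M. \<bar>g x\<bar> \<le> D" by (rule ess_boundedE[OF assms(2)])
 have "AE x in M. \<bar>f x * g x\<bar> \<le> C * D"
  using C(2) D(2) by eventually_elim (use C D in \<open>auto simp: abs_mult intro!: mult_mono\<close>)
 then show ?thesis
  by (rule ess_boundedI[OF borel_measurable_times[OF assms[THEN ess_bounded_measurable]]])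
qed

lemma ess_bounded_cmult: "ess_bounded M f ==> ess_bounded M (\<lambda>x. c * f x)"
 by (rule ess_bounded_mult[OF ess_bounded_const])

lemma ess_bounded_diff:
 assumes "ess_bounded M f" "ess_bounded M g"
 shows "ess_bounded M (\<lambda>x. f x - g x)"
 using ess_bounded_add[OF assms(1) ess_bounded_cmult[OF assms(2), of "-1"]] by simp

lemma ess_bounded_sum:
 assumes "\<And>i. i \<in> I ==> ess_bounded M (f i)"
 shows "ess_bounded M (\<lambda>x. \<Sum>i\<in>I. f i x)"
 using assms
proof (induction I rule: infinite_finite_induct)
 case (insert i I)
 then show ?case using ess_bounded_add[of M "f i" "\<lambda>x. \<Sum>i\<in>I. f i x"] by simp
qed (auto intro: ess_bounded_const)

lemma ess_bounded_cong:
 assumes "ess_bounded M f" "g \<in> borel_measurable M" "AE x in M. f x = g x"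
 shows "ess_bounded M g"
proof -
 obtain C where "C > 0" "AE x in M. \<bar>f x\<bar> \<le> C" by (rule ess_boundedE[OF assms(1)])
 from this(2) assms(3) have "AE x in M. \<bar>g x\<bar> \<le> C" by eventually_elim simp
 with assms(2) show ?thesis by (rule ess_boundedI)
qed

lemma ess_bounded_mult_integrable:
 assumes "ess_bounded M f" "integrable M g"
 shows "integrable M (\<lambda>x. f x * g x)"
proof -
 obtain C where C: "C > 0" "AE x in M. \<bar>f x\<bar> \<le> C" by (rule ess_boundedE[OF assms(1)])
 show ?thesis
 proof (rule integrable_of_AE_bound(1))
  show "integrable M (\<lambda>x. C * \<bar>g x\<bar>)" using assms(2) by auto
  show "AE x in M. \<bar>f x * g x\<bar> \<le> C * \<bar>g x\<bar>"
   using C(2) by eventually_elim (auto simp: abs_mult intro: mult_right_mono)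
  show "(\<lambda>x. f x * g x) \<in> borel_measurable M"
   by (rule borel_measurable_times[OF ess_bounded_measurable[OF assms(1)] borel_measurable_integrable[OF assms(2)]])
 qed
qed

lemma ess_bounded_integrable:
 assumes "finite_measure M" "ess_bounded M f"
 shows "integrable M f"
 using ess_bounded_mult_integrable[OF assms(2), of "\<lambda>x. 1"] finite_measure.integrable_const[OF assms(1), of 1]
 by simp

lemma ess_bounded_extend:
 fixes f :: "'a::euclidean_space \<Rightarrow> real"
 assumes "open S" "AE x in lebesgue_on S. \<bar>f x\<bar> \<le> C" "C \<ge> 0"
 shows "AE x in lebesgue. \<bar>indicator S x * f x\<bar> \<le> C"
proof -
 have "AE x in lebesgue. x \<in> S \<longrightarrow> \<bar>f x\<bar> \<le> C" using assms by (simp add: AE_lebesgue_on)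
 then show ?thesis by eventually_elim (use assms in \<open>auto split: split_indicator\<close>)
qed

section \<open>The chain rule for weak derivatives\<close>

lemma mollify_continuous:
 fixes f :: "'a::euclidean_space \<Rightarrow> real"
 assumes f: "integrable lebesgue f" and r: "mollifier r" and t: "t > 0"
 shows "continuous_on UNIV (mollify r f t)"
 unfolding continuous_on_sequentially
proof (intro allI impI ballI)
 fix X :: "nat \<Rightarrow> 'a" and a assume *: "(\<forall>n. X n \<in> UNIV) \<and> X \<longlonglongrightarrow> a"
 obtain B where B: "\<And>x. \<bar>r x\<bar> \<le> B"
  using continuous_bounded_support_bounded[OF mollifier_continuous[OF r]] r unfolding mollifier_def by metis
 have [measurable]: "r \<in> borel_measurable borel" by (rule mollifier_measurable[OF r])
 have m: "(\<lambda>z. r ((z - x) /\<^sub>R t) / t ^ DIM('a)) \<in> borel_measurable lebesgue" for x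
 proof -
  have "(\<lambda>z. r ((z - x) /\<^sub>R t) / t ^ DIM('a)) \<in> borel_measurable lborel" by measurable
  then show ?thesis by (rule measurable_completion)
 qed
 have c: "isCont r y" for y using mollifier_continuous[OF r] by (simp add: continuous_on_eq_continuous_at)
 have "(\<lambda>n. \<integral>z. f z * (r ((z - X n) /\<^sub>R t) / t ^ DIM('a)) \<partial>lebesgue) \<longlonglongrightarrow> (LINT z|lebesgue. f z * (r ((z - a) /\<^sub>R t) / t ^ DIM('a)))"
 proof (rule integral_dominated_convergence[where w="\<lambda>z. \<bar>f z\<bar> * (B / t ^ DIM('a))"])
  show "integrable lebesgue (\<lambda>z. \<bar>f z\<bar> * (B / t ^ DIM('a)))" using f by auto
  show "AE z in lebesgue. (\<lambda>n. f z * (r ((z - X n) /\<^sub>R t) / t ^ DIM('a))) \<longlonglongrightarrow> f z * (r ((z - a) /\<^sub>R t) / t ^ DIM('a))"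
   using * t by (intro AE_I2 tendsto_intros isCont_tendsto_compose[OF c]) auto
  show "AE z in lebesgue. norm (f z * (r ((z - X n) /\<^sub>R t) / t ^ DIM('a))) \<le> \<bar>f z\<bar> * (B / t ^ DIM('a))" for n
   unfolding real_norm_def abs_mult using B t
   by (intro AE_I2 mult_left_mono) (auto simp: abs_divide divide_right_mono)
 qed (intro borel_measurable_times borel_measurable_integrable[OF f] m)+
 then show "(mollify r f t \<circ> X) \<longlonglongrightarrow> mollify r f t a" by (simp add: mollify_def o_def)
qed

text \<open>All ingredients are mollified at a common scale. There the classical chain rule holds,
  as mollification commutes with the weak derivative away from the boundary, and the product with a
  test function integrates to zero after differentiation. Essential boundedness keeps the mollified
  values in a compact set on which \<open>G\<close> and its first derivatives are bounded, so
  dominated convergence applies along a subsequence converging almost everywhere.\<close>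

lemma weak_deriv_chain_rule:
 fixes S :: "'a::euclidean_space set" and G :: "'a \<times> 'a \<Rightarrow> real"
 assumes S: "open S" "bounded S" and i: "i \<in> Basis"
  and G: "smooth_on (S \<times> UNIV) G"
  and \<eta>: "ess_bounded (lebesgue_on S) \<eta>" "is_weak_deriv S [i] \<eta> \<eta>1" "ess_bounded (lebesgue_on S) \<eta>1"
  and p: "\<And>j. j \<in> Basis ==> ess_bounded (lebesgue_on S) (p j)"
   "\<And>j. j \<in> Basis ==> is_weak_deriv S [i] (p j) (p1 j)"
   "\<And>j. j \<in> Basis ==> ess_bounded (lebesgue_on S) (p1 j)"
  and P: "P = (\<lambda>x. \<Sum>j\<in>Basis. p j x *\<^sub>R j)"
  and f: "f = (\<lambda>x. \<eta> x * G (x, P x))" "locally_integrable S f"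
  and f1: "f1 = (\<lambda>x. \<eta>1 x * G (x, P x) + \<eta> x * (pdiff G (x, P x) (i, 0)
   + (\<Sum>j\<in>Basis. p1 j x * pdiff G (x, P x) (0, j))))" "locally_integrable S f1"
 shows "is_weak_deriv S [i] f f1"
proof -
 have Sl: "S \<in> sets lebesgue" using S by auto
 interpret finite_measure "lebesgue_on S" by (rule bounded_open_finite_measure[OF S])
 have int: "integrable lebesgue (\<lambda>z. indicator S z * u z)" if "ess_bounded (lebesgue_on S) u" for u
  using ess_bounded_integrable[OF finite_measure_axioms that] Sl by (simp add: integral_lebesgue_on)
 define ext where "ext = (\<lambda>u z. indicator S z * (u z :: real))"
 obtain rh where rh: "mollifier rh" "\<And>x. rh x \<noteq> 0 ==> x \<in> ball (0::'a) 1"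
  using mollifier_exists[of 1 "0::'a"] by auto
 then have rhs: "smooth_on UNIV rh" and rh1: "\<And>x. rh x \<noteq> 0 ==> x \<in> cball 0 1"
  by (auto simp: mollifier_def less_imp_le)
 \<comment> \<open>The flag separates the functions (\<open>True\<close>) from their derivatives in
   direction \<open>i\<close> (\<open>False\<close>); the vector \<open>0\<close>, which is not a
   basis vector, stands for \<open>\<eta>\<close>.\<close>
 define J :: "(bool \<times> 'a) set" where "J = UNIV \<times> insert 0 Basis"
 define fam where "fam = (\<lambda>(b, j). if b then (if j = 0 then \<eta> else p j) else (if j = 0 then \<eta>1 else p1 j))"
 have fam_bdd: "ess_bounded (lebesgue_on S) (fam j)" if "j \<in> J" for j
  using that \<eta> p by (auto simp: fam_def J_def)
 have "\<exists>C>0. AE x in lebesgue. \<bar>ext (fam j) x\<bar> \<le> C" if j: "j \<in> J" for j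
 proof -
  obtain C where C: "C > 0" "AE x in lebesgue_on S. \<bar>fam j x\<bar> \<le> C" by (rule ess_boundedE[OF fam_bdd[OF j]])
  then show ?thesis unfolding ext_def using ess_bounded_extend[OF S(1) C(2)] by (intro exI[of _ C]) auto
 qed
 then obtain c where c: "\<And>j. j \<in> J ==> c j > 0" "\<And>j. j \<in> J ==> AE x in lebesgue. \<bar>ext (fam j) x\<bar> \<le> c j" by metis
 define N where "N = (\<Sum>j\<in>J. c j)"
 have fJ: "finite J" by (simp add: J_def)
 have cN: "c j \<le> N" if "j \<in> J" for j
  unfolding N_def using that c(1) fJ by (intro member_le_sum) (auto intro: less_imp_le)
 have N0: "N \<ge> 0" unfolding N_def using c(1) by (intro sum_nonneg) (auto intro: less_imp_le)
 have fam_int: "integrable lebesgue (ext (fam j))" if "j \<in> J" for j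
  unfolding ext_def by (rule int[OF fam_bdd[OF that]])
 define m where "m = (\<lambda>t j. mollify rh (ext (fam j)) t)"
 have m_bound: "\<bar>m t j x\<bar> \<le> N" if "j \<in> J" "t > 0" for t j x
  using mollify_bound[OF fam_int[OF that(1)] rh(1) that(2) c(2)[OF that(1)], of x] cN[OF that(1)]
  by (simp add: m_def)
 have m_cont: "continuous_on UNIV (m t j)" if "j \<in> J" "t > 0" for t j
  unfolding m_def by (rule mollify_continuous[OF fam_int[OF that(1)] rh(1) that(2)])
 have m_deriv: "((\<lambda>s. m t (True, j) (x + s *\<^sub>R i)) has_real_derivative m t (False, j) x) (at 0)"
  if j: "j \<in> insert 0 Basis" and t: "t > 0" "cball x t \<subseteq> S" for j t x
 proof -
  have w: "is_weak_deriv S [i] (fam (True, j)) (fam (False, j))" using j \<eta> p by (auto simp: fam_def)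
  have jJ: "(True, j) \<in> J" using j by (auto simp: J_def)
  show ?thesis unfolding m_def ext_def
   by (rule mollify_directional_derivative[OF S(1) ess_bounded_integrable[OF finite_measure_axioms fam_bdd[OF jJ]] w i rhs rh1 t])
 qed
 obtain q where q: "strict_mono q" "AE x in lebesgue. \<forall>j\<in>J. (\<lambda>n. mollify rh (ext (fam j)) (1 / real (Suc (q n))) x) \<longlonglongrightarrow> ext (fam j) x"
  using mollify_AE_subseq[of J "\<lambda>j. ext (fam j)" rh, OF fJ fam_int rh(1)] by blast
 define \<tau> where "\<tau> = (\<lambda>n. 1 / real (Suc (q n)))"
 have \<tau>0: "\<tau> n > 0" for n by (simp add: \<tau>_def)
 have \<tau>_lim: "\<tau> \<longlonglongrightarrow> 0"
  using LIMSEQ_subseq_LIMSEQ[OF LIMSEQ_inverse_real_of_nat q(1)] by (simp add: o_def inverse_eq_divide \<tau>_def)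
 have m_lim: "AE x in lebesgue. \<forall>j\<in>J. (\<lambda>n. m (\<tau> n) j x) \<longlonglongrightarrow> ext (fam j) x"
  using q(2) by (simp add: m_def \<tau>_def)
 define Pm where "Pm = (\<lambda>t x. \<Sum>j\<in>Basis. m t (True, j) x *\<^sub>R j)"
 let ?Gx = "\<lambda>z. pdiff G z (i, 0)"
 let ?Gp = "\<lambda>j z. pdiff G z (0, j)"
 have Bi: "(i, 0) \<in> (Basis :: ('a \<times> 'a) set)" using i by (simp add: Basis_prod_def)
 have Bj: "(0, j) \<in> (Basis :: ('a \<times> 'a) set)" if "j \<in> Basis" for j :: 'a using that by (simp add: Basis_prod_def)
 have Gc: "continuous_on (S \<times> UNIV) G" "continuous_on (S \<times> UNIV) ?Gx"
  "\<And>j. j \<in> Basis ==> continuous_on (S \<times> UNIV) (?Gp j)"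
  using G Bi Bj by (auto intro!: smooth_on_imp_continuous_on smooth_on_partial)
 have oS: "open (S \<times> (UNIV :: 'a set))" using S by (intro open_Times) auto
 have "(LINT x|lebesgue_on S. f x * pdiff \<psi> x i) = - (LINT x|lebesgue_on S. f1 x * \<psi> x)"
  if \<psi>: "test_function S \<psi>" for \<psi>
 proof -
  let ?\<psi>' = "\<lambda>x. pdiff \<psi> x i"
  note \<psi>' = test_function_partial[OF \<psi> i]
  define K where "K = closure {x. \<psi> x \<noteq> 0}"
  have K: "compact K" "K \<subseteq> S" unfolding K_def by (rule test_functionD[OF \<psi>])+
  have \<psi>0: "\<psi> x = 0" "?\<psi>' x = 0" if "x \<notin> K" for x
   using that test_functionD(7)[OF \<psi>, of x] iter_partial_outside_support[of x \<psi> "[i]"] by (simp_all add: K_def)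
  obtain B\<psi> where B\<psi>: "B\<psi> > 0" "\<And>x. \<bar>\<psi> x\<bar> \<le> B\<psi>" using test_function_bounded[OF \<psi>] by metis
  obtain B\<psi>' where B\<psi>': "B\<psi>' > 0" "\<And>x. \<bar>?\<psi>' x\<bar> \<le> B\<psi>'" using test_function_bounded[OF \<psi>'] by metis
  obtain dl where dl: "dl > 0" "\<And>x. x \<in> K ==> ball x dl \<subseteq> S"
  proof -
   have "closed (- S)" "K \<inter> - S = {}" using K S by auto
   from separate_compact_closed[OF K(1) this] obtain d where d: "d > 0" "\<And>x y. x \<in> K ==> y \<in> - S ==> d \<le> dist x y" by blast
   have "ball x d \<subseteq> S" if "x \<in> K" for x using d(2)[OF that] by force
   with d(1) that show ?thesis by blast
  qed
  have cb: "cball x t \<subseteq> S" if "x \<in> K" "t < dl" for x t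
   using dl(2)[OF that(1)] that(2) by force
  \<comment> \<open>This bounds every mollified vector \<open>Pm t x\<close>, so that
    \<open>G\<close> has to be controlled on the compact set \<open>K \<times> cball 0 R\<close>
    only.\<close>
  define R where "R = real DIM('a) * N"
  obtain B where B: "B \<ge> 0" "\<And>x y. x \<in> K ==> norm y \<le> R ==> \<bar>G (x, y)\<bar> \<le> B"
   "\<And>x y. x \<in> K ==> norm y \<le> R ==> \<bar>?Gx (x, y)\<bar> \<le> B"
   "\<And>x y j. x \<in> K ==> norm y \<le> R ==> j \<in> Basis ==> \<bar>?Gp j (x, y)\<bar> \<le> B"
  proof -
   define g where "g = (\<lambda>z. \<bar>G z\<bar> + \<bar>?Gx z\<bar> + (\<Sum>j\<in>Basis. \<bar>?Gp j z\<bar>))"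
   have sub: "K \<times> cball 0 R \<subseteq> S \<times> UNIV" using K(2) by auto
   have "continuous_on (S \<times> UNIV) g" unfolding g_def using Gc by (intro continuous_intros) auto
   then have "compact (g ` (K \<times> cball 0 R))"
    by (intro compact_continuous_image compact_Times K(1) compact_cball) (rule continuous_on_subset[OF _ sub])
   then have "bounded (g ` (K \<times> cball 0 R))" by (rule compact_imp_bounded)
   then obtain B where B: "\<And>z. z \<in> K \<times> cball 0 R ==> \<bar>g z\<bar> \<le> B" by (auto simp: bounded_iff)
   have g0: "\<bar>G z\<bar> \<le> g z" "\<bar>?Gx z\<bar> \<le> g z" "g z \<ge> 0" for z by (auto simp: g_def sum_nonneg)
   have gj: "\<bar>?Gp j z\<bar> \<le> g z" if "j \<in> Basis" for j z
    using member_le_sum[of j Basis "\<lambda>j. \<bar>?Gp j z\<bar>"] that by (auto simp: g_def)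
   have gB: "g (x, y) \<le> max 0 B" if "x \<in> K" "norm y \<le> R" for x y using B[of "(x, y)"] that by auto
   show ?thesis
   proof (rule that[of "max 0 B"])
    show "\<bar>G (x, y)\<bar> \<le> max 0 B" if "x \<in> K" "norm y \<le> R" for x y using g0(1) gB[OF that] by (rule order_trans)
    show "\<bar>?Gx (x, y)\<bar> \<le> max 0 B" if "x \<in> K" "norm y \<le> R" for x y using g0(2) gB[OF that] by (rule order_trans)
    show "\<bar>?Gp j (x, y)\<bar> \<le> max 0 B" if "x \<in> K" "norm y \<le> R" "j \<in> Basis" for x y j using gj[OF that(3)] gB[OF that(1,2)] by (rule order_trans)
   qed simp
  qed
  \<comment> \<open>The integrand of the product rule as a function of the values plugged in: the
    mollified expression and its limit become instances of the same formula, and one bound covers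
    all scales.\<close>
  define X where "X = (\<lambda>(e::real) e1 y (r::'a \<Rightarrow> real) x. ?\<psi>' x * (e * G (x, y)) + \<psi> x * (e1 * G (x, y) + e * (?Gx (x, y) + (\<Sum>j\<in>Basis. r j * ?Gp j (x, y)))))"
  define C where "C = B\<psi>' * (N * B) + B\<psi> * (N * B + N * (B + real DIM('a) * (N * B)))"
  have C0: "C \<ge> 0" unfolding C_def using B\<psi> B\<psi>' N0 B(1) by (intro add_nonneg_nonneg mult_nonneg_nonneg) auto
  have X_bound: "\<bar>X e e1 y r x\<bar> \<le> C" if "x \<in> K" "\<bar>e\<bar> \<le> N" "\<bar>e1\<bar> \<le> N" "norm y \<le> R" "\<And>j. j \<in> Basis ==> \<bar>r j\<bar> \<le> N" for e e1 y r x
  proof -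
   have "\<bar>\<Sum>j\<in>Basis. r j * ?Gp j (x, y)\<bar> \<le> (\<Sum>j\<in>(Basis::'a set). N * B)"
    using that B N0 by (intro order_trans[OF sum_abs] sum_mono) (auto simp: abs_mult intro!: mult_mono)
   then have "\<bar>?Gx (x, y) + (\<Sum>j\<in>Basis. r j * ?Gp j (x, y))\<bar> \<le> B + real DIM('a) * (N * B)"
    using B(3)[OF that(1,4)] by simp
   then have 1: "\<bar>e * (?Gx (x, y) + (\<Sum>j\<in>Basis. r j * ?Gp j (x, y)))\<bar> \<le> N * (B + real DIM('a) * (N * B))"
    unfolding abs_mult using that N0 by (intro mult_mono) auto
   have 2: "\<bar>e1 * G (x, y)\<bar> \<le> N * B" "\<bar>e * G (x, y)\<bar> \<le> N * B"
    unfolding abs_mult using that B N0 by (auto intro!: mult_mono)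
   have 3: "\<bar>?\<psi>' x * (e * G (x, y))\<bar> \<le> B\<psi>' * (N * B)"
    unfolding abs_mult[of "?\<psi>' x"] using 2 B\<psi>' N0 B(1) by (intro mult_mono) (auto intro: less_imp_le)
   have "\<bar>\<psi> x * (e1 * G (x, y) + e * (?Gx (x, y) + (\<Sum>j\<in>Basis. r j * ?Gp j (x, y))))\<bar> \<le> B\<psi> * (N * B + N * (B + real DIM('a) * (N * B)))"
    unfolding abs_mult[of "\<psi> x"] using 1 2 B\<psi> by (intro mult_mono) (auto intro: less_imp_le order_trans[OF abs_triangle_ineq add_mono])
   with 3 show ?thesis unfolding X_def C_def by (intro order_trans[OF abs_triangle_ineq] add_mono)
  qed
  have X_0: "X e e1 y r x = 0" if "x \<notin> K" for e e1 y r x using \<psi>0[OF that] by (simp add: X_def)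
  have J_in: "(b, 0) \<in> J" "\<And>j. j \<in> Basis ==> (b, j) \<in> J" for b by (auto simp: J_def)
  have Pm_le: "norm (Pm t x) \<le> R" if "t > 0" for t x
  proof -
   have "norm (Pm t x) \<le> (\<Sum>j\<in>(Basis::'a set). N)"
    unfolding Pm_def using m_bound[OF J_in(2) that] by (intro order_trans[OF norm_sum] sum_mono) simp
   then show ?thesis by (simp add: R_def)
  qed
  define F where "F = (\<lambda>t x. \<psi> x * (m t (True, 0) x * G (x, Pm t x)))"
  define F' where "F' = (\<lambda>t x. X (m t (True, 0) x) (m t (False, 0) x) (Pm t x) (\<lambda>j. m t (False, j) x) x)"
  have F'C: "\<bar>F' t x\<bar> \<le> C" if "t > 0" for t x
   using X_bound[of x] X_0[of x] C0 m_bound[OF J_in(1) that] m_bound[OF J_in(2) that] Pm_le[OF that]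
   unfolding F'_def by (cases "x \<in> K") auto
  have F0: "F t x = 0" if "x \<notin> K" for t x using \<psi>0[OF that] by (simp add: F_def)
  have Pm_cont: "isCont (Pm t) x" if "t > 0" for t x
   unfolding Pm_def using m_cont[OF J_in(2) that]
   by (intro continuous_intros) (auto simp: continuous_on_eq_continuous_at)
  have contF: "continuous_on UNIV (F t)" if t: "t > 0" for t
  proof (rule continuous_at_imp_continuous_on, rule ballI)
   fix x show "isCont (F t) x"
   proof (cases "x \<in> K")
    case True
    then have xS: "x \<in> S" using K by auto
    have "isCont G (x, Pm t x)" using Gc(1) oS xS by (simp add: continuous_on_eq_continuous_at)
    then have "isCont (\<lambda>x. G (x, Pm t x)) x"
     by (intro isCont_o2[where g=G and f="\<lambda>x. (x, Pm t x)"] continuous_intros Pm_cont[OF t]) auto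
    moreover have "isCont \<psi> x" using test_functionD(2)[OF \<psi>] by (simp add: continuous_on_eq_continuous_at)
    moreover have "isCont (m t (True, 0)) x" using m_cont[OF J_in(1) t] by (simp add: continuous_on_eq_continuous_at)
    ultimately show ?thesis unfolding F_def by (intro continuous_intros) auto
   next
    case False
    have "continuous_on (- K) (F t)"
     using F0 by (subst continuous_on_cong[OF refl, of _ _ "\<lambda>x. 0"]) auto
    moreover have "open (- K)" using compact_imp_closed[OF K(1)] by auto
    ultimately show ?thesis using False by (simp add: continuous_on_eq_continuous_at)
   qed
  qed
  have dirF: "((\<lambda>s. F t (x + s *\<^sub>R i)) has_real_derivative F' t x) (at 0)" if t: "0 < t" "t < dl" for t x
  proof (cases "x \<in> K")
   case True
   have xS: "x \<in> S" using True K by auto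
   note D = m_deriv[OF _ t(1) cb[OF True t(2)]]
   have line: "((\<lambda>s. x + s *\<^sub>R i) has_derivative (\<lambda>s. s *\<^sub>R i)) (at 0)"
    by (auto intro!: derivative_eq_intros)
   have "((\<lambda>s. \<psi> (x + s *\<^sub>R i)) has_derivative (\<lambda>s. pdiff \<psi> x (s *\<^sub>R i))) (at 0)"
    using has_derivative_compose[OF line, of \<psi> "pdiff \<psi> x"] test_functionD(4)[OF \<psi>, of x]
    by (simp add: frechet_derivative_works)
   moreover have "pdiff \<psi> x (s *\<^sub>R i) = ?\<psi>' x * s" for s
    using linear_cmul[OF linear_frechet_derivative[OF test_functionD(4)[OF \<psi>, of x]], of s i] by simp
   ultimately have D1: "((\<lambda>s. \<psi> (x + s *\<^sub>R i)) has_real_derivative ?\<psi>' x) (at 0)"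
    by (simp add: has_field_derivative_def)
   define v where "v = (\<Sum>j\<in>Basis. m t (False, j) x *\<^sub>R j)"
   have "((\<lambda>s. Pm t (x + s *\<^sub>R i)) has_derivative (\<lambda>s. \<Sum>j\<in>Basis. (m t (False, j) x * s) *\<^sub>R j)) (at 0)"
    unfolding Pm_def using D
    by (intro has_derivative_sum bounded_linear.has_derivative[OF bounded_linear_scaleR_left]) (auto simp: has_field_derivative_def)
   then have "((\<lambda>s. Pm t (x + s *\<^sub>R i)) has_derivative (\<lambda>s. s *\<^sub>R v)) (at 0)"
    by (simp add: v_def scaleR_sum_right mult.commute)
   from has_derivative_Pair[OF line this]
   have pair: "((\<lambda>s. (x + s *\<^sub>R i, Pm t (x + s *\<^sub>R i))) has_derivative (\<lambda>s. s *\<^sub>R (i, v))) (at 0)" by simp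
   have Gd: "G differentiable (at (x, Pm t x))" using smooth_on_imp_differentiable[OF G] xS by auto
   note Glin = linear_frechet_derivative[OF Gd]
   have "((\<lambda>s. G (x + s *\<^sub>R i, Pm t (x + s *\<^sub>R i))) has_derivative (\<lambda>s. pdiff G (x, Pm t x) (s *\<^sub>R (i, v)))) (at 0)"
    using has_derivative_compose[OF pair, of G "pdiff G (x, Pm t x)"] Gd
    by (simp add: frechet_derivative_works)
   moreover have "pdiff G (x, Pm t x) (i, v) = ?Gx (x, Pm t x) + (\<Sum>j\<in>Basis. m t (False, j) x * ?Gp j (x, Pm t x))"
   proof -
    have "(i, v) = (i, 0) + (\<Sum>j\<in>Basis. m t (False, j) x *\<^sub>R (0, j))"
     by (simp add: v_def sum_prod prod_eq_iff fst_sum snd_sum)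
    then show ?thesis
     by (simp only: linear_add[OF Glin] linear_sum[OF Glin] linear_cmul[OF Glin] real_scaleR_def)
   qed
   ultimately have D3: "((\<lambda>s. G (x + s *\<^sub>R i, Pm t (x + s *\<^sub>R i))) has_real_derivative (?Gx (x, Pm t x) + (\<Sum>j\<in>Basis. m t (False, j) x * ?Gp j (x, Pm t x)))) (at 0)"
    by (simp only: has_field_derivative_def linear_cmul[OF Glin] real_scaleR_def mult_commute_abs)
   have D2: "((\<lambda>s. m t (True, 0) (x + s *\<^sub>R i)) has_real_derivative m t (False, 0) x) (at 0)" by (rule D) simp
   from DERIV_mult[OF D1 DERIV_mult[OF D2 D3]]
   show ?thesis unfolding F_def F'_def X_def by (rule DERIV_cong) (simp add: algebra_simps)
  next
   case False
   have "((\<lambda>s. 0) has_real_derivative 0) (at 0)" by simp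
   then have "((\<lambda>s. F t (x + s *\<^sub>R i)) has_real_derivative 0) (at 0)"
   proof (rule has_field_derivative_transform_within_open[of _ _ _ "(\<lambda>s. x + s *\<^sub>R i) -` (- K)"])
    show "open ((\<lambda>s. x + s *\<^sub>R i) -` (- K))"
     by (rule open_vimage) (use K(1) in \<open>auto intro!: continuous_intros compact_imp_closed\<close>)
   qed (use False F0 in auto)
   then show ?thesis using X_0[OF False] by (simp add: F'_def)
  qed
  have zero: "integrable lborel (F' t)" "(LINT x|lborel. F' t x) = 0" if t: "0 < t" "t < dl" for t
   using integral_directional_derivative[OF contF[OF t(1)] dirF[OF t] F'C[OF t(1)] K(1) F0] by blast+
  have zero_l: "(LINT x|lebesgue. F' t x) = 0" "F' t \<in> borel_measurable lebesgue" if t: "0 < t" "t < dl" for t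
  proof -
   have b: "F' t \<in> borel_measurable lborel" using zero(1)[OF t] by (rule borel_measurable_integrable)
   show "(LINT x|lebesgue. F' t x) = 0" using zero(2)[OF t] b by (simp add: integral_completion)
   show "F' t \<in> borel_measurable lebesgue" using b by (rule measurable_completion)
  qed
  have "\<forall>\<^sub>F n in sequentially. \<tau> n < dl" by (rule order_tendstoD(2)[OF \<tau>_lim dl(1)])
  then obtain n0 where n0: "\<And>n. n \<ge> n0 ==> \<tau> n < dl" by (auto simp: eventually_sequentially)
  define L where "L = (\<lambda>x. indicator S x * (f x * ?\<psi>' x + f1 x * \<psi> x))"
  have lim: "AE x in lebesgue. (\<lambda>n. F' (\<tau> (n + n0)) x) \<longlonglongrightarrow> L x"
   using m_lim
  proof eventually_elim
   case (elim x)
   show ?case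
   proof (cases "x \<in> K")
    case True
    then have xS: "x \<in> S" using K by auto
    have e: "ext (fam j) x = fam j x" for j using xS by (simp add: ext_def)
    have l: "(\<lambda>n. m (\<tau> (n + n0)) j x) \<longlonglongrightarrow> fam j x" if "j \<in> J" for j
     using elim that e LIMSEQ_ignore_initial_segment[of "\<lambda>n. m (\<tau> n) j x" "fam j x" n0] by auto
    have l0: "(\<lambda>n. m (\<tau> (n + n0)) (True, 0) x) \<longlonglongrightarrow> \<eta> x" "(\<lambda>n. m (\<tau> (n + n0)) (False, 0) x) \<longlonglongrightarrow> \<eta>1 x"
     using l[OF J_in(1)[of True]] l[OF J_in(1)[of False]] by (auto simp: fam_def)
    have lj: "(\<lambda>n. m (\<tau> (n + n0)) (True, j) x) \<longlonglongrightarrow> p j x" "(\<lambda>n. m (\<tau> (n + n0)) (False, j) x) \<longlonglongrightarrow> p1 j x" if "j \<in> Basis" for j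
     using l[OF J_in(2)[OF that, of True]] l[OF J_in(2)[OF that, of False]] nonzero_Basis[OF that] by (auto simp: fam_def)
    have lP: "(\<lambda>n. Pm (\<tau> (n + n0)) x) \<longlonglongrightarrow> P x"
     unfolding Pm_def P by (intro tendsto_sum tendsto_scaleR lj tendsto_const)
    have pr: "(\<lambda>n. (x, Pm (\<tau> (n + n0)) x)) \<longlonglongrightarrow> (x, P x)" by (intro tendsto_Pair lP tendsto_const)
    have G_lim: "(\<lambda>n. g (x, Pm (\<tau> (n + n0)) x)) \<longlonglongrightarrow> g (x, P x)" if "continuous_on (S \<times> UNIV) g" for g :: "'a \<times> 'a \<Rightarrow> real"
    proof (rule isCont_tendsto_compose[OF _ pr])
     show "isCont g (x, P x)" using that oS xS by (simp add: continuous_on_eq_continuous_at)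
    qed
    have "(\<lambda>n. F' (\<tau> (n + n0)) x) \<longlonglongrightarrow> X (\<eta> x) (\<eta>1 x) (P x) (\<lambda>j. p1 j x) x"
     unfolding F'_def X_def
     by (intro tendsto_add tendsto_mult tendsto_sum tendsto_const l0 lj G_lim Gc)
    moreover have "X (\<eta> x) (\<eta>1 x) (P x) (\<lambda>j. p1 j x) x = L x"
     using xS unfolding X_def L_def f(1) f1(1) by (simp add: algebra_simps)
    ultimately show ?thesis by simp
   next
    case False
    then show ?thesis using \<psi>0[OF False] X_0[OF False] by (simp add: F'_def L_def)
   qed
  qed
  have li: "integrable (lebesgue_on S) (\<lambda>x. f x * ?\<psi>' x)" "integrable (lebesgue_on S) (\<lambda>x. f1 x * \<psi> x)"
   by (rule integrable_mult_test[OF S(1) f(2) \<psi>'], rule integrable_mult_test[OF S(1) f1(2) \<psi>])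
  have Li: "integrable lebesgue L" using Bochner_Integration.integrable_add[OF li] Sl by (simp add: L_def integral_lebesgue_on)
  have "(\<lambda>n. \<integral>x. F' (\<tau> (n + n0)) x \<partial>lebesgue) \<longlonglongrightarrow> (LINT x|lebesgue. L x)"
  proof (rule integral_dominated_convergence[where w="\<lambda>x. C * indicator K x"])
   have "emeasure lebesgue K < \<infinity>" using emeasure_compact_finite[OF K(1)] borel_compact[OF K(1)] by simp
   then show "integrable lebesgue (\<lambda>x. C * indicator K x)"
    using K(1) by (intro integrable_mult_right integrable_real_indicator) (auto simp: sets_lebesgue_compact)
   show "AE x in lebesgue. norm (F' (\<tau> (n + n0)) x) \<le> C * indicator K x" for n
   proof (rule AE_I2)
    fix x show "norm (F' (\<tau> (n + n0)) x) \<le> C * indicator K x"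
     using F'C[OF \<tau>0, of "n + n0" x] X_0[of x] by (cases "x \<in> K") (auto simp: F'_def)
   qed
  qed (use Li lim zero_l(2)[OF \<tau>0 n0] in auto)
  moreover have "(LINT x|lebesgue. F' (\<tau> (n + n0)) x) = 0" for n by (rule zero_l(1)[OF \<tau>0 n0]) simp
  ultimately have "(LINT x|lebesgue. L x) = 0" by (simp add: LIMSEQ_const_iff)
  then have "(LINT x|lebesgue_on S. f x * ?\<psi>' x + f1 x * \<psi> x) = 0"
   using Sl by (simp add: L_def integral_lebesgue_on)
  then show ?thesis using li by simp
 qed
 with f(2) f1(2) show ?thesis by (simp add: is_weak_deriv_def)
qed

section \<open>Sobolev spaces of high order\<close>

lemma is_weak_deriv_append:
 assumes "is_weak_deriv S a f f1" "\<beta> \<in> multi_indices"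
 shows "is_weak_deriv S (a @ \<beta>) f f2 \<longleftrightarrow> is_weak_deriv S \<beta> f1 f2"
proof -
 have "(LINT x|lebesgue_on S. f x * iter_partial (a @ \<beta>) \<psi> x) = (- 1) ^ length a * (LINT x|lebesgue_on S. f1 x * iter_partial \<beta> \<psi> x)"
  if "test_function S \<psi>" for \<psi>
  using assms test_function_iter_partial[OF that assms(2)] by (auto simp: is_weak_deriv_def iter_partial_append)
 then show ?thesis using assms(1) unfolding is_weak_deriv_def by (simp add: power_add mult.assoc)
qed

text \<open>Completeness of Lebesgue measure: measurability survives changes on null sets, and so
  passes to functions picked by \<open>SOME\<close>.\<close>

lemma measurable_cong_AE_lebesgue_on:
 fixes f g :: "'a::euclidean_space \<Rightarrow> real"
 assumes "S \<in> sets lebesgue" "f \<in> borel_measurable (lebesgue_on S)" "AE x in lebesgue_on S. f x = g x"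
 shows "g \<in> borel_measurable (lebesgue_on S)"
proof -
 have "(\<lambda>x. indicator S x *\<^sub>R f x) \<in> borel_measurable lebesgue"
  using assms by (subst borel_measurable_restrict_space_iff[symmetric]) auto
 moreover have "AE x in lebesgue. indicator S x *\<^sub>R f x = indicator S x *\<^sub>R g x"
 proof -
  have "AE x in lebesgue. x \<in> S \<longrightarrow> f x = g x" using assms by (simp add: AE_lebesgue_on)
  then show ?thesis by eventually_elim (auto split: split_indicator)
 qed
 ultimately have "(\<lambda>x. indicator S x *\<^sub>R g x) \<in> borel_measurable lebesgue" by (rule borel_measurable_AE)
 then show ?thesis using assms by (subst borel_measurable_restrict_space_iff) auto
qed

definition square_integrable :: "'a measure \<Rightarrow> ('a \<Rightarrow> real) \<Rightarrow> bool" where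
 "square_integrable M f \<longleftrightarrow> f \<in> borel_measurable M \<and> integrable M (\<lambda>x. (f x)\<^sup>2)"

lemma abs_powr_2: "\<bar>x::real\<bar> powr 2 = x\<^sup>2"
 by (simp add: powr_numeral)

lemma Lp_space_2: "f \<in> Lp_space 2 M \<longleftrightarrow> square_integrable M f"
 by (simp add: Lp_space_def square_integrable_def abs_powr_2)

lemma square_integrable_add:
 assumes f: "square_integrable M f" and g: "square_integrable M g"
 shows "square_integrable M (\<lambda>x. f x + g x)"
  "(LINT x|M. (f x + g x)\<^sup>2) \<le> 2 * (LINT x|M. (f x)\<^sup>2) + 2 * (LINT x|M. (g x)\<^sup>2)"
proof -
 have m: "f \<in> borel_measurable M" "g \<in> borel_measurable M" using f g by (auto simp: square_integrable_def)
 have i: "integrable M (\<lambda>x. 2 * (f x)\<^sup>2 + 2 * (g x)\<^sup>2)" using f g by (auto simp: square_integrable_def)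
 have le: "(f x + g x)\<^sup>2 \<le> 2 * (f x)\<^sup>2 + 2 * (g x)\<^sup>2" for x
  using zero_le_power2[of "f x - g x"] by (simp add: power2_sum power2_diff)
 have mm: "(\<lambda>x. f x + g x) \<in> borel_measurable M" using m by simp
 have mm2: "(\<lambda>x. (f x + g x)\<^sup>2) \<in> borel_measurable M" using mm by simp
 have ae: "AE x in M. \<bar>(f x + g x)\<^sup>2\<bar> \<le> 2 * (f x)\<^sup>2 + 2 * (g x)\<^sup>2" using le by simp
 note * = integrable_of_AE_bound[OF mm2 i ae]
 show "square_integrable M (\<lambda>x. f x + g x)" using *(1) mm by (simp add: square_integrable_def)
 show "(LINT x|M. (f x + g x)\<^sup>2) \<le> 2 * (LINT x|M. (f x)\<^sup>2) + 2 * (LINT x|M. (g x)\<^sup>2)"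
  using *(2) f g by (auto simp: square_integrable_def abs_le_iff)
qed

lemma square_integrable_cmult:
 assumes "square_integrable M f" shows "square_integrable M (\<lambda>x. c * f x)"
 using assms by (auto simp: square_integrable_def power_mult_distrib)

lemma square_integrable_cong_AE:
 assumes "square_integrable M f" "g \<in> borel_measurable M" "AE x in M. f x = g x"
 shows "square_integrable M g" "(LINT x|M. (f x)\<^sup>2) = (LINT x|M. (g x)\<^sup>2)"
proof -
 have m: "(\<lambda>x. (f x)\<^sup>2) \<in> borel_measurable M" "(\<lambda>x. (g x)\<^sup>2) \<in> borel_measurable M"
  using assms by (auto simp: square_integrable_def)
 have ae: "AE x in M. (f x)\<^sup>2 = (g x)\<^sup>2" using assms(3) by eventually_elim simp
 show "square_integrable M g"
  using integrable_cong_AE[OF m ae] assms by (simp add: square_integrable_def)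
 show "(LINT x|M. (f x)\<^sup>2) = (LINT x|M. (g x)\<^sup>2)" by (rule integral_cong_AE[OF m ae])
qed

definition index_set :: "nat \<Rightarrow> 'a::euclidean_space list set" where
 "index_set l = {a \<in> multi_indices. length a \<le> l}"

lemma finite_index_set: "finite (index_set l)"
 using finite_lists_length_le[of "Basis :: 'a::euclidean_space set" l]
 by (simp add: index_set_def multi_indices_def)

lemma H_spaceD:
 assumes "open S" "f \<in> H_space S l" "a \<in> index_set l"
 shows "is_weak_deriv S a f (weak_deriv S a f)" "square_integrable (lebesgue_on S) (weak_deriv S a f)"
proof -
 obtain f' where f': "f' \<in> Lp_space 2 (lebesgue_on S)" "is_weak_deriv S a f f'"
  using assms unfolding H_space_def sobolev_def index_set_def by blast
 show "is_weak_deriv S a f (weak_deriv S a f)" by (rule weak_deriv_is[OF f'(2)])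
 have ae: "AE x in lebesgue_on S. f' x = weak_deriv S a f x" using weak_deriv_AE[OF assms(1) f'(2)] by auto
 have m: "weak_deriv S a f \<in> borel_measurable (lebesgue_on S)"
  by (rule measurable_cong_AE_lebesgue_on[OF _ _ ae]) (use f' assms(1) in \<open>auto simp: Lp_space_def\<close>)
 show "square_integrable (lebesgue_on S) (weak_deriv S a f)"
  by (rule square_integrable_cong_AE(1)[OF _ m ae]) (use f' in \<open>simp add: Lp_space_2\<close>)
qed

lemma H_space_measurable: "f \<in> H_space S l ==> square_integrable (lebesgue_on S) f"
 unfolding H_space_def sobolev_def using Lp_space_2 by blast

lemma H_spaceI:
 assumes "square_integrable (lebesgue_on S) f"
  "\<And>a. a \<in> index_set l ==> \<exists>f'. is_weak_deriv S a f f' \<and> square_integrable (lebesgue_on S) f'"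
 shows "f \<in> H_space S l"
 using assms unfolding H_space_def sobolev_def index_set_def Lp_space_2[symmetric] by blast

lemma H_space_add:
 fixes S :: "'a::euclidean_space set"
 assumes "open S" "f \<in> H_space S l" "g \<in> H_space S l"
 shows "(\<lambda>x. f x + g x) \<in> H_space S l"
proof (rule H_spaceI)
 show "square_integrable (lebesgue_on S) (\<lambda>x. f x + g x)"
  using assms by (intro square_integrable_add H_space_measurable)
 fix a :: "'a list" assume a: "a \<in> index_set l"
 then have "a \<in> multi_indices" by (simp add: index_set_def)
 then show "\<exists>f'. is_weak_deriv S a (\<lambda>x. f x + g x) f' \<and> square_integrable (lebesgue_on S) f'"
  using is_weak_deriv_add[OF assms(1) _ H_spaceD(1)[OF assms(1,2) a] H_spaceD(1)[OF assms(1,3) a]]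
   square_integrable_add(1)[OF H_spaceD(2)[OF assms(1,2) a] H_spaceD(2)[OF assms(1,3) a]] by blast
qed

lemma H_space_cmult:
 fixes S :: "'a::euclidean_space set"
 assumes "open S" "f \<in> H_space S l"
 shows "(\<lambda>x. c * f x) \<in> H_space S l"
proof (rule H_spaceI)
 show "square_integrable (lebesgue_on S) (\<lambda>x. c * f x)"
  using assms by (intro square_integrable_cmult H_space_measurable)
 fix a :: "'a list" assume a: "a \<in> index_set l"
 then show "\<exists>f'. is_weak_deriv S a (\<lambda>x. c * f x) f' \<and> square_integrable (lebesgue_on S) f'"
  using is_weak_deriv_cmult[OF H_spaceD(1)[OF assms a]] square_integrable_cmult[OF H_spaceD(2)[OF assms a]] by blast
qed

lemma H_space_diff:
 assumes "open S" "f \<in> H_space S l" "g \<in> H_space S l"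
 shows "(\<lambda>x. f x - g x) \<in> H_space S l"
 using H_space_add[OF assms(1,2) H_space_cmult[OF assms(1,3), of "-1"]] by simp

text \<open>The square of \<open>sobolev_norm S l 2\<close>. Convergence to zero is all that
  matters, and for it \<open>H_energy_add\<close> with its factor \<open>2\<close> does the work of
  the triangle inequality.\<close>

definition H_energy :: "'a::euclidean_space set \<Rightarrow> nat \<Rightarrow> ('a \<Rightarrow> real) \<Rightarrow> real" where
 "H_energy S l f = (\<Sum>a\<in>index_set l. \<integral>x. (weak_deriv S a f x)\<^sup>2 \<partial>lebesgue_on S)"

lemma H_energy_nonneg: "H_energy S l f \<ge> 0"
 unfolding H_energy_def by (intro sum_nonneg) simp

lemma sobolev_norm_H_energy: "sobolev_norm S l 2 f = H_energy S l f powr (1 / 2)"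
 by (simp add: sobolev_norm_def H_energy_def index_set_def abs_powr_2)

lemma sobolev_norm_tendsto_H_energy:
 "(\<lambda>n. sobolev_norm S l 2 (f n)) \<longlonglongrightarrow> 0 \<longleftrightarrow> (\<lambda>n. H_energy S l (f n)) \<longlonglongrightarrow> 0"
proof
 assume "(\<lambda>n. sobolev_norm S l 2 (f n)) \<longlonglongrightarrow> 0"
 then have "(\<lambda>n. (sobolev_norm S l 2 (f n))\<^sup>2) \<longlonglongrightarrow> 0\<^sup>2" by (rule tendsto_power)
 moreover have "(sobolev_norm S l 2 (f n))\<^sup>2 = H_energy S l (f n)" for n
  using H_energy_nonneg[of S l "f n"] by (simp add: sobolev_norm_H_energy powr_half_sqrt)
 ultimately show "(\<lambda>n. H_energy S l (f n)) \<longlonglongrightarrow> 0" by simp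
next
 assume "(\<lambda>n. H_energy S l (f n)) \<longlonglongrightarrow> 0"
 then have "(\<lambda>n. sqrt (H_energy S l (f n))) \<longlonglongrightarrow> sqrt 0" by (rule tendsto_real_sqrt)
 then show "(\<lambda>n. sobolev_norm S l 2 (f n)) \<longlonglongrightarrow> 0"
  by (simp add: sobolev_norm_H_energy powr_half_sqrt[OF H_energy_nonneg])
qed

lemma H_energy_add:
 fixes S :: "'a::euclidean_space set"
 assumes "open S" "f \<in> H_space S l" "g \<in> H_space S l"
 shows "H_energy S l (\<lambda>x. f x + g x) \<le> 2 * H_energy S l f + 2 * H_energy S l g"
 unfolding H_energy_def sum_distrib_left sum.distrib[symmetric]
proof (rule sum_mono)
 fix a :: "'a list" assume a: "a \<in> index_set l"
 then have mi: "a \<in> multi_indices" by (simp add: index_set_def)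
 note sq = H_spaceD(2)[OF assms(1,2) a] H_spaceD(2)[OF assms(1,3) a]
 have ae: "AE x in lebesgue_on S. weak_deriv S a f x + weak_deriv S a g x = weak_deriv S a (\<lambda>x. f x + g x) x"
  using weak_deriv_AE[OF assms(1) is_weak_deriv_add[OF assms(1) mi H_spaceD(1)[OF assms(1,2) a] H_spaceD(1)[OF assms(1,3) a]]] by auto
 have m: "weak_deriv S a (\<lambda>x. f x + g x) \<in> borel_measurable (lebesgue_on S)"
  using H_spaceD(2)[OF assms(1) H_space_add[OF assms] a] by (simp add: square_integrable_def)
 show "(LINT x|lebesgue_on S. (weak_deriv S a (\<lambda>x. f x + g x) x)\<^sup>2)
   \<le> 2 * (LINT x|lebesgue_on S. (weak_deriv S a f x)\<^sup>2) + 2 * (LINT x|lebesgue_on S. (weak_deriv S a g x)\<^sup>2)"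
  using square_integrable_add(2)[OF sq] square_integrable_cong_AE(2)[OF square_integrable_add(1)[OF sq] m ae] by simp
qed

lemma H_energy_cmult:
 fixes S :: "'a::euclidean_space set"
 assumes "open S" "f \<in> H_space S l"
 shows "H_energy S l (\<lambda>x. c * f x) = c\<^sup>2 * H_energy S l f"
 unfolding H_energy_def sum_distrib_left
proof (rule sum.cong[OF refl])
 fix a :: "'a list" assume a: "a \<in> index_set l"
 have ae: "AE x in lebesgue_on S. c * weak_deriv S a f x = weak_deriv S a (\<lambda>x. c * f x) x"
  using weak_deriv_AE[OF assms(1) is_weak_deriv_cmult[OF H_spaceD(1)[OF assms a], of c]] by eventually_elim simp
 have m: "weak_deriv S a (\<lambda>x. c * f x) \<in> borel_measurable (lebesgue_on S)"
  using H_spaceD(2)[OF assms(1) H_space_cmult[OF assms] a] by (simp add: square_integrable_def)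
 show "(LINT x|lebesgue_on S. (weak_deriv S a (\<lambda>x. c * f x) x)\<^sup>2) = c\<^sup>2 * (LINT x|lebesgue_on S. (weak_deriv S a f x)\<^sup>2)"
  using square_integrable_cong_AE(2)[OF square_integrable_cmult[OF H_spaceD(2)[OF assms a]] m ae]
  by (simp add: power_mult_distrib)
qed

lemma test_function_closure_bounded:
 assumes "\<And>a. a \<in> multi_indices ==> \<exists>B. \<forall>x\<in>S. \<bar>iter_partial a f x\<bar> \<le> B"
  and "open S" "bounded S" "smooth_on S f"
 shows "f \<in> H_space S l" and "\<And>a. a \<in> multi_indices ==> ess_bounded (lebesgue_on S) (iter_partial a f)"
proof -
 note fin = bounded_open_finite_measure[OF assms(2,3)]
 have Sl: "S \<in> sets lebesgue" using assms by auto
 show eb: "ess_bounded (lebesgue_on S) (iter_partial a f)" if a: "a \<in> multi_indices" for a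
 proof -
  obtain B where "\<forall>x\<in>S. \<bar>iter_partial a f x\<bar> \<le> B" using assms(1)[OF a] by blast
  then have "AE x in lebesgue_on S. \<bar>iter_partial a f x\<bar> \<le> B" using Sl by (simp add: AE_lebesgue_on)
  moreover have "iter_partial a f \<in> borel_measurable (lebesgue_on S)"
   using Sl smooth_on_imp_continuous_on[OF smooth_on_iter_partial[OF assms(4) a]]
   by (rule continuous_imp_measurable_on_sets_lebesgue[rotated])
  ultimately show ?thesis by (intro ess_boundedI)
 qed
 have sq: "square_integrable (lebesgue_on S) (iter_partial a f)" if a: "a \<in> multi_indices" for a
  using ess_bounded_integrable[OF fin ess_bounded_mult[OF eb[OF a] eb[OF a]]] ess_bounded_measurable[OF eb[OF a]]
  by (simp add: square_integrable_def power2_eq_square)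
 show "f \<in> H_space S l"
 proof (rule H_spaceI)
  show "square_integrable (lebesgue_on S) f" using sq[of "[]"] by (simp add: multi_indices_def)
  fix a :: "'a list" assume "a \<in> index_set l"
  then have a: "a \<in> multi_indices" "rev a \<in> multi_indices" by (auto simp: index_set_def multi_indices_def)
  show "\<exists>f'. is_weak_deriv S a f f' \<and> square_integrable (lebesgue_on S) f'"
   using smooth_is_weak_deriv[OF assms(2,4) a(1)] sq[OF a(2)] by blast
 qed
qed

section \<open>Functions smooth up to the boundary\<close>

lemma smooth_on_closure_bounded:
 assumes "smooth_on_closure S f" "bounded S" "a \<in> multi_indices"
 shows "\<exists>B. \<forall>x\<in>S. \<bar>iter_partial a f x\<bar> \<le> B"
proof -
 obtain G where G: "continuous_on (closure S) G" "\<And>x. x \<in> S ==> G x = iter_partial a f x"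
  using assms unfolding smooth_on_closure_def by blast
 have "bounded (G ` closure S)"
  using assms(2) by (intro compact_imp_bounded compact_continuous_image[OF G(1)]) simp
 then obtain B where "\<forall>x\<in>closure S. \<bar>G x\<bar> \<le> B" by (auto simp: bounded_iff)
 then show ?thesis using G(2) closure_subset[of S] by (metis subsetD)
qed

lemma smooth_on_closure_H_space:
 assumes "smooth_on_closure S f" "open S" "bounded S"
 shows "f \<in> H_space S l" "\<And>a. a \<in> multi_indices ==> ess_bounded (lebesgue_on S) (iter_partial a f)"
 using assms test_function_closure_bounded[of S f] smooth_on_closure_bounded[OF assms(1,3)]
 unfolding smooth_on_closure_def by blast+

lemma test_function_smooth_on_closure:
 assumes "test_function S \<psi>"
 shows "smooth_on_closure S \<psi>"
 unfolding smooth_on_closure_def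
proof (intro conjI ballI)
 have s: "smooth_on UNIV \<psi>" by (rule test_functionD(1)[OF assms])
 then show "smooth_on S \<psi>" by (rule smooth_on_subset) simp
 show "continuous_on (closure S) \<psi>" using test_functionD(2)[OF assms] by (rule continuous_on_subset) simp
 fix a :: "'a list" assume "a \<in> multi_indices"
 then have "continuous_on UNIV (iter_partial a \<psi>)" by (intro smooth_on_imp_continuous_on smooth_on_iter_partial s)
 then show "\<exists>G. continuous_on (closure S) G \<and> (\<forall>x\<in>S. G x = iter_partial a \<psi> x)"
  by (intro exI[of _ "iter_partial a \<psi>"]) (auto intro: continuous_on_subset)
qed

lemma smooth_on_closure_add:
 assumes "open S" "smooth_on_closure S f" "smooth_on_closure S g"
 shows "smooth_on_closure S (\<lambda>x. f x + g x)"
 unfolding smooth_on_closure_def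
proof (intro conjI ballI)
 have s: "smooth_on S f" "smooth_on S g" using assms by (auto simp: smooth_on_closure_def)
 then show "smooth_on S (\<lambda>x. f x + g x)" by (intro smooth_on_add assms)
 show "continuous_on (closure S) (\<lambda>x. f x + g x)"
  using assms by (auto simp: smooth_on_closure_def intro: continuous_on_add)
 fix a :: "'a list" assume a: "a \<in> multi_indices"
 obtain F G where "continuous_on (closure S) F" "\<And>x. x \<in> S ==> F x = iter_partial a f x"
  "continuous_on (closure S) G" "\<And>x. x \<in> S ==> G x = iter_partial a g x"
  using assms a unfolding smooth_on_closure_def by metis
 then show "\<exists>G. continuous_on (closure S) G \<and> (\<forall>x\<in>S. G x = iter_partial a (\<lambda>x. f x + g x) x)"
  using iter_partial_add[OF assms(1) s a] by (intro exI[of _ "\<lambda>x. F x + G x"]) (auto intro: continuous_on_add)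
qed

lemma smooth_on_closure_const:
 assumes "open S" shows "smooth_on_closure S (\<lambda>x. c)"
 unfolding smooth_on_closure_def
proof (intro conjI ballI)
 show "smooth_on S (\<lambda>x. c)" by (rule smooth_on_const[OF assms])
 fix a :: "'a list" assume a: "a \<in> multi_indices"
 have "\<exists>f'\<in>{\<lambda>x. c |c. True}. \<forall>x\<in>S. iter_partial a (\<lambda>x. c) x = f' x"
 proof (rule iter_partial_family[OF assms _ _ _ a])
  fix f :: "'a \<Rightarrow> real" and x assume "f \<in> {\<lambda>x. c |c. True}"
  then show "f differentiable (at x)" by auto
 next
  fix f :: "'a \<Rightarrow> real" and i assume "f \<in> {\<lambda>x. c |c. True}"
  then show "\<exists>f'\<in>{\<lambda>x. c |c. True}. \<forall>x\<in>S. pdiff f x i = f' x"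
   by (intro bexI[of _ "\<lambda>x. 0"]) (auto simp: frechet_derivative_const)
 qed auto
 then obtain d where "\<forall>x\<in>S. iter_partial a (\<lambda>x. c) x = d" by auto
 then show "\<exists>G. continuous_on (closure S) G \<and> (\<forall>x\<in>S. G x = iter_partial a (\<lambda>x. c) x)"
  by (intro exI[of _ "\<lambda>x. d"]) simp
qed auto

lemma test_function_H_space:
 assumes "test_function S \<psi>" "open S" "bounded S" shows "\<psi> \<in> H_space S l"
 by (rule smooth_on_closure_H_space(1)[OF test_function_smooth_on_closure[OF assms(1)] assms(2,3)])

section \<open>The closure of the test functions and convex combinations\<close>

lemma H0_spaceD: "f \<in> H0_space S l ==> f \<in> H_space S l"
 by (simp add: H0_space_def)

lemma H0_space_energy:
 "f \<in> H0_space S l \<longleftrightarrow> f \<in> H_space S l \<and> (\<exists>\<psi>. (\<forall>n::nat. test_function S (\<psi> n)) \<and> (\<lambda>n. H_energy S l (\<lambda>x. \<psi> n x - f x)) \<longlonglongrightarrow> 0)"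
 unfolding H0_space_def sobolev_norm_tendsto_H_energy by simp

lemma H0_space_zero:
 assumes "open S" "bounded S" shows "(\<lambda>x. 0) \<in> H0_space S l"
 unfolding H0_space_energy
proof (intro conjI exI[of _ "\<lambda>n x. 0"] allI)
 show "(\<lambda>x. 0) \<in> H_space S l" by (rule test_function_H_space[OF test_function_zero assms])
 from H_energy_cmult[OF assms(1) this, of 0]
 show "(\<lambda>n. H_energy S l (\<lambda>x. 0 - 0)) \<longlonglongrightarrow> 0" by simp
qed (rule test_function_zero)

lemma H0_space_add:
 assumes S: "open S" "bounded S" and f: "f \<in> H0_space S l" and g: "g \<in> H0_space S l"
 shows "(\<lambda>x. f x + g x) \<in> H0_space S l"
 unfolding H0_space_energy
proof
 note fg = H0_spaceD[OF f] H0_spaceD[OF g]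
 show "(\<lambda>x. f x + g x) \<in> H_space S l" by (rule H_space_add[OF S(1) fg])
 obtain \<psi> \<phi> where \<psi>: "\<And>n::nat. test_function S (\<psi> n)" "(\<lambda>n. H_energy S l (\<lambda>x. \<psi> n x - f x)) \<longlonglongrightarrow> 0"
  and \<phi>: "\<And>n::nat. test_function S (\<phi> n)" "(\<lambda>n. H_energy S l (\<lambda>x. \<phi> n x - g x)) \<longlonglongrightarrow> 0"
  using f g unfolding H0_space_energy by blast
 have h: "(\<lambda>x. \<psi> n x - f x) \<in> H_space S l" "(\<lambda>x. \<phi> n x - g x) \<in> H_space S l" for n
  using \<psi>(1) \<phi>(1) fg S by (auto intro: H_space_diff test_function_H_space)
 have le: "H_energy S l (\<lambda>x. (\<psi> n x + \<phi> n x) - (f x + g x)) \<le> 2 * H_energy S l (\<lambda>x. \<psi> n x - f x) + 2 * H_energy S l (\<lambda>x. \<phi> n x - g x)" for n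
  using H_energy_add[OF S(1) h] by (simp add: algebra_simps)
 have "(\<lambda>n. 2 * H_energy S l (\<lambda>x. \<psi> n x - f x) + 2 * H_energy S l (\<lambda>x. \<phi> n x - g x)) \<longlonglongrightarrow> 2 * 0 + 2 * 0"
  by (intro tendsto_intros \<psi> \<phi>)
 then have lim: "(\<lambda>n. 2 * H_energy S l (\<lambda>x. \<psi> n x - f x) + 2 * H_energy S l (\<lambda>x. \<phi> n x - g x)) \<longlonglongrightarrow> 0"
  by simp
 have "(\<lambda>n. H_energy S l (\<lambda>x. (\<psi> n x + \<phi> n x) - (f x + g x))) \<longlonglongrightarrow> 0"
 proof (rule real_tendsto_sandwich[OF _ _ tendsto_const lim])
  show "\<forall>\<^sub>F n in sequentially. 0 \<le> H_energy S l (\<lambda>x. (\<psi> n x + \<phi> n x) - (f x + g x))"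
   by (rule always_eventually) (simp only: H_energy_nonneg simp_thms)
  show "\<forall>\<^sub>F n in sequentially. H_energy S l (\<lambda>x. (\<psi> n x + \<phi> n x) - (f x + g x)) \<le> 2 * H_energy S l (\<lambda>x. \<psi> n x - f x) + 2 * H_energy S l (\<lambda>x. \<phi> n x - g x)"
   by (rule always_eventually) (rule allI, rule le)
 qed
 then show "\<exists>\<psi>. (\<forall>n::nat. test_function S (\<psi> n)) \<and> (\<lambda>n. H_energy S l (\<lambda>x. \<psi> n x - (f x + g x))) \<longlonglongrightarrow> 0"
  using test_function_add[OF \<psi>(1) \<phi>(1)] by (intro exI[of _ "\<lambda>n x. \<psi> n x + \<phi> n x"]) simp
qed

lemma H0_space_cmult:
 assumes S: "open S" "bounded S" and f: "f \<in> H0_space S l"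
 shows "(\<lambda>x. c * f x) \<in> H0_space S l"
 unfolding H0_space_energy
proof
 show "(\<lambda>x. c * f x) \<in> H_space S l" by (rule H_space_cmult[OF S(1) H0_spaceD[OF f]])
 obtain \<psi> where \<psi>: "\<And>n::nat. test_function S (\<psi> n)" "(\<lambda>n. H_energy S l (\<lambda>x. \<psi> n x - f x)) \<longlonglongrightarrow> 0"
  using f unfolding H0_space_energy by blast
 have h: "(\<lambda>x. \<psi> n x - f x) \<in> H_space S l" for n
  using \<psi>(1) H0_spaceD[OF f] S by (auto intro: H_space_diff test_function_H_space)
 have "H_energy S l (\<lambda>x. c * \<psi> n x - c * f x) = c\<^sup>2 * H_energy S l (\<lambda>x. \<psi> n x - f x)" for n
  using H_energy_cmult[OF S(1) h, of c] by (simp add: right_diff_distrib)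
 moreover have "(\<lambda>n. c\<^sup>2 * H_energy S l (\<lambda>x. \<psi> n x - f x)) \<longlonglongrightarrow> c\<^sup>2 * 0" by (intro tendsto_intros \<psi>)
 ultimately show "\<exists>\<psi>. (\<forall>n::nat. test_function S (\<psi> n)) \<and> (\<lambda>n. H_energy S l (\<lambda>x. \<psi> n x - c * f x)) \<longlonglongrightarrow> 0"
  using test_function_cmult[OF \<psi>(1)] by (intro exI[of _ "\<lambda>n x. c * \<psi> n x"]) simp
qed

lemma H0_space_sum:
 assumes S: "open S" "bounded S" and "finite I" and f: "\<And>i. i \<in> I ==> f i \<in> H0_space S l"
 shows "(\<lambda>x. \<Sum>i\<in>I. c i * f i x) \<in> H0_space S l"
 using assms(3,4)
proof (induction I rule: finite_induct)
 case (insert i I)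
 then have "(\<lambda>x. c i * f i x + (\<Sum>i\<in>I. c i * f i x)) \<in> H0_space S l"
  by (intro H0_space_add[OF S] H0_space_cmult[OF S]) auto
 then show ?case using insert by simp
qed (simp add: H0_space_zero[OF S])

lemma H_space_sum:
 assumes S: "open S" "bounded S" and "finite I" and f: "\<And>i. i \<in> I ==> f i \<in> H_space S l"
 shows "(\<lambda>x. \<Sum>i\<in>I. c i * f i x) \<in> H_space S l"
 using assms(3,4)
proof (induction I rule: finite_induct)
 case (insert i I)
 then have "(\<lambda>x. c i * f i x + (\<Sum>i\<in>I. c i * f i x)) \<in> H_space S l"
  by (intro H_space_add[OF S(1)] H_space_cmult[OF S(1)]) auto
 then show ?case using insert by simp
qed (simp add: H0_spaceD[OF H0_space_zero[OF S]])

lemma H_affine_convex: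
 assumes S: "open S" "bounded S" and "finite I" and v: "\<And>i. i \<in> I ==> v i \<in> H_affine S l h"
  and c: "(\<Sum>i\<in>I. c i) = 1"
 shows "(\<lambda>x. \<Sum>i\<in>I. c i * v i x) \<in> H_affine S l h"
 unfolding H_affine_def
proof (intro CollectI conjI)
 show "(\<lambda>x. \<Sum>i\<in>I. c i * v i x) \<in> H_space S l"
  using v by (intro H_space_sum[OF S `finite I`]) (auto simp: H_affine_def)
 have "(\<lambda>x. \<Sum>i\<in>I. c i * (v i x - h x)) \<in> H0_space S l"
  using v by (intro H0_space_sum[OF S `finite I`]) (auto simp: H_affine_def)
 moreover have "(\<Sum>i\<in>I. c i * (v i x - h x)) = (\<Sum>i\<in>I. c i * v i x) - h x" for x
  using c by (simp add: right_diff_distrib sum_subtractf sum_distrib_right[symmetric])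
 ultimately show "(\<lambda>x. (\<Sum>i\<in>I. c i * v i x) - h x) \<in> H0_space S l" by simp
qed

lemma H_nonneg_convex:
 assumes S: "open S" "bounded S" and "finite I" and v: "\<And>i. i \<in> I ==> m i \<in> H_nonneg S l"
  and c: "\<And>i. i \<in> I ==> c i \<ge> 0"
 shows "(\<lambda>x. \<Sum>i\<in>I. c i * m i x) \<in> H_nonneg S l"
 unfolding H_nonneg_def
proof (intro CollectI conjI)
 show "(\<lambda>x. \<Sum>i\<in>I. c i * m i x) \<in> H_space S l"
  using v by (intro H_space_sum[OF S `finite I`]) (auto simp: H_nonneg_def)
 have "AE x in lebesgue_on S. \<forall>i\<in>I. m i x \<ge> 0"
  using v `finite I` by (intro AE_finite_allI) (auto simp: H_nonneg_def)
 then show "AE x in lebesgue_on S. (\<Sum>i\<in>I. c i * m i x) \<ge> 0"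
  by eventually_elim (use c in \<open>auto intro!: sum_nonneg\<close>)
qed

lemma H_affine_diff_H0:
 assumes S: "open S" "bounded S" and "u \<in> H_affine S l h" "v \<in> H_affine S l h"
 shows "(\<lambda>x. u x - v x) \<in> H0_space S l"
proof -
 have "(\<lambda>x. (u x - h x) + (-1) * (v x - h x)) \<in> H0_space S l"
  using assms by (intro H0_space_add[OF S] H0_space_cmult[OF S]) (auto simp: H_affine_def)
 then show ?thesis by simp
qed

section \<open>Essential bounds for derivatives of Sobolev functions\<close>

lemma sobolev_unit_weak_deriv:
 assumes S: "open S" and f: "f \<in> H_space S l" and "e > 0" "H_energy S l f \<le> e\<^sup>2"
  and "a \<in> multi_indices" "length a + m \<le> l"
 shows "sobolev_unit S m (\<lambda>x. (1 / e) * weak_deriv S a f x)"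
 using assms(5,6)
proof (induction m arbitrary: a)
 have base: "(\<lambda>x. (1 / e) * weak_deriv S a f x) \<in> borel_measurable (lebesgue_on S) \<and>
   integrable (lebesgue_on S) (\<lambda>x. ((1 / e) * weak_deriv S a f x)\<^sup>2) \<and>
   (LINT x|lebesgue_on S. ((1 / e) * weak_deriv S a f x)\<^sup>2) \<le> 1" if a: "a \<in> index_set l" for a
 proof -
  have sq: "square_integrable (lebesgue_on S) (\<lambda>x. (1 / e) * weak_deriv S a f x)"
   by (rule square_integrable_cmult[OF H_spaceD(2)[OF S f a]])
  have "(LINT x|lebesgue_on S. (weak_deriv S a f x)\<^sup>2) \<le> H_energy S l f"
   unfolding H_energy_def using a finite_index_set by (intro member_le_sum) auto
  then have "(LINT x|lebesgue_on S. (weak_deriv S a f x)\<^sup>2) \<le> e\<^sup>2" using assms(4) by linarith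
  moreover have "(LINT x|lebesgue_on S. ((1 / e) * weak_deriv S a f x)\<^sup>2) = (1 / e)\<^sup>2 * (LINT x|lebesgue_on S. (weak_deriv S a f x)\<^sup>2)"
   by (simp only: power_mult_distrib integral_mult_right_zero)
  ultimately have "(LINT x|lebesgue_on S. ((1 / e) * weak_deriv S a f x)\<^sup>2) \<le> 1"
   using `e > 0` by (simp add: power_divide divide_le_eq)
  then show ?thesis using sq by (simp only: square_integrable_def)
 qed
 {
  case 0
  then show ?case using base[of a] by (simp add: index_set_def)
 next
  case (Suc m)
  have a: "a \<in> index_set l" using Suc.prems by (simp add: index_set_def)
  have "\<exists>f'. is_weak_deriv S [i] (\<lambda>x. (1 / e) * weak_deriv S a f x) f' \<and> sobolev_unit S m f'" if i: "i \<in> Basis" for i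
  proof -
   \<comment> \<open>The last entry of a list is the derivative applied last to \<open>f\<close>, so
     one more derivative is appended rather than prepended.\<close>
   have ai: "a @ [i] \<in> index_set l" using Suc.prems i by (auto simp: index_set_def multi_indices_def)
   have "is_weak_deriv S [i] (weak_deriv S a f) (weak_deriv S (a @ [i]) f)"
    using is_weak_deriv_append[OF H_spaceD(1)[OF S f a], of "[i]"] H_spaceD(1)[OF S f ai] i
    by (simp add: multi_indices_def)
   moreover have "sobolev_unit S m (\<lambda>x. (1 / e) * weak_deriv S (a @ [i]) f x)"
    using Suc.prems i by (intro Suc.IH) (auto simp: multi_indices_def)
   ultimately show ?thesis using is_weak_deriv_cmult by blast
  qed
  with base[OF a] show ?case by simp
 }
qed

text \<open>Of the \<open>l\<close> available derivatives \<open>n\<close> are taken, and the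
  remaining ones, more than half the dimension, pay for the embedding. Keeping the bound
  proportional to \<open>e\<close> makes it usable for convergence as well as for
  boundedness.\<close>

lemma H_space_sup_bound:
 fixes S :: "'a::euclidean_space set"
 assumes S: "open S" "bounded S" "cone_condition S" and l: "real l > real DIM('a) / 2 + real n"
 shows "\<exists>C>0. \<forall>f\<in>H_space S l. \<forall>e>0. H_energy S l f \<le> e\<^sup>2 \<longrightarrow>
  (\<forall>a\<in>index_set n. AE x in lebesgue_on S. \<bar>weak_deriv S a f x\<bar> \<le> C * e)"
proof -
 have ln: "n \<le> l" using l by linarith
 then have "real (l - n) > real DIM('a) / 2" using l by (simp add: of_nat_diff)
 from sobolev_embedding[OF S this] obtain C where C: "C > 0" "\<And>f. sobolev_unit S (l - n) f ==> AE x in lebesgue_on S. \<bar>f x\<bar> \<le> C"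
  by blast
 have "AE x in lebesgue_on S. \<bar>weak_deriv S a f x\<bar> \<le> C * e"
  if "f \<in> H_space S l" "e > 0" "H_energy S l f \<le> e\<^sup>2" "a \<in> index_set n" for f e a
 proof -
  have "AE x in lebesgue_on S. \<bar>(1 / e) * weak_deriv S a f x\<bar> \<le> C"
   by (rule C(2)[OF sobolev_unit_weak_deriv[OF S(1) that(1-3)]]) (use that ln in \<open>auto simp: index_set_def\<close>)
  then show ?thesis by eventually_elim (use that in \<open>simp add: abs_mult field_simps\<close>)
 qed
 with C(1) show ?thesis by blast
qed

lemma weak_deriv_Nil_AE:
 assumes "open S" "f \<in> H_space S l"
 shows "AE x in lebesgue_on S. weak_deriv S [] f x = f x"
proof -
 have "is_weak_deriv S [] f (weak_deriv S [] f)"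
  by (rule H_spaceD(1)[OF assms]) (simp add: index_set_def multi_indices_def)
 then have "is_weak_deriv S [] f f" by (intro is_weak_deriv_Nil) (simp add: is_weak_deriv_def)
 then show ?thesis by (rule weak_deriv_AE[OF assms(1)])
qed

lemma H_space_ess_bounded:
 fixes S :: "'a::euclidean_space set"
 assumes S: "open S" "bounded S" "cone_condition S" and l: "real l > real DIM('a) / 2 + real n"
  and f: "f \<in> H_space S l"
 shows "\<And>a. a \<in> index_set n ==> ess_bounded (lebesgue_on S) (weak_deriv S a f)"
  "ess_bounded (lebesgue_on S) f"
proof -
 show 1: "ess_bounded (lebesgue_on S) (weak_deriv S a f)" if a: "a \<in> index_set n" for a
 proof -
  define e where "e = sqrt (H_energy S l f + 1)"
  have "e > 0" "H_energy S l f \<le> e\<^sup>2" using H_energy_nonneg[of S l f] by (auto simp: e_def)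
  then obtain C where "AE x in lebesgue_on S. \<bar>weak_deriv S a f x\<bar> \<le> C * e"
   using H_space_sup_bound[OF S l] f a by blast
  moreover have "a \<in> index_set l" using a l by (auto simp: index_set_def)
  from H_spaceD(2)[OF S(1) f this] have "weak_deriv S a f \<in> borel_measurable (lebesgue_on S)" by (simp add: square_integrable_def)
  ultimately show ?thesis by (intro ess_boundedI)
 qed
 show "ess_bounded (lebesgue_on S) f"
  by (rule ess_bounded_cong[OF 1[of "[]"] _ weak_deriv_Nil_AE[OF S(1) f]])
   (use H_space_measurable[OF f] in \<open>auto simp: square_integrable_def index_set_def multi_indices_def\<close>)
qed

text \<open>The sup bound, applied to the difference from an approximating test function, upgrades
  convergence in the Sobolev norm to uniform closeness of values and first derivatives. Through this
  lemma integration by parts, the Poincare inequality and the trace are inherited from test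
  functions.\<close>

lemma H0_space_uniform_approx:
 fixes S :: "'a::euclidean_space set"
 assumes S: "open S" "bounded S" "cone_condition S" and l: "real l > real DIM('a) / 2 + 1"
  and w: "w \<in> H0_space S l" and "eps > 0"
 shows "\<exists>\<psi>. test_function S \<psi> \<and> (AE x in lebesgue_on S. \<bar>\<psi> x - w x\<bar> \<le> eps \<and>
  (\<forall>i\<in>Basis. \<bar>pdiff \<psi> x i - weak_deriv S [i] w x\<bar> \<le> eps))"
proof -
 have l': "real l > real DIM('a) / 2 + real 1" using l by simp
 obtain C where C: "C > 0" "\<And>f eps a. f \<in> H_space S l ==> eps > 0 ==> H_energy S l f \<le> eps\<^sup>2 ==> a \<in> index_set 1 ==>
  AE x in lebesgue_on S. \<bar>weak_deriv S a f x\<bar> \<le> C * eps"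
  using H_space_sup_bound[OF S l'] by blast
 obtain \<psi>s where \<psi>s: "\<And>n::nat. test_function S (\<psi>s n)" "(\<lambda>n. H_energy S l (\<lambda>x. \<psi>s n x - w x)) \<longlonglongrightarrow> 0"
  using w unfolding H0_space_energy by blast
 define e where "e = eps / C"
 have e: "e > 0" "C * e = eps" using `eps > 0` C(1) by (auto simp: e_def)
 then have "\<forall>\<^sub>F n in sequentially. H_energy S l (\<lambda>x. \<psi>s n x - w x) < e\<^sup>2"
  by (intro order_tendstoD(2)[OF \<psi>s(2)]) auto
 then obtain n where "H_energy S l (\<lambda>x. \<psi>s n x - w x) < e\<^sup>2" unfolding eventually_sequentially by blast
 then have n: "H_energy S l (\<lambda>x. \<psi>s n x - w x) \<le> e\<^sup>2" by simp
 let ?\<psi> = "\<psi>s n"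
 let ?f = "\<lambda>x. ?\<psi> x - w x"
 have f: "?f \<in> H_space S l" using H_space_diff[OF S(1) test_function_H_space[OF \<psi>s(1) S(1,2)] H0_spaceD[OF w]] .
 have bound: "AE x in lebesgue_on S. \<bar>weak_deriv S a ?f x\<bar> \<le> eps" if "a \<in> index_set 1" for a
  using C(2)[OF f e(1) n that] e(2) by simp
 have "AE x in lebesgue_on S. \<bar>?\<psi> x - w x\<bar> \<le> eps"
 proof -
  have "[] \<in> index_set 1" by (simp add: index_set_def multi_indices_def)
  from bound[OF this] weak_deriv_Nil_AE[OF S(1) f] show ?thesis by eventually_elim simp
 qed
 moreover have "AE x in lebesgue_on S. \<forall>i\<in>Basis. \<bar>pdiff ?\<psi> x i - weak_deriv S [i] w x\<bar> \<le> eps"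
 proof (rule AE_finite_allI)
  fix i :: 'a assume i: "i \<in> Basis"
  then have il: "[i] \<in> index_set l" "[i] \<in> index_set 1" using l by (auto simp: index_set_def multi_indices_def)
  have "smooth_on S ?\<psi>" using test_functionD(1)[OF \<psi>s(1)] by (rule smooth_on_subset) simp
  from is_weak_deriv_diff[OF S(1) _ smooth_is_weak_deriv1[OF S(1) this i] H_spaceD(1)[OF S(1) H0_spaceD[OF w] il(1)]]
  have "is_weak_deriv S [i] ?f (\<lambda>x. pdiff ?\<psi> x i - weak_deriv S [i] w x)"
   using i by (simp add: multi_indices_def)
  from weak_deriv_AE[OF S(1) this] bound[OF il(2)]
  show "AE x in lebesgue_on S. \<bar>pdiff ?\<psi> x i - weak_deriv S [i] w x\<bar> \<le> eps"
   by eventually_elim simp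
 qed simp
 ultimately have "AE x in lebesgue_on S. \<bar>?\<psi> x - w x\<bar> \<le> eps \<and>
  (\<forall>i\<in>Basis. \<bar>pdiff ?\<psi> x i - weak_deriv S [i] w x\<bar> \<le> eps)"
  by eventually_elim simp
 with \<psi>s(1) show ?thesis by blast
qed

section \<open>Surface measure of the boundary and traces\<close>

text \<open>Finite covers by sets of arbitrarily small diameter whose total gauge stays below one
  constant: a form of finite Hausdorff measure that passes to subsets and finite unions by
  elementary means.\<close>

definition finite_gauge_covers :: "nat \<Rightarrow> 'a::euclidean_space set \<Rightarrow> bool" where
 "finite_gauge_covers s A \<longleftrightarrow> (\<exists>K::real. \<forall>d>0. \<exists>\<C>. finite \<C> \<and> A \<subseteq> \<Union>\<C> \<and>
  (\<forall>C\<in>\<C>. bounded C \<and> diameter C \<le> d) \<and> (\<Sum>C\<in>\<C>. hausdorff_gauge s C) \<le> ennreal K)"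

lemma hausdorff_outer_finite:
 assumes "finite_gauge_covers s A"
 shows "hausdorff_outer s A < \<infinity>"
proof -
 obtain K where K: "\<And>d::real. d > 0 ==> \<exists>\<C>. finite \<C> \<and> A \<subseteq> \<Union>\<C> \<and>
  (\<forall>C\<in>\<C>. bounded C \<and> diameter C \<le> d) \<and> (\<Sum>C\<in>\<C>. hausdorff_gauge s C) \<le> ennreal K"
  using assms unfolding finite_gauge_covers_def by blast
 have "hausdorff_outer s A \<le> ennreal K"
  unfolding hausdorff_outer_def
 proof (rule SUP_least)
  fix d :: real assume "d \<in> {0<..}"
  then have d: "d > 0" by simp
  obtain \<C> where \<C>: "finite \<C>" "A \<subseteq> \<Union>\<C>" "\<And>C. C \<in> \<C> ==> bounded C" "\<And>C. C \<in> \<C> ==> diameter C \<le> d"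
   "(\<Sum>C\<in>\<C>. hausdorff_gauge s C) \<le> ennreal K" using K[OF d] by blast
  obtain f n where f: "bij_betw f {..<n::nat} \<C>"
   using ex_bij_betw_nat_finite[OF \<C>(1)] by (auto simp: atLeast0LessThan)
  \<comment> \<open>The finite cover is padded to a sequence at no cost, because the gauge of the
    empty set is \<open>0\<close> even for \<open>s = 0\<close>.\<close>
  define D where "D = (\<lambda>i. if i < n then f i else {})"
  have "\<C> = f ` {..<n}" using f by (simp add: bij_betw_def)
  then have D: "A \<subseteq> (\<Union>i. D i)" "\<And>i. bounded (D i)" "\<And>i. diameter (D i) \<le> d"
   using \<C>(2-4) d by (auto simp: D_def)
  have "(\<Sum>i. hausdorff_gauge s (D i)) = (\<Sum>i<n. hausdorff_gauge s (D i))"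
   by (rule suminf_finite) (auto simp: D_def hausdorff_gauge_def)
  also have "\<dots> = (\<Sum>i<n. hausdorff_gauge s (f i))" by (simp add: D_def)
  also have "\<dots> = (\<Sum>C\<in>\<C>. hausdorff_gauge s C)" by (rule sum.reindex_bij_betw[OF f])
  finally have le: "(\<Sum>i. hausdorff_gauge s (D i)) \<le> ennreal K" using \<C>(5) by simp
  show "(INF C\<in>{C. A \<subseteq> (\<Union>i. C i) \<and> (\<forall>i. bounded (C i) \<and> diameter (C i) \<le> d)}. \<Sum>i. hausdorff_gauge s (C i)) \<le> ennreal K"
   by (rule INF_lower2[of D]) (use D le in auto)
 qed
 then show ?thesis by (rule le_less_trans) simp
qed

lemma finite_gauge_covers_subset: "finite_gauge_covers s B ==> A \<subseteq> B ==> finite_gauge_covers s A"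
 unfolding finite_gauge_covers_def by (meson subset_trans)

lemma finite_gauge_covers_Un:
 assumes "finite_gauge_covers s A" "finite_gauge_covers s B"
 shows "finite_gauge_covers s (A \<union> B)"
proof -
 obtain K where K: "\<And>d::real. d > 0 ==> \<exists>\<C>. finite \<C> \<and> A \<subseteq> \<Union>\<C> \<and>
  (\<forall>C\<in>\<C>. bounded C \<and> diameter C \<le> d) \<and> (\<Sum>C\<in>\<C>. hausdorff_gauge s C) \<le> ennreal K"
  using assms(1) unfolding finite_gauge_covers_def by blast
 obtain L where L: "\<And>d::real. d > 0 ==> \<exists>\<C>. finite \<C> \<and> B \<subseteq> \<Union>\<C> \<and>
  (\<forall>C\<in>\<C>. bounded C \<and> diameter C \<le> d) \<and> (\<Sum>C\<in>\<C>. hausdorff_gauge s C) \<le> ennreal L"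
  using assms(2) unfolding finite_gauge_covers_def by blast
 show ?thesis
  unfolding finite_gauge_covers_def
 proof (intro exI[of _ "max 0 K + max 0 L"] allI impI)
  fix d :: real assume d: "d > 0"
  obtain \<C> where \<C>: "finite \<C>" "A \<subseteq> \<Union>\<C>" "\<forall>C\<in>\<C>. bounded C \<and> diameter C \<le> d" "(\<Sum>C\<in>\<C>. hausdorff_gauge s C) \<le> ennreal K"
   using K[OF d] by blast
  obtain \<D> where \<D>: "finite \<D>" "B \<subseteq> \<Union>\<D>" "\<forall>C\<in>\<D>. bounded C \<and> diameter C \<le> d" "(\<Sum>C\<in>\<D>. hausdorff_gauge s C) \<le> ennreal L"
   using L[OF d] by blast
  note * = \<C> \<D>
  have "(\<Sum>C\<in>\<C> \<union> \<D>. hausdorff_gauge s C) \<le> (\<Sum>C\<in>\<C> \<union> \<D>. hausdorff_gauge s C) + (\<Sum>C\<in>\<C> \<inter> \<D>. hausdorff_gauge s C)"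
   by (rule add_increasing2) auto
  also have "\<dots> = (\<Sum>C\<in>\<C>. hausdorff_gauge s C) + (\<Sum>C\<in>\<D>. hausdorff_gauge s C)"
   by (rule sum.union_inter[OF *(1,5)])
  also have "\<dots> \<le> ennreal (max 0 K) + ennreal (max 0 L)"
   by (intro add_mono order_trans[OF *(4)] order_trans[OF *(8)] ennreal_leI) simp_all
  also have "\<dots> = ennreal (max 0 K + max 0 L)" by (simp add: ennreal_plus)
  finally show "\<exists>\<C>. finite \<C> \<and> A \<union> B \<subseteq> \<Union>\<C> \<and> (\<forall>C\<in>\<C>. bounded C \<and> diameter C \<le> d) \<and> (\<Sum>C\<in>\<C>. hausdorff_gauge s C) \<le> ennreal (max 0 K + max 0 L)"
   using * by (intro exI[of _ "\<C> \<union> \<D>"] conjI) auto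
 qed
qed

lemma finite_gauge_covers_empty: "finite_gauge_covers s {}"
 unfolding finite_gauge_covers_def by (intro exI[of _ 0] allI impI exI[of _ "{}"]) auto

lemma finite_gauge_covers_UN:
 "finite I ==> (\<And>i. i \<in> I ==> finite_gauge_covers s (A i)) ==> finite_gauge_covers s (\<Union>i\<in>I. A i)"
 by (induction I rule: finite_induct) (auto intro: finite_gauge_covers_empty finite_gauge_covers_Un)

text \<open>\<open>A\<close> is parametrised in a Lipschitz way by all coordinates of
  \<open>y\<close> except the \<open>i\<close>-th. A box of side \<open>R\<close> is cut into
  \<open>N ^ (d - 1)\<close> cells of side \<open>w = R / N\<close>; their preimages have diameter
  at most \<open>M * w\<close>, and the total gauge does not depend on \<open>N\<close>.\<close>

lemma finite_gauge_covers_coordinates: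
 fixes A :: "'a::euclidean_space set" and y :: "'a \<Rightarrow> 'a"
 assumes i: "i \<in> Basis" and M: "M \<ge> 0"
  and lip: "\<And>x x' w. x \<in> A ==> x' \<in> A ==> (\<forall>j\<in>Basis - {i}. \<bar>y x \<bullet> j - y x' \<bullet> j\<bar> \<le> w) ==> w \<ge> 0 ==> norm (x - x') \<le> M * w"
  and R: "R > 0" "\<And>x j. x \<in> A ==> j \<in> Basis - {i} ==> b j \<le> y x \<bullet> j \<and> y x \<bullet> j < b j + R"
 shows "finite_gauge_covers (DIM('a) - 1) A"
proof -
 let ?s = "DIM('a) - 1"
 let ?J = "Basis - {i}"
 have cJ: "card ?J = ?s" using i by simp
 define c where "c = unit_ball_vol (real ?s)"
 have c0: "c \<ge> 0" by (simp add: c_def)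
 show ?thesis
  unfolding finite_gauge_covers_def
 proof (intro exI[of _ "c * (M * R / 2) ^ ?s"] allI impI)
  fix d :: real assume "d > 0"
  obtain N :: nat where N: "N > 0" "M * (R / real N) \<le> d"
  proof -
   obtain n :: nat where "M * R / d < real n" using reals_Archimedean2 by blast
   then have "M * R \<le> d * real (Suc n)" using `d > 0` by (simp add: divide_less_eq algebra_simps)
   then have "M * (R / real (Suc n)) \<le> d" by (simp add: divide_le_eq)
   then show ?thesis by (intro that[of "Suc n"]) auto
  qed
  define w where "w = R / real N"
  have w: "w > 0" using R N by (simp add: w_def)
  define cell where "cell = (\<lambda>\<tau>. {x \<in> A. \<forall>j\<in>?J. real (\<tau> j) * w \<le> y x \<bullet> j - b j \<and> y x \<bullet> j - b j \<le> (real (\<tau> j) + 1) * w})"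
  define T where "T = PiE ?J (\<lambda>_. {..<N})"
  have fT: "finite T" unfolding T_def by (intro finite_PiE) auto
  have cT: "card T = N ^ ?s" unfolding T_def using cJ by (simp add: card_PiE)
  have close: "norm (x - x') \<le> M * w" if "x \<in> cell \<tau>" "x' \<in> cell \<tau>" for x x' \<tau>
  proof (rule lip)
   show "\<forall>j\<in>?J. \<bar>y x \<bullet> j - y x' \<bullet> j\<bar> \<le> w"
   proof
    fix j assume "j \<in> ?J"
    then have "real (\<tau> j) * w \<le> y x \<bullet> j - b j" "y x \<bullet> j - b j \<le> (real (\<tau> j) + 1) * w"
     "real (\<tau> j) * w \<le> y x' \<bullet> j - b j" "y x' \<bullet> j - b j \<le> (real (\<tau> j) + 1) * w"
     using that by (auto simp: cell_def)
    then show "\<bar>y x \<bullet> j - y x' \<bullet> j\<bar> \<le> w" unfolding distrib_right abs_le_iff by linarith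
   qed
  qed (use that w in \<open>auto simp: cell_def\<close>)
  have Mw: "M * w \<ge> 0" using M w by simp
  have diam: "diameter (cell \<tau>) \<le> M * w" for \<tau>
   by (rule diameter_le) (use Mw close in auto)
  have bdd: "bounded (cell \<tau>)" for \<tau>
  proof (cases "cell \<tau> = {}")
   case False
   then obtain x where x: "x \<in> cell \<tau>" by blast
   have "cell \<tau> \<subseteq> cball x (M * w)" using close[OF x] by (auto simp: dist_norm)
   then show ?thesis by (rule bounded_subset[OF bounded_cball])
  qed simp
  have cover: "A \<subseteq> \<Union> (cell ` T)"
  proof
   fix x assume x: "x \<in> A"
   define \<tau> where "\<tau> = (\<lambda>j\<in>?J. nat \<lfloor>(y x \<bullet> j - b j) / w\<rfloor>)"
   have "\<tau> j < N \<and> real (\<tau> j) * w \<le> y x \<bullet> j - b j \<and> y x \<bullet> j - b j \<le> (real (\<tau> j) + 1) * w" if j: "j \<in> ?J" for j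
   proof -
    have nn: "(y x \<bullet> j - b j) / w \<ge> 0" using R(2)[OF x j] w by simp
    then have e: "real (\<tau> j) = of_int \<lfloor>(y x \<bullet> j - b j) / w\<rfloor>" using j by (simp add: \<tau>_def)
    have "(y x \<bullet> j - b j) / w < R / w" using R(2)[OF x j] w by (intro divide_strict_right_mono) auto
    then have "(y x \<bullet> j - b j) / w < real N" using R(1) N by (simp add: w_def)
    then have "real (\<tau> j) < real N" using e by linarith
    moreover have "real (\<tau> j) \<le> (y x \<bullet> j - b j) / w" "(y x \<bullet> j - b j) / w \<le> real (\<tau> j) + 1"
     using e by linarith+
    ultimately show ?thesis using w by (simp add: pos_le_divide_eq pos_divide_le_eq)
   qed
   then have "\<tau> \<in> T" "x \<in> cell \<tau>" using x by (auto simp: T_def cell_def \<tau>_def)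
   then show "x \<in> \<Union> (cell ` T)" by blast
  qed
  have g: "hausdorff_gauge ?s (cell \<tau>) \<le> ennreal (c * (M * w / 2) ^ ?s)" for \<tau>
   unfolding hausdorff_gauge_def c_def[symmetric]
   using c0 diam[of \<tau>] diameter_ge_0[OF bdd[of \<tau>]]
   by (auto intro!: ennreal_leI mult_left_mono power_mono)
  have "(\<Sum>C\<in>cell ` T. hausdorff_gauge ?s C) \<le> (\<Sum>C\<in>cell ` T. ennreal (c * (M * w / 2) ^ ?s))"
   by (rule sum_mono) (use g in auto)
  also have "\<dots> = of_nat (card (cell ` T)) * ennreal (c * (M * w / 2) ^ ?s)" by simp
  also have "\<dots> \<le> of_nat (N ^ ?s) * ennreal (c * (M * w / 2) ^ ?s)"
   using card_image_le[OF fT, of cell] cT by (intro mult_right_mono of_nat_mono) auto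
  also have "\<dots> = ennreal (real (N ^ ?s) * (c * (M * w / 2) ^ ?s))"
   by (simp add: ennreal_mult' ennreal_of_nat_eq_real_of_nat)
  also have "real (N ^ ?s) * (c * (M * w / 2) ^ ?s) = c * (M * R / 2) ^ ?s"
  proof -
   have "M * R / 2 = real N * (M * w / 2)" using N by (simp add: w_def)
   then show ?thesis by (simp only: power_mult_distrib of_nat_power mult.left_commute)
  qed
  finally have "(\<Sum>C\<in>cell ` T. hausdorff_gauge ?s C) \<le> ennreal (c * (M * R / 2) ^ ?s)" .
  moreover have "\<forall>C\<in>cell ` T. bounded C \<and> diameter C \<le> d" using bdd diam N(2) w_def by (auto intro: order_trans)
  ultimately show "\<exists>\<C>. finite \<C> \<and> A \<subseteq> \<Union>\<C> \<and> (\<forall>C\<in>\<C>. bounded C \<and> diameter C \<le> d) \<and> (\<Sum>C\<in>\<C>. hausdorff_gauge ?s C) \<le> ennreal (c * (M * R / 2) ^ ?s)"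
   using fT cover by (intro exI[of _ "cell ` T"]) auto
 qed
qed

text \<open>Projections along \<open>e\<close> are orthogonal to \<open>e\<close>, hence determined
  by their coordinates other than a fixed one in which \<open>e\<close> does not vanish. This
  supplies \<open>d - 1\<close> parameters for the graph without rotating the axes.\<close>

lemma finite_gauge_covers_graph:
 fixes e :: "'a::euclidean_space"
 assumes e: "norm e = 1" and \<psi>: "smooth_on UNIV \<psi>" and r: "r > 0"
  and A: "A \<subseteq> {x \<in> ball x0 r. x \<bullet> e = \<psi> (x - (x \<bullet> e) *\<^sub>R e)}"
 shows "finite_gauge_covers (DIM('a) - 1) A"
proof -
 define P where "P = (\<lambda>x. x - (x \<bullet> e) *\<^sub>R e)"
 have P_diff: "P x - P x' = P (x - x')" for x x' by (simp add: P_def algebra_simps inner_diff_left)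
 have P_le: "norm (P w) \<le> 2 * norm w" for w unfolding P_def by (rule norm_project_le[OF e])
 have P_ball: "norm (P x - P x0) < 2 * r" if "x \<in> ball x0 r" for x
  using P_le[of "x - x0"] that by (simp add: P_diff dist_norm norm_minus_commute)
 obtain L where L: "L > 0" "\<And>x y. x \<in> cball (P x0) (2 * r) ==> y \<in> cball (P x0) (2 * r) ==> \<bar>\<psi> x - \<psi> y\<bar> \<le> L * norm (x - y)"
  using smooth_on_lipschitz_cball[OF \<psi>] by metis
 have "e \<noteq> 0" using e by auto
 then obtain i where i: "i \<in> Basis" "e \<bullet> i \<noteq> 0" using euclidean_all_zero_iff[of e] by blast
 have ee: "e \<bullet> e = 1" using e by (simp add: dot_square_norm)
 have Pe: "P x \<bullet> e = 0" for x by (simp add: P_def inner_diff_left ee)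
 define d where "d = real DIM('a)"
 \<comment> \<open>The factor \<open>1 + L\<close> leads from the projection to the graph. The other
   factor recovers the projection from \<open>d - 1\<close> coordinates, the missing one being
   solved from orthogonality to \<open>e\<close>, which costs
   \<open>1 / \<bar>e \<bullet> i\<bar>\<close>.\<close>
 define M where "M = (1 + L) * (d * (1 + 1 / \<bar>e \<bullet> i\<bar>))"
 have d0: "d \<ge> 0" by (simp add: d_def)
 have M0: "M \<ge> 0" unfolding M_def using L(1) d0 by (intro mult_nonneg_nonneg add_nonneg_nonneg) auto
 show ?thesis
 proof (rule finite_gauge_covers_coordinates[OF i(1) M0, where y=P and R="4 * r" and b="\<lambda>j. P x0 \<bullet> j - 2 * r"])
  show "4 * r > 0" using r by simp
  fix x j assume x: "x \<in> A" and j: "j \<in> Basis - {i}"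
  then have "x \<in> ball x0 r" using A by auto
  have "\<bar>(P x - P x0) \<bullet> j\<bar> < 2 * r"
   using Basis_le_norm[of j "P x - P x0"] P_ball[OF `x \<in> ball x0 r`] j by simp
  then show "P x0 \<bullet> j - 2 * r \<le> P x \<bullet> j \<and> P x \<bullet> j < P x0 \<bullet> j - 2 * r + 4 * r"
   unfolding inner_diff_left by linarith
 next
  fix x x' w assume x: "x \<in> A" and x': "x' \<in> A" and w: "\<forall>j\<in>Basis - {i}. \<bar>P x \<bullet> j - P x' \<bullet> j\<bar> \<le> w" and w0: "0 \<le> w"
  define z where "z = P x - P x'"
  have zj: "\<bar>z \<bullet> j\<bar> \<le> w" if "j \<in> Basis - {i}" for j using w that by (auto simp: z_def inner_diff_left)
  have "z \<bullet> e = 0" using Pe by (simp add: z_def inner_diff_left)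
  then have "(\<Sum>j\<in>Basis. (z \<bullet> j) * (e \<bullet> j)) = 0" by (simp add: euclidean_inner[of z e])
  then have "(z \<bullet> i) * (e \<bullet> i) = - (\<Sum>j\<in>Basis - {i}. (z \<bullet> j) * (e \<bullet> j))"
   using i(1) by (simp add: sum.remove[of Basis i])
  then have "\<bar>z \<bullet> i\<bar> * \<bar>e \<bullet> i\<bar> = \<bar>\<Sum>j\<in>Basis - {i}. (z \<bullet> j) * (e \<bullet> j)\<bar>"
   unfolding abs_mult[symmetric] by (simp only: abs_minus_cancel)
  also have "\<dots> \<le> (\<Sum>j\<in>Basis - {i}. \<bar>(z \<bullet> j) * (e \<bullet> j)\<bar>)" by (rule sum_abs)
  also have "\<dots> \<le> (\<Sum>j\<in>Basis - {i}. w * 1)"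
  proof (rule sum_mono)
   fix j assume j: "j \<in> Basis - {i}"
   have "\<bar>e \<bullet> j\<bar> \<le> 1" using Basis_le_norm[of j e] j e by simp
   then show "\<bar>(z \<bullet> j) * (e \<bullet> j)\<bar> \<le> w * 1" unfolding abs_mult using zj[OF j] w0 by (intro mult_mono) auto
  qed
  also have "\<dots> \<le> d * w" using i(1) w0 by (simp add: d_def mult_right_mono)
  finally have zi: "\<bar>z \<bullet> i\<bar> \<le> d * w / \<bar>e \<bullet> i\<bar>" using i(2) by (simp add: pos_le_divide_eq)
  have "norm z \<le> (\<Sum>j\<in>Basis. \<bar>z \<bullet> j\<bar>)" by (rule norm_le_l1)
  also have "\<dots> = \<bar>z \<bullet> i\<bar> + (\<Sum>j\<in>Basis - {i}. \<bar>z \<bullet> j\<bar>)" using i(1) by (simp add: sum.remove)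
  also have "\<dots> \<le> d * w / \<bar>e \<bullet> i\<bar> + (\<Sum>j\<in>Basis - {i}. w)" using zi zj by (intro add_mono sum_mono) auto
  also have "\<dots> \<le> d * w / \<bar>e \<bullet> i\<bar> + d * w" using i(1) w0 by (simp add: d_def mult_right_mono)
  finally have nz: "norm z \<le> (d * (1 + 1 / \<bar>e \<bullet> i\<bar>)) * w" by (simp add: algebra_simps)
  have bx: "x \<in> ball x0 r" "x' \<in> ball x0 r" and gx: "x \<bullet> e = \<psi> (P x)" "x' \<bullet> e = \<psi> (P x')" using x x' A by (auto simp: P_def)
  have "x - x' = z + (x \<bullet> e - x' \<bullet> e) *\<^sub>R e"
   unfolding z_def P_def by (simp add: algebra_simps)
  then have "x - x' = z + (\<psi> (P x) - \<psi> (P x')) *\<^sub>R e" by (simp only: gx)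
  then have "norm (x - x') \<le> norm z + \<bar>\<psi> (P x) - \<psi> (P x')\<bar>"
   using norm_triangle_ineq[of z "(\<psi> (P x) - \<psi> (P x')) *\<^sub>R e"] e by simp
  also have "\<dots> \<le> norm z + L * norm z"
   unfolding z_def using P_ball[OF bx(1)] P_ball[OF bx(2)]
   by (intro add_left_mono L(2)) (auto simp: dist_norm norm_minus_commute)
  also have "\<dots> = (1 + L) * norm z" by (simp add: algebra_simps)
  also have "\<dots> \<le> (1 + L) * ((d * (1 + 1 / \<bar>e \<bullet> i\<bar>)) * w)" using nz L(1) by (intro mult_left_mono) auto
  finally show "norm (x - x') \<le> M * w" by (simp add: M_def)
 qed
qed

lemma hausdorff_outer_frontier_finite:
 fixes S :: "'a::euclidean_space set"
 assumes "open S" "bounded S" "smooth_boundary S"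
 shows "hausdorff_outer (DIM('a) - 1) (frontier S) < \<infinity>"
proof (rule hausdorff_outer_finite)
 have loc: "\<exists>r>0. finite_gauge_covers (DIM('a) - 1) (frontier S \<inter> ball x0 r)" if x0: "x0 \<in> frontier S" for x0
 proof -
  obtain r e \<psi> where r: "r > 0" "norm e = 1" "smooth_on UNIV \<psi>"
   and eq: "S \<inter> ball x0 r = {x \<in> ball x0 r. x \<bullet> e > \<psi> (x - (x \<bullet> e) *\<^sub>R e)}"
   using assms(3)[unfolded smooth_boundary_def, rule_format, OF x0] by blast
  \<comment> \<open>A frontier point above the graph would belong to the open set \<open>S\<close>,
    and one below the graph would have a neighbourhood free of \<open>S\<close>.\<close>
  have "x \<bullet> e = \<psi> (x - (x \<bullet> e) *\<^sub>R e)" if x: "x \<in> frontier S" "x \<in> ball x0 r" for x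
  proof (rule ccontr)
   assume ne: "x \<bullet> e \<noteq> \<psi> (x - (x \<bullet> e) *\<^sub>R e)"
   have "x \<notin> S" using x(1) assms(1) by (simp add: frontier_def interior_open)
   then have "\<not> x \<bullet> e > \<psi> (x - (x \<bullet> e) *\<^sub>R e)" using eq x(2) by blast
   with ne have lt: "x \<bullet> e < \<psi> (x - (x \<bullet> e) *\<^sub>R e)" by simp
   have c: "continuous_on UNIV (\<lambda>x. \<psi> (x - (x \<bullet> e) *\<^sub>R e))"
    by (intro continuous_on_compose2[OF smooth_on_imp_continuous_on[OF r(3)]] continuous_intros) auto
   have "open {x. x \<bullet> e < \<psi> (x - (x \<bullet> e) *\<^sub>R e)}"
    by (intro open_Collect_less continuous_intros c)
   then have op: "open (ball x0 r \<inter> {x. x \<bullet> e < \<psi> (x - (x \<bullet> e) *\<^sub>R e)})" by auto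
   have "x \<in> ball x0 r \<inter> {x. x \<bullet> e < \<psi> (x - (x \<bullet> e) *\<^sub>R e)}" using lt x(2) by simp
   moreover have "x \<in> closure S" using x(1) by (simp add: frontier_def)
   ultimately have "(ball x0 r \<inter> {x. x \<bullet> e < \<psi> (x - (x \<bullet> e) *\<^sub>R e)}) \<inter> S \<noteq> {}"
    using open_Int_closure_eq_empty[OF op, of S] by blast
   then obtain z where z: "z \<in> S \<inter> ball x0 r" "z \<bullet> e < \<psi> (z - (z \<bullet> e) *\<^sub>R e)" by blast
   then have "z \<bullet> e > \<psi> (z - (z \<bullet> e) *\<^sub>R e)" using eq by blast
   with z(2) show False by simp
  qed
  then have "frontier S \<inter> ball x0 r \<subseteq> {x \<in> ball x0 r. x \<bullet> e = \<psi> (x - (x \<bullet> e) *\<^sub>R e)}" by blast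
  from finite_gauge_covers_graph[OF r(2,3,1) this] r(1) show ?thesis by blast
 qed
 then obtain r where r: "\<And>x0. x0 \<in> frontier S ==> r x0 > 0"
  "\<And>x0. x0 \<in> frontier S ==> finite_gauge_covers (DIM('a) - 1) (frontier S \<inter> ball x0 (r x0))" by metis
 have "compact (frontier S)" using assms(2) by (simp add: compact_frontier_bounded)
 then obtain T where T: "T \<subseteq> frontier S" "finite T" "frontier S \<subseteq> (\<Union>x\<in>T. ball x (r x))"
  by (rule compactE_image[of _ "frontier S" "\<lambda>x. ball x (r x)"]) (use r(1) in auto)
 have "finite_gauge_covers (DIM('a) - 1) (\<Union>x\<in>T. frontier S \<inter> ball x (r x))"
  using T r(2) by (intro finite_gauge_covers_UN) auto
 then show "finite_gauge_covers (DIM('a) - 1) (frontier S)"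
  by (rule finite_gauge_covers_subset) (use T(3) in auto)
qed

section \<open>Finite surface measure and traces\<close>

lemma sets_hausdorff_measure: "sets (hausdorff_measure s) = sets borel" "space (hausdorff_measure s) = UNIV"
 unfolding hausdorff_measure_def using sets.sigma_sets_eq[of borel] by (simp_all add: sets_measure_of_conv space_measure_of_conv)

lemma finite_surface_measure:
 fixes S :: "'a::euclidean_space set"
 assumes "open S" "bounded S" "smooth_boundary S"
 shows "finite_measure (surface_measure S)"
proof
 have fr: "frontier S \<in> sets (hausdorff_measure (DIM('a) - 1))"
  by (simp add: sets_hausdorff_measure)
 have "emeasure (surface_measure S) (space (surface_measure S)) = emeasure (hausdorff_measure (DIM('a) - 1)) (frontier S)"
  unfolding surface_measure_def using fr by (subst emeasure_restrict_space) (auto simp: space_restrict_space sets_hausdorff_measure)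
 \<comment> \<open>An inequality is enough for finiteness: \<open>measure_of\<close> yields either
   the outer measure or, if that failed to be a measure on the Borel sets, the default value
   \<open>0\<close>.\<close>
 also have "\<dots> \<le> hausdorff_outer (DIM('a) - 1) (frontier S)"
  unfolding hausdorff_measure_def by (simp add: emeasure_measure_of_conv)
 also have "\<dots> < \<infinity>" by (rule hausdorff_outer_frontier_finite[OF assms])
 finally show "emeasure (surface_measure S) (space (surface_measure S)) \<noteq> \<infinity>" by simp
qed

lemma space_surface_measure: "space (surface_measure S) = frontier S"
 by (simp add: surface_measure_def space_restrict_space sets_hausdorff_measure)

lemma continuous_Lp_surface:
 assumes S: "open S" "bounded S" "smooth_boundary S" and h: "continuous_on (closure S) h" and p: "p > 0"
 shows "h \<in> Lp_space p (surface_measure S)"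
proof -
 have hf: "continuous_on (frontier S) h" using h by (rule continuous_on_subset) (auto simp: frontier_def)
 have "h \<in> borel_measurable (restrict_space borel (frontier S))" by (rule borel_measurable_continuous_on_restrict[OF hf])
 moreover have "sets (surface_measure S) = sets (restrict_space borel (frontier S))"
  unfolding surface_measure_def by (rule sets_restrict_space_cong) (simp add: sets_hausdorff_measure)
 ultimately have m: "h \<in> borel_measurable (surface_measure S)" by (simp cong: measurable_cong_sets)
 have "compact (h ` frontier S)" using hf S(2) by (intro compact_continuous_image compact_frontier_bounded)
 then obtain B where B: "\<And>x. x \<in> frontier S ==> \<bar>h x\<bar> \<le> B" using compact_imp_bounded[of "h ` frontier S"] by (auto simp: bounded_iff)
 interpret finite_measure "surface_measure S" by (rule finite_surface_measure[OF S])
 have "integrable (surface_measure S) (\<lambda>x. \<bar>h x\<bar> powr p)"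
 proof (rule integrable_const_bound[where B="B powr p"])
  show "AE x in surface_measure S. norm (\<bar>h x\<bar> powr p) \<le> B powr p"
   using B p by (intro AE_I2) (auto simp: space_surface_measure intro!: powr_mono2)
 qed (use m in auto)
 with m show ?thesis by (simp add: Lp_space_def)
qed

text \<open>The approximants \<open>\<psi> n + h\<close> coincide with \<open>h\<close> on the
  frontier, so the boundary integrals in \<open>has_trace\<close> are identically zero and no
  inequality between boundary and interior norms enters.\<close>

lemma has_trace_of_test_functions:
 assumes S: "open S" "bounded S" "smooth_boundary S" and h: "smooth_on_closure S h" and p: "p > 0"
  and u: "u \<in> sobolev S 1 p" and \<psi>: "\<And>n::nat. test_function S (\<psi> n)"
  and lim: "(\<lambda>n. sobolev_norm S 1 p (\<lambda>x. \<psi> n x + h x - u x)) \<longlonglongrightarrow> 0"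
 shows "has_trace S p u h"
 unfolding has_trace_def
proof (intro conjI exI[of _ "\<lambda>n x. \<psi> n x + h x"] allI)
 show "u \<in> sobolev S 1 p" by fact
 show "h \<in> Lp_space p (surface_measure S)"
  using h by (intro continuous_Lp_surface[OF S _ p]) (simp add: smooth_on_closure_def)
 show "smooth_on_closure S (\<lambda>x. \<psi> n x + h x)" for n
  by (rule smooth_on_closure_add[OF S(1) test_function_smooth_on_closure[OF \<psi>] h])
 show "(\<lambda>n. sobolev_norm S 1 p (\<lambda>x. \<psi> n x + h x - u x)) \<longlonglongrightarrow> 0" by fact
 have "(\<integral>x. \<bar>\<psi> n x + h x - h x\<bar> powr p \<partial>surface_measure S) = (\<integral>x. 0 \<partial>surface_measure S)" for n
 proof (rule Bochner_Integration.integral_cong[OF refl])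
  fix x assume "x \<in> space (surface_measure S)"
  then have "x \<notin> S" using S(1) by (simp add: space_surface_measure frontier_def interior_open)
  then have "\<psi> n x = 0" by (rule test_functionD(8)[OF \<psi>])
  then show "\<bar>\<psi> n x + h x - h x\<bar> powr p = 0" by simp
 qed
 then show "(\<lambda>n. \<integral>x. \<bar>\<psi> n x + h x - h x\<bar> powr p \<partial>surface_measure S) \<longlonglongrightarrow> 0" by simp
qed

section \<open>Finite monotone problems\<close>

text \<open>Weights are functions on all natural numbers that vanish from \<open>n\<close> on, so
  that compactness comes from the product topology whatever the value of \<open>n\<close>.\<close>

definition simplex_weights :: "nat \<Rightarrow> (nat \<Rightarrow> real) set" where
 "simplex_weights n = {l. (\<forall>i<n. l i \<ge> 0) \<and> (\<forall>i\<ge>n. l i = 0) \<and> (\<Sum>i<n. l i) = 1}"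

lemma compact_simplex_weights: "compact (simplex_weights n)"
proof -
 let ?P = "PiE UNIV (\<lambda>i. if i < n then {0..1} else {0::real})"
 have "compactin (product_topology (\<lambda>i::nat. euclidean) UNIV) ?P"
  by (subst compactin_PiE) auto
 then have c: "compact ?P" by (simp add: euclidean_product_topology)
 have "closed {l::nat \<Rightarrow> real. (\<Sum>i<n. l i) = 1}"
  by (intro closed_Collect_eq continuous_on_sum continuous_on_product_coordinates continuous_on_const)
 then have "compact (?P \<inter> {l. (\<Sum>i<n. l i) = 1})" using c by (rule compact_Int_closed[rotated])
 moreover have "?P \<inter> {l. (\<Sum>i<n. l i) = 1} = simplex_weights n"
 proof -
  have "l i \<le> 1" if "\<forall>i<n. l i \<ge> 0" "(\<Sum>i<n. l i) = 1" "i < n" for l :: "nat \<Rightarrow> real" and i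
   using member_le_sum[of i "{..<n}" l] that by auto
  then show ?thesis unfolding simplex_weights_def PiE_def Pi_def
   by (auto split: if_splits)
 qed
 ultimately show ?thesis by simp
qed

lemma simplex_weights_unit: "k < n ==> (\<lambda>i. if i = k then 1 else 0) \<in> simplex_weights n"
 by (auto simp: simplex_weights_def)

lemma simplex_weights_combination:
 assumes "w \<in> simplex_weights p" "\<And>j. j < p ==> l j \<in> simplex_weights n"
 shows "(\<lambda>i. \<Sum>j<p. w j * l j i) \<in> simplex_weights n"
proof -
 have "(\<Sum>i<n. \<Sum>j<p. w j * l j i) = (\<Sum>j<p. w j * (\<Sum>i<n. l j i))"
  by (subst sum.swap) (simp add: sum_distrib_left)
 also have "\<dots> = 1" using assms by (simp add: simplex_weights_def)
 finally show ?thesis using assms by (auto simp: simplex_weights_def intro!: sum_nonneg sum.neutral)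
qed

text \<open>If the defects \<open>f\<^sup>-\<close> at a minimiser of their sum of squares did not vanish, moving towards
 the weights proportional to \<open>f\<^sup>-\<close> would decrease that sum, by monotonicity.\<close>

lemma monotone_finite_solution:
 fixes a :: "nat \<Rightarrow> nat \<Rightarrow> real"
 assumes "n > 0" and mono: "\<And>i j. i < n ==> j < n ==> a i j + a j i \<ge> 0"
 shows "\<exists>l\<in>simplex_weights n. \<forall>i<n. (\<Sum>j<n. l j * a i j) \<ge> 0"
proof -
 define f where "f = (\<lambda>l i. \<Sum>j<n. l j * a i j)"
 define neg where "neg = (\<lambda>l i. max 0 (- f l i))"
 have "continuous_on (simplex_weights n) (\<lambda>l. \<Sum>i<n. (neg l i)\<^sup>2)"
  unfolding neg_def f_def
  by (intro continuous_intros continuous_on_subset[OF continuous_on_product_coordinates]) auto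
 then obtain l where l: "l \<in> simplex_weights n" and
  min: "\<And>k. k \<in> simplex_weights n ==> (\<Sum>i<n. (neg l i)\<^sup>2) \<le> (\<Sum>i<n. (neg k i)\<^sup>2)"
  using continuous_attains_inf[OF compact_simplex_weights] simplex_weights_unit[OF `n > 0`] by blast
 define s where "s = (\<Sum>i<n. neg l i)"
 have neg0: "neg k i \<ge> 0" for k i by (simp add: neg_def)
 have "s = 0"
 proof (rule ccontr)
  assume "s \<noteq> 0"
  then have s: "s > 0" using sum_nonneg[of "{..<n}" "neg l"] neg0 by (simp add: s_def less_le)
  define k where "k = (\<lambda>i. if i < n then neg l i / s else 0)"
  have k: "k \<in> simplex_weights n"
   using s neg0 by (auto simp: simplex_weights_def k_def s_def sum_divide_distrib[symmetric])
  define d where "d = (\<lambda>i. f k i - f l i)"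
  have "(\<Sum>i<n. k i * f k i) \<ge> 0"
  proof -
   have "(\<Sum>i<n. \<Sum>j<n. k i * k j * a i j) = (\<Sum>i<n. \<Sum>j<n. k i * k j * a j i)"
    by (subst sum.swap) (simp add: mult.commute)
   then have "2 * (\<Sum>i<n. \<Sum>j<n. k i * k j * a i j) = (\<Sum>i<n. \<Sum>j<n. k i * k j * (a i j + a j i))"
    by (simp add: distrib_left sum.distrib)
   also have "\<dots> \<ge> 0" using mono k by (intro sum_nonneg mult_nonneg_nonneg) (auto simp: simplex_weights_def)
   finally have "(\<Sum>i<n. \<Sum>j<n. k i * k j * a i j) \<ge> 0" by linarith
   then show ?thesis by (simp add: f_def sum_distrib_left mult.assoc)
  qed
  then have 1: "(\<Sum>i<n. neg l i * f k i) \<ge> 0"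
   using s by (simp add: k_def sum_divide_distrib[symmetric] zero_le_divide_iff)
  have 2: "neg l i * f l i = - (neg l i)\<^sup>2" for i
   by (auto simp: neg_def power2_eq_square max_def)
  have pos: "(\<Sum>i<n. (neg l i)\<^sup>2) > 0"
  proof (rule ccontr)
   assume "\<not> (\<Sum>i<n. (neg l i)\<^sup>2) > 0"
   then have "(\<Sum>i<n. (neg l i)\<^sup>2) = 0" using sum_nonneg[of "{..<n}" "\<lambda>i. (neg l i)\<^sup>2"] by auto
   then have "\<forall>i<n. neg l i = 0" by (simp add: sum_nonneg_eq_0_iff)
   then show False using s by (simp add: s_def)
  qed
  have D: "(\<Sum>i<n. neg l i * d i) > 0"
   using 1 pos by (simp add: d_def right_diff_distrib 2 sum.distrib)
  define Q where "Q = (\<Sum>i<n. (d i)\<^sup>2)"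
  \<comment> \<open>Small enough for the quadratic term \<open>t * Q\<close> to stay below the
    linear gain; the summand \<open>1\<close> covers \<open>Q = 0\<close>.\<close>
  define t where "t = min 1 ((\<Sum>i<n. neg l i * d i) / (Q + 1))"
  have Q: "Q \<ge> 0" unfolding Q_def by (intro sum_nonneg) auto
  have t: "t > 0" "t \<le> 1" "t * Q < 2 * (\<Sum>i<n. neg l i * d i)"
  proof -
   show "t > 0" "t \<le> 1" using D Q by (auto simp: t_def)
   have "t * (Q + 1) \<le> (\<Sum>i<n. neg l i * d i)" using Q by (simp add: t_def pos_le_divide_eq[symmetric])
   then show "t * Q < 2 * (\<Sum>i<n. neg l i * d i)" using D `t > 0` by (simp add: distrib_left)
  qed
  let ?m = "\<lambda>i. (1 - t) * l i + t * k i"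
  have m: "?m \<in> simplex_weights n"
   using l k t by (auto simp: simplex_weights_def sum.distrib sum_distrib_left[symmetric])
  have fm: "f ?m i = f l i + t * d i" for i
   by (simp add: f_def d_def distrib_right sum.distrib sum_distrib_left mult.assoc left_diff_distrib sum_subtractf right_diff_distrib)
  \<comment> \<open>Since \<open>neg l i \<ge> - f l i\<close>, the new defect is at most the
    positive part of \<open>neg l i - t * d i\<close>.\<close>
  have "(neg ?m i)\<^sup>2 \<le> (neg l i - t * d i)\<^sup>2" for i
  proof -
   have "\<bar>neg ?m i\<bar> \<le> \<bar>neg l i - t * d i\<bar>" unfolding neg_def fm by auto
   then show ?thesis by (rule abs_le_square_iff[THEN iffD1])
  qed
  then have "(\<Sum>i<n. (neg ?m i)\<^sup>2) \<le> (\<Sum>i<n. (neg l i - t * d i)\<^sup>2)" by (intro sum_mono) auto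
  also have "\<dots> = (\<Sum>i<n. (neg l i)\<^sup>2) - t * (2 * (\<Sum>i<n. neg l i * d i) - t * Q)"
   unfolding Q_def sum_distrib_left sum_subtractf[symmetric]
   by (intro sum.cong refl) (simp add: power2_eq_square algebra_simps)
  also have "\<dots> < (\<Sum>i<n. (neg l i)\<^sup>2)" using t by simp
  finally show False using min[OF m] by simp
 qed
 then have "\<forall>i<n. neg l i = 0" using neg0 by (simp add: s_def sum_nonneg_eq_0_iff)
 then have "f l i \<ge> 0" if "i < n" for i using that by (force simp: neg_def max_def split: if_splits)
 then show ?thesis using l by (auto simp: f_def)
qed

text \<open>Compactness and the finite intersection property leave finitely many competitors
  \<open>l\<close>. For these the solution is sought in their own convex hull, which is a monotone
  matrix problem because the pairing is linear in \<open>m\<close>.\<close>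

lemma minty_simplex:
 fixes b :: "(nat \<Rightarrow> real) \<Rightarrow> nat \<Rightarrow> real"
 assumes "n > 0"
  and mono: "\<And>l m. l \<in> simplex_weights n ==> m \<in> simplex_weights n ==>
   (\<Sum>j<n. m j * b l j) + (\<Sum>j<n. l j * b m j) \<ge> 0"
 shows "\<exists>m\<in>simplex_weights n. \<forall>l\<in>simplex_weights n. (\<Sum>j<n. m j * b l j) \<ge> 0"
proof -
 define K where "K = (\<lambda>l m. \<Sum>j<n. m j * b l j)"
 have "simplex_weights n \<inter> \<Inter> ((\<lambda>l. {m. K l m \<ge> 0}) ` simplex_weights n) \<noteq> {}"
 proof (rule compact_imp_fip[OF compact_simplex_weights])
  fix T assume "T \<in> (\<lambda>l. {m. K l m \<ge> 0}) ` simplex_weights n"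
  then show "closed T" unfolding K_def
   by (auto intro!: closed_Collect_le continuous_intros continuous_on_product_coordinates)
 next
  fix F' assume F': "finite F'" "F' \<subseteq> (\<lambda>l. {m. K l m \<ge> 0}) ` simplex_weights n"
  then obtain L where L: "finite L" "L \<subseteq> simplex_weights n" "F' = (\<lambda>l. {m. K l m \<ge> 0}) ` L"
   by (meson finite_subset_image)
  show "simplex_weights n \<inter> \<Inter> F' \<noteq> {}"
  proof (cases "L = {}")
   case True
   then show ?thesis using L simplex_weights_unit[OF `n > 0`] by auto
  next
   case False
   obtain l where l: "bij_betw l {0..<card L} L" using ex_bij_betw_nat_finite[OF L(1)] by blast
   let ?p = "card L"
   have p: "?p > 0" using False L(1) by (simp add: card_gt_0_iff)
   have ls: "l i \<in> simplex_weights n" if "i < ?p" for i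
    using bij_betwE[OF l] that L(2) by auto
   obtain w where w: "w \<in> simplex_weights ?p" "\<And>i. i < ?p ==> (\<Sum>j<?p. w j * K (l i) (l j)) \<ge> 0"
    using monotone_finite_solution[OF p, of "\<lambda>i j. K (l i) (l j)"] mono ls unfolding K_def by blast
   define m where "m = (\<lambda>i. \<Sum>j<?p. w j * l j i)"
   have m: "m \<in> simplex_weights n" unfolding m_def by (rule simplex_weights_combination[OF w(1) ls])
   have "K (l i) m = (\<Sum>j<?p. w j * K (l i) (l j))" for i
    unfolding K_def m_def sum_distrib_right sum_distrib_left by (subst sum.swap) (simp add: mult.assoc)
   then have "K (l i) m \<ge> 0" if "i < ?p" for i using w(2)[OF that] by simp
   then have "K x m \<ge> 0" if "x \<in> L" for x
    using that l unfolding bij_betw_def by (metis atLeastLessThan_iff imageE)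
   then show ?thesis using m L(3) by auto
  qed
 qed
 then show ?thesis unfolding K_def by auto
qed

section \<open>Powers and their uniform convexity\<close>

lemma bernoulli_powr_strict:
 fixes t p :: real
 assumes "p > 1" "t \<ge> 0" "t \<noteq> 1"
 shows "t powr p > 1 + p * (t - 1)"
proof (cases "t = 0")
 case False
 then have t: "t > 0" using assms by simp
 have d: "((\<lambda>s. s powr p - p * s) has_real_derivative (p * (s powr (p - 1) - 1))) (at s)" if "s > 0" for s
  using that by (auto intro!: derivative_eq_intros simp: algebra_simps powr_diff)
 have "t powr p - p * t > 1 powr p - p * 1"
 proof (cases "t > 1")
  case True
  show ?thesis
  proof (rule DERIV_pos_imp_increasing_open[OF True])
   fix s :: real assume s: "1 < s" "s < t"
   then have "1 < s powr (p - 1)" using assms by (intro gr_one_powr) auto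
   then show "\<exists>y. ((\<lambda>s. s powr p - p * s) has_real_derivative y) (at s) \<and> y > 0"
    using d[of s] s assms by (intro exI[of _ "p * (s powr (p - 1) - 1)"]) auto
  qed (auto intro!: continuous_intros)
 next
  case False
  then have "t < 1" using assms by simp
  show ?thesis
  proof (rule DERIV_neg_imp_decreasing_open[OF `t < 1`])
   fix s assume s: "t < s" "s < 1"
   then have "s powr (p - 1) < 1" using t assms powr_less_mono2[of "p - 1" s 1] by simp
   then show "\<exists>y. ((\<lambda>s. s powr p - p * s) has_real_derivative y) (at s) \<and> y < 0"
    using d[of s] s t assms by (intro exI[of _ "p * (s powr (p - 1) - 1)"]) (auto simp: mult_pos_neg)
  qed (use t in \<open>auto intro!: continuous_intros\<close>)
 qed
 then show ?thesis by (simp add: algebra_simps)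
qed (use assms in auto)

text \<open>The tangent line of the power at \<open>m = \<bar>a + b\<bar> / 2\<close> lies below the
  power at \<open>\<bar>a\<bar>\<close> and at \<open>\<bar>b\<bar>\<close>, strictly at one of
  them: both absolute values equal to \<open>m > 0\<close> would force \<open>a = b\<close>. The
  triangle inequality then compares the sum of the two tangent values with
  \<open>2 * m powr p\<close>.\<close>

lemma powr_midpoint_strict:
 fixes a b p :: real
 assumes "p > 1" "a \<noteq> b"
 shows "\<bar>(a + b) / 2\<bar> powr p < (\<bar>a\<bar> powr p + \<bar>b\<bar> powr p) / 2"
proof (cases "a + b = 0")
 case True
 then have "a \<noteq> 0" using assms by auto
 then have "\<bar>a\<bar> powr p > 0" by simp
 then show ?thesis using True by (simp add: add_pos_nonneg)
next
 case False
 define m where "m = \<bar>a + b\<bar> / 2"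
 have m: "m > 0" using False by (simp add: m_def)
 have B: "x powr p \<ge> m powr p * (1 + p * (x / m - 1))" "x \<noteq> m ==> x powr p > m powr p * (1 + p * (x / m - 1))" if "x \<ge> 0" for x
 proof -
  have eq: "x powr p = m powr p * (x / m) powr p" using m that by (simp add: powr_divide)
  show g: "x powr p > m powr p * (1 + p * (x / m - 1))" if "x \<noteq> m"
   unfolding eq using bernoulli_powr_strict[OF assms(1), of "x / m"] m that `x \<ge> 0` by (intro mult_strict_left_mono) auto
  show "x powr p \<ge> m powr p * (1 + p * (x / m - 1))" using g m by (cases "x = m") auto
 qed
 have "\<bar>a\<bar> \<noteq> m \<or> \<bar>b\<bar> \<noteq> m" using assms(2) False unfolding m_def by (auto simp: abs_if split: if_splits)
 then have "\<bar>a\<bar> powr p + \<bar>b\<bar> powr p > m powr p * (1 + p * (\<bar>a\<bar> / m - 1)) + m powr p * (1 + p * (\<bar>b\<bar> / m - 1))"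
  using B[of "\<bar>a\<bar>"] B[of "\<bar>b\<bar>"] by fastforce
 moreover have "m powr p * (1 + p * (\<bar>a\<bar> / m - 1)) + m powr p * (1 + p * (\<bar>b\<bar> / m - 1)) = m powr p * (2 + p * ((\<bar>a\<bar> + \<bar>b\<bar>) / m - 2))"
 proof -
  have "(1 + p * (u - 1)) + (1 + p * (v - 1)) = 2 + p * ((u + v) - 2)" for u v by (simp add: algebra_simps)
  then show ?thesis unfolding add_divide_distrib distrib_left[symmetric] by (simp only:)
 qed
 moreover have "m powr p * (2 + p * ((\<bar>a\<bar> + \<bar>b\<bar>) / m - 2)) \<ge> m powr p * 2"
 proof -
  have "(\<bar>a\<bar> + \<bar>b\<bar>) / m \<ge> 2" using m by (simp add: pos_le_divide_eq) (simp add: m_def)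
  then show ?thesis using assms(1) by (intro mult_left_mono) auto
 qed
 ultimately have "\<bar>a\<bar> powr p + \<bar>b\<bar> powr p > m powr p * 2" by linarith
 moreover have "\<bar>(a + b) / 2\<bar> = m" by (simp add: m_def)
 ultimately show ?thesis by simp
qed

text \<open>A scalar inequality in the role of Clarkson's inequalities, for all \<open>p > 1\<close>
  at once. By homogeneity only pairs with
  \<open>\<bar>a\<bar> powr p + \<bar>b\<bar> powr p = 1\<close> matter. Where the difference is at
  least \<open>e\<close>, compactness bounds the strict midpoint defect \<open>D\<close> away from
  zero; elsewhere the first term suffices.\<close>

lemma powr_uniform_convexity:
 fixes p e :: real
 assumes p: "p > 1" and "e > 0"
 shows "\<exists>C>0. \<forall>a b. \<bar>a - b\<bar> powr p \<le> e * (\<bar>a\<bar> powr p + \<bar>b\<bar> powr p)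
  + C * ((\<bar>a\<bar> powr p + \<bar>b\<bar> powr p) / 2 - \<bar>(a + b) / 2\<bar> powr p)"
proof -
 define D where "D = (\<lambda>(a, b). (\<bar>a\<bar> powr p + \<bar>b\<bar> powr p) / 2 - \<bar>(a + b) / 2\<bar> powr p :: real)"
 have D0: "D (a, b) \<ge> 0" for a b
 proof (cases "a = b")
  case True
  then have "\<bar>(a + b) / 2\<bar> = \<bar>a\<bar>" by simp
  then show ?thesis using True by (simp only: D_def prod.case) simp
 qed (use powr_midpoint_strict[OF p, of a b] in \<open>simp add: D_def\<close>)
 have cont: "continuous_on UNIV (\<lambda>x::real \<times> real. \<bar>fst x\<bar> powr p)" "continuous_on UNIV (\<lambda>x::real \<times> real. \<bar>snd x\<bar> powr p)"
  "continuous_on UNIV (\<lambda>x::real \<times> real. \<bar>fst x - snd x\<bar> powr p)" "continuous_on UNIV D"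
  unfolding D_def split_beta using p by (auto intro!: continuous_intros continuous_on_powr')
 define K where "K = {x::real \<times> real. \<bar>fst x\<bar> powr p + \<bar>snd x\<bar> powr p = 1 \<and> \<bar>fst x - snd x\<bar> powr p \<ge> e}"
 have le1: "\<bar>fst x\<bar> \<le> 1" "\<bar>snd x\<bar> \<le> 1" if "x \<in> K" for x
 proof -
  have "y \<le> 1" if "y powr p \<le> 1" "y \<ge> 0" for y :: real
   using that p gr_one_powr[of y p] by linarith
  moreover have "\<bar>fst x\<bar> powr p \<le> 1" "\<bar>snd x\<bar> powr p \<le> 1"
   using that powr_ge_zero[of "\<bar>fst x\<bar>" p] powr_ge_zero[of "\<bar>snd x\<bar>" p] unfolding K_def mem_Collect_eq by linarith+
  ultimately show "\<bar>fst x\<bar> \<le> 1" "\<bar>snd x\<bar> \<le> 1" by auto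
 qed
 have "closed K" unfolding K_def Collect_conj_eq
  by (rule closed_Int[OF closed_Collect_eq[OF continuous_on_add[OF cont(1,2)] continuous_on_const] closed_Collect_le[OF continuous_on_const cont(3)]])
 moreover have "bounded K"
 proof (rule bounded_subset)
  show "bounded ({-1..1::real} \<times> {-1..1::real})" by (intro bounded_Times) auto
  show "K \<subseteq> {-1..1} \<times> {-1..1}"
  proof
   fix x assume "x \<in> K"
   from le1[OF this] show "x \<in> {-1..1} \<times> {-1..1}" by (auto simp: mem_Times_iff abs_le_iff)
  qed
 qed
 ultimately have cK: "compact K" by (simp add: compact_eq_bounded_closed)
 obtain C where C: "C > 0" "\<And>x. x \<in> K ==> 2 powr p \<le> C * D x"
 proof (cases "K = {}")
  case True
  then show ?thesis using that[of 1] by auto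
 next
  case False
  obtain x0 where x0: "x0 \<in> K" "\<And>x. x \<in> K ==> D x0 \<le> D x"
   using continuous_attains_inf[OF cK False continuous_on_subset[OF cont(4)]] by auto
  have "fst x0 \<noteq> snd x0" using x0(1) p `e > 0` by (auto simp: K_def)
  then have "D x0 > 0" using powr_midpoint_strict[OF p, of "fst x0" "snd x0"] by (simp add: D_def split_beta)
  then show ?thesis using that[of "2 powr p / D x0"] x0(2) by (simp add: field_simps mult_left_mono)
 qed
 have "\<bar>a - b\<bar> powr p \<le> e * (\<bar>a\<bar> powr p + \<bar>b\<bar> powr p) + C * D (a, b)" for a b
 proof (cases "\<bar>a\<bar> powr p + \<bar>b\<bar> powr p = 0")
  case True
  then have "a = 0" "b = 0" using powr_ge_zero[of "\<bar>a\<bar>" p] powr_ge_zero[of "\<bar>b\<bar>" p]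
   by (auto simp: add_nonneg_eq_0_iff)
  then show ?thesis by (simp add: D_def)
 next
  case False
  define s where "s = (\<bar>a\<bar> powr p + \<bar>b\<bar> powr p) powr (1 / p)"
  have pos: "\<bar>a\<bar> powr p + \<bar>b\<bar> powr p > 0" using False by (simp add: less_le)
  then have s: "s > 0" "s powr p = \<bar>a\<bar> powr p + \<bar>b\<bar> powr p" using p by (auto simp: s_def powr_powr)
  have sc: "\<bar>y\<bar> powr p = s powr p * \<bar>y / s\<bar> powr p" for y
   using s(1) by (simp add: abs_divide powr_divide)
  define x where "x = (a / s, b / s)"
  have 1: "\<bar>fst x\<bar> powr p + \<bar>snd x\<bar> powr p = 1"
  proof -
   have "s powr p * (\<bar>fst x\<bar> powr p + \<bar>snd x\<bar> powr p) = \<bar>a\<bar> powr p + \<bar>b\<bar> powr p"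
    unfolding sc[of a] sc[of b] x_def fst_conv snd_conv by (rule distrib_left)
   then have "s powr p * (\<bar>fst x\<bar> powr p + \<bar>snd x\<bar> powr p) = s powr p * 1" unfolding s(2) by (simp only: mult_1_right)
   then show ?thesis using s(1) by (simp only: mult_cancel_left) simp
  qed
  have ab: "\<bar>a - b\<bar> powr p = s powr p * \<bar>fst x - snd x\<bar> powr p"
   unfolding sc[of "a - b"] by (simp add: x_def diff_divide_distrib)
  have Dx: "D (a, b) = s powr p * D x"
  proof -
   have "(a + b) / 2 / s = (a / s + b / s) / 2" by (simp add: add_divide_distrib)
   then have "\<bar>(a + b) / 2\<bar> powr p = s powr p * \<bar>(a / s + b / s) / 2\<bar> powr p" unfolding sc[of "(a + b) / 2"] by (simp only:)
   moreover have "(k * y + k * z) / 2 - k * w = k * ((y + z) / 2 - w)" for k y z w :: real by (simp add: algebra_simps add_divide_distrib)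
   ultimately show ?thesis unfolding D_def x_def prod.case sc[of a] sc[of b] by (simp only:)
  qed
  have "\<bar>fst x - snd x\<bar> powr p \<le> e + C * D x"
  proof (cases "x \<in> K")
   case True
   have "\<bar>fst x - snd x\<bar> powr p \<le> 2 powr p" using le1[OF True] p by (intro powr_mono2) auto
   then show ?thesis using C(2)[OF True] `e > 0` by linarith
  next
   case False
   then have "\<bar>fst x - snd x\<bar> powr p < e" using 1 by (simp add: K_def)
   moreover have "C * D x \<ge> 0" using C(1) D0[of "fst x" "snd x"] by simp
   ultimately show ?thesis by simp
  qed
  then have "s powr p * \<bar>fst x - snd x\<bar> powr p \<le> s powr p * (e + C * D x)" by (intro mult_left_mono) auto
  also have "\<dots> = e * (s powr p) + C * (s powr p * D x)" by (simp add: distrib_left mult.left_commute mult.commute)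
  finally show ?thesis unfolding ab Dx s(2) .
 qed
 then show ?thesis using C(1) unfolding D_def prod.case by blast
qed

section \<open>Separability of the set of test coefficients\<close>

lemma countable_L1_dense_family:
 fixes A B :: "'z \<Rightarrow> 'a::euclidean_space \<Rightarrow> real" and c :: "'z \<Rightarrow> real"
 assumes S: "S \<in> sets lebesgue"
  and A: "\<And>z. z \<in> Z ==> integrable (lebesgue_on S) (A z)" and B: "\<And>z. z \<in> Z ==> integrable (lebesgue_on S) (B z)"
 shows "\<exists>Z0\<subseteq>Z. countable Z0 \<and> (\<forall>z\<in>Z. \<forall>eps>0. \<exists>y\<in>Z0.
  (LINT x|lebesgue_on S. \<bar>A z x - A y x\<bar>) < eps \<and> (LINT x|lebesgue_on S. \<bar>B z x - B y x\<bar>) < eps \<and> \<bar>c z - c y\<bar> < eps)"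
proof -
 obtain \<F> :: "'a set set" where \<F>: "countable \<F>" "\<And>F. F \<in> \<F> ==> open F"
  "\<And>A eps. A \<in> sets lebesgue ==> emeasure lebesgue A < \<infinity> ==> eps > 0 ==> \<exists>F\<in>\<F>. emeasure lebesgue ((A - F) \<union> (F - A)) < ennreal eps"
  using countable_open_approx by metis
 define D where "D = step_sum ` lists (\<rat> \<times> \<F>)"
 have cD: "countable D" unfolding D_def using \<F>(1) countable_rat by (intro countable_image countable_lists countable_SIGMA) auto
 have D: "\<exists>d\<in>D. d \<in> borel_measurable lebesgue \<and> (\<integral>\<^sup>+x. ennreal \<bar>f x - d x\<bar> \<partial>lebesgue) < ennreal eps"
  if f: "integrable lebesgue f" "eps > 0" for f eps
 proof -
  obtain xs where xs: "xs \<in> lists (\<rat> \<times> \<F>)" "(\<integral>\<^sup>+x. ennreal \<bar>f x - step_sum xs x\<bar> \<partial>lebesgue) < ennreal eps"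
   using step_sums_dense[OF \<F>(2,3) f] by blast
  have "step_sum xs \<in> borel_measurable lebesgue" by (rule step_sum_measurable[OF xs(1) sets_lebesgue_open[OF \<F>(2)]])
  then show ?thesis using xs unfolding D_def by blast
 qed
 define ball where "ball = (\<lambda>f d n. d \<in> borel_measurable lebesgue \<and>
  (\<integral>\<^sup>+x. ennreal \<bar>indicator S x * f x - d x\<bar> \<partial>lebesgue) < ennreal (1 / real (Suc n)))"
 \<comment> \<open>The step functions and rationals need not come from members of \<open>Z\<close>.
   Therefore a member of \<open>Z\<close> is picked for each datum \<open>(d, e, q, n)\<close> that
   some member realises; two members with the same datum are within \<open>2 / (n + 1)\<close> of
   each other.\<close>
 define P where "P = (\<lambda>z (d, e, q, n). z \<in> Z \<and> ball (A z) d n \<and> ball (B z) e n \<and> \<bar>c z - q\<bar> < 1 / real (Suc n))"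
 define I where "I = {i \<in> D \<times> D \<times> \<rat> \<times> UNIV. \<exists>z. P z i}"
 define Z0 where "Z0 = (\<lambda>i. SOME z. P z i) ` I"
 have ext: "integrable lebesgue (\<lambda>x. indicator S x * f x)" if "integrable (lebesgue_on S) f" for f :: "'a \<Rightarrow> real"
  using that S by (simp add: integral_lebesgue_on)
 have near: "(LINT x|lebesgue_on S. \<bar>f x - g x\<bar>) < 2 / real (Suc n)"
  if "ball f d n" "ball g d n" "integrable (lebesgue_on S) f" "integrable (lebesgue_on S) g" for f g d n
 proof -
  have m: "(\<lambda>x. indicator S x * f x) \<in> borel_measurable lebesgue" "(\<lambda>x. indicator S x * g x) \<in> borel_measurable lebesgue"
   using ext that by blast+
  have d: "d \<in> borel_measurable lebesgue" using that(1) by (simp add: ball_def)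
  note [measurable] = m d
  have "ennreal (LINT x|lebesgue_on S. \<bar>f x - g x\<bar>) = ennreal (LINT x|lebesgue. \<bar>indicator S x * f x - indicator S x * g x\<bar>)"
   using S by (subst integral_lebesgue_on) (auto intro!: arg_cong[where f="ennreal"] Bochner_Integration.integral_cong split: split_indicator)
  also have "\<dots> = (\<integral>\<^sup>+x. ennreal \<bar>indicator S x * f x - indicator S x * g x\<bar> \<partial>lebesgue)"
   using ext that by (intro nn_integral_eq_integral[symmetric]) auto
  also have "\<dots> \<le> (\<integral>\<^sup>+x. ennreal \<bar>indicator S x * f x - d x\<bar> + ennreal \<bar>indicator S x * g x - d x\<bar> \<partial>lebesgue)"
   by (intro nn_integral_mono) (simp flip: ennreal_plus)
  also have "\<dots> = (\<integral>\<^sup>+x. ennreal \<bar>indicator S x * f x - d x\<bar> \<partial>lebesgue) + (\<integral>\<^sup>+x. ennreal \<bar>indicator S x * g x - d x\<bar> \<partial>lebesgue)"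
   by (rule nn_integral_add) measurable
  also have "\<dots> < ennreal (1 / real (Suc n)) + ennreal (1 / real (Suc n))"
   using that unfolding ball_def by (intro add_strict_mono) auto
  also have "\<dots> = ennreal (2 / real (Suc n))" by (simp flip: ennreal_plus)
  finally show ?thesis by (simp add: ennreal_less_iff)
 qed
 have Z0: "P (SOME z. P z i) i" if "i \<in> I" for i
  using that someI_ex[of "\<lambda>z. P z i"] unfolding I_def by blast
 have "Z0 \<subseteq> Z" using Z0 by (auto simp: Z0_def P_def split_beta)
 moreover have "countable Z0"
 proof -
  have "countable (D \<times> D \<times> (\<rat> :: real set) \<times> (UNIV :: nat set))" using cD countable_rat by (intro countable_SIGMA) auto
  then show ?thesis unfolding Z0_def I_def by (intro countable_image) (rule countable_subset[rotated], auto)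
 qed
 moreover have "\<exists>y\<in>Z0. (LINT x|lebesgue_on S. \<bar>A z x - A y x\<bar>) < eps \<and> (LINT x|lebesgue_on S. \<bar>B z x - B y x\<bar>) < eps \<and> \<bar>c z - c y\<bar> < eps"
  if z: "z \<in> Z" and "eps > 0" for z eps
 proof -
  obtain n where n: "1 / real (Suc n) < eps / 2" using `eps > 0` nat_approx_posE[of "eps / 2"] by auto
  have n': "2 / real (Suc n) < eps" using n by simp
  have p: "1 / real (Suc n) > 0" by simp
  obtain d where d: "d \<in> D" "ball (A z) d n" using D[OF ext[OF A[OF z]] p] unfolding ball_def by blast
  obtain e where e: "e \<in> D" "ball (B z) e n" using D[OF ext[OF B[OF z]] p] unfolding ball_def by blast
  have "c z < c z + 1 / real (Suc n)" using p by linarith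
  from Rats_dense_in_real[OF this] obtain q where q: "q \<in> \<rat>" "\<bar>c z - q\<bar> < 1 / real (Suc n)" by auto
  have i: "(d, e, q, n) \<in> I" unfolding I_def P_def using z d e q by auto
  define y where "y = (SOME z. P z (d, e, q, n))"
  have y: "y \<in> Z" "ball (A y) d n" "ball (B y) e n" "\<bar>c y - q\<bar> < 1 / real (Suc n)"
   using Z0[OF i] by (auto simp: P_def y_def)
  have "y \<in> Z0" unfolding Z0_def y_def using i by blast
  moreover have "(LINT x|lebesgue_on S. \<bar>A z x - A y x\<bar>) < eps"
   using near[OF d(2) y(2) A[OF z] A[OF y(1)]] n' by linarith
  moreover have "(LINT x|lebesgue_on S. \<bar>B z x - B y x\<bar>) < eps"
   using near[OF e(2) y(3) B[OF z] B[OF y(1)]] n' by linarith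
  moreover have "\<bar>c z - c y\<bar> < eps" using q(2) y(4) n by linarith
  ultimately show ?thesis by blast
 qed
 ultimately show ?thesis by blast
qed

section \<open>Completeness of \<open>L\<^sup>p\<close>\<close>

lemma powr_add_le:
 fixes a b p :: real
 assumes "p > 0" shows "\<bar>a + b\<bar> powr p \<le> 2 powr p * (\<bar>a\<bar> powr p + \<bar>b\<bar> powr p)"
proof -
 have "\<bar>a + b\<bar> powr p \<le> (2 * max \<bar>a\<bar> \<bar>b\<bar>) powr p" using assms by (intro powr_mono2) auto
 also have "\<dots> = 2 powr p * max \<bar>a\<bar> \<bar>b\<bar> powr p" by (simp add: powr_mult)
 also have "\<dots> \<le> 2 powr p * (\<bar>a\<bar> powr p + \<bar>b\<bar> powr p)" by (intro mult_left_mono) (auto simp: max_def)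
 finally show ?thesis .
qed

text \<open>The parameter \<open>d\<close> trades the additive constant against the factor
  \<open>d powr (1 - p)\<close>: a small constant gives \<open>L1\<close> convergence on finite
  measure spaces, a small factor gives absorption in the a priori estimate.\<close>

lemma abs_le_powr:
 fixes x p d :: real
 assumes "p > 1" "d > 0" shows "\<bar>x\<bar> \<le> d + d powr (1 - p) * \<bar>x\<bar> powr p"
proof (cases "\<bar>x\<bar> \<le> d")
 case False
 then have x: "\<bar>x\<bar> > d" "\<bar>x\<bar> > 0" using assms by auto
 have "\<bar>x\<bar> = \<bar>x\<bar> powr (1 - p) * \<bar>x\<bar> powr p" using x(2) by (simp flip: powr_add)
 also have "\<dots> \<le> d powr (1 - p) * \<bar>x\<bar> powr p"
  using x assms by (intro mult_right_mono powr_mono2') auto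
 finally show ?thesis using assms by simp
qed (use assms in \<open>simp add: add_increasing2\<close>)

lemma Lp_space_add:
 assumes "p > 0" "f \<in> Lp_space p M" "g \<in> Lp_space p M"
 shows "(\<lambda>x. f x + g x) \<in> Lp_space p M"
  "(LINT x|M. \<bar>f x + g x\<bar> powr p) \<le> 2 powr p * ((LINT x|M. \<bar>f x\<bar> powr p) + (LINT x|M. \<bar>g x\<bar> powr p))"
proof -
 have fg: "f \<in> borel_measurable M" "g \<in> borel_measurable M" "integrable M (\<lambda>x. \<bar>f x\<bar> powr p)" "integrable M (\<lambda>x. \<bar>g x\<bar> powr p)"
  using assms by (auto simp: Lp_space_def)
 note [measurable] = fg(1,2)
 have i: "integrable M (\<lambda>x. 2 powr p * (\<bar>f x\<bar> powr p + \<bar>g x\<bar> powr p))" using fg by auto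
 have m: "(\<lambda>x. \<bar>f x + g x\<bar> powr p) \<in> borel_measurable M" by measurable
 have ae: "AE x in M. \<bar>\<bar>f x + g x\<bar> powr p\<bar> \<le> 2 powr p * (\<bar>f x\<bar> powr p + \<bar>g x\<bar> powr p)" using powr_add_le[OF assms(1)] by simp
 note * = integrable_of_AE_bound[OF m i ae]
 show "(\<lambda>x. f x + g x) \<in> Lp_space p M" using *(1) by (simp add: Lp_space_def)
 show "(LINT x|M. \<bar>f x + g x\<bar> powr p) \<le> 2 powr p * ((LINT x|M. \<bar>f x\<bar> powr p) + (LINT x|M. \<bar>g x\<bar> powr p))"
  using *(2) fg by (simp add: abs_le_iff)
qed

lemma Lp_space_cmult: "f \<in> Lp_space p M ==> (\<lambda>x. c * f x) \<in> Lp_space p M"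
 by (auto simp: Lp_space_def abs_mult powr_mult)

lemma Lp_space_diff:
 assumes "p > 0" "f \<in> Lp_space p M" "g \<in> Lp_space p M"
 shows "(\<lambda>x. f x - g x) \<in> Lp_space p M"
 using Lp_space_add(1)[OF assms(1,2) Lp_space_cmult[OF assms(3), of "-1"]] by simp

lemma Lp_space_L1:
 assumes "finite_measure M" "p > 1" "d > 0" "f \<in> Lp_space p M"
 shows "integrable M f" "(LINT x|M. \<bar>f x\<bar>) \<le> d * measure M (space M) + d powr (1 - p) * (LINT x|M. \<bar>f x\<bar> powr p)"
proof -
 interpret finite_measure M by fact
 have f: "f \<in> borel_measurable M" "integrable M (\<lambda>x. \<bar>f x\<bar> powr p)" using assms by (auto simp: Lp_space_def)
 have i: "integrable M (\<lambda>x. d + d powr (1 - p) * \<bar>f x\<bar> powr p)" using f by auto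
 have m: "(\<lambda>x. \<bar>f x\<bar>) \<in> borel_measurable M" using f by simp
 have ae: "AE x in M. \<bar>\<bar>f x\<bar>\<bar> \<le> d + d powr (1 - p) * \<bar>f x\<bar> powr p" using abs_le_powr[OF assms(2,3)] by simp
 note * = integrable_of_AE_bound[OF m i ae]
 show "integrable M f" using *(1) f integrable_abs_iff by blast
 show "(LINT x|M. \<bar>f x\<bar>) \<le> d * measure M (space M) + d powr (1 - p) * (LINT x|M. \<bar>f x\<bar> powr p)"
  using *(2) f by (simp add: abs_le_iff mult.commute)
qed

lemma Lp_small_imp_L1_small:
 assumes M: "finite_measure M" and p: "p > 1" and "e > 0"
 shows "\<exists>\<eta>>0. \<forall>f\<in>Lp_space p M. (LINT x|M. \<bar>f x\<bar> powr p) < \<eta> \<longrightarrow> (LINT x|M. \<bar>f x\<bar>) < e"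
proof -
 define dl where "dl = e / 2 / (measure M (space M) + 1)"
 have dl: "dl > 0" "dl * measure M (space M) < e / 2"
 proof -
  have m: "measure M (space M) + 1 > 0" using measure_nonneg[of M "space M"] by linarith
  then show d: "dl > 0" using `e > 0` by (simp add: dl_def)
  have "dl * (measure M (space M) + 1) = e / 2"
   by (rule nonzero_eq_divide_eq[THEN iffD1]) (use m in \<open>auto simp: dl_def\<close>)
  then show "dl * measure M (space M) < e / 2" using d by (simp add: distrib_left)
 qed
 have "(LINT x|M. \<bar>f x\<bar>) < e" if "f \<in> Lp_space p M" "(LINT x|M. \<bar>f x\<bar> powr p) < e / 2 / dl powr (1 - p)" for f
 proof -
  have "dl powr (1 - p) > 0" using dl by simp
  then have "dl powr (1 - p) * (LINT x|M. \<bar>f x\<bar> powr p) < e / 2"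
   using that(2) by (simp only: pos_less_divide_eq mult.commute)
  then show ?thesis using Lp_space_L1(2)[OF M p dl(1) that(1)] dl by linarith
 qed
 then show ?thesis using dl(1) `e > 0` by (intro exI[of _ "e / 2 / dl powr (1 - p)"]) auto
qed

text \<open>On a finite measure space the sequence is also Cauchy in \<open>L1\<close>, which
  provides a subsequence converging almost everywhere; Fatou's lemma passes the Cauchy estimate to
  the limit.\<close>

lemma Lp_complete:
 fixes f :: "nat \<Rightarrow> 'a \<Rightarrow> real"
 assumes M: "finite_measure M" and p: "p > 1" and f: "\<And>n. f n \<in> Lp_space p M"
  and cauchy: "\<And>e. e > 0 ==> \<exists>N. \<forall>i\<ge>N. \<forall>j\<ge>N. (LINT x|M. \<bar>f i x - f j x\<bar> powr p) < e"
 shows "\<exists>f0\<in>Lp_space p M. (\<lambda>n. \<integral>x. \<bar>f n x - f0 x\<bar> powr p \<partial>M) \<longlonglongrightarrow> 0"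
proof -
 have p0: "p > 0" using p by simp
 have fm[measurable]: "f n \<in> borel_measurable M" for n using f by (simp add: Lp_space_def)
 have "\<exists>N. \<forall>i\<ge>N. \<forall>j\<ge>N. (LINT x|M. norm (f i x - f j x)) < e" if "e > 0" for e
 proof -
  obtain \<eta> where "\<eta> > 0" "\<And>g. g \<in> Lp_space p M ==> (LINT x|M. \<bar>g x\<bar> powr p) < \<eta> ==> (LINT x|M. \<bar>g x\<bar>) < e"
   using Lp_small_imp_L1_small[OF M p `e > 0`] by blast
  moreover obtain N where "\<And>i j. i \<ge> N ==> j \<ge> N ==> (LINT x|M. \<bar>f i x - f j x\<bar> powr p) < \<eta>"
   using cauchy[OF `\<eta> > 0`] by blast
  ultimately show ?thesis unfolding real_norm_def using Lp_space_diff[OF p0 f f] by blast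
 qed
 then obtain r where r: "strict_mono r" "AE x in M. Cauchy (\<lambda>i. f (r i) x)"
  using cauchy_L1_AE_cauchy_subseq[of M f] Lp_space_L1(1)[OF M p zero_less_one f] by blast
 define f0 where "f0 = (\<lambda>x. lim (\<lambda>i. f (r i) x))"
 have [measurable]: "f0 \<in> borel_measurable M" unfolding f0_def by measurable
 have lim: "AE x in M. (\<lambda>i. f (r i) x) \<longlonglongrightarrow> f0 x"
  using r(2) by eventually_elim (simp add: f0_def Cauchy_convergent_iff convergent_LIMSEQ_iff)
 have int: "integrable M (\<lambda>x. \<bar>f i x - f j x\<bar> powr p)" for i j
  using Lp_space_diff[OF p0 f f] by (simp add: Lp_space_def)
 have bound: "integrable M (\<lambda>x. \<bar>f n x - f0 x\<bar> powr p) \<and> (LINT x|M. \<bar>f n x - f0 x\<bar> powr p) \<le> e"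
  if "e > 0" and N: "\<And>i j. i \<ge> N ==> j \<ge> N ==> (LINT x|M. \<bar>f i x - f j x\<bar> powr p) < e" and "n \<ge> N" for N e n
 proof -
  have "(\<integral>\<^sup>+x. ennreal (\<bar>f n x - f0 x\<bar> powr p) \<partial>M) = (\<integral>\<^sup>+x. liminf (\<lambda>i. ennreal (\<bar>f n x - f (r i) x\<bar> powr p)) \<partial>M)"
  proof (rule nn_integral_cong_AE)
   show "AE x in M. ennreal (\<bar>f n x - f0 x\<bar> powr p) = liminf (\<lambda>i. ennreal (\<bar>f n x - f (r i) x\<bar> powr p))"
    using lim
   proof eventually_elim
    case (elim x)
    have "(\<lambda>i. ennreal (\<bar>f n x - f (r i) x\<bar> powr p)) \<longlonglongrightarrow> ennreal (\<bar>f n x - f0 x\<bar> powr p)"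
     using p0 elim by (intro tendsto_ennrealI tendsto_powr' tendsto_intros) auto
    then show ?case by (intro lim_imp_Liminf[symmetric]) auto
   qed
  qed
  also have "\<dots> \<le> liminf (\<lambda>i. \<integral>\<^sup>+x. ennreal (\<bar>f n x - f (r i) x\<bar> powr p) \<partial>M)"
   by (rule nn_integral_liminf) measurable
  also have "\<dots> \<le> ennreal e"
  proof (rule Liminf_le)
   show "\<forall>\<^sub>F i in sequentially. (\<integral>\<^sup>+x. ennreal (\<bar>f n x - f (r i) x\<bar> powr p) \<partial>M) \<le> ennreal e"
   proof (intro eventually_sequentiallyI)
    fix i assume "i \<ge> N"
    then have "r i \<ge> N" using seq_suble[OF r(1), of i] by simp
    then have "(LINT x|M. \<bar>f n x - f (r i) x\<bar> powr p) < e" using N that by blast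
    then show "(\<integral>\<^sup>+x. ennreal (\<bar>f n x - f (r i) x\<bar> powr p) \<partial>M) \<le> ennreal e"
     by (subst nn_integral_eq_integral[OF int]) (auto intro: ennreal_leI)
   qed
  qed simp
  finally have *: "(\<integral>\<^sup>+x. ennreal (\<bar>f n x - f0 x\<bar> powr p) \<partial>M) \<le> ennreal e" .
  then have i: "integrable M (\<lambda>x. \<bar>f n x - f0 x\<bar> powr p)"
   by (intro integrableI_bounded) (auto intro: le_less_trans)
  moreover have "(LINT x|M. \<bar>f n x - f0 x\<bar> powr p) \<le> e"
   using * `e > 0` by (subst (asm) nn_integral_eq_integral[OF i]) (auto simp: ennreal_le_iff)
  ultimately show ?thesis by blast
 qed
 have "f0 \<in> Lp_space p M"
 proof -
  obtain N where "\<And>i j. i \<ge> N ==> j \<ge> N ==> (LINT x|M. \<bar>f i x - f j x\<bar> powr p) < 1" using cauchy[of 1] by auto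
  from bound[OF zero_less_one this, where n=N] have "(\<lambda>x. f N x - f0 x) \<in> Lp_space p M" by (simp add: Lp_space_def)
  from Lp_space_diff[OF p0 f[of N] this] show ?thesis by simp
 qed
 moreover have "(\<lambda>n. \<integral>x. \<bar>f n x - f0 x\<bar> powr p \<partial>M) \<longlonglongrightarrow> 0"
 proof (rule LIMSEQ_I)
  fix e :: real assume "e > 0"
  then obtain N where "\<And>i j. i \<ge> N ==> j \<ge> N ==> (LINT x|M. \<bar>f i x - f j x\<bar> powr p) < e / 2" using cauchy[of "e / 2"] by auto
  from bound[OF _ this] `e > 0` show "\<exists>no. \<forall>n\<ge>no. norm ((LINT x|M. \<bar>f n x - f0 x\<bar> powr p) - 0) < e"
   by (intro exI[of _ N]) (fastforce simp: integral_nonneg)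
 qed
 ultimately show ?thesis by blast
qed

section \<open>Integration by parts and the Poincare inequality\<close>

lemma measurable_continuous_compose:
 fixes G :: "'a::euclidean_space \<times> 'a \<Rightarrow> real"
 assumes S: "open S" and G: "continuous_on (S \<times> UNIV) G" and P: "P \<in> borel_measurable (lebesgue_on S)"
 shows "(\<lambda>x. G (x, P x)) \<in> borel_measurable (lebesgue_on S)"
proof -
 have o: "open (S \<times> (UNIV :: 'a set))" using S by (intro open_Times) auto
 have "(\<lambda>z. if z \<in> S \<times> UNIV then G z else 0) \<in> borel_measurable borel"
  using borel_measurable_continuous_on_if[OF borel_open[OF o] G, of "\<lambda>z. 0"] by simp
 moreover have "(\<lambda>x. x) \<in> borel_measurable (lebesgue_on S)"
  by (intro continuous_imp_measurable_on_sets_lebesgue continuous_on_id sets_lebesgue_open S)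
 then have "(\<lambda>x. (x, P x)) \<in> borel_measurable (lebesgue_on S)" by (rule borel_measurable_Pair[OF _ P])
 ultimately have "(\<lambda>x. (if (x, P x) \<in> S \<times> UNIV then G (x, P x) else 0)) \<in> borel_measurable (lebesgue_on S)"
  by (rule measurable_compose[rotated])
 then show ?thesis by (rule measurable_cong[THEN iffD1, rotated]) (auto simp: space_restrict_space)
qed

lemma integral_mult_close:
 assumes f: "integrable M f" and a: "ess_bounded M a" and b: "ess_bounded M b"
  and ab: "AE x in M. \<bar>a x - b x\<bar> \<le> e"
 shows "\<bar>(LINT x|M. f x * a x) - (LINT x|M. f x * b x)\<bar> \<le> e * (LINT x|M. \<bar>f x\<bar>)"
proof -
 have i: "integrable M (\<lambda>x. f x * a x)" "integrable M (\<lambda>x. f x * b x)"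
  using ess_bounded_mult_integrable[OF a f] ess_bounded_mult_integrable[OF b f] by (simp_all add: mult.commute)
 have "AE x in M. \<bar>f x * a x - f x * b x\<bar> \<le> e * \<bar>f x\<bar>"
  using ab by eventually_elim (auto simp: abs_mult mult.commute[of e] simp flip: right_diff_distrib intro: mult_left_mono)
 then have "\<bar>\<integral>x. f x * a x - f x * b x \<partial>M\<bar> \<le> (LINT x|M. e * \<bar>f x\<bar>)"
  using i f by (intro integrable_of_AE_bound(2)) auto
 then show ?thesis using i by simp
qed

lemma ess_bounded_test_function:
 assumes "test_function S \<psi>" "open S"
 shows "ess_bounded (lebesgue_on S) \<psi>"
proof -
 obtain B where B: "\<And>x. \<bar>\<psi> x\<bar> \<le> B" using test_function_bounded[OF assms(1)] by blast
 have "\<psi> \<in> borel_measurable (lebesgue_on S)"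
  using test_functionD(2)[OF assms(1)] assms(2)
  by (intro continuous_imp_measurable_on_sets_lebesgue) (auto intro: continuous_on_subset)
 then show ?thesis using B by (intro ess_boundedI) auto
qed

section \<open>The weak divergence\<close>

lemma inner_gradient:
 assumes "f differentiable (at x)"
 shows "X \<bullet> gradient f x = (\<Sum>i\<in>Basis. (X \<bullet> i) * pdiff f x i)"
 by (simp add: gradient_def inner_sum_right mult.commute)

lemma is_weak_divI:
 assumes S: "open S" "bounded S"
  and X: "\<And>i. i \<in> Basis ==> ess_bounded (lebesgue_on S) (\<lambda>x. X x \<bullet> i)"
  and d: "\<And>i. i \<in> Basis ==> is_weak_deriv S [i] (\<lambda>x. X x \<bullet> i) (f i)"
 shows "is_weak_div S X (\<lambda>x. \<Sum>i\<in>Basis. f i x)"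
 unfolding is_weak_div_def
proof (intro conjI allI impI)
 have lf: "locally_integrable S (\<lambda>x. X x \<bullet> i)" "locally_integrable S (f i)" if "i \<in> Basis" for i
  using d[OF that] by (auto simp: is_weak_deriv_def)
 show "locally_integrable S X"
  unfolding locally_integrable_def
 proof (intro allI impI)
  fix K assume "compact K \<and> K \<subseteq> S"
  then have "integrable (lebesgue_on K) (\<lambda>x. \<Sum>i\<in>Basis. (X x \<bullet> i) *\<^sub>R i)"
   using lf(1) by (intro Bochner_Integration.integrable_sum integrable_scaleR_left) (auto simp: locally_integrable_def)
  then show "integrable (lebesgue_on K) X" by (simp add: euclidean_representation)
 qed
 show "locally_integrable S (\<lambda>x. \<Sum>i\<in>Basis. f i x)" using lf(2) by (auto simp: locally_integrable_def)
 fix \<psi> assume \<psi>: "test_function S \<psi>"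
 have "(LINT x|lebesgue_on S. X x \<bullet> gradient \<psi> x) = (LINT x|lebesgue_on S. (\<Sum>i\<in>Basis. (X x \<bullet> i) * iter_partial [i] \<psi> x))"
  by (simp add: inner_gradient[OF test_functionD(4)[OF \<psi>]])
 also have "\<dots> = (\<Sum>i\<in>Basis. \<integral>x. (X x \<bullet> i) * iter_partial [i] \<psi> x \<partial>lebesgue_on S)"
  using integrable_mult_test[OF S(1) lf(1) test_function_partial[OF \<psi>]]
  by (intro Bochner_Integration.integral_sum) auto
 also have "\<dots> = (\<Sum>i\<in>Basis. - (LINT x|lebesgue_on S. f i x * \<psi> x))"
  using d \<psi> by (intro sum.cong refl) (simp add: is_weak_deriv_def)
 also have "\<dots> = - (LINT x|lebesgue_on S. (\<Sum>i\<in>Basis. f i x) * \<psi> x)"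
  using integrable_mult_test[OF S(1) lf(2) \<psi>]
  by (simp add: sum_distrib_right sum_negf Bochner_Integration.integral_sum)
 finally show "(LINT x|lebesgue_on S. X x \<bullet> gradient \<psi> x) = - (LINT x|lebesgue_on S. (\<Sum>i\<in>Basis. f i x) * \<psi> x)" .
qed

lemma weak_div_AE:
 assumes "open S" "is_weak_div S X f"
 shows "AE x in lebesgue_on S. weak_div S X x = f x" "is_weak_div S X (weak_div S X)"
proof -
 show w: "is_weak_div S X (weak_div S X)" unfolding weak_div_def by (rule someI[of "is_weak_div S X", OF assms(2)])
 have l: "locally_integrable S (weak_div S X)" "locally_integrable S f" using w assms by (auto simp: is_weak_div_def)
 have "AE x in lebesgue_on S. weak_div S X x - f x = 0"
 proof (rule fundamental_lemma[OF assms(1) locally_integrable_diff[OF l]])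
  fix \<psi> assume \<psi>: "test_function S \<psi>"
  have "- (LINT x|lebesgue_on S. weak_div S X x * \<psi> x) = - (LINT x|lebesgue_on S. f x * \<psi> x)"
   using w assms(2) \<psi> unfolding is_weak_div_def by metis
  then show "(LINT x|lebesgue_on S. (weak_div S X x - f x) * \<psi> x) = 0"
   using integrable_mult_test[OF assms(1) l(1) \<psi>] integrable_mult_test[OF assms(1) l(2) \<psi>]
   by (simp add: left_diff_distrib)
 qed
 then show "AE x in lebesgue_on S. weak_div S X x = f x" by auto
qed

text \<open>For test functions this is the definition. A uniformly close test function changes each
  side by at most \<open>eps\<close> times the \<open>L1\<close> norm of a fixed coefficient, and
  those norms add up to \<open>K\<close>.\<close>

lemma weak_div_by_parts:
 fixes S :: "'a::euclidean_space set"
 assumes S: "open S" "bounded S" "cone_condition S" and l: "real l > real DIM('a) / 2 + 1"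
  and X: "\<And>i. i \<in> Basis ==> ess_bounded (lebesgue_on S) (\<lambda>x. X x \<bullet> i)"
  and f: "is_weak_div S X f" "ess_bounded (lebesgue_on S) f" and w: "w \<in> H0_space S l"
 shows "(LINT x|lebesgue_on S. f x * w x) = - (LINT x|lebesgue_on S. (\<Sum>i\<in>Basis. (X x \<bullet> i) * weak_deriv S [i] w x))"
proof -
 let ?M = "lebesgue_on S"
 note fin = bounded_open_finite_measure[OF S(1,2)]
 note ebi = ess_bounded_integrable[OF fin]
 have l': "real l > real DIM('a) / 2 + real 1" using l by simp
 have ew: "ess_bounded ?M w" "\<And>i. i \<in> Basis ==> ess_bounded ?M (weak_deriv S [i] w)"
  using H_space_ess_bounded[OF S l' H0_spaceD[OF w]] by (auto simp: index_set_def multi_indices_def)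
 define K where "K = (LINT x|?M. \<bar>f x\<bar>) + (\<Sum>i\<in>Basis. \<integral>x. \<bar>X x \<bullet> i\<bar> \<partial>?M)"
 have "\<bar>(LINT x|?M. f x * w x) + (\<Sum>i\<in>Basis. \<integral>x. (X x \<bullet> i) * weak_deriv S [i] w x \<partial>?M)\<bar> \<le> eps * K" if "eps > 0" for eps
 proof -
  obtain \<psi> where \<psi>: "test_function S \<psi>" "AE x in ?M. \<bar>\<psi> x - w x\<bar> \<le> eps \<and> (\<forall>i\<in>Basis. \<bar>pdiff \<psi> x i - weak_deriv S [i] w x\<bar> \<le> eps)"
   using H0_space_uniform_approx[OF S l w `eps > 0`] by blast
  have e\<psi>: "ess_bounded ?M \<psi>" "\<And>i. i \<in> Basis ==> ess_bounded ?M (\<lambda>x. pdiff \<psi> x i)"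
   using ess_bounded_test_function[OF _ S(1)] test_function_partial[OF \<psi>(1)] \<psi>(1) by blast+
  have "(LINT x|?M. X x \<bullet> gradient \<psi> x) = - (LINT x|?M. f x * \<psi> x)" using f(1) \<psi>(1) by (auto simp: is_weak_div_def)
  moreover have "(LINT x|?M. X x \<bullet> gradient \<psi> x) = (\<Sum>i\<in>Basis. \<integral>x. (X x \<bullet> i) * pdiff \<psi> x i \<partial>?M)"
   unfolding inner_gradient[OF test_functionD(4)[OF \<psi>(1)]] using X e\<psi>
   by (intro Bochner_Integration.integral_sum ebi ess_bounded_mult) auto
  ultimately have 1: "(LINT x|?M. f x * \<psi> x) = - (\<Sum>i\<in>Basis. \<integral>x. (X x \<bullet> i) * pdiff \<psi> x i \<partial>?M)" by simp
  have 2: "\<bar>(LINT x|?M. f x * \<psi> x) - (LINT x|?M. f x * w x)\<bar> \<le> eps * (LINT x|?M. \<bar>f x\<bar>)"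
   using \<psi>(2) by (intro integral_mult_close[OF ebi[OF f(2)] e\<psi>(1) ew(1)]) auto
  have "\<bar>(\<Sum>i\<in>Basis. \<integral>x. (X x \<bullet> i) * pdiff \<psi> x i \<partial>?M) - (\<Sum>i\<in>Basis. \<integral>x. (X x \<bullet> i) * weak_deriv S [i] w x \<partial>?M)\<bar>
    \<le> (\<Sum>i\<in>Basis. \<bar>(LINT x|?M. (X x \<bullet> i) * pdiff \<psi> x i) - (LINT x|?M. (X x \<bullet> i) * weak_deriv S [i] w x)\<bar>)"
   unfolding sum_subtractf[symmetric] by (rule sum_abs)
  also have "\<dots> \<le> (\<Sum>i\<in>Basis. eps * (LINT x|?M. \<bar>X x \<bullet> i\<bar>))"
   using \<psi>(2) by (intro sum_mono integral_mult_close ebi X e\<psi> ew) auto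
  also have "\<dots> = eps * (\<Sum>i\<in>Basis. \<integral>x. \<bar>X x \<bullet> i\<bar> \<partial>?M)" by (simp add: sum_distrib_left)
  finally show ?thesis using 1 2 unfolding K_def distrib_left by linarith
 qed
 note small = this
 have "\<bar>(LINT x|?M. f x * w x) + (\<Sum>i\<in>Basis. \<integral>x. (X x \<bullet> i) * weak_deriv S [i] w x \<partial>?M)\<bar> = 0" (is "?a = 0")
 proof -
  have "?a \<le> 0"
  proof (rule field_le_epsilon)
   fix e :: real assume "e > 0"
   have K: "K \<ge> 0" unfolding K_def by (intro add_nonneg_nonneg sum_nonneg integral_nonneg) auto
   then have "e / (K + 1) > 0" using `e > 0` by simp
   from small[OF this] have "?a \<le> e / (K + 1) * K" .
   also have "\<dots> \<le> e / (K + 1) * (K + 1)" using `e / (K + 1) > 0` by (intro mult_left_mono) auto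
   also have "\<dots> = e" using K by simp
   finally show "?a \<le> 0 + e" by (simp only: add_0)
  qed
  then show ?thesis by (intro antisym abs_ge_zero)
 qed
 moreover have "(LINT x|?M. (\<Sum>i\<in>Basis. (X x \<bullet> i) * weak_deriv S [i] w x)) = (\<Sum>i\<in>Basis. \<integral>x. (X x \<bullet> i) * weak_deriv S [i] w x \<partial>?M)"
  using X ew by (intro Bochner_Integration.integral_sum ebi ess_bounded_mult) auto
 ultimately show ?thesis by simp
qed

section \<open>The Poincare inequality\<close>

lemma abs_powr_has_derivative:
 fixes p y :: real
 assumes "p > 1"
 shows "((\<lambda>y. \<bar>y\<bar> powr p) has_real_derivative (p * \<bar>y\<bar> powr (p - 1) * sgn y)) (at y)"
proof -
 consider "y > 0" | "y < 0" | "y = 0" by linarith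
 then show ?thesis
 proof cases
  case 1
  have "((\<lambda>y. y powr p) has_real_derivative (p * y powr (p - 1))) (at y)" by (rule has_real_derivative_powr[OF 1])
  then show ?thesis
   using 1 by (rule_tac has_field_derivative_transform_within_open[where S="{0<..}"]) (auto simp: sgn_if)
 next
  case 2
  have "((\<lambda>y. (- y) powr p) has_real_derivative (p * (- y) powr (p - 1) * (- 1))) (at y)"
   using 2 by (intro DERIV_chain2[OF has_real_derivative_powr]) (auto intro!: derivative_eq_intros)
  then show ?thesis
   using 2 by (rule_tac has_field_derivative_transform_within_open[where S="{..<0}"]) (auto simp: sgn_if)
 next
  case 3
  have "(\<lambda>h::real. \<bar>h\<bar> powr (p - 1)) \<midarrow>0\<rightarrow> \<bar>0\<bar> powr (p - 1)"
   using assms by (intro tendsto_powr' tendsto_intros) auto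
  also have "\<bar>0::real\<bar> powr (p - 1) = 0" by simp
  finally have lim: "(\<lambda>h::real. \<bar>h\<bar> powr (p - 1)) \<midarrow>0\<rightarrow> 0" .
  have "\<bar>(\<bar>0 + h\<bar> powr p - \<bar>0\<bar> powr p) / h\<bar> = \<bar>h\<bar> powr (p - 1)" if "h \<noteq> 0" for h :: real
   using that by (simp add: powr_diff)
  then have "(\<lambda>h::real. \<bar>(\<bar>0 + h\<bar> powr p - \<bar>0\<bar> powr p) / h\<bar>) \<midarrow>0\<rightarrow> 0"
   using lim by (subst LIM_equal[where g="\<lambda>h. \<bar>h\<bar> powr (p - 1)"]) auto
  then have "(\<lambda>h::real. (\<bar>0 + h\<bar> powr p - \<bar>0\<bar> powr p) / h) \<midarrow>0\<rightarrow> 0" by (rule tendsto_rabs_zero_cancel)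
  then show ?thesis unfolding 3 DERIV_def sgn_zero mult_zero_right .
 qed
qed

text \<open>Either \<open>b \<le> e * a\<close> or not, and each alternative is paid for by one of
  the two terms; conjugate exponents do not appear.\<close>

lemma powr_young:
 fixes a b p e :: real
 assumes "p > 1" "e > 0" "a \<ge> 0" "b \<ge> 0"
 shows "a powr (p - 1) * b \<le> e * a powr p + e powr (1 - p) * b powr p"
proof (cases "b \<le> e * a")
 case True
 have "a powr (p - 1) * b \<le> a powr (p - 1) * (e * a)" using True by (intro mult_left_mono) auto
 also have "\<dots> = e * a powr p"
  using assms by (cases "a = 0") (auto simp: powr_diff)
 finally show ?thesis using assms by (simp add: add_increasing2)
next
 case False
 then have b: "b > 0" "a \<le> b / e" using assms by (auto simp: field_simps intro: le_less_trans[of 0 "e * a"])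
 have "a powr (p - 1) * b \<le> (b / e) powr (p - 1) * b" using assms b by (intro mult_right_mono powr_mono2) auto
 also have "\<dots> = e powr (1 - p) * b powr p"
  using assms b by (simp add: powr_divide powr_diff)
 finally show ?thesis using assms by (simp add: add_increasing)
qed

text \<open>The derivative of \<open>(x \<bullet> i) * \<bar>\<psi> x\<bar> powr p\<close> in
  direction \<open>i\<close> integrates to zero. It consists of
  \<open>\<bar>\<psi> x\<bar> powr p\<close> and a term with the derivative of
  \<open>\<psi>\<close>, to which Young's inequality applies; the parameter
  \<open>1 / (2 * R * p)\<close> lets half of the left side be absorbed.\<close>

lemma poincare_test_function:
 fixes \<psi> :: "'a::euclidean_space \<Rightarrow> real"
 assumes \<psi>: "test_function S \<psi>" and S: "open S" "S \<subseteq> ball 0 R" and p: "p > 1" and i: "i \<in> Basis" and R: "R > 0"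
 defines "C \<equiv> 2 * R * p * (1 / (2 * R * p)) powr (1 - p)"
 shows "(LINT x|lebesgue_on S. \<bar>\<psi> x\<bar> powr p) \<le> C * (LINT x|lebesgue_on S. \<bar>pdiff \<psi> x i\<bar> powr p)"
proof -
 define d where "d = (\<lambda>x. pdiff \<psi> x i)"
 have d: "test_function S d" unfolding d_def by (rule test_function_partial[OF \<psi> i])
 obtain B where B: "B > 0" "\<And>x. \<bar>\<psi> x\<bar> \<le> B" using test_function_bounded[OF \<psi>] by blast
 obtain B1 where B1: "B1 > 0" "\<And>x. \<bar>d x\<bar> \<le> B1" using test_function_bounded[OF d] by blast
 define F where "F = (\<lambda>x. (x \<bullet> i) * \<bar>\<psi> x\<bar> powr p)"
 define F' where "F' = (\<lambda>x. \<bar>\<psi> x\<bar> powr p + (x \<bullet> i) * (p * \<bar>\<psi> x\<bar> powr (p - 1) * sgn (\<psi> x) * d x))"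
 have out: "\<psi> x = 0" "d x = 0" if "x \<notin> S" for x
  using test_functionD(8)[OF \<psi> that] test_functionD(8)[OF d that] by auto
 have xi: "\<bar>x \<bullet> i\<bar> \<le> R" if "x \<in> S" for x
  using Basis_le_norm[OF i, of x] that S(2) by auto
 have "integrable lborel F' \<and> (LINT x|lborel. F' x) = 0"
 proof (intro conjI integral_directional_derivative[of F i F' "B powr p + R * (p * B powr (p - 1) * B1)" "closure {x. \<psi> x \<noteq> 0}"])
  have c: "continuous_on UNIV (\<lambda>x. \<bar>\<psi> x\<bar> powr p)"
   using p test_functionD(2)[OF \<psi>] by (intro continuous_on_powr' continuous_intros) auto
  then show "continuous_on UNIV F" "continuous_on UNIV F" unfolding F_def by (auto intro!: continuous_intros)
  show "((\<lambda>s. F (x + s *\<^sub>R i)) has_real_derivative F' x) (at 0)" for x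
  proof -
   have "(\<psi> has_derivative pdiff \<psi> x) (at (x + 0 *\<^sub>R i))"
    using test_functionD(4)[OF \<psi>, of x] by (simp add: frechet_derivative_works)
   moreover have "((\<lambda>s. x + s *\<^sub>R i) has_derivative (\<lambda>s. s *\<^sub>R i)) (at 0)" by (auto intro!: derivative_eq_intros)
   ultimately have "((\<lambda>s. \<psi> (x + s *\<^sub>R i)) has_derivative (\<lambda>s. pdiff \<psi> x (s *\<^sub>R i))) (at 0)"
    by (rule has_derivative_compose[rotated])
   then have 1: "((\<lambda>s. \<psi> (x + s *\<^sub>R i)) has_real_derivative d x) (at 0)"
    using linear_frechet_derivative[OF test_functionD(4)[OF \<psi>, of x]]
    by (simp add: has_field_derivative_def d_def linear_cmul mult_commute_abs)
   have 2: "((\<lambda>s. \<bar>\<psi> (x + s *\<^sub>R i)\<bar> powr p) has_real_derivative p * \<bar>\<psi> x\<bar> powr (p - 1) * sgn (\<psi> x) * d x) (at 0)"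
    using DERIV_chain2[OF abs_powr_has_derivative[OF p] 1] by simp
   have 3: "((\<lambda>s. (x + s *\<^sub>R i) \<bullet> i) has_real_derivative 1) (at 0)"
    using i by (auto intro!: derivative_eq_intros simp: inner_add_left inner_Basis)
   show ?thesis unfolding F_def F'_def using DERIV_mult[OF 3 2] by (simp add: mult.commute)
  qed
  then show "((\<lambda>s. F (x + s *\<^sub>R i)) has_real_derivative F' x) (at 0)" for x .
  show "\<bar>F' x\<bar> \<le> B powr p + R * (p * B powr (p - 1) * B1)" for x
  proof (cases "x \<in> S")
   case True
   have "\<bar>F' x\<bar> \<le> \<bar>\<psi> x\<bar> powr p + \<bar>x \<bullet> i\<bar> * (p * \<bar>\<psi> x\<bar> powr (p - 1) * \<bar>sgn (\<psi> x)\<bar> * \<bar>d x\<bar>)"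
    unfolding F'_def using p by (intro order_trans[OF abs_triangle_ineq]) (simp add: abs_mult)
   also have "\<dots> \<le> B powr p + R * (p * B powr (p - 1) * 1 * B1)"
    using p B B1 xi[OF True] R by (intro add_mono mult_mono powr_mono2) (auto simp: abs_sgn_eq)
   finally show ?thesis by simp
  next
   case False
   then show ?thesis using out p B B1 R by (simp add: F'_def add_nonneg_nonneg)
  qed
  then show "\<bar>F' x\<bar> \<le> B powr p + R * (p * B powr (p - 1) * B1)" for x .
  show K: "compact (closure {x. \<psi> x \<noteq> 0})" "compact (closure {x. \<psi> x \<noteq> 0})" using test_functionD(5)[OF \<psi>] by auto
  show "F x = 0" if "x \<notin> closure {x. \<psi> x \<noteq> 0}" for x
   using test_functionD(7)[OF \<psi> that] by (simp add: F_def)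
  then show "F x = 0" if "x \<notin> closure {x. \<psi> x \<noteq> 0}" for x using that .
 qed
 then have F': "integrable lborel F'" "(LINT x|lborel. F' x) = 0" by auto
 have cpow: "integrable lborel (\<lambda>x. \<bar>f x\<bar> powr p)" "(LINT x|lebesgue_on S. \<bar>f x\<bar> powr p) = (LINT x|lborel. \<bar>f x\<bar> powr p)"
  if f: "test_function S f" for f
 proof -
  have c: "continuous_on UNIV (\<lambda>x. \<bar>f x\<bar> powr p)"
   using p test_functionD(2)[OF f] by (intro continuous_on_powr' continuous_intros) auto
  have b: "bounded {x. \<bar>f x\<bar> powr p \<noteq> 0}" using test_functionD(3)[OF f] by simp
  show "integrable lborel (\<lambda>x. \<bar>f x\<bar> powr p)" by (rule continuous_bounded_support_integrable[OF c b])
  have "(LINT x|lebesgue_on S. \<bar>f x\<bar> powr p) = (LINT x|lebesgue. indicator S x * \<bar>f x\<bar> powr p)"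
   using S(1) by (intro integral_lebesgue_on) auto
  also have "(\<lambda>x. indicator S x * \<bar>f x\<bar> powr p) = (\<lambda>x. \<bar>f x\<bar> powr p)"
   using test_functionD(8)[OF f] by (auto simp: fun_eq_iff split: split_indicator)
  also have "(LINT x|lebesgue. \<bar>f x\<bar> powr p) = (LINT x|lborel. \<bar>f x\<bar> powr p)"
   using borel_measurable_continuous_onI[OF c] by (intro integral_completion) simp
  finally show "(LINT x|lebesgue_on S. \<bar>f x\<bar> powr p) = (LINT x|lborel. \<bar>f x\<bar> powr p)" .
 qed
 define e where "e = 1 / (2 * R * p)"
 have e: "e > 0" "R * p * e = 1 / 2" using R p by (auto simp: e_def)
 have "1 / 2 * \<bar>\<psi> x\<bar> powr p \<le> F' x + R * p * e powr (1 - p) * \<bar>d x\<bar> powr p" for x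
 proof (cases "x \<in> S")
  case True
  have "\<bar>(x \<bullet> i) * (p * \<bar>\<psi> x\<bar> powr (p - 1) * sgn (\<psi> x) * d x)\<bar> \<le> R * (p * \<bar>\<psi> x\<bar> powr (p - 1) * 1 * \<bar>d x\<bar>)"
   unfolding abs_mult using p xi[OF True] R by (intro mult_mono) (auto simp: abs_sgn_eq)
  also have "\<dots> = R * p * (\<bar>\<psi> x\<bar> powr (p - 1) * \<bar>d x\<bar>)" by simp
  also have "\<dots> \<le> R * p * (e * \<bar>\<psi> x\<bar> powr p + e powr (1 - p) * \<bar>d x\<bar> powr p)"
   using R p by (intro mult_left_mono powr_young e) auto
  also have "\<dots> = 1 / 2 * \<bar>\<psi> x\<bar> powr p + R * p * e powr (1 - p) * \<bar>d x\<bar> powr p"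
   unfolding e(2)[symmetric] by (simp only: distrib_left mult.assoc)
  finally show ?thesis unfolding F'_def by linarith
 qed (use out p in \<open>simp add: F'_def\<close>)
 then have "(LINT x|lborel. 1 / 2 * \<bar>\<psi> x\<bar> powr p) \<le> (LINT x|lborel. F' x + R * p * e powr (1 - p) * \<bar>d x\<bar> powr p)"
  using cpow(1)[OF \<psi>] cpow(1)[OF d] F'(1) by (intro integral_mono) auto
 also have "\<dots> = R * p * e powr (1 - p) * (LINT x|lborel. \<bar>d x\<bar> powr p)"
  using cpow(1)[OF d] F' by simp
 finally show ?thesis using cpow(2)[OF \<psi>] cpow(2)[OF d] by (simp add: C_def d_def e_def)
qed

lemma ess_bounded_Lp:
 assumes "finite_measure M" "p > 0" "ess_bounded M f"
 shows "f \<in> Lp_space p M"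
proof -
 interpret finite_measure M by fact
 obtain C where C: "C > 0" "AE x in M. \<bar>f x\<bar> \<le> C" by (rule ess_boundedE[OF assms(3)])
 have [measurable]: "f \<in> borel_measurable M" by (rule ess_bounded_measurable[OF assms(3)])
 have "integrable M (\<lambda>x. \<bar>f x\<bar> powr p)"
 proof (rule integrable_const_bound[where B="C powr p"])
  show "AE x in M. norm (\<bar>f x\<bar> powr p) \<le> C powr p" using C(2) by eventually_elim (use assms(2) in \<open>auto intro!: powr_mono2\<close>)
 qed measurable
 then show ?thesis by (simp add: Lp_space_def)
qed

lemma Lp_perturbation:
 assumes "finite_measure M" and p: "p > 0" and "f \<in> Lp_space p M" "g \<in> Lp_space p M" and fg: "AE x in M. \<bar>f x - g x\<bar> \<le> e"
 shows "(LINT x|M. \<bar>f x\<bar> powr p) \<le> 2 powr p * ((LINT x|M. \<bar>g x\<bar> powr p) + measure M (space M) * e powr p)"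
proof -
 interpret finite_measure M by fact
 have int: "integrable M (\<lambda>x. \<bar>f x\<bar> powr p)" "integrable M (\<lambda>x. \<bar>g x\<bar> powr p)" using assms by (auto simp: Lp_space_def)
 have "(LINT x|M. \<bar>f x\<bar> powr p) \<le> (LINT x|M. 2 powr p * (\<bar>g x\<bar> powr p + e powr p))"
 proof (intro integral_mono_AE int)
  show "integrable M (\<lambda>x. 2 powr p * (\<bar>g x\<bar> powr p + e powr p))" using int by auto
  show "AE x in M. \<bar>f x\<bar> powr p \<le> 2 powr p * (\<bar>g x\<bar> powr p + e powr p)"
   using fg
  proof eventually_elim
   case (elim x)
   have "\<bar>g x + (f x - g x)\<bar> powr p \<le> 2 powr p * (\<bar>g x\<bar> powr p + \<bar>f x - g x\<bar> powr p)" by (rule powr_add_le[OF p])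
   also have "\<dots> \<le> 2 powr p * (\<bar>g x\<bar> powr p + e powr p)"
    using elim p by (intro mult_left_mono add_left_mono powr_mono2) auto
   finally show ?case by simp
  qed
 qed
 also have "\<dots> = 2 powr p * ((LINT x|M. \<bar>g x\<bar> powr p) + measure M (space M) * e powr p)" using int by simp
 finally show ?thesis .
qed

text \<open>The constant picks up \<open>2 powr p\<close> twice, in passing from \<open>w\<close> to
  a test function and from the derivative of the test function back to that of \<open>w\<close>. The
  uniform error \<open>eps\<close> is fitted so that all perturbation terms together stay below an
  arbitrary \<open>e0\<close>.\<close>

lemma poincare_H0:
 fixes S :: "'a::euclidean_space set"
 assumes S: "open S" "bounded S" "cone_condition S" and l: "real l > real DIM('a) / 2 + 1" and p: "p > 1" and i: "i \<in> Basis"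
 shows "\<exists>C>0. \<forall>w\<in>H0_space S l. (LINT x|lebesgue_on S. \<bar>w x\<bar> powr p) \<le> C * (LINT x|lebesgue_on S. \<bar>weak_deriv S [i] w x\<bar> powr p)"
proof -
 let ?M = "lebesgue_on S"
 interpret finite_measure ?M by (rule bounded_open_finite_measure[OF S(1,2)])
 obtain R where R: "R > 0" "S \<subseteq> ball 0 R" using S(2) bounded_subset_ballD by blast
 define C where "C = 2 * R * p * (1 / (2 * R * p)) powr (1 - p)"
 have C: "C > 0" using R p by (simp add: C_def)
 have p0: "p > 0" using p by simp
 have l': "real l > real DIM('a) / 2 + real 1" using l by simp
 define k where "k = 2 powr p * (C * 2 powr p)"
 have "(LINT x|?M. \<bar>w x\<bar> powr p) \<le> k * (LINT x|?M. \<bar>weak_deriv S [i] w x\<bar> powr p)" if w: "w \<in> H0_space S l" for w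
 proof (rule field_le_epsilon)
  fix e0 :: real assume "e0 > 0"
  define \<mu> where "\<mu> = measure ?M (space ?M)"
  define K where "K = 2 powr p * \<mu> + k * \<mu>"
  have K: "K \<ge> 0" using C by (simp add: K_def k_def \<mu>_def)
  define q where "q = e0 / (K + 1)"
  define eps where "eps = q powr (1 / p)"
  have q: "q > 0" "(K + 1) * q = e0" using `e0 > 0` K by (simp_all add: q_def)
  have eps: "eps > 0" "eps powr p = q" using q p by (simp_all add: eps_def powr_powr)
  obtain \<psi> where \<psi>: "test_function S \<psi>" "AE x in ?M. \<bar>\<psi> x - w x\<bar> \<le> eps \<and> (\<forall>i\<in>Basis. \<bar>pdiff \<psi> x i - weak_deriv S [i] w x\<bar> \<le> eps)"
   using H0_space_uniform_approx[OF S l w eps(1)] by blast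
  have ew: "ess_bounded ?M w" "ess_bounded ?M (weak_deriv S [i] w)"
   using H_space_ess_bounded[OF S l' H0_spaceD[OF w]] i by (auto simp: index_set_def multi_indices_def)
  have e\<psi>: "ess_bounded ?M \<psi>" "ess_bounded ?M (\<lambda>x. pdiff \<psi> x i)"
   using ess_bounded_test_function[OF _ S(1)] test_function_partial[OF \<psi>(1) i] \<psi>(1) by blast+
  note close = Lp_perturbation[OF finite_measure_axioms p0, folded \<mu>_def] and eL = ess_bounded_Lp[OF finite_measure_axioms p0 ew(1)] ess_bounded_Lp[OF finite_measure_axioms p0 ew(2)]
   ess_bounded_Lp[OF finite_measure_axioms p0 e\<psi>(1)] ess_bounded_Lp[OF finite_measure_axioms p0 e\<psi>(2)]
  have "(LINT x|?M. \<bar>w x\<bar> powr p) \<le> 2 powr p * ((LINT x|?M. \<bar>\<psi> x\<bar> powr p) + \<mu> * eps powr p)"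
   using \<psi>(2) by (intro close eL) (auto simp: abs_minus_commute)
  also have "\<dots> \<le> 2 powr p * (C * (LINT x|?M. \<bar>pdiff \<psi> x i\<bar> powr p) + \<mu> * eps powr p)"
   using poincare_test_function[OF \<psi>(1) S(1) R(2) p i R(1)] unfolding C_def by (intro mult_left_mono add_right_mono) auto
  also have "\<dots> \<le> 2 powr p * (C * (2 powr p * ((LINT x|?M. \<bar>weak_deriv S [i] w x\<bar> powr p) + \<mu> * eps powr p)) + \<mu> * eps powr p)"
   using \<psi>(2) C i by (intro mult_left_mono add_right_mono close eL) auto
  also have "\<dots> = k * (LINT x|?M. \<bar>weak_deriv S [i] w x\<bar> powr p) + K * eps powr p"
   by (simp add: k_def K_def algebra_simps)
  also have "K * eps powr p \<le> e0"
  proof -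
   have "K * q \<le> (K + 1) * q" using q by (intro mult_right_mono) auto
   also have "\<dots> = e0" by (rule q(2))
   finally show ?thesis by (simp only: eps(2))
  qed
  finally show "(LINT x|?M. \<bar>w x\<bar> powr p) \<le> k * (LINT x|?M. \<bar>weak_deriv S [i] w x\<bar> powr p) + e0" by simp
 qed
 moreover have "k > 0" using C by (simp add: k_def)
 ultimately show ?thesis by blast
qed

lemma is_weak_deriv_cong:
 assumes "is_weak_deriv S a f f'" "\<And>x. x \<in> S ==> f x = g x"
 shows "is_weak_deriv S a g f'"
proof -
 have "integrable (lebesgue_on K) g = integrable (lebesgue_on K) f" if "K \<subseteq> S" for K
  using that assms(2) by (intro Bochner_Integration.integrable_cong) (auto simp: space_restrict_space)
 moreover have "(LINT x|lebesgue_on S. g x * \<psi> x) = (LINT x|lebesgue_on S. f x * \<psi> x)" for \<psi>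
  using assms(2) by (intro Bochner_Integration.integral_cong) (auto simp: space_restrict_space)
 ultimately show ?thesis using assms(1) by (auto simp: is_weak_deriv_def locally_integrable_def)
qed

section \<open>The mean-field game operator on bounded pairs\<close>

text \<open>Collects what makes the coefficients of \<open>F\<close> bounded functions; growth,
  compactness and the monotonicity of \<open>F\<close> enter as assumptions of the individual lemmas
  below.\<close>

locale mfg_data =
 fixes S :: "'a::euclidean_space set" and k :: nat
  and V \<phi> h :: "'a \<Rightarrow> real" and g :: "real \<Rightarrow> real" and H :: "'a \<Rightarrow> 'a \<Rightarrow> real"
 assumes open_dom: "open S" and bounded_dom: "bounded S" and smooth_dom: "smooth_boundary S"
  and order: "2 * real k > real DIM('a) / 2 + 2"
  and V: "smooth_on_closure S V" and \<phi>: "smooth_on_closure S \<phi>" and h: "smooth_on_closure S h"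
  and g: "smooth_on_closure {0<..} g"
  and H: "smooth_on_closure (S \<times> UNIV) (\<lambda>(x, p). H x p)"
  and g_mono: "mono_on {0..} g"
begin

abbreviation "M \<equiv> lebesgue_on S"
abbreviation "HH \<equiv> (\<lambda>(x, p). H x p)"
abbreviation "eb \<equiv> ess_bounded M"
abbreviation "HS \<equiv> H_space S (2 * k)"
abbreviation "H0 \<equiv> H0_space S (2 * k)"
abbreviation "HA \<equiv> H_affine S (2 * k) h"
abbreviation "HN \<equiv> H_nonneg S (2 * k)"
abbreviation "F \<equiv> mfg_F S H g V \<phi>"
abbreviation "grad \<equiv> weak_gradient S"
abbreviation "pd \<equiv> \<lambda>i. weak_deriv S [i]"

definition opA :: "('a \<Rightarrow> real) \<Rightarrow> ('a \<Rightarrow> real) \<Rightarrow> 'a \<Rightarrow> real" where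
 "opA \<eta> v x = - v x - H x (grad v x) + g (\<eta> x) - V x"

definition flux :: "('a \<Rightarrow> real) \<Rightarrow> 'a \<Rightarrow> 'a" where
 "flux v x = gradient (H x) (grad v x)"

definition opB :: "('a \<Rightarrow> real) \<Rightarrow> ('a \<Rightarrow> real) \<Rightarrow> 'a \<Rightarrow> real" where
 "opB \<eta> v x = \<eta> x - weak_div S (\<lambda>y. \<eta> y *\<^sub>R flux v y) x - \<phi> x"

lemma mfg_F_eq: "F \<eta> v w1 w2 = (LINT x|M. opA \<eta> v x * w1 x) + (LINT x|M. opB \<eta> v x * w2 x)"
 by (simp add: mfg_F_def opA_def opB_def flux_def)

lemma finite_M: "finite_measure M"
 by (rule bounded_open_finite_measure[OF open_dom bounded_dom])

lemma dom_sets: "S \<in> sets lebesgue"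
 by (rule sets_lebesgue_open[OF open_dom])

lemma cone: "cone_condition S"
 by (rule smooth_boundary_cone_condition[OF open_dom smooth_dom])

lemma order1: "real (2 * k) > real DIM('a) / 2 + 1" and order2: "real (2 * k) > real DIM('a) / 2 + real 2"
 using order by auto

lemma H_bounded:
 assumes "v \<in> HS"
 shows "eb v" "i \<in> Basis ==> eb (pd i v)"
  "i \<in> Basis ==> j \<in> Basis ==> eb (weak_deriv S [i, j] v)"
 using H_space_ess_bounded[OF open_dom bounded_dom cone order2 assms] by (auto simp: index_set_def multi_indices_def)

lemma two_le_order: "2 \<le> 2 * k"
 using order by (cases k) auto

lemma H_weak_deriv:
 assumes v: "v \<in> HS" and i: "i \<in> Basis"
 shows "is_weak_deriv S [i] v (pd i v)"
  "j \<in> Basis ==> is_weak_deriv S [i] (pd j v) (weak_deriv S [j, i] v)"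
proof -
 have *: "is_weak_deriv S [i] v (pd i v)" if "i \<in> Basis" for i
  using two_le_order that by (intro H_spaceD(1)[OF open_dom v]) (auto simp: index_set_def multi_indices_def)
 show "is_weak_deriv S [i] v (pd i v)" by (rule *[OF i])
 show "is_weak_deriv S [i] (pd j v) (weak_deriv S [j, i] v)" if j: "j \<in> Basis"
 proof -
  have "is_weak_deriv S [j, i] v (weak_deriv S [j, i] v)"
   using two_le_order i j by (intro H_spaceD(1)[OF open_dom v]) (auto simp: index_set_def multi_indices_def)
  then show ?thesis using is_weak_deriv_Cons[OF *[OF j], of "[i]"] i by (simp add: multi_indices_def)
 qed
qed

lemma weak_gradient_inner: "i \<in> Basis ==> grad v x \<bullet> i = pd i v x"
 by (simp add: weak_gradient_def inner_sum_left inner_Basis if_distrib cong: if_cong)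

lemma weak_gradient_measurable:
 assumes "v \<in> HS" shows "grad v \<in> borel_measurable M"
 unfolding weak_gradient_def
 using H_bounded(2)[OF assms] by (intro borel_measurable_sum borel_measurable_scaleR ess_bounded_measurable borel_measurable_const) auto

lemma weak_gradient_bounded:
 assumes "v \<in> HS" shows "\<exists>R>0. AE x in M. norm (grad v x) \<le> R"
proof -
 have "\<exists>C>0. AE x in M. \<bar>pd i v x\<bar> \<le> C" if "i \<in> Basis" for i
  using H_bounded(2)[OF assms that] ess_boundedE by metis
 then obtain C where C: "\<And>i. i \<in> Basis ==> C i > 0 \<and> (AE x in M. \<bar>pd i v x\<bar> \<le> C i)" by metis
 have "AE x in M. \<forall>i\<in>Basis. \<bar>pd i v x\<bar> \<le> C i" using C by (intro AE_finite_allI) auto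
 then have "AE x in M. norm (grad v x) \<le> (\<Sum>i\<in>Basis. C i)"
 proof eventually_elim
  case (elim x)
  have "norm (grad v x) \<le> (\<Sum>i\<in>Basis. norm (pd i v x *\<^sub>R i))"
   unfolding weak_gradient_def by (rule norm_sum)
  also have "\<dots> \<le> (\<Sum>i\<in>Basis. C i)" using elim by (intro sum_mono) auto
  finally show ?case .
 qed
 moreover have "(\<Sum>i\<in>Basis. C i) > 0" using C by (intro sum_pos) auto
 ultimately show ?thesis by blast
qed

section \<open>Boundedness of both components of the operator\<close>

lemma HH_smooth: "smooth_on (S \<times> UNIV) HH"
 using H by (simp add: smooth_on_closure_def)

lemma HH_partial_bounded:
 assumes "a \<in> multi_indices" shows "\<exists>B. \<forall>x\<in>S. \<forall>p. norm p \<le> R \<longrightarrow> \<bar>iter_partial a HH (x, p)\<bar> \<le> B"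
proof -
 obtain G where G: "continuous_on (closure (S \<times> UNIV)) G" "\<And>z. z \<in> S \<times> UNIV ==> G z = iter_partial a HH z"
  using H assms unfolding smooth_on_closure_def by metis
 have "compact (closure S \<times> (cball 0 R :: 'a set))" using bounded_dom by (intro compact_Times compact_cball) auto
 moreover have "continuous_on (closure S \<times> cball 0 R) G"
  by (rule continuous_on_subset[OF G(1)]) (auto simp: closure_Times)
 ultimately have "bounded (G ` (closure S \<times> cball 0 R))" by (intro compact_imp_bounded compact_continuous_image)
 then obtain B where "\<And>z. z \<in> closure S \<times> cball 0 R ==> \<bar>G z\<bar> \<le> B" by (auto simp: bounded_iff)
 then have "\<bar>iter_partial a HH (x, p)\<bar> \<le> B" if "x \<in> S" "norm p \<le> R" for x p
  using G(2)[of "(x, p)"] that closure_subset[of S] by force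
 then show ?thesis by blast
qed

lemma AE_dom: "AE x in M. x \<in> S"
 by (rule AE_I2) (simp add: space_restrict_space)

lemma HH_compose_bounded:
 assumes a: "a \<in> multi_indices" and P: "P \<in> borel_measurable M" "AE x in M. norm (P x) \<le> R"
 shows "eb (\<lambda>x. iter_partial a HH (x, P x))"
proof -
 obtain B where B: "\<And>x p. x \<in> S ==> norm p \<le> R ==> \<bar>iter_partial a HH (x, p)\<bar> \<le> B" using HH_partial_bounded[OF a] by blast
 show ?thesis
 proof (rule ess_boundedI)
  show "(\<lambda>x. iter_partial a HH (x, P x)) \<in> borel_measurable M"
   by (rule measurable_continuous_compose[OF open_dom smooth_on_imp_continuous_on[OF smooth_on_iter_partial[OF HH_smooth a]] P(1)])
  show "AE x in M. \<bar>iter_partial a HH (x, P x)\<bar> \<le> B" using P(2) AE_dom by eventually_elim (rule B)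
 qed
qed

lemma HH_v_bounded:
 assumes a: "a \<in> multi_indices" and v: "v \<in> HS"
 shows "eb (\<lambda>x. iter_partial a HH (x, grad v x))"
 using weak_gradient_bounded[OF v] HH_compose_bounded[OF a weak_gradient_measurable[OF v]] by blast

text \<open>The gradient in the second variable alone is expressed by derivatives on the product
  space in the directions \<open>(0, i)\<close>, since smoothness up to the boundary is assumed for
  \<open>H\<close> jointly in both variables.\<close>

lemma gradient_H_inner:
 assumes "x \<in> S" "i \<in> Basis"
 shows "gradient (H x) p \<bullet> i = iter_partial [(0, i)] HH (x, p)"
proof -
 have "(HH has_derivative pdiff HH (x, p)) (at (x, p))"
  using smooth_on_imp_differentiable[OF HH_smooth, of "(x, p)"] assms(1) by (simp add: frechet_derivative_works)
 moreover have "((\<lambda>q. (x, q)) has_derivative (\<lambda>q. (0, q))) (at p)" by (auto intro!: derivative_eq_intros)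
 ultimately have "((\<lambda>q. HH (x, q)) has_derivative (\<lambda>q. pdiff HH (x, p) (0, q))) (at p)"
  by (rule has_derivative_compose[rotated])
 then have "pdiff (H x) p = (\<lambda>q. pdiff HH (x, p) (0, q))"
  by (simp add: frechet_derivative_at[symmetric])
 then show ?thesis using assms(2) by (simp add: gradient_def inner_sum_left inner_Basis if_distrib cong: if_cong)
qed

lemma multi_indices_p: "i \<in> Basis ==> [(0 :: 'a, i)] \<in> multi_indices"
 by (simp add: multi_indices_def Basis_prod_def)

lemma eb_flux:
 assumes v: "v \<in> HS" and i: "i \<in> Basis"
 shows "eb (\<lambda>x. flux v x \<bullet> i)"
proof (rule ess_bounded_cong[OF HH_v_bounded[OF multi_indices_p[OF i] v]])
 show ae: "AE x in M. iter_partial [(0, i)] HH (x, grad v x) = flux v x \<bullet> i"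
  using AE_dom by eventually_elim (simp only: flux_def gradient_H_inner[OF _ i])
 show "(\<lambda>x. flux v x \<bullet> i) \<in> borel_measurable M"
  by (rule measurable_cong_AE_lebesgue_on[OF dom_sets ess_bounded_measurable[OF HH_v_bounded[OF multi_indices_p[OF i] v]] ae])
qed

text \<open>The chain rule with \<open>G\<close> the derivative of \<open>H\<close> in direction
  \<open>(0, i)\<close> and \<open>p j\<close> the weak derivatives of \<open>v\<close>. Its result
  contains second derivatives of \<open>v\<close>, whose boundedness is the reason for two orders
  beyond half the dimension.\<close>

lemma flux_weak_deriv:
 assumes \<eta>: "\<eta> \<in> HS" and v: "v \<in> HS" and i: "i \<in> Basis"
 shows "\<exists>f. is_weak_deriv S [i] (\<lambda>x. \<eta> x * (flux v x \<bullet> i)) f \<and> eb f"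
proof -
 let ?P = "grad v"
 let ?G = "iter_partial [(0, i)] HH"
 define f where "f = (\<lambda>x. \<eta> x * ?G (x, ?P x))"
 define f1 where "f1 = (\<lambda>x. pd i \<eta> x * ?G (x, ?P x) + \<eta> x * (pdiff ?G (x, ?P x) (i, 0)
   + (\<Sum>j\<in>Basis. weak_deriv S [j, i] v x * pdiff ?G (x, ?P x) (0, j))))"
 have G: "eb (\<lambda>x. ?G (x, ?P x))" by (rule HH_v_bounded[OF multi_indices_p[OF i] v])
 have G1: "eb (\<lambda>x. pdiff ?G (x, ?P x) b)" if "b \<in> Basis" for b
  using HH_v_bounded[of "[b, (0, i)]", OF _ v] that multi_indices_p[OF i] by (simp add: multi_indices_def)
 have b1: "(i, 0) \<in> (Basis :: ('a \<times> 'a) set)" "\<And>j. j \<in> Basis ==> (0, j) \<in> (Basis :: ('a \<times> 'a) set)"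
  using i by (auto simp: Basis_prod_def)
 have ef: "eb f" unfolding f_def by (intro ess_bounded_mult H_bounded \<eta> G)
 have ef1: "eb f1" unfolding f1_def
  by (intro ess_bounded_add ess_bounded_mult ess_bounded_sum H_bounded \<eta> v G G1 i b1)
 have loc: "locally_integrable S u" if "eb u" for u
  by (rule locally_integrable_of_integrable[OF open_dom ess_bounded_integrable[OF finite_M that]])
 have "is_weak_deriv S [i] f f1"
  by (rule weak_deriv_chain_rule[OF open_dom bounded_dom i smooth_on_iter_partial[OF HH_smooth multi_indices_p[OF i]]
   H_bounded(1)[OF \<eta>] H_weak_deriv(1)[OF \<eta> i] H_bounded(2)[OF \<eta> i] H_bounded(2)[OF v] H_weak_deriv(2)[OF v i] H_bounded(3)[OF v _ i] _
   f_def loc[OF ef] f1_def loc[OF ef1]]) (simp_all add: weak_gradient_def fun_eq_iff)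
 then have "is_weak_deriv S [i] (\<lambda>x. \<eta> x * (flux v x \<bullet> i)) f1"
  by (rule is_weak_deriv_cong) (simp only: f_def flux_def gradient_H_inner[OF _ i])
 then show ?thesis using ef1 by blast
qed

lemma g_compose_bounded:
 assumes "\<eta> \<in> HN"
 shows "eb (\<lambda>x. g (\<eta> x))"
proof -
 have \<eta>: "eb \<eta>" "AE x in M. \<eta> x \<ge> 0" using assms H_bounded(1) by (auto simp: H_nonneg_def)
 obtain C where C: "C > 0" "AE x in M. \<bar>\<eta> x\<bar> \<le> C" by (rule ess_boundedE[OF \<eta>(1)])
 have "continuous_on {0..} g" using g by (simp add: smooth_on_closure_def)
 \<comment> \<open>Continuity of \<open>g\<close> is known only on the half-line, and
   \<open>\<eta>\<close> is nonnegative only almost everywhere; hence measurability is obtained for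
   a version cut off at negative arguments and transferred.\<close>
 then have "(\<lambda>t. if t \<in> {0..} then g t else 0) \<in> borel_measurable borel"
  by (intro borel_measurable_continuous_on_if) auto
 then have m: "(\<lambda>x. if \<eta> x \<in> {0..} then g (\<eta> x) else 0) \<in> borel_measurable M"
  by (rule measurable_compose[OF ess_bounded_measurable[OF \<eta>(1)]])
 have ae: "AE x in M. (if \<eta> x \<in> {0..} then g (\<eta> x) else 0) = g (\<eta> x)" using \<eta>(2) by eventually_elim simp
 show ?thesis
 proof (rule ess_boundedI)
  show "(\<lambda>x. g (\<eta> x)) \<in> borel_measurable M" by (rule measurable_cong_AE_lebesgue_on[OF dom_sets m ae])
  show "AE x in M. \<bar>g (\<eta> x)\<bar> \<le> \<bar>g 0\<bar> + \<bar>g C\<bar>"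
   using C(2) \<eta>(2)
  proof eventually_elim
   case (elim x)
   then have "g 0 \<le> g (\<eta> x)" "g (\<eta> x) \<le> g C" using C(1) by (auto intro!: mono_onD[OF g_mono])
   then show ?case by linarith
  qed
 qed
qed

lemma eb_smooth: "smooth_on_closure S f ==> eb f"
 using smooth_on_closure_H_space(2)[OF _ open_dom bounded_dom, of f "[]"] by (simp add: multi_indices_def)

lemma eb_H:
 assumes "v \<in> HS" shows "eb (\<lambda>x. H x (grad v x))"
 using HH_v_bounded[OF _ assms, of "[]"] by (simp add: multi_indices_def)

lemma eb_opA:
 assumes "\<eta> \<in> HN" "v \<in> HS"
 shows "eb (opA \<eta> v)"
proof -
 have "eb (\<lambda>x. - 1 * v x - H x (grad v x) + g (\<eta> x) - V x)"
  by (intro ess_bounded_add ess_bounded_diff ess_bounded_cmult g_compose_bounded eb_H H_bounded(1) eb_smooth[OF V] assms)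
 moreover have "(\<lambda>x. - 1 * v x - H x (grad v x) + g (\<eta> x) - V x) = opA \<eta> v"
  by (simp add: fun_eq_iff opA_def)
 ultimately show ?thesis by simp
qed

lemma weak_div_flux:
 assumes \<eta>: "\<eta> \<in> HS" and v: "v \<in> HS"
 shows "is_weak_div S (\<lambda>y. \<eta> y *\<^sub>R flux v y) (weak_div S (\<lambda>y. \<eta> y *\<^sub>R flux v y))"
  "eb (weak_div S (\<lambda>y. \<eta> y *\<^sub>R flux v y))" "i \<in> Basis ==> eb (\<lambda>y. (\<eta> y *\<^sub>R flux v y) \<bullet> i)"
proof -
 show X: "eb (\<lambda>y. (\<eta> y *\<^sub>R flux v y) \<bullet> i)" if "i \<in> Basis" for i
  unfolding inner_scaleR_left by (intro ess_bounded_mult H_bounded(1)[OF \<eta>] eb_flux[OF v that])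
 obtain f where f: "\<And>i. i \<in> Basis ==> is_weak_deriv S [i] (\<lambda>x. \<eta> x * (flux v x \<bullet> i)) (f i) \<and> eb (f i)"
  using flux_weak_deriv[OF \<eta> v] by metis
 have d: "is_weak_div S (\<lambda>y. \<eta> y *\<^sub>R flux v y) (\<lambda>x. \<Sum>i\<in>Basis. f i x)"
  using f by (intro is_weak_divI[OF open_dom bounded_dom X]) auto
 show "is_weak_div S (\<lambda>y. \<eta> y *\<^sub>R flux v y) (weak_div S (\<lambda>y. \<eta> y *\<^sub>R flux v y))"
  by (rule weak_div_AE(2)[OF open_dom d])
 have e: "eb (\<lambda>x. \<Sum>i\<in>Basis. f i x)" using f by (intro ess_bounded_sum) auto
 have ae: "AE x in M. (\<Sum>i\<in>Basis. f i x) = weak_div S (\<lambda>y. \<eta> y *\<^sub>R flux v y) x"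
  using weak_div_AE(1)[OF open_dom d] by eventually_elim simp
 show "eb (weak_div S (\<lambda>y. \<eta> y *\<^sub>R flux v y))"
  by (rule ess_bounded_cong[OF e measurable_cong_AE_lebesgue_on[OF dom_sets ess_bounded_measurable[OF e] ae] ae])
qed

lemma eb_opB:
 assumes "\<eta> \<in> HS" "v \<in> HS"
 shows "eb (opB \<eta> v)"
 unfolding opB_def by (intro ess_bounded_diff H_bounded(1) weak_div_flux(2) eb_smooth[OF \<phi>] assms)

text \<open>Tested with elements of \<open>H0\<close> the divergence disappears in favour of the
  flux, for which growth bounds are available; the bound on \<open>weak_div\<close> itself depends
  on second derivatives and would be of no use in an estimate uniform in \<open>\<eta>\<close> and
  \<open>v\<close>.\<close>

lemma opB_by_parts:
 assumes \<eta>: "\<eta> \<in> HS" and v: "v \<in> HS" and w: "w \<in> H0"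
 shows "(LINT x|M. opB \<eta> v x * w x) = (LINT x|M. (\<eta> x - \<phi> x) * w x + \<eta> x * (flux v x \<bullet> grad w x))"
  "eb (\<lambda>x. \<eta> x * (flux v x \<bullet> grad w x))"
proof -
 note wH = H0_spaceD[OF w]
 note ebi = ess_bounded_integrable[OF finite_M]
 let ?d = "weak_div S (\<lambda>y. \<eta> y *\<^sub>R flux v y)"
 have eq: "\<eta> x * (flux v x \<bullet> grad w x) = (\<Sum>i\<in>Basis. ((\<eta> x *\<^sub>R flux v x) \<bullet> i) * pd i w x)" for x
  by (subst euclidean_inner) (simp add: weak_gradient_inner sum_distrib_left mult.assoc)
 show e: "eb (\<lambda>x. \<eta> x * (flux v x \<bullet> grad w x))"
  unfolding eq by (intro ess_bounded_sum ess_bounded_mult weak_div_flux(3) H_bounded(2) \<eta> v wH)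
 have p: "(LINT x|M. ?d x * w x) = - (LINT x|M. \<eta> x * (flux v x \<bullet> grad w x))"
  unfolding eq by (rule weak_div_by_parts[OF open_dom bounded_dom cone order1 weak_div_flux(3)[OF \<eta> v] weak_div_flux(1,2)[OF \<eta> v] w])
 have e1: "eb (\<lambda>x. (\<eta> x - \<phi> x) * w x)"
  by (intro ess_bounded_mult ess_bounded_diff H_bounded(1) \<eta> wH eb_smooth[OF \<phi>])
 have e2: "eb (\<lambda>x. ?d x * w x)" by (intro ess_bounded_mult H_bounded(1) weak_div_flux(2) \<eta> v wH)
 have "(LINT x|M. opB \<eta> v x * w x) = (LINT x|M. (\<eta> x - \<phi> x) * w x - ?d x * w x)"
  by (intro Bochner_Integration.integral_cong refl) (simp add: opB_def algebra_simps)
 also have "\<dots> = (LINT x|M. (\<eta> x - \<phi> x) * w x) - (LINT x|M. ?d x * w x)"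
  by (rule Bochner_Integration.integral_diff[OF ebi[OF e1] ebi[OF e2]])
 also have "\<dots> = (LINT x|M. (\<eta> x - \<phi> x) * w x + \<eta> x * (flux v x \<bullet> grad w x))"
  using Bochner_Integration.integral_add[OF ebi[OF e1] ebi[OF e]] p by simp
 finally show "(LINT x|M. opB \<eta> v x * w x) = (LINT x|M. (\<eta> x - \<phi> x) * w x + \<eta> x * (flux v x \<bullet> grad w x))" .
qed

end

context mfg_data
begin

section \<open>Monotone problems on convex hulls of finitely many pairs\<close>

lemma weak_gradient_combination:
 assumes "v \<in> HS" "u \<in> HS"
 shows "AE x in M. grad (\<lambda>x. a * v x + b * u x) x = a *\<^sub>R grad v x + b *\<^sub>R grad u x"
proof -
 have "AE x in M. \<forall>i\<in>Basis. pd i (\<lambda>x. a * v x + b * u x) x = a * pd i v x + b * pd i u x"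
 proof (rule AE_finite_allI)
  fix i :: 'a assume i: "i \<in> Basis"
  then have mi: "[i] \<in> multi_indices" by (simp add: multi_indices_def)
  show "AE x in M. pd i (\<lambda>x. a * v x + b * u x) x = a * pd i v x + b * pd i u x"
   by (rule weak_deriv_AE[OF open_dom is_weak_deriv_add[OF open_dom mi
    is_weak_deriv_cmult[OF H_weak_deriv(1)[OF assms(1) i]] is_weak_deriv_cmult[OF H_weak_deriv(1)[OF assms(2) i]]]])
 qed simp
 then show ?thesis
 proof eventually_elim
  case (elim x)
  then show ?case by (simp add: weak_gradient_def scaleR_add_left sum.distrib scaleR_sum_right)
 qed
qed

lemma eb_H_nonneg: "\<eta> \<in> HN ==> eb \<eta>"
 using H_bounded(1) by (simp add: H_nonneg_def)

lemma eb_H_affine: "v \<in> HA ==> eb v"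
 using H_bounded(1) by (simp add: H_affine_def)

lemma mfg_F_sum:
 assumes \<eta>: "\<eta> \<in> HN" and v: "v \<in> HA"
  and w: "\<And>j. j \<in> I ==> eb (w1 j)" "\<And>j. j \<in> I ==> eb (w2 j)"
 shows "F \<eta> v (\<lambda>x. \<Sum>j\<in>I. c j * w1 j x) (\<lambda>x. \<Sum>j\<in>I. c j * w2 j x)
  = (\<Sum>j\<in>I. c j * F \<eta> v (w1 j) (w2 j))"
proof -
 have e: "eb (opA \<eta> v)" "eb (opB \<eta> v)"
  using \<eta> v by (auto intro!: eb_opA eb_opB simp: H_affine_def H_nonneg_def)
 have "(LINT x|M. f x * (\<Sum>j\<in>I. c j * w j x)) = (\<Sum>j\<in>I. c j * (LINT x|M. f x * w j x))"
  if "eb f" "\<And>j. j \<in> I ==> eb (w j)" for f w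
 proof -
  have "(LINT x|M. f x * (\<Sum>j\<in>I. c j * w j x)) = (LINT x|M. (\<Sum>j\<in>I. c j * (f x * w j x)))"
   by (simp add: sum_distrib_left mult.left_commute)
  also have "\<dots> = (\<Sum>j\<in>I. \<integral>x. c j * (f x * w j x) \<partial>M)"
   using that by (intro Bochner_Integration.integral_sum ess_bounded_integrable[OF finite_M] ess_bounded_cmult ess_bounded_mult) auto
  finally show ?thesis by simp
 qed
 then show ?thesis unfolding mfg_F_eq using e w by (simp add: sum.distrib distrib_left)
qed

lemma mfg_F_scale:
 assumes "\<eta> \<in> HN" "v \<in> HA" "eb w1" "eb w2"
 shows "F \<eta> v (\<lambda>x. c * w1 x) (\<lambda>x. c * w2 x) = c * F \<eta> v w1 w2"
 using mfg_F_sum[OF assms(1,2), of "{()}" "\<lambda>_. w1" "\<lambda>_. w2" "\<lambda>_. c"] assms(3,4) by simp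

text \<open>The first inequality is the Minty inequality at the vertices and survives in the limit.
  The family in \<open>t\<close> serves the a priori estimate: there \<open>F\<close> is evaluated
  at the approximate solution itself and tested towards a prescribed vertex.\<close>

lemma finite_solution:
 assumes mono: "\<And>\<eta>1 v1 \<eta>2 v2. \<eta>1 \<in> HN ==> v1 \<in> HA ==>
   \<eta>2 \<in> HN ==> v2 \<in> HA ==>
   F \<eta>1 v1 (\<lambda>x. \<eta>1 x - \<eta>2 x) (\<lambda>x. v1 x - v2 x) - F \<eta>2 v2 (\<lambda>x. \<eta>1 x - \<eta>2 x) (\<lambda>x. v1 x - v2 x) \<ge> 0"
  and n: "(n :: nat) > 0" and \<eta>: "\<And>i. i < n ==> \<eta> i \<in> HN" and v: "\<And>i. i < n ==> v i \<in> HA"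
 shows "\<exists>m u. \<forall>i<n. F (\<eta> i) (v i) (\<lambda>x. \<eta> i x - m x) (\<lambda>x. v i x - u x) \<ge> 0 \<and>
   m \<in> HN \<and> u \<in> HA \<and>
   (\<forall>t. 0 < t \<longrightarrow> t \<le> 1 \<longrightarrow> (let m' = (\<lambda>x. (1 - t) * m x + t * \<eta> i x); u' = (\<lambda>x. (1 - t) * u x + t * v i x)
    in m' \<in> HN \<and> u' \<in> HA \<and>
     F m' u' (\<lambda>x. \<eta> i x - m' x) (\<lambda>x. v i x - u' x) \<ge> 0))"
proof -
 define cb where "cb = (\<lambda>l (f :: nat \<Rightarrow> 'a \<Rightarrow> real) x. \<Sum>i<n. l i * f i x)"
 have cb: "cb l \<eta> \<in> HN" "cb l v \<in> HA" if "l \<in> simplex_weights n" for l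
  unfolding cb_def using that \<eta> v
  by (auto intro!: H_nonneg_convex H_affine_convex open_dom bounded_dom simp: simplex_weights_def)
 have dist: "cb l f x - cb m f x = (\<Sum>j<n. m j * (cb l f x - f j x))" if "m \<in> simplex_weights n" for l m f x
 proof -
  have "(\<Sum>j<n. m j * (cb l f x - f j x)) = (\<Sum>j<n. m j) * cb l f x - (\<Sum>j<n. m j * f j x)"
   by (simp add: right_diff_distrib sum_subtractf sum_distrib_right)
  then show ?thesis using that by (simp add: simplex_weights_def) (simp add: cb_def)
 qed
 \<comment> \<open>The direction runs from the vertex \<open>j\<close> to the point with weights
   \<open>l\<close>. Averaging over \<open>j\<close> with weights \<open>m\<close> replaces the
   vertex by the point with weights \<open>m\<close>, because \<open>F\<close> is linear in the
   direction (\<open>bsum\<close>).\<close>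
 define b where "b = (\<lambda>l j. F (cb l \<eta>) (cb l v) (\<lambda>x. cb l \<eta> x - \<eta> j x) (\<lambda>x. cb l v x - v j x))"
 have bsum: "(\<Sum>j<n. m j * b l j) = F (cb l \<eta>) (cb l v) (\<lambda>x. cb l \<eta> x - cb m \<eta> x) (\<lambda>x. cb l v x - cb m v x)"
  if l: "l \<in> simplex_weights n" and m: "m \<in> simplex_weights n" for l m
  unfolding b_def dist[OF m] using \<eta> v cb[OF l]
  by (intro mfg_F_sum[symmetric] ess_bounded_diff) (auto intro: eb_H_nonneg eb_H_affine)
 have "\<exists>m\<in>simplex_weights n. \<forall>l\<in>simplex_weights n. (\<Sum>j<n. m j * b l j) \<ge> 0"
 proof (rule minty_simplex[OF n])
  fix l m assume l: "l \<in> simplex_weights n" and m: "m \<in> simplex_weights n"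
  have "F (cb m \<eta>) (cb m v) (\<lambda>x. (-1) * (cb l \<eta> x - cb m \<eta> x)) (\<lambda>x. (-1) * (cb l v x - cb m v x))
    = (-1) * F (cb m \<eta>) (cb m v) (\<lambda>x. cb l \<eta> x - cb m \<eta> x) (\<lambda>x. cb l v x - cb m v x)"
   using cb l m by (intro mfg_F_scale ess_bounded_diff eb_H_nonneg eb_H_affine)
  then show "(\<Sum>j<n. m j * b l j) + (\<Sum>j<n. l j * b m j) \<ge> 0"
   unfolding bsum[OF l m] bsum[OF m l] using mono[OF cb[OF l] cb[OF m]] by simp
 qed
 then obtain m where m: "m \<in> simplex_weights n" and
  minty: "\<And>l. l \<in> simplex_weights n ==> F (cb l \<eta>) (cb l v) (\<lambda>x. cb l \<eta> x - cb m \<eta> x) (\<lambda>x. cb l v x - cb m v x) \<ge> 0"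
  using bsum by metis
 show ?thesis
 proof (rule exI[of _ "cb m \<eta>"], rule exI[of _ "cb m v"], intro allI impI conjI cb[OF m])
  fix i assume i: "i < n"
  define e where "e = (\<lambda>j. if j = i then 1 else 0 :: real)"
  have e: "e \<in> simplex_weights n" unfolding e_def by (rule simplex_weights_unit[OF i])
  have cbe: "cb e f = f i" for f
   using i by (simp add: cb_def e_def fun_eq_iff if_distrib[where f="\<lambda>t. t * _"] cong: if_cong)
  show "F (\<eta> i) (v i) (\<lambda>x. \<eta> i x - cb m \<eta> x) (\<lambda>x. v i x - cb m v x) \<ge> 0"
   using minty[OF e] unfolding cbe .
  fix t :: real assume t: "0 < t" "t \<le> 1"
  define l where "l = (\<lambda>j. (1 - t) * m j + t * e j)"
  have l: "l \<in> simplex_weights n"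
   using m e t by (auto simp: l_def simplex_weights_def sum.distrib sum_distrib_left[symmetric])
  have cbl: "cb l f = (\<lambda>x. (1 - t) * cb m f x + t * f i x)" for f
  proof -
   have "cb l f x = (1 - t) * cb m f x + t * cb e f x" for x
    unfolding cb_def l_def by (simp add: distrib_right sum.distrib sum_distrib_left mult.assoc)
   then show ?thesis unfolding cbe by blast
  qed
  \<comment> \<open>The point with weights \<open>l\<close> lies between the Minty solution and the
    vertex, so the displacement to the vertex is a nonnegative multiple of the displacement from the
    solution. The sign of the Minty inequality is thus kept, without a limit
    \<open>t \<rightarrow> 0\<close>.\<close>
  have "f i x - cb l f x = ((1 - t) / t) * (cb l f x - cb m f x)" for f x
   unfolding cbl using t by (simp add: field_simps)
  then have "F (cb l \<eta>) (cb l v) (\<lambda>x. \<eta> i x - cb l \<eta> x) (\<lambda>x. v i x - cb l v x)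
   = ((1 - t) / t) * F (cb l \<eta>) (cb l v) (\<lambda>x. cb l \<eta> x - cb m \<eta> x) (\<lambda>x. cb l v x - cb m v x)"
   using cb[OF l] cb[OF m] by (simp only:) (intro mfg_F_scale ess_bounded_diff eb_H_nonneg eb_H_affine)
  also have "\<dots> \<ge> 0" using minty[OF l] t by simp
  finally show "let m' = (\<lambda>x. (1 - t) * cb m \<eta> x + t * \<eta> i x); u' = (\<lambda>x. (1 - t) * cb m v x + t * v i x)
   in m' \<in> HN \<and> u' \<in> HA \<and>
    F m' u' (\<lambda>x. \<eta> i x - m' x) (\<lambda>x. v i x - u' x) \<ge> 0"
   using cb[OF l] unfolding cbl Let_def by blast
 qed
qed

end

section \<open>The a priori estimate\<close>

lemma ext_integral_integrable:
 assumes "integrable M f" shows "ext_integral M f = ereal (LINT x|M. f x)"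
proof -
 have "(\<integral>\<^sup>+x. ennreal (f x) \<partial>M) < \<infinity>" "(\<integral>\<^sup>+x. ennreal (- f x) \<partial>M) < \<infinity>"
  using assms by (auto simp: real_integrable_def less_top)
 moreover have "enn2ereal a - enn2ereal b = ereal (enn2real a - enn2real b)" if "a < \<infinity>" "b < \<infinity>" for a b
  using that by (cases a; cases b) (auto simp: enn2ereal_ennreal)
 ultimately show ?thesis using assms by (simp add: ext_integral_def real_lebesgue_integral_def)
qed

context mfg_data
begin

lemma eb_gradient_powr:
 assumes "v \<in> HS" "p > 0" shows "eb (\<lambda>x. norm (grad v x) powr p)"
proof -
 obtain R where R: "R > 0" "AE x in M. norm (grad v x) \<le> R" using weak_gradient_bounded[OF assms(1)] by blast
 show ?thesis
 proof (rule ess_boundedI)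
  show "(\<lambda>x. norm (grad v x) powr p) \<in> borel_measurable M"
   using weak_gradient_measurable[OF assms(1)] by simp
  show "AE x in M. \<bar>norm (grad v x) powr p\<bar> \<le> R powr p"
   using R(2) by eventually_elim (use assms(2) in \<open>auto intro!: powr_mono2\<close>)
 qed
qed

text \<open>Here \<open>Hp\<close> is \<open>H\<close> at \<open>Dv\<close>, \<open>bp\<close> and
  \<open>bq\<close> are its gradient there paired with \<open>Dv\<close> and \<open>Dh\<close>,
  \<open>G\<close> is \<open>g(\<eta>)\<close>, and \<open>T\<close> is the power of
  \<open>\<bar>Dv\<bar>\<close>. Sorted by factors, \<open>\<eta>\<close> multiplies
  \<open>Hp - bp + bq\<close>, in which the two terms \<open>T / C1\<close> cancel; the remaining
  \<open>- Hp\<close> yields the gain \<open>- T / C2\<close>, and \<open>- \<eta> * G\<close> is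
  the gain in the density.\<close>

lemma reference_integrand_bound:
 fixes \<eta> a hx Vx \<phi>x G Hp bp bq T C1 C2 C4 N :: real
 assumes "\<eta> \<ge> 0" "- Hp + bp \<ge> T / C1 - C1" "Hp \<ge> T / C2 - C2" "bq \<le> T / C1 + C4"
  "\<bar>Vx\<bar> \<le> N" "\<bar>\<phi>x\<bar> \<le> N" "\<bar>hx\<bar> \<le> N"
 shows "(- a - Hp + G - Vx) * (1 - \<eta>) + ((\<eta> - \<phi>x) * (hx - a) + \<eta> * (bq - bp))
  \<le> - (\<eta> * G) - T / C2 + \<bar>G\<bar> + (C1 + C4 + 2 * N) * \<eta> + (N + 1) * \<bar>a\<bar> + (C2 + N + N * N)"
proof -
 have "(- a - Hp + G - Vx) * (1 - \<eta>) + ((\<eta> - \<phi>x) * (hx - a) + \<eta> * (bq - bp))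
  = \<eta> * (Hp - bp + bq) + \<eta> * (Vx + hx) - Hp - a + \<phi>x * a + G - \<eta> * G - Vx - \<phi>x * hx"
  by (simp add: algebra_simps)
 moreover have "\<eta> * (Hp - bp + bq) \<le> \<eta> * (C1 + C4)" using assms by (intro mult_left_mono) auto
 moreover have "\<eta> * (Vx + hx) \<le> \<eta> * (2 * N)" using assms by (intro mult_left_mono) auto
 moreover have "\<phi>x * a \<le> N * \<bar>a\<bar>"
  by (rule order_trans[OF abs_ge_self]) (use assms in \<open>auto simp: abs_mult intro!: mult_right_mono\<close>)
 moreover have "- (\<phi>x * hx) \<le> N * N"
  by (rule order_trans[OF abs_ge_minus_self]) (use assms in \<open>auto simp: abs_mult intro!: mult_mono\<close>)
 moreover have "- a \<le> \<bar>a\<bar>" "G \<le> \<bar>G\<bar>" "- Vx \<le> N" using assms by auto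
 moreover have "(C1 + C4 + 2 * N) * \<eta> = \<eta> * (C1 + C4) + \<eta> * (2 * N)" "(N + 1) * \<bar>a\<bar> = N * \<bar>a\<bar> + \<bar>a\<bar>"
  by (simp_all add: algebra_simps)
 ultimately show ?thesis using assms(3) by linarith
qed

text \<open>Poincare's inequality holds for \<open>v - h\<close>, and \<open>abs_le_powr\<close>
  converts the power into an \<open>L1\<close> norm with an arbitrarily small factor, at the price
  of a constant.\<close>

lemma affine_L1_bound:
 assumes p: "p > 1" and "eps > 0"
 shows "\<exists>c\<ge>0. \<forall>v\<in>HA. (LINT x|M. \<bar>v x\<bar>) \<le> eps * (LINT x|M. norm (grad v x) powr p) + c"
proof -
 interpret finite_measure M by (rule finite_M)
 note ebi = ess_bounded_integrable[OF finite_M]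
 obtain i :: 'a where i: "i \<in> Basis" using nonempty_Basis by blast
 obtain C where C: "C > 0" "\<And>w. w \<in> H0 ==>
   (LINT x|M. \<bar>w x\<bar> powr p) \<le> C * (LINT x|M. \<bar>pd i w x\<bar> powr p)"
  using poincare_H0[OF open_dom bounded_dom cone order1 p i] by blast
 have hH: "h \<in> HS" by (rule smooth_on_closure_H_space(1)[OF h open_dom bounded_dom])
 obtain N where N: "N > 0" "AE x in M. \<bar>h x\<bar> \<le> N" by (rule ess_boundedE[OF eb_smooth[OF h]])
 obtain R where R: "R > 0" "AE x in M. norm (grad h x) \<le> R" using weak_gradient_bounded[OF hH] by blast
 define c2 where "c2 = C * 2 powr p"
 have c2: "c2 > 0" using C by (simp add: c2_def)
 \<comment> \<open>Solves \<open>d powr (1 - p) = eps / c2\<close>, which turns the factor in front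
   of the gradient term into \<open>eps\<close>.\<close>
 define d where "d = (eps / c2) powr (1 / (1 - p))"
 have d: "d > 0" "d powr (1 - p) = eps / c2" using c2 `eps > 0` p by (simp_all add: d_def powr_powr)
 define \<mu> where "\<mu> = measure M (space M)"
 define c where "c = (N + d) * \<mu> + eps * (R powr p * \<mu>)"
 have c: "c \<ge> 0" using N d `eps > 0` by (simp add: c_def \<mu>_def)
 have "(LINT x|M. \<bar>v x\<bar>) \<le> eps * (LINT x|M. norm (grad v x) powr p) + c" if v: "v \<in> HA" for v
 proof -
  have vH: "v \<in> HS" using v by (simp add: H_affine_def)
  define w where "w = (\<lambda>x. v x - h x)"
  have w: "w \<in> H0" using v by (simp add: w_def H_affine_def)
  have ew: "integrable M (\<lambda>x. \<bar>w x\<bar> powr p)" "integrable M (\<lambda>x. \<bar>pd i w x\<bar> powr p)"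
   using p H_bounded[OF H0_spaceD[OF w]] i ess_bounded_Lp[OF finite_M, of p] by (auto simp: Lp_space_def)
  have eD: "eb (\<lambda>x. norm (grad v x) powr p)" using p by (intro eb_gradient_powr vH) simp
  have "(LINT x|M. \<bar>pd i w x\<bar> powr p) \<le> (LINT x|M. 2 powr p * (norm (grad v x) powr p + R powr p))"
  proof (rule integral_mono_AE[OF ew(2)])
   show "integrable M (\<lambda>x. 2 powr p * (norm (grad v x) powr p + R powr p))" using ebi[OF eD] by auto
   show "AE x in M. \<bar>pd i w x\<bar> powr p \<le> 2 powr p * (norm (grad v x) powr p + R powr p)"
    using weak_gradient_combination[OF vH hH, of 1 "-1"] R(2)
   proof eventually_elim
    case (elim x)
    have "\<bar>pd i w x\<bar> = \<bar>grad w x \<bullet> i\<bar>" by (simp add: weak_gradient_inner[OF i])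
    also have "\<dots> \<le> norm (grad w x)" by (rule Basis_le_norm[OF i])
    also have "\<dots> = norm (grad v x - grad h x)" using elim(1) by (simp add: w_def)
    also have "\<dots> \<le> norm (grad v x) + R" using elim(2) norm_triangle_ineq4[of "grad v x" "grad h x"] by linarith
    finally have "\<bar>pd i w x\<bar> powr p \<le> \<bar>norm (grad v x) + R\<bar> powr p"
     using p R by (intro powr_mono2) auto
    also have "\<dots> \<le> 2 powr p * (norm (grad v x) powr p + R powr p)"
     using powr_add_le[of p "norm (grad v x)" R] p R by simp
    finally show ?case .
   qed
  qed
  also have "\<dots> = 2 powr p * ((LINT x|M. norm (grad v x) powr p) + R powr p * \<mu>)"
   using ebi[OF eD] by (simp add: \<mu>_def mult.commute)
  finally have D: "(LINT x|M. \<bar>pd i w x\<bar> powr p) \<le> 2 powr p * ((LINT x|M. norm (grad v x) powr p) + R powr p * \<mu>)" .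
  have "(LINT x|M. \<bar>w x\<bar> powr p) \<le> C * (LINT x|M. \<bar>pd i w x\<bar> powr p)" by (rule C(2)[OF w])
  also have "\<dots> \<le> C * (2 powr p * ((LINT x|M. norm (grad v x) powr p) + R powr p * \<mu>))"
   using C(1) D by (intro mult_left_mono) auto
  also have "\<dots> = c2 * ((LINT x|M. norm (grad v x) powr p) + R powr p * \<mu>)"
   by (simp add: c2_def mult.assoc)
  finally have P: "(LINT x|M. \<bar>w x\<bar> powr p) \<le> c2 * ((LINT x|M. norm (grad v x) powr p) + R powr p * \<mu>)" .
  have "(LINT x|M. \<bar>v x\<bar>) \<le> (LINT x|M. (N + d) + eps / c2 * \<bar>w x\<bar> powr p)"
  proof (rule integral_mono_AE)
   show "integrable M (\<lambda>x. \<bar>v x\<bar>)" using ebi[OF H_bounded(1)[OF vH]] by auto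
   show "integrable M (\<lambda>x. (N + d) + eps / c2 * \<bar>w x\<bar> powr p)" using ew(1) by auto
   show "AE x in M. \<bar>v x\<bar> \<le> (N + d) + eps / c2 * \<bar>w x\<bar> powr p"
    using N(2)
   proof eventually_elim
    case (elim x)
    have "\<bar>v x\<bar> \<le> \<bar>h x\<bar> + \<bar>w x\<bar>" by (simp add: w_def)
    also have "\<bar>w x\<bar> \<le> d + eps / c2 * \<bar>w x\<bar> powr p" using abs_le_powr[OF p d(1), of "w x"] d(2) by simp
    finally show ?case using elim by linarith
   qed
  qed
  also have "\<dots> = (N + d) * \<mu> + eps / c2 * (LINT x|M. \<bar>w x\<bar> powr p)" using ew(1) by (simp add: \<mu>_def)
  also have "\<dots> \<le> (N + d) * \<mu> + eps / c2 * (c2 * ((LINT x|M. norm (grad v x) powr p) + R powr p * \<mu>))"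
   using P `eps > 0` c2 by (intro add_left_mono mult_left_mono) auto
  also have "\<dots> = eps * (LINT x|M. norm (grad v x) powr p) + c"
   using c2 by (simp add: c_def distrib_left)
  finally show ?thesis .
 qed
 then show ?thesis using c by blast
qed

lemma one_H_nonneg: "(\<lambda>x. 1) \<in> HN"
 unfolding H_nonneg_def using smooth_on_closure_H_space(1)[OF smooth_on_closure_const[OF open_dom] open_dom bounded_dom] by simp

lemma h_H_affine: "h \<in> HA"
 unfolding H_affine_def
 using smooth_on_closure_H_space(1)[OF h open_dom bounded_dom] H0_space_zero[OF open_dom bounded_dom] by simp

lemma reference_inequality:
 assumes p: "\<gamma> > 1"
  and A1: "C1 > 0" "\<And>x q. x \<in> S ==> - H x q + gradient (H x) q \<bullet> q \<ge> 1 / C1 * norm q powr \<gamma> - C1"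
  and A2: "C2 > 0" "\<And>x q. x \<in> S ==> H x q \<ge> 1 / C2 * norm q powr \<gamma> - C2"
  and A3: "C3 > 0" "\<And>x q. x \<in> S ==> norm (gradient (H x) q) \<le> C3 * norm q powr (\<gamma> - 1) + C3"
 shows "\<exists>c1\<ge>0. \<exists>c0\<ge>0. \<forall>\<eta>\<in>HN. \<forall>v\<in>HA.
   F \<eta> v (\<lambda>x. 1 - \<eta> x) (\<lambda>x. h x - v x) \<ge> 0 \<longrightarrow>
   (LINT x|M. \<eta> x * g (\<eta> x)) + 1 / (2 * C2) * (LINT x|M. norm (grad v x) powr \<gamma>)
    \<le> (LINT x|M. \<bar>g (\<eta> x)\<bar>) + c1 * (LINT x|M. \<eta> x) + c0"
proof -
 interpret finite_measure M by (rule finite_M)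
 note ebi = ess_bounded_integrable[OF finite_M]
 have hH: "h \<in> HS" by (rule smooth_on_closure_H_space(1)[OF h open_dom bounded_dom])
 obtain NV where NV: "NV > 0" "AE x in M. \<bar>V x\<bar> \<le> NV" by (rule ess_boundedE[OF eb_smooth[OF V]])
 obtain NF where NF: "NF > 0" "AE x in M. \<bar>\<phi> x\<bar> \<le> NF" by (rule ess_boundedE[OF eb_smooth[OF \<phi>]])
 obtain NH where NH: "NH > 0" "AE x in M. \<bar>h x\<bar> \<le> NH" by (rule ess_boundedE[OF eb_smooth[OF h]])
 obtain R where R: "R > 0" "AE x in M. norm (grad h x) \<le> R" using weak_gradient_bounded[OF hH] by blast
 define N where "N = NV + NF + NH"
 have N: "N > 0" using NV NF NH by (simp add: N_def)
 \<comment> \<open>With this parameter Young's inequality bounds the pairing of the flux with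
   \<open>Dh\<close> by exactly the multiple of \<open>\<bar>Dv\<bar>\<close> to the power
   \<open>\<gamma>\<close> that \<open>A1\<close> cancels.\<close>
 define e where "e = 1 / (C1 * C3 * R)"
 have e: "e > 0" "R * C3 * e = 1 / C1" using A1 A3 R by (auto simp: e_def)
 define C4 where "C4 = R * C3 * (e powr (1 - \<gamma>) + 1)"
 have C4: "C4 \<ge> 0" using R A3 by (simp add: C4_def)
 have bq: "gradient (H x) q \<bullet> d \<le> norm q powr \<gamma> / C1 + C4" if "x \<in> S" "norm d \<le> R" for x q d
 proof -
  have "gradient (H x) q \<bullet> d \<le> norm (gradient (H x) q) * norm d" by (rule norm_cauchy_schwarz)
  also have "\<dots> \<le> (C3 * norm q powr (\<gamma> - 1) + C3) * R" using A3 that R by (intro mult_mono) auto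
  also have "\<dots> = R * C3 * (norm q powr (\<gamma> - 1) * 1 + 1)" by (simp add: algebra_simps)
  also have "\<dots> \<le> R * C3 * ((e * norm q powr \<gamma> + e powr (1 - \<gamma>) * 1 powr \<gamma>) + 1)"
   using R A3 by (intro mult_left_mono add_right_mono powr_young p e) auto
  also have "\<dots> = (R * C3 * e) * norm q powr \<gamma> + C4" by (simp add: C4_def algebra_simps)
  finally show ?thesis by (simp add: e(2))
 qed
 \<comment> \<open>Tuned so that the term \<open>(N + 1) * \<bar>v x\<bar>\<close> consumes half of
   the coercive gradient term, leaving \<open>1 / (2 * C2)\<close>.\<close>
 define r where "r = 1 / (2 * C2) / (N + 1)"
 have r: "r > 0" "(N + 1) * r = 1 / (2 * C2)" using A2 N by (simp_all add: r_def)
 from affine_L1_bound[OF p r(1)] obtain cv where cv: "cv \<ge> 0" "\<And>v. v\<in>HA ==>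
  (LINT x|M. \<bar>v x\<bar>) \<le> r * (LINT x|M. norm (grad v x) powr \<gamma>) + cv" by blast
 define \<mu> where "\<mu> = measure M (space M)"
 define c1 where "c1 = C1 + C4 + 2 * N"
 define c0 where "c0 = (N + 1) * cv + (C2 + N + N * N) * \<mu>"
 have "(LINT x|M. \<eta> x * g (\<eta> x)) + 1 / (2 * C2) * (LINT x|M. norm (grad v x) powr \<gamma>)
    \<le> (LINT x|M. \<bar>g (\<eta> x)\<bar>) + c1 * (LINT x|M. \<eta> x) + c0"
  if \<eta>: "\<eta> \<in> HN" and v: "v \<in> HA"
   and pos: "F \<eta> v (\<lambda>x. 1 - \<eta> x) (\<lambda>x. h x - v x) \<ge> 0" for \<eta> v
 proof -
  have vH: "v \<in> HS" using v by (simp add: H_affine_def)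
  have \<eta>H: "\<eta> \<in> HS" "AE x in M. \<eta> x \<ge> 0" using \<eta> by (auto simp: H_nonneg_def)
  define w where "w = (\<lambda>x. h x - v x)"
  have w: "w \<in> H0" unfolding w_def by (rule H_affine_diff_H0[OF open_dom bounded_dom h_H_affine v])
  have e1: "eb (\<lambda>x. opA \<eta> v x * (1 - \<eta> x))"
   by (intro ess_bounded_mult ess_bounded_diff ess_bounded_const eb_opA eb_H_nonneg \<eta> vH)
  have e2: "eb (\<lambda>x. (\<eta> x - \<phi> x) * w x + \<eta> x * (flux v x \<bullet> grad w x))"
   by (intro ess_bounded_add opB_by_parts(2) ess_bounded_mult ess_bounded_diff
     H_bounded(1) eb_smooth[OF \<phi>] \<eta>H vH H0_spaceD w)
  have eG: "eb (\<lambda>x. \<eta> x * g (\<eta> x))" "eb (\<lambda>x. g (\<eta> x))"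
   by (intro ess_bounded_mult eb_H_nonneg g_compose_bounded \<eta>)+
  have eD: "eb (\<lambda>x. norm (grad v x) powr \<gamma>)" using p by (intro eb_gradient_powr vH) simp
  note ints = ebi[OF e1] ebi[OF e2] ebi[OF eG(1)] ebi[OF eG(2)] ebi[OF eD] ebi[OF H_bounded(1)[OF vH]] ebi[OF eb_H_nonneg[OF \<eta>]]
  let ?rhs = "\<lambda>x. - (\<eta> x * g (\<eta> x)) - 1 / C2 * norm (grad v x) powr \<gamma> + \<bar>g (\<eta> x)\<bar> + c1 * \<eta> x + (N + 1) * \<bar>v x\<bar> + (C2 + N + N * N)"
  have "0 \<le> F \<eta> v (\<lambda>x. 1 - \<eta> x) w" using pos by (simp add: w_def)
  also have "\<dots> = (LINT x|M. opA \<eta> v x * (1 - \<eta> x) + ((\<eta> x - \<phi> x) * w x + \<eta> x * (flux v x \<bullet> grad w x)))"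
   unfolding mfg_F_eq opB_by_parts(1)[OF \<eta>H(1) vH w] by (rule Bochner_Integration.integral_add[OF ints(1,2), symmetric])
  also have "\<dots> \<le> (LINT x|M. ?rhs x)"
  proof (rule integral_mono_AE)
   show "integrable M (\<lambda>x. opA \<eta> v x * (1 - \<eta> x) + ((\<eta> x - \<phi> x) * w x + \<eta> x * (flux v x \<bullet> grad w x)))"
    by (rule Bochner_Integration.integrable_add[OF ints(1,2)])
   show "integrable M ?rhs" using ints by auto
   show "AE x in M. opA \<eta> v x * (1 - \<eta> x) + ((\<eta> x - \<phi> x) * w x + \<eta> x * (flux v x \<bullet> grad w x)) \<le> ?rhs x"
    using NV(2) NF(2) NH(2) R(2) \<eta>H(2) AE_dom weak_gradient_combination[OF hH vH, of 1 "-1"]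
   proof eventually_elim
    case (elim x)
    have wg: "grad w x = grad h x - grad v x" using elim(7) by (simp add: w_def)
    have b: "\<bar>V x\<bar> \<le> N" "\<bar>\<phi> x\<bar> \<le> N" "\<bar>h x\<bar> \<le> N" using elim NV NF NH by (auto simp: N_def)
    have b': "- H x (grad v x) + flux v x \<bullet> grad v x \<ge> norm (grad v x) powr \<gamma> / C1 - C1"
     "H x (grad v x) \<ge> norm (grad v x) powr \<gamma> / C2 - C2"
     "flux v x \<bullet> grad h x \<le> norm (grad v x) powr \<gamma> / C1 + C4"
     using A1(2)[OF elim(6)] A2(2)[OF elim(6)] bq[OF elim(6,4)] by (auto simp: flux_def)
    from reference_integrand_bound[OF elim(5) b' b, of "v x" "g (\<eta> x)"]
    show ?case unfolding opA_def wg c1_def by (simp add: w_def inner_diff_right)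
   qed
  qed
  also have "\<dots> = - (LINT x|M. \<eta> x * g (\<eta> x)) - 1 / C2 * (LINT x|M. norm (grad v x) powr \<gamma>)
   + (LINT x|M. \<bar>g (\<eta> x)\<bar>) + c1 * (LINT x|M. \<eta> x) + (N + 1) * (LINT x|M. \<bar>v x\<bar>) + (C2 + N + N * N) * \<mu>"
   using ints by (simp add: \<mu>_def)
  also have "(N + 1) * (LINT x|M. \<bar>v x\<bar>) \<le> (N + 1) * (r * (LINT x|M. norm (grad v x) powr \<gamma>) + cv)"
   using N cv(2)[OF v] by (intro mult_left_mono) auto
  also have "\<dots> = 1 / (2 * C2) * (LINT x|M. norm (grad v x) powr \<gamma>) + (N + 1) * cv"
   unfolding distrib_left mult.assoc[symmetric] r(2) ..
  finally show ?thesis by (simp add: c0_def)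
 qed
 moreover have "c1 \<ge> 0" using A1 C4 N by (simp add: c1_def)
 moreover have "c0 \<ge> 0" using N cv A2 by (simp add: c0_def \<mu>_def)
 ultimately show ?thesis by blast
qed

end

section \<open>Limits in \<open>L\<^sup>1\<close> and in Sobolev spaces\<close>

text \<open>As \<open>m\<close> is merely integrable, smallness of \<open>f\<close> in
  \<open>L1\<close> does not control the pairing without a common bound \<open>N\<close>. Where
  \<open>m\<close> is below a cut the smallness of \<open>f\<close> counts; above the cut the bound
  \<open>N\<close> multiplies a small tail of \<open>m\<close>.\<close>

lemma small_L1_pairing:
 fixes m :: "'a \<Rightarrow> real"
 assumes m: "integrable M m" and "e > 0" "N \<ge> 0"
 shows "\<exists>d>0. \<forall>f. integrable M f \<longrightarrow> (AE x in M. \<bar>f x\<bar> \<le> N) \<longrightarrow> (LINT x|M. \<bar>f x\<bar>) < d \<longrightarrow> \<bar>\<integral>x. f x * m x \<partial>M\<bar> < e"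
proof -
 note [measurable] = borel_measurable_integrable[OF m]
 define tail where "tail = (\<lambda>(n::nat) x. if \<bar>m x\<bar> > real n then \<bar>m x\<bar> else 0)"
 have tm[measurable]: "tail n \<in> borel_measurable M" for n unfolding tail_def by measurable
 have ti: "integrable M (tail n)" for n
  by (rule integrable_of_AE_bound(1)[OF tm, of "\<lambda>x. \<bar>m x\<bar>"]) (use m in \<open>auto simp: tail_def\<close>)
 have "(\<lambda>n. \<integral>x. tail n x \<partial>M) \<longlonglongrightarrow> (LINT x|M. 0)"
 proof (rule integral_dominated_convergence[where w="\<lambda>x. \<bar>m x\<bar>"])
  have "(\<lambda>n. tail n x) \<longlonglongrightarrow> 0" for x
  proof (rule tendsto_eventually)
   obtain n0 where "\<bar>m x\<bar> < real n0" using reals_Archimedean2 by blast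
   then show "\<forall>\<^sub>F n in sequentially. tail n x = 0"
    by (intro eventually_sequentiallyI[of n0]) (auto simp: tail_def)
  qed
  then show "AE x in M. (\<lambda>n. tail n x) \<longlonglongrightarrow> 0" by simp
 qed (use m in \<open>auto simp: tail_def\<close>)
 then have "(\<lambda>n. \<integral>x. tail n x \<partial>M) \<longlonglongrightarrow> 0" by simp
 define q where "q = e / 2 / (N + 1)"
 have q: "q > 0" "(N + 1) * q = e / 2" using assms unfolding q_def by (simp_all del: divide_divide_eq_left)
 note `(\<lambda>n. \<integral>x. tail n x \<partial>M) \<longlonglongrightarrow> 0`
 moreover note q(1)
 ultimately have "\<forall>\<^sub>F n in sequentially. (LINT x|M. tail n x) < q" by (rule order_tendstoD(2))
 then obtain n where n: "(LINT x|M. tail n x) < q" by (auto simp: eventually_sequentially)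
 define d where "d = e / 2 / (real n + 1)"
 have d: "d > 0" "(real n + 1) * d = e / 2" using `e > 0` unfolding d_def by (simp_all del: divide_divide_eq_left)
 have "\<bar>\<integral>x. f x * m x \<partial>M\<bar> < e" if f: "integrable M f" "AE x in M. \<bar>f x\<bar> \<le> N" "(LINT x|M. \<bar>f x\<bar>) < d" for f
 proof -
  note [measurable] = borel_measurable_integrable[OF f(1)]
  have "\<bar>\<integral>x. f x * m x \<partial>M\<bar> \<le> (LINT x|M. (real n + 1) * \<bar>f x\<bar> + (N + 1) * tail n x)"
  proof (rule integrable_of_AE_bound(2))
   show "integrable M (\<lambda>x. (real n + 1) * \<bar>f x\<bar> + (N + 1) * tail n x)" using f(1) ti by auto
   show "AE x in M. \<bar>f x * m x\<bar> \<le> (real n + 1) * \<bar>f x\<bar> + (N + 1) * tail n x"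
    using f(2)
   proof eventually_elim
    case (elim x)
    show ?case
    proof (cases "\<bar>m x\<bar> > real n")
     case True
     have "\<bar>f x * m x\<bar> \<le> (N + 1) * \<bar>m x\<bar>" unfolding abs_mult using elim by (intro mult_right_mono) auto
     moreover have "(N + 1) * tail n x = (N + 1) * \<bar>m x\<bar>" using True by (simp add: tail_def)
     moreover have "(real n + 1) * \<bar>f x\<bar> \<ge> 0" by simp
     ultimately show ?thesis by linarith
    next
     case False
     have "\<bar>f x * m x\<bar> \<le> \<bar>f x\<bar> * (real n + 1)" unfolding abs_mult using False by (intro mult_left_mono) auto
     then show ?thesis using False by (simp add: tail_def mult.commute)
    qed
   qed
  qed measurable
  also have "\<dots> = (real n + 1) * (LINT x|M. \<bar>f x\<bar>) + (N + 1) * (LINT x|M. tail n x)" using f(1) ti by simp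
  also have "\<dots> < (real n + 1) * d + (N + 1) * q"
   using n f(3) `N \<ge> 0` by (intro add_strict_mono mult_strict_left_mono) auto
  also have "\<dots> = e" using d(2) q(2) by simp
  finally show ?thesis .
 qed
 then show ?thesis using d(1) by blast
qed

section \<open>Pairings with essentially bounded functions\<close>

lemma bounded_functional_pairing:
 assumes f: "ess_bounded M f"
 shows "bounded_functional_L1 M (\<lambda>m. \<integral>x. f x * m x \<partial>M)"
 unfolding bounded_functional_L1_def L1_space_def
proof (intro conjI ballI allI)
 obtain C where C: "C > 0" "AE x in M. \<bar>f x\<bar> \<le> C" by (rule ess_boundedE[OF f])
 note i = ess_bounded_mult_integrable[OF f]
 show "(LINT x|M. f x * (u x + v x)) = (LINT x|M. f x * u x) + (LINT x|M. f x * v x)"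
  if "u \<in> {f. integrable M f}" "v \<in> {f. integrable M f}" for u v
  using that i by (simp add: distrib_left)
 show "(LINT x|M. f x * (c * u x)) = c * (LINT x|M. f x * u x)" for c u by (simp add: mult.left_commute)
 have "\<bar>\<integral>x. f x * u x \<partial>M\<bar> \<le> C * (LINT x|M. \<bar>u x\<bar>)" if "integrable M u" for u
 proof -
  have "AE x in M. \<bar>f x * u x\<bar> \<le> C * \<bar>u x\<bar>" using C(2) by eventually_elim (auto simp: abs_mult intro: mult_right_mono)
  from integrable_of_AE_bound(2)[OF borel_measurable_integrable[OF i[OF that]] _ this] that show ?thesis by simp
 qed
 then show "\<exists>C. \<forall>u\<in>{f. integrable M f}. \<bar>\<integral>x. f x * u x \<partial>M\<bar> \<le> C * (LINT x|M. \<bar>u x\<bar>)" by auto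
qed

lemma weakly_converges_pairing:
 assumes "weakly_converges_L1 M m m0" "ess_bounded M f"
 shows "(\<lambda>j. \<integral>x. f x * m j x \<partial>M) \<longlonglongrightarrow> (LINT x|M. f x * m0 x)"
 using assms bounded_functional_pairing[OF assms(2)] unfolding weakly_converges_L1_def by blast

text \<open>Pairing with the indicator of the set where the limit is negative gives a limit of
  nonnegative numbers that is also nonpositive.\<close>

lemma weakly_converges_nonneg:
 assumes w: "weakly_converges_L1 M m m0" and pos: "\<And>j. AE x in M. m j x \<ge> 0"
 shows "AE x in M. m0 x \<ge> 0"
proof -
 have m0: "integrable M m0" using w by (simp add: weakly_converges_L1_def L1_space_def)
 note [measurable] = borel_measurable_integrable[OF m0]
 define f where "f = (\<lambda>x. if m0 x < 0 then 1 else 0 :: real)"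
 have f: "ess_bounded M f" by (rule ess_boundedI[of _ _ 1]) (auto simp: f_def)
 have "(LINT x|M. f x * m0 x) \<ge> 0"
 proof (rule LIMSEQ_le_const[OF weakly_converges_pairing[OF w f]])
  have "(LINT x|M. f x * m j x) \<ge> 0" for j
   using pos[of j] by (intro integral_nonneg_AE) (auto simp: f_def elim!: eventually_mono)
  then show "\<exists>N. \<forall>n\<ge>N. 0 \<le> (LINT x|M. f x * m n x)" by blast
 qed
 moreover have i: "integrable M (\<lambda>x. - (f x * m0 x))" using ess_bounded_mult_integrable[OF f m0] by simp
 moreover have nn: "- (f x * m0 x) \<ge> 0" for x by (simp add: f_def)
 moreover have "(LINT x|M. - (f x * m0 x)) \<ge> 0" by (rule integral_nonneg_AE) (use nn in simp)
 ultimately have "(LINT x|M. - (f x * m0 x)) = 0" by simp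
 then have "AE x in M. - (f x * m0 x) = 0" using integral_nonneg_eq_0_iff_AE[OF i] nn by simp
 then show ?thesis by eventually_elim (auto simp: f_def split: if_splits)
qed

lemma Lp_tendsto_pairing:
 assumes M: "finite_measure M" and p: "p > 1" and f: "\<And>n. f n \<in> Lp_space p M" "f0 \<in> Lp_space p M"
  and lim: "(\<lambda>n. \<integral>x. \<bar>f n x - f0 x\<bar> powr p \<partial>M) \<longlonglongrightarrow> 0" and B: "ess_bounded M B"
 shows "(\<lambda>n. \<integral>x. B x * f n x \<partial>M) \<longlonglongrightarrow> (LINT x|M. B x * f0 x)"
proof (rule LIMSEQ_I)
 fix e :: real assume "e > 0"
 obtain C where C: "C > 0" "AE x in M. \<bar>B x\<bar> \<le> C" by (rule ess_boundedE[OF B])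
 have p0: "p > 0" using p by simp
 have "e / C > 0" using C `e > 0` by simp
 from Lp_small_imp_L1_small[OF M p this] obtain \<eta> where \<eta>: "\<eta> > 0"
  "\<And>g. g \<in> Lp_space p M ==> (LINT x|M. \<bar>g x\<bar> powr p) < \<eta> ==> (LINT x|M. \<bar>g x\<bar>) < e / C" by blast
 from order_tendstoD(2)[OF lim \<eta>(1)] obtain N where N: "\<And>n. n \<ge> N ==> (LINT x|M. \<bar>f n x - f0 x\<bar> powr p) < \<eta>"
  by (auto simp: eventually_sequentially)
 have "norm ((LINT x|M. B x * f n x) - (LINT x|M. B x * f0 x)) < e" if "n \<ge> N" for n
 proof -
  have d: "(\<lambda>x. f n x - f0 x) \<in> Lp_space p M" by (rule Lp_space_diff[OF p0 f])
  note i = Lp_space_L1(1)[OF M p zero_less_one]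
  have iB: "integrable M (\<lambda>x. B x * f n x)" "integrable M (\<lambda>x. B x * f0 x)" "integrable M (\<lambda>x. B x * (f n x - f0 x))"
   using ess_bounded_mult_integrable[OF B i] f d by blast+
  have "AE x in M. \<bar>B x * (f n x - f0 x)\<bar> \<le> C * \<bar>f n x - f0 x\<bar>"
   using C(2) by eventually_elim (auto simp: abs_mult intro: mult_right_mono)
  then have "\<bar>\<integral>x. B x * (f n x - f0 x) \<partial>M\<bar> \<le> (LINT x|M. C * \<bar>f n x - f0 x\<bar>)"
   using i[OF d] iB by (intro integrable_of_AE_bound(2)) auto
  also have "\<dots> = C * (LINT x|M. \<bar>f n x - f0 x\<bar>)" by simp
  also have "\<dots> < C * (e / C)" using \<eta>(2)[OF d N[OF that]] C by (intro mult_strict_left_mono) auto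
  also have "\<dots> = e" using C by simp
  also have "(LINT x|M. B x * (f n x - f0 x)) = (LINT x|M. B x * f n x) - (LINT x|M. B x * f0 x)"
   using iB by (simp add: right_diff_distrib)
  finally show ?thesis by simp
 qed
 then show "\<exists>no. \<forall>n\<ge>no. norm ((LINT x|M. B x * f n x) - (LINT x|M. B x * f0 x)) < e" by blast
qed

lemma is_weak_deriv_limit:
 assumes S: "open S" "bounded S" and p: "p > 1" and a: "a \<in> multi_indices"
  and d: "\<And>n. is_weak_deriv S a (f n) (f' n)"
  and f: "\<And>n. f n \<in> Lp_space p (lebesgue_on S)" "f0 \<in> Lp_space p (lebesgue_on S)" "(\<lambda>n. \<integral>x. \<bar>f n x - f0 x\<bar> powr p \<partial>lebesgue_on S) \<longlonglongrightarrow> 0"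
  and f': "\<And>n. f' n \<in> Lp_space p (lebesgue_on S)" "f0' \<in> Lp_space p (lebesgue_on S)" "(\<lambda>n. \<integral>x. \<bar>f' n x - f0' x\<bar> powr p \<partial>lebesgue_on S) \<longlonglongrightarrow> 0"
 shows "is_weak_deriv S a f0 f0'"
 unfolding is_weak_deriv_def
proof (intro conjI allI impI)
 note fin = bounded_open_finite_measure[OF S]
 show "locally_integrable S f0" "locally_integrable S f0'"
  using locally_integrable_of_integrable[OF S(1)] Lp_space_L1(1)[OF fin p zero_less_one] f f' by blast+
 fix \<psi> assume \<psi>: "test_function S \<psi>"
 have "(\<lambda>n. \<integral>x. iter_partial a \<psi> x * f n x \<partial>lebesgue_on S) \<longlonglongrightarrow> (LINT x|lebesgue_on S. iter_partial a \<psi> x * f0 x)"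
  by (rule Lp_tendsto_pairing[OF fin p f ess_bounded_test_function[OF test_function_iter_partial[OF \<psi> a] S(1)]])
 moreover have "(\<lambda>n. (- 1) ^ length a * (LINT x|lebesgue_on S. \<psi> x * f' n x)) \<longlonglongrightarrow> (- 1) ^ length a * (LINT x|lebesgue_on S. \<psi> x * f0' x)"
  by (intro tendsto_intros Lp_tendsto_pairing[OF fin p f' ess_bounded_test_function[OF \<psi> S(1)]])
 moreover have "(LINT x|lebesgue_on S. iter_partial a \<psi> x * f n x) = (- 1) ^ length a * (LINT x|lebesgue_on S. \<psi> x * f' n x)" for n
  using d[of n] \<psi> by (simp add: is_weak_deriv_def mult.commute)
 ultimately have "(LINT x|lebesgue_on S. iter_partial a \<psi> x * f0 x) = (- 1) ^ length a * (LINT x|lebesgue_on S. \<psi> x * f0' x)"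
  by (simp add: LIMSEQ_unique)
 then show "(LINT x|lebesgue_on S. f0 x * iter_partial a \<psi> x) = (- 1) ^ length a * (LINT x|lebesgue_on S. f0' x * \<psi> x)"
  by (simp add: mult.commute)
qed

section \<open>Minimising sequences of the gradient energy\<close>

context mfg_data
begin

text \<open>A sum over coordinates instead of the norm of the gradient, so that the scalar uniform
  convexity inequality can be integrated for each coordinate separately.\<close>

definition gradient_energy :: "real \<Rightarrow> ('a \<Rightarrow> real) \<Rightarrow> real" where
 "gradient_energy p u = (\<Sum>i\<in>Basis. \<integral>x. \<bar>pd i u x\<bar> powr p \<partial>M)"

lemma gradient_energy_nonneg: "gradient_energy p u \<ge> 0"
 unfolding gradient_energy_def by (intro sum_nonneg integral_nonneg) auto

lemma weak_deriv_Lp: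
 assumes "u \<in> HS" "i \<in> Basis" "p > 0"
 shows "pd i u \<in> Lp_space p M" "integrable M (\<lambda>x. \<bar>pd i u x\<bar> powr p)"
 using ess_bounded_Lp[OF finite_M assms(3) H_bounded(2)[OF assms(1,2)]] by (auto simp: Lp_space_def)

lemma weak_deriv_combination:
 assumes "v \<in> HS" "u \<in> HS" "i \<in> Basis"
 shows "AE x in M. pd i (\<lambda>x. a * v x + b * u x) x = a * pd i v x + b * pd i u x"
 using weak_gradient_combination[OF assms(1,2), of a b]
 by eventually_elim (simp add: inner_add_left flip: weak_gradient_inner[OF assms(3)])

lemma integral_weak_deriv_combination:
 assumes "v \<in> HS" "u \<in> HS" "i \<in> Basis" "p > 0"
 shows "(LINT x|M. \<bar>pd i (\<lambda>x. a * v x + b * u x) x\<bar> powr p)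
  = (LINT x|M. \<bar>a * pd i v x + b * pd i u x\<bar> powr p)"
proof (rule integral_cong_AE)
 have "(\<lambda>x. a * v x + b * u x) \<in> HS" by (intro H_space_add H_space_cmult open_dom assms)
 from weak_deriv_Lp(2)[OF this assms(3,4)]
 show "(\<lambda>x. \<bar>pd i (\<lambda>x. a * v x + b * u x) x\<bar> powr p) \<in> borel_measurable M" by auto
 have "pd i v \<in> borel_measurable M" "pd i u \<in> borel_measurable M"
  using weak_deriv_Lp(1)[OF _ assms(3,4)] assms(1,2) by (auto simp: Lp_space_def)
 then show "(\<lambda>x. \<bar>a * pd i v x + b * pd i u x\<bar> powr p) \<in> borel_measurable M" by simp
 show "AE x in M. \<bar>pd i (\<lambda>x. a * v x + b * u x) x\<bar> powr p = \<bar>a * pd i v x + b * pd i u x\<bar> powr p"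
  using weak_deriv_combination[OF assms(1-3), of a b] by eventually_elim simp
qed

lemma integrable_weak_deriv_combination:
 assumes "v \<in> HS" "u \<in> HS" "i \<in> Basis" "p > 0"
 shows "integrable M (\<lambda>x. \<bar>a * pd i v x + b * pd i u x\<bar> powr p)"
 using Lp_space_add(1)[OF assms(4) Lp_space_cmult[OF weak_deriv_Lp(1)[OF assms(1,3,4)]] Lp_space_cmult[OF weak_deriv_Lp(1)[OF assms(2,3,4)]], of a b]
 by (simp add: Lp_space_def)

lemma gradient_energy_uniform_convexity:
 assumes p: "p > 1" and "e > 0"
 shows "\<exists>C>0. \<forall>u\<in>HS. \<forall>v\<in>HS. gradient_energy p (\<lambda>x. u x - v x) \<le> e * (gradient_energy p u + gradient_energy p v)
  + C * ((gradient_energy p u + gradient_energy p v) / 2 - gradient_energy p (\<lambda>x. 1 / 2 * u x + 1 / 2 * v x))"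
proof -
 have p0: "p > 0" using p by simp
 obtain C where C: "C > 0" "\<And>a b. \<bar>a - b\<bar> powr p \<le> e * (\<bar>a\<bar> powr p + \<bar>b\<bar> powr p) + C * ((\<bar>a\<bar> powr p + \<bar>b\<bar> powr p) / 2 - \<bar>(a + b) / 2\<bar> powr p)"
  using powr_uniform_convexity[OF p `e > 0`] by blast
 have "gradient_energy p (\<lambda>x. u x - v x) \<le> e * (gradient_energy p u + gradient_energy p v)
  + C * ((gradient_energy p u + gradient_energy p v) / 2 - gradient_energy p (\<lambda>x. 1 / 2 * u x + 1 / 2 * v x))"
  if u: "u \<in> HS" and v: "v \<in> HS" for u v
 proof -
  define I where "I = (\<lambda>i f. \<integral>x. \<bar>pd i f x\<bar> powr p \<partial>M)"
  have "I i (\<lambda>x. u x - v x) \<le> e * (I i u + I i v) + C * ((I i u + I i v) / 2 - I i (\<lambda>x. 1 / 2 * u x + 1 / 2 * v x))" if i: "i \<in> Basis" for i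
  proof -
   note ints = weak_deriv_Lp(2)[OF u i p0] weak_deriv_Lp(2)[OF v i p0]
    integrable_weak_deriv_combination[OF u v i p0, of "1 / 2" "1 / 2"] integrable_weak_deriv_combination[OF u v i p0, of 1 "-1"]
   let ?r = "\<lambda>x. e * (\<bar>pd i u x\<bar> powr p + \<bar>pd i v x\<bar> powr p)
     + C * ((\<bar>pd i u x\<bar> powr p + \<bar>pd i v x\<bar> powr p) / 2 - \<bar>1 / 2 * pd i u x + 1 / 2 * pd i v x\<bar> powr p)"
   have "I i (\<lambda>x. u x - v x) = (LINT x|M. \<bar>1 * pd i u x + (-1) * pd i v x\<bar> powr p)"
    unfolding I_def integral_weak_deriv_combination[OF u v i p0, symmetric] by simp
   also have "\<dots> \<le> (LINT x|M. ?r x)"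
   proof (rule integral_mono)
    show "integrable M ?r"
     by (intro Bochner_Integration.integrable_add Bochner_Integration.integrable_diff integrable_mult_right integrable_divide ints)
    show "\<bar>1 * pd i u x + - 1 * pd i v x\<bar> powr p \<le> ?r x" for x
     using C(2)[of "pd i u x" "pd i v x"] by (simp add: add_divide_distrib)
   qed (rule ints(4))
   also have "\<dots> = e * (I i u + I i v) + C * ((I i u + I i v) / 2 - I i (\<lambda>x. 1 / 2 * u x + 1 / 2 * v x))"
    unfolding I_def integral_weak_deriv_combination[OF u v i p0] using ints(1-3)
    by (simp del: times_divide_eq_left)
   finally show ?thesis .
  qed
  then have "(\<Sum>i\<in>Basis. I i (\<lambda>x. u x - v x)) \<le> (\<Sum>i\<in>Basis. e * (I i u + I i v) + C * ((I i u + I i v) / 2 - I i (\<lambda>x. 1 / 2 * u x + 1 / 2 * v x)))"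
   by (rule sum_mono)
  also have "\<dots> = e * (gradient_energy p u + gradient_energy p v)
   + C * ((gradient_energy p u + gradient_energy p v) / 2 - gradient_energy p (\<lambda>x. 1 / 2 * u x + 1 / 2 * v x))"
   by (simp add: gradient_energy_def I_def sum.distrib sum_subtractf flip: sum_distrib_left sum_divide_distrib)
  finally show ?thesis by (simp add: gradient_energy_def I_def)
 qed
 then show ?thesis using C(1) by blast
qed

lemma gradient_energy_midpoint:
 assumes p: "p > 1" and u: "u \<in> HS" and v: "v \<in> HS"
 shows "gradient_energy p (\<lambda>x. 1 / 2 * u x + 1 / 2 * v x) \<le> (gradient_energy p u + gradient_energy p v) / 2"
 unfolding gradient_energy_def sum.distrib[symmetric] sum_divide_distrib
proof (rule sum_mono)
 fix i :: 'a assume i: "i \<in> Basis"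
 have p0: "p > 0" using p by simp
 note ints = weak_deriv_Lp(2)[OF u i p0] weak_deriv_Lp(2)[OF v i p0]
 have "(LINT x|M. \<bar>1 / 2 * pd i u x + 1 / 2 * pd i v x\<bar> powr p)
  \<le> (LINT x|M. (\<bar>pd i u x\<bar> powr p + \<bar>pd i v x\<bar> powr p) / 2)"
 proof (rule integral_mono[OF integrable_weak_deriv_combination[OF u v i p0]])
  have "\<bar>(a + b) / 2\<bar> powr p \<le> (\<bar>a\<bar> powr p + \<bar>b\<bar> powr p) / 2" for a b :: real
  proof (cases "a = b")
   case True
   then have "(a + b) / 2 = b" by simp
   then show ?thesis using True by (simp only:) simp
  qed (use powr_midpoint_strict[OF p, of a b] in simp)
  then show "\<bar>1 / 2 * pd i u x + 1 / 2 * pd i v x\<bar> powr p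
   \<le> (\<bar>pd i u x\<bar> powr p + \<bar>pd i v x\<bar> powr p) / 2" for x
   by (simp add: add_divide_distrib)
 qed (use ints in auto)
 then show "(LINT x|M. \<bar>pd i (\<lambda>x. 1 / 2 * u x + 1 / 2 * v x) x\<bar> powr p)
  \<le> ((LINT x|M. \<bar>pd i u x\<bar> powr p) + (LINT x|M. \<bar>pd i v x\<bar> powr p)) / 2"
  unfolding integral_weak_deriv_combination[OF u v i p0] using ints by simp
qed

lemma gradient_energy_le:
 assumes u: "u \<in> HS" and p: "p > 0"
 shows "gradient_energy p u \<le> real DIM('a) * (LINT x|M. norm (grad u x) powr p)"
proof -
 have "gradient_energy p u \<le> (\<Sum>i\<in>(Basis :: 'a set). \<integral>x. norm (grad u x) powr p \<partial>M)"
  unfolding gradient_energy_def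
 proof (rule sum_mono)
  fix i :: 'a assume i: "i \<in> Basis"
  show "(LINT x|M. \<bar>pd i u x\<bar> powr p) \<le> (LINT x|M. norm (grad u x) powr p)"
  proof (rule integral_mono[OF weak_deriv_Lp(2)[OF u i p] ess_bounded_integrable[OF finite_M eb_gradient_powr[OF u p]]])
   show "\<bar>pd i u x\<bar> powr p \<le> norm (grad u x) powr p" for x
    using Basis_le_norm[OF i, of "grad u x"] p by (intro powr_mono2) (auto simp: weak_gradient_inner[OF i])
  qed
 qed
 then show ?thesis by simp
qed

text \<open>The infima \<open>J n\<close> over the shrinking sets increase to a limit
  \<open>L\<close>. For \<open>i, j \<ge> N\<close> both energies are at most
  \<open>L + 1 / (N + 1)\<close>, while the midpoint still lies in \<open>C N\<close> and has energy
  at least \<open>J N\<close>. The midpoint defect is therefore small, and uniform convexity makes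
  the difference small.\<close>

lemma near_minimisers_cauchy:
 fixes C :: "nat \<Rightarrow> ('a \<Rightarrow> real) set"
 assumes p: "p > 1" and sub: "\<And>n. C n \<subseteq> HS" and ne: "\<And>n. C n \<noteq> {}" and dec: "\<And>n. C (Suc n) \<subseteq> C n"
  and mid: "\<And>n u v. u \<in> C n ==> v \<in> C n ==> (\<lambda>x. 1 / 2 * u x + 1 / 2 * v x) \<in> C n"
  and bd: "\<And>n u. u \<in> C n ==> gradient_energy p u \<le> K"
 shows "\<exists>w. (\<forall>n. w n \<in> C n) \<and> (\<forall>e>0. \<exists>N. \<forall>i\<ge>N. \<forall>j\<ge>N. gradient_energy p (\<lambda>x. w i x - w j x) < e)"
proof -
 define J where "J = (\<lambda>n. Inf (gradient_energy p ` C n))"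
 have below: "bdd_below (gradient_energy p ` C n)" for n
  using gradient_energy_nonneg by (intro bdd_belowI[of _ 0]) auto
 have anti: "C n \<subseteq> C m" if "m \<le> n" for m n using that dec by (rule lift_Suc_antimono_le[rotated])
 have JK: "J n \<le> K" for n
 proof -
  obtain u where "u \<in> C n" using ne by blast
  then have "J n \<le> gradient_energy p u" unfolding J_def by (intro cInf_lower below) auto
  also have "\<dots> \<le> K" using bd `u \<in> C n` by blast
  finally show ?thesis .
 qed
 have Jle: "J n \<le> gradient_energy p u" if "u \<in> C n" for n u unfolding J_def using that by (intro cInf_lower below) auto
 have Jmono: "J m \<le> J n" if "m \<le> n" for m n
  unfolding J_def using anti[OF that] ne by (intro cInf_superset_mono below image_mono) auto
 have "\<exists>u\<in>C n. gradient_energy p u < J n + 1 / real (Suc n)" for n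
 proof -
  have "\<exists>y\<in>gradient_energy p ` C n. y < J n + 1 / real (Suc n)"
   unfolding J_def using ne below by (subst cInf_less_iff[symmetric]) auto
  then show ?thesis by blast
 qed
 then obtain w where w: "\<And>n. w n \<in> C n" "\<And>n. gradient_energy p (w n) < J n + 1 / real (Suc n)" by metis
 have "incseq J" using Jmono by (simp add: incseq_def)
 then obtain L where L: "J \<longlonglongrightarrow> L" "\<And>n. J n \<le> L" using incseq_convergent[of J K] JK by blast
 have wH: "w n \<in> HS" for n using w(1) sub by blast
 have K0: "K \<ge> 0" using gradient_energy_nonneg[of p "w 0"] bd[OF w(1)[of 0]] by linarith
 have "\<exists>N. \<forall>i\<ge>N. \<forall>j\<ge>N. gradient_energy p (\<lambda>x. w i x - w j x) < e" if "e > 0" for e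
 proof -
  \<comment> \<open>Multiplied by the total energy, at most \<open>2 * K\<close>, this stays below
    \<open>3 / 4\<close> of \<open>e\<close>; the midpoint defect gets the last quarter. The summand
    \<open>1\<close> covers \<open>K = 0\<close>.\<close>
  define eps where "eps = e / (4 * (K + 1))"
  have eps: "eps > 0" "eps * (2 * K) < e / 2 + e / 4" using `e > 0` K0
   by (auto simp: eps_def field_simps intro!: add_pos_nonneg mult_nonneg_nonneg)
  obtain c where c: "c > 0" "\<And>u v. u\<in>HS ==> v\<in>HS ==> gradient_energy p (\<lambda>x. u x - v x) \<le> eps * (gradient_energy p u + gradient_energy p v)
  + c * ((gradient_energy p u + gradient_energy p v) / 2 - gradient_energy p (\<lambda>x. 1 / 2 * u x + 1 / 2 * v x))"
   using gradient_energy_uniform_convexity[OF p eps(1)] by blast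
  have "(\<lambda>n. c * (L - J n + 1 / real (Suc n))) \<longlonglongrightarrow> c * (L - L + 0)"
   by (intro tendsto_intros L(1) LIMSEQ_Suc[OF lim_1_over_n])
  then have "\<forall>\<^sub>F n in sequentially. c * (L - J n + 1 / real (Suc n)) < e / 4"
   using `e > 0` by (intro order_tendstoD(2)) auto
  then obtain N where N: "c * (L - J N + 1 / real (Suc N)) < e / 4" by (auto simp: eventually_sequentially)
  have "gradient_energy p (\<lambda>x. w i x - w j x) < e" if "i \<ge> N" "j \<ge> N" for i j
  proof -
   have wN: "w i \<in> C N" "w j \<in> C N" using w(1) anti that by blast+
   have "gradient_energy p (w n) \<le> L + 1 / real (Suc N)" if "n \<ge> N" for n
   proof -
    have "1 / real (Suc n) \<le> 1 / real (Suc N)" using that by (intro divide_left_mono) auto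
    then show ?thesis using w(2)[of n] L(2)[of n] by linarith
   qed
   note le = this[OF that(1)] this[OF that(2)] Jle[OF mid[OF wN]]
   have arith: "a \<le> l + s ==> b \<le> l + s ==> j \<le> m ==> (a + b) / 2 - m \<le> l - j + s" for a b l s j m :: real by (simp add: field_simps)
   have "(gradient_energy p (w i) + gradient_energy p (w j)) / 2 - gradient_energy p (\<lambda>x. 1 / 2 * w i x + 1 / 2 * w j x) \<le> L - J N + 1 / real (Suc N)"
    by (rule arith[OF le])
   then have "c * ((gradient_energy p (w i) + gradient_energy p (w j)) / 2 - gradient_energy p (\<lambda>x. 1 / 2 * w i x + 1 / 2 * w j x)) \<le> c * (L - J N + 1 / real (Suc N))"
    using c(1) by (intro mult_left_mono) auto
   moreover have "eps * (gradient_energy p (w i) + gradient_energy p (w j)) \<le> eps * (2 * K)"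
    using bd[OF w(1)[of i]] bd[OF w(1)[of j]] eps by (intro mult_left_mono) auto
   ultimately show ?thesis using c(2)[OF wH wH, of i j] N eps(2) by linarith
  qed
  then show ?thesis by blast
 qed
 then show ?thesis using w(1) by blast
qed

section \<open>Limits of gradient-Cauchy sequences and their traces\<close>

lemma Lp_cong_AE:
 assumes "f \<in> Lp_space p M" "AE x in M. f x = f2 x"
 shows "f2 \<in> Lp_space p M" "(LINT x|M. \<bar>f2 x\<bar> powr p) = (LINT x|M. \<bar>f x\<bar> powr p)"
proof -
 have f: "f \<in> borel_measurable M" "integrable M (\<lambda>x. \<bar>f x\<bar> powr p)" using assms by (auto simp: Lp_space_def)
 have f2: "f2 \<in> borel_measurable M" by (rule measurable_cong_AE_lebesgue_on[OF dom_sets f(1) assms(2)])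
 have m: "(\<lambda>x. \<bar>f x\<bar> powr p) \<in> borel_measurable M" "(\<lambda>x. \<bar>f2 x\<bar> powr p) \<in> borel_measurable M" using f f2 by auto
 have ae: "AE x in M. \<bar>f x\<bar> powr p = \<bar>f2 x\<bar> powr p" using assms(2) by eventually_elim simp
 show "f2 \<in> Lp_space p M" using integrable_cong_AE[OF m ae] f f2 by (simp add: Lp_space_def)
 show "(LINT x|M. \<bar>f2 x\<bar> powr p) = (LINT x|M. \<bar>f x\<bar> powr p)" by (rule integral_cong_AE[OF m(2,1)]) (use ae in \<open>auto elim!: eventually_mono\<close>)
qed

text \<open>Each \<open>w n - h\<close> is replaced by a test function that is uniformly close to it
  together with its first derivatives, with error \<open>1 / (n + 1)\<close>. Adding
  \<open>h\<close> back gives functions smooth up to the boundary that have the right boundary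
  values and the same limit as \<open>w n\<close>.\<close>

lemma sobolev_limit_has_trace:
 assumes p: "p > 1" and w: "\<And>n. w n \<in> HA" and u: "u \<in> Lp_space p M"
  and wu: "(\<lambda>n. \<integral>x. \<bar>w n x - u x\<bar> powr p \<partial>M) \<longlonglongrightarrow> 0"
  and d: "\<And>i. i \<in> Basis ==> d i \<in> Lp_space p M"
  and wd: "\<And>i. i \<in> Basis ==> (\<lambda>n. \<integral>x. \<bar>pd i (w n) x - d i x\<bar> powr p \<partial>M) \<longlonglongrightarrow> 0"
 shows "u \<in> sobolev S 1 p" "has_trace S p u h"
proof -
 interpret finite_measure M by (rule finite_M)
 have p0: "p > 0" using p by simp
 have wH: "w n \<in> HS" for n using w by (simp add: H_affine_def)
 have hH: "h \<in> HS" by (rule smooth_on_closure_H_space(1)[OF h open_dom bounded_dom])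
 have wLp: "w n \<in> Lp_space p M" for n by (rule ess_bounded_Lp[OF finite_M p0 H_bounded(1)[OF wH]])
 have wd_u: "is_weak_deriv S [i] u (d i)" if i: "i \<in> Basis" for i
  by (rule is_weak_deriv_limit[OF open_dom bounded_dom p _ H_weak_deriv(1)[OF wH i] wLp u wu weak_deriv_Lp(1)[OF wH i p0] d[OF i] wd[OF i]])
   (use i in \<open>simp add: multi_indices_def\<close>)
 have lu: "is_weak_deriv S [] u u"
  by (intro is_weak_deriv_Nil locally_integrable_of_integrable[OF open_dom] Lp_space_L1(1)[OF finite_M p zero_less_one u])
 have short: "a = [] \<or> (\<exists>i\<in>Basis. a = [i])" if "a \<in> multi_indices" "length a \<le> 1" for a :: "'a list"
  using that by (cases a) (auto simp: multi_indices_def)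
 show us: "u \<in> sobolev S 1 p"
  unfolding sobolev_def using u lu wd_u d short by fast
 define approx where "approx = (\<lambda>n \<psi>. test_function S \<psi> \<and> (AE x in M. \<bar>\<psi> x - (w n x - h x)\<bar> \<le> 1 / real (Suc n) \<and>
  (\<forall>i\<in>Basis. \<bar>pdiff \<psi> x i - pd i (\<lambda>x. w n x - h x) x\<bar> \<le> 1 / real (Suc n))))"
 have "\<exists>\<psi>. approx n \<psi>" for n
  unfolding approx_def using w by (intro H0_space_uniform_approx[OF open_dom bounded_dom cone order1]) (auto simp: H_affine_def)
 then obtain \<psi> where \<psi>0: "\<And>n. approx n (\<psi> n)" by metis
 then have \<psi>: "\<And>n. test_function S (\<psi> n)" "\<And>n. AE x in M. \<bar>\<psi> n x - (w n x - h x)\<bar> \<le> 1 / real (Suc n)"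
  "\<And>n. AE x in M. \<forall>i\<in>Basis. \<bar>pdiff (\<psi> n) x i - pd i (\<lambda>x. w n x - h x) x\<bar> \<le> 1 / real (Suc n)"
  unfolding approx_def AE_conj_iff by blast+
 \<comment> \<open>\<open>f n\<close> is a known weak derivative and \<open>e n\<close> a nearby
   sequence known to tend to zero; the function chosen by \<open>weak_deriv\<close> differs from
   \<open>f n\<close> on a null set. Both orders of differentiation are instances.\<close>
 have small: "(\<lambda>n. \<integral>x. \<bar>weak_deriv S a (\<lambda>x. \<psi> n x + h x - u x) x\<bar> powr p \<partial>M) \<longlonglongrightarrow> 0"
  if f: "\<And>n. is_weak_deriv S a (\<lambda>x. \<psi> n x + h x - u x) (f n)" "\<And>n. f n \<in> Lp_space p M" "\<And>n. AE x in M. \<bar>f n x - e n x\<bar> \<le> 1 / real (Suc n)"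
   and e: "\<And>n. e n \<in> Lp_space p M" "(\<lambda>n. \<integral>x. \<bar>e n x\<bar> powr p \<partial>M) \<longlonglongrightarrow> 0" for a :: "'a list" and f e
 proof (rule tendsto_sandwich[OF _ _ tendsto_const])
  have "AE x in M. f n x = weak_deriv S a (\<lambda>x. \<psi> n x + h x - u x) x" for n using weak_deriv_AE[OF open_dom f(1)[of n]] by eventually_elim simp
  from Lp_cong_AE(2)[OF f(2) this] Lp_perturbation[OF finite_M p0 f(2) e(1) f(3)]
  show "\<forall>\<^sub>F n in sequentially. (LINT x|M. \<bar>weak_deriv S a (\<lambda>x. \<psi> n x + h x - u x) x\<bar> powr p)
   \<le> 2 powr p * ((LINT x|M. \<bar>e n x\<bar> powr p) + measure M (space M) * (1 / real (Suc n)) powr p)" by simp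
  have "(\<lambda>n. (1 / real (Suc n)) powr p) \<longlonglongrightarrow> 0 powr p"
   using p0 by (intro tendsto_powr' LIMSEQ_Suc[OF lim_1_over_n] tendsto_const) auto
  then have "(\<lambda>n. 2 powr p * ((LINT x|M. \<bar>e n x\<bar> powr p) + measure M (space M) * (1 / real (Suc n)) powr p)) \<longlonglongrightarrow> 2 powr p * (0 + measure M (space M) * 0 powr p)"
   by (intro tendsto_add tendsto_mult tendsto_const e)
  then show "(\<lambda>n. 2 powr p * ((LINT x|M. \<bar>e n x\<bar> powr p) + measure M (space M) * (1 / real (Suc n)) powr p)) \<longlonglongrightarrow> 0" using p0 by simp
 qed simp
 have e\<psi>: "eb (\<psi> n)" "i \<in> Basis ==> eb (\<lambda>x. pdiff (\<psi> n) x i)" for n i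
  using ess_bounded_test_function[OF _ open_dom] test_function_partial[OF \<psi>(1)] \<psi>(1) by blast+
 have part: "(\<lambda>n. \<integral>x. \<bar>weak_deriv S a (\<lambda>x. \<psi> n x + h x - u x) x\<bar> powr p \<partial>M) \<longlonglongrightarrow> 0"
  if a: "a \<in> multi_indices" "length a \<le> 1" for a
  using short[OF a]
 proof (elim disjE bexE)
  assume a: "a = []"
  show ?thesis unfolding a
  proof (rule small[where e="\<lambda>n x. w n x - u x"])
   show fLp: "(\<lambda>x. \<psi> n x + h x - u x) \<in> Lp_space p M" for n
    by (intro Lp_space_diff[OF p0 _ u] Lp_space_add(1)[OF p0] ess_bounded_Lp[OF finite_M p0] e\<psi> eb_smooth h)
   show "is_weak_deriv S [] (\<lambda>x. \<psi> n x + h x - u x) (\<lambda>x. \<psi> n x + h x - u x)" for n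
    by (intro is_weak_deriv_Nil locally_integrable_of_integrable[OF open_dom] Lp_space_L1(1)[OF finite_M p zero_less_one fLp])
   show "AE x in M. \<bar>\<psi> n x + h x - u x - (w n x - u x)\<bar> \<le> 1 / real (Suc n)" for n
    using \<psi>(2)[of n] by eventually_elim (simp add: algebra_simps)
  qed (use wLp u p0 wu in \<open>auto intro: Lp_space_diff\<close>)
 next
  fix i :: 'a assume i: "i \<in> Basis" and a: "a = [i]"
  have mi: "[i] \<in> multi_indices" using i by (simp add: multi_indices_def)
  show ?thesis unfolding a
  proof (rule small[where f="\<lambda>n x. pdiff (\<psi> n) x i + pd i h x - d i x" and e="\<lambda>n x. pd i (w n) x - d i x"])
   show "(\<lambda>x. pdiff (\<psi> n) x i + pd i h x - d i x) \<in> Lp_space p M" for n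
    by (intro Lp_space_diff[OF p0 _ d[OF i]] Lp_space_add(1)[OF p0] weak_deriv_Lp(1)[OF hH i p0] ess_bounded_Lp[OF finite_M p0] e\<psi> i)
   have "smooth_on S (\<psi> n)" for n using test_functionD(1)[OF \<psi>(1)] by (rule smooth_on_subset) simp
   then show "is_weak_deriv S [i] (\<lambda>x. \<psi> n x + h x - u x) (\<lambda>x. pdiff (\<psi> n) x i + pd i h x - d i x)" for n
    by (intro is_weak_deriv_diff[OF open_dom mi] is_weak_deriv_add[OF open_dom mi] smooth_is_weak_deriv1[OF open_dom _ i] H_weak_deriv(1)[OF hH i] wd_u[OF i])
   show "AE x in M. \<bar>pdiff (\<psi> n) x i + pd i h x - d i x - (pd i (w n) x - d i x)\<bar> \<le> 1 / real (Suc n)" for n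
    using \<psi>(3)[of n] weak_deriv_combination[OF wH[of n] hH i, of 1 "-1"]
   proof eventually_elim
    case (elim x)
    then have "\<bar>pdiff (\<psi> n) x i - pd i (\<lambda>x. w n x - h x) x\<bar> \<le> 1 / real (Suc n)" using i by blast
    with elim(2) show ?case by (simp add: algebra_simps)
   qed
  qed (use weak_deriv_Lp(1)[OF wH i p0] d[OF i] p0 wd[OF i] in \<open>auto intro: Lp_space_diff\<close>)
 qed
 have "(\<lambda>n. \<Sum>a | a \<in> multi_indices \<and> length a \<le> 1. \<integral>x. \<bar>weak_deriv S a (\<lambda>x. \<psi> n x + h x - u x) x\<bar> powr p \<partial>M) \<longlonglongrightarrow>
   (\<Sum>a \<in> {a :: 'a list. a \<in> multi_indices \<and> length a \<le> 1}. 0)"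
  using part by (intro tendsto_sum) auto
 then have "(\<lambda>n. sobolev_norm S 1 p (\<lambda>x. \<psi> n x + h x - u x)) \<longlonglongrightarrow> 0 powr (1 / p)"
  unfolding sobolev_norm_def using p0 by (intro tendsto_powr' tendsto_const) (auto intro!: always_eventually sum_nonneg)
 then have "(\<lambda>n. sobolev_norm S 1 p (\<lambda>x. \<psi> n x + h x - u x)) \<longlonglongrightarrow> 0" using p0 by simp
 then show "has_trace S p u h"
  by (rule has_trace_of_test_functions[OF open_dom bounded_dom smooth_dom h p0 us \<psi>(1)])
qed

text \<open>The differences \<open>w i - w j\<close> lie in \<open>H0\<close>, where Poincare's
  inequality makes the functions themselves Cauchy; completeness then supplies limits for the
  functions and for each derivative.\<close>

lemma gradient_cauchy_limit:
 assumes p: "p > 1" and w: "\<And>n. w n \<in> HA"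
  and cauchy: "\<And>e. e > 0 ==> \<exists>N. \<forall>i\<ge>N. \<forall>j\<ge>N. gradient_energy p (\<lambda>x. w i x - w j x) < e"
 shows "\<exists>u\<in>sobolev S 1 p. has_trace S p u h \<and> (\<lambda>n. \<integral>x. \<bar>w n x - u x\<bar> powr p \<partial>M) \<longlonglongrightarrow> 0"
proof -
 have p0: "p > 0" using p by simp
 have wH: "w n \<in> HS" for n using w by (simp add: H_affine_def)
 have wLp: "w n \<in> Lp_space p M" for n by (rule ess_bounded_Lp[OF finite_M p0 H_bounded(1)[OF wH]])
 have part: "(LINT x|M. \<bar>pd b f x\<bar> powr p) \<le> gradient_energy p f" if "b \<in> Basis" for b f
  unfolding gradient_energy_def using that by (intro member_le_sum) auto
 have dc: "\<exists>N. \<forall>i\<ge>N. \<forall>j\<ge>N. (LINT x|M. \<bar>pd b (w i) x - pd b (w j) x\<bar> powr p) < e"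
  if b: "b \<in> Basis" and "e > 0" for b e
 proof -
  have "(LINT x|M. \<bar>pd b (w i) x - pd b (w j) x\<bar> powr p) \<le> gradient_energy p (\<lambda>x. w i x - w j x)" for i j
   using part[OF b, of "\<lambda>x. w i x - w j x"] integral_weak_deriv_combination[OF wH[of i] wH[of j] b p0, of 1 "-1"] by simp
  then show ?thesis using cauchy[OF `e > 0`] by (meson le_less_trans)
 qed
 define lim where "lim = (\<lambda>b d. (\<lambda>n. \<integral>x. \<bar>pd b (w n) x - d x\<bar> powr p \<partial>M) \<longlonglongrightarrow> 0)"
 have "\<exists>d\<in>Lp_space p M. lim b d" if b: "b \<in> Basis" for b
  unfolding lim_def by (rule Lp_complete[OF finite_M p weak_deriv_Lp(1)[OF wH b p0] dc[OF b]])
 then obtain d where d: "\<And>b. b \<in> Basis ==> d b \<in> Lp_space p M" "\<And>b. b \<in> Basis ==> lim b (d b)" by metis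
 obtain b :: 'a where b: "b \<in> Basis" using nonempty_Basis by blast
 obtain C where C: "C > 0" "\<And>f. f \<in> H0 ==> (LINT x|M. \<bar>f x\<bar> powr p) \<le> C * (LINT x|M. \<bar>pd b f x\<bar> powr p)"
  using poincare_H0[OF open_dom bounded_dom cone order1 p b] by blast
 have "\<exists>N. \<forall>i\<ge>N. \<forall>j\<ge>N. (LINT x|M. \<bar>w i x - w j x\<bar> powr p) < e" if "e > 0" for e
 proof -
  obtain N where N: "\<And>i j. i \<ge> N ==> j \<ge> N ==> gradient_energy p (\<lambda>x. w i x - w j x) < e / C"
   using cauchy[of "e / C"] C(1) `e > 0` by auto
  have "(LINT x|M. \<bar>w i x - w j x\<bar> powr p) < e" if "i \<ge> N" "j \<ge> N" for i j
  proof -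
   have "(LINT x|M. \<bar>w i x - w j x\<bar> powr p) \<le> C * (LINT x|M. \<bar>pd b (\<lambda>x. w i x - w j x) x\<bar> powr p)"
    by (rule C(2)[OF H_affine_diff_H0[OF open_dom bounded_dom w w]])
   also have "\<dots> \<le> C * gradient_energy p (\<lambda>x. w i x - w j x)" using C(1) part[OF b] by (intro mult_left_mono) auto
   also have "\<dots> < C * (e / C)" using C(1) N[OF that] by (intro mult_strict_left_mono) auto
   finally show ?thesis using C(1) by simp
  qed
  then show ?thesis by blast
 qed
 from Lp_complete[OF finite_M p wLp this] obtain u where u: "u \<in> Lp_space p M" "(\<lambda>n. \<integral>x. \<bar>w n x - u x\<bar> powr p \<partial>M) \<longlonglongrightarrow> 0"
  by blast
 then show ?thesis using sobolev_limit_has_trace[OF p w u d(1) d(2)[unfolded lim_def]] by blast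
qed

end

section \<open>Existence of weak solutions\<close>

context mfg_data
begin

lemma H_affine_midpoint:
 assumes "u \<in> HA" "v \<in> HA"
 shows "(\<lambda>x. 1 / 2 * u x + 1 / 2 * v x) \<in> HA"
 using H_affine_convex[OF open_dom bounded_dom finite, of "UNIV :: bool set" "\<lambda>b. if b then u else v" "2 * k" h "\<lambda>b. 1 / 2"] assms
 by (simp add: UNIV_bool add.commute)

lemma a_priori_estimate:
 fixes \<gamma> :: real
 assumes p: "\<gamma> > 1"
  and A1: "\<exists>C1>0. \<forall>x\<in>S. \<forall>p. - H x p + gradient (H x) p \<bullet> p \<ge> 1 / C1 * norm p powr \<gamma> - C1"
  and A2: "\<exists>C2>0. \<forall>x\<in>S. \<forall>p. H x p \<ge> 1 / C2 * norm p powr \<gamma> - C2"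
  and A3: "\<exists>C3>0. \<forall>x\<in>S. \<forall>p. norm (gradient (H x) p) \<le> C3 * norm p powr (\<gamma> - 1) + C3"
  and A4: "\<forall>d>0. \<exists>Cd>0. \<forall>m\<in>L1_space M. (AE x in M. m x \<ge> 0) \<longrightarrow>
     max (ext_integral M (\<lambda>x. \<bar>g (m x)\<bar>)) (ext_integral M m)
      \<le> ereal d * ext_integral M (\<lambda>x. m x * g (m x)) + ereal Cd"
  and A5: "\<exists>C5>0. \<forall>m\<in>L1_space M. (AE x in M. m x \<ge> 0) \<longrightarrow> ext_integral M (\<lambda>x. m x * g (m x)) \<ge> ereal (- C5)"
 shows "\<exists>K. \<forall>\<eta>\<in>HN. \<forall>v\<in>HA.
   F \<eta> v (\<lambda>x. 1 - \<eta> x) (\<lambda>x. h x - v x) \<ge> 0 \<longrightarrow>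
   (LINT x|M. \<eta> x * g (\<eta> x)) \<le> K \<and> (LINT x|M. norm (grad v x) powr \<gamma>) \<le> K"
proof -
 obtain C1 where C1: "C1 > 0" "\<And>x p. x \<in> S ==> - H x p + gradient (H x) p \<bullet> p \<ge> 1 / C1 * norm p powr \<gamma> - C1" using A1 by blast
 obtain C2 where C2: "C2 > 0" "\<And>x p. x \<in> S ==> H x p \<ge> 1 / C2 * norm p powr \<gamma> - C2" using A2 by blast
 obtain C3 where C3: "C3 > 0" "\<And>x p. x \<in> S ==> norm (gradient (H x) p) \<le> C3 * norm p powr (\<gamma> - 1) + C3" using A3 by blast
 obtain c1 c0 where c: "c1 \<ge> 0" "c0 \<ge> 0" and ineq: "\<And>\<eta> v. \<eta> \<in> HN ==> v \<in> HA ==>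
   F \<eta> v (\<lambda>x. 1 - \<eta> x) (\<lambda>x. h x - v x) \<ge> 0 ==>
   (LINT x|M. \<eta> x * g (\<eta> x)) + 1 / (2 * C2) * (LINT x|M. norm (grad v x) powr \<gamma>)
    \<le> (LINT x|M. \<bar>g (\<eta> x)\<bar>) + c1 * (LINT x|M. \<eta> x) + c0"
  using reference_inequality[OF p C1 C2 C3] by blast
 \<comment> \<open>With \<open>(1 + c1) * d = 1 / 2\<close> the terms estimated by \<open>A4\<close>
   return at most half of the integral of \<open>\<eta> * g(\<eta>)\<close>, which is absorbed on
   the left.\<close>
 define d where "d = 1 / 2 / (1 + c1)"
 have d: "d > 0" "(1 + c1) * d = 1 / 2" using c unfolding d_def by (simp_all del: divide_divide_eq_left)
 obtain Cd where Cd: "Cd > 0" "\<And>m. m\<in>L1_space M ==> (AE x in M. m x \<ge> 0) ==>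
     max (ext_integral M (\<lambda>x. \<bar>g (m x)\<bar>)) (ext_integral M m) \<le> ereal d * ext_integral M (\<lambda>x. m x * g (m x)) + ereal Cd"
  using A4 d(1) by blast
 obtain C5 where C5: "C5 > 0" "\<And>m. m\<in>L1_space M ==> (AE x in M. m x \<ge> 0) ==> ext_integral M (\<lambda>x. m x * g (m x)) \<ge> ereal (- C5)"
  using A5 by blast
 define c5 where "c5 = (1 + c1) * Cd + c0"
 \<comment> \<open>The first entry bounds the integral of \<open>\<eta> * g(\<eta>)\<close>. The
   second bounds the gradient term; it needs the lower bound \<open>- C5\<close> because that
   integral may be negative and remains on the left with factor \<open>1 / 2\<close>.\<close>
 define K where "K = max (2 * c5) (2 * C2 * (c5 + C5 / 2))"
 have "(LINT x|M. \<eta> x * g (\<eta> x)) \<le> K \<and> (LINT x|M. norm (grad v x) powr \<gamma>) \<le> K"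
  if \<eta>: "\<eta> \<in> HN" and v: "v \<in> HA"
   and pos: "F \<eta> v (\<lambda>x. 1 - \<eta> x) (\<lambda>x. h x - v x) \<ge> 0" for \<eta> v
 proof -
  note ebi = ess_bounded_integrable[OF finite_M]
  have \<eta>i: "integrable M \<eta>" "AE x in M. \<eta> x \<ge> 0" using ebi[OF eb_H_nonneg[OF \<eta>]] \<eta> by (auto simp: H_nonneg_def)
  have gi: "integrable M (\<lambda>x. \<bar>g (\<eta> x)\<bar>)" "integrable M (\<lambda>x. \<eta> x * g (\<eta> x))"
   using ebi[OF g_compose_bounded[OF \<eta>]] ebi[OF ess_bounded_mult[OF eb_H_nonneg[OF \<eta>] g_compose_bounded[OF \<eta>]]] by auto
  note ext = ext_integral_integrable[OF \<eta>i(1)] ext_integral_integrable[OF gi(1)] ext_integral_integrable[OF gi(2)]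
  define I where "I = (LINT x|M. \<eta> x * g (\<eta> x))"
  define X where "X = (LINT x|M. norm (grad v x) powr \<gamma>)"
  have X: "X \<ge> 0" unfolding X_def by simp
  have L1: "\<eta> \<in> L1_space M" using \<eta>i by (simp add: L1_space_def)
  have a: "(LINT x|M. \<bar>g (\<eta> x)\<bar>) \<le> d * I + Cd" "(LINT x|M. \<eta> x) \<le> d * I + Cd"
   using Cd(2)[OF L1 \<eta>i(2)] unfolding ext I_def by simp_all
  have b: "I \<ge> - C5" using C5(2)[OF L1 \<eta>i(2)] unfolding ext I_def by simp
  have "I + 1 / (2 * C2) * X \<le> (LINT x|M. \<bar>g (\<eta> x)\<bar>) + c1 * (LINT x|M. \<eta> x) + c0"
   unfolding I_def X_def by (rule ineq[OF \<eta> v pos])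
  also have "\<dots> \<le> (d * I + Cd) + c1 * (d * I + Cd) + c0" using a c by (intro add_mono mult_left_mono) auto
  also have "\<dots> = ((1 + c1) * d) * I + c5" by (simp add: c5_def algebra_simps)
  finally have f: "I + 1 / (2 * C2) * X \<le> 1 / 2 * I + c5" unfolding d(2) .
  moreover have "1 / (2 * C2) * X \<ge> 0" using X C2 by simp
  ultimately have "I \<le> 2 * c5" by linarith
  moreover have "1 / (2 * C2) * X \<le> c5 + C5 / 2" using f b by linarith
  then have "X \<le> 2 * C2 * (c5 + C5 / 2)" using C2(1) by (simp add: field_simps)
  ultimately show ?thesis unfolding I_def X_def K_def by auto
 qed
 then show ?thesis by blast
qed

lemma mfg_F_split:
 assumes \<eta>: "\<eta> \<in> HN" and v: "v \<in> HA" and "integrable M m" "integrable M u"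
 shows "F \<eta> v (\<lambda>x. \<eta> x - m x) (\<lambda>x. v x - u x) =
  ((LINT x|M. opA \<eta> v x * \<eta> x) + (LINT x|M. opB \<eta> v x * v x)) - (LINT x|M. opA \<eta> v x * m x) - (LINT x|M. opB \<eta> v x * u x)"
proof -
 have "eb (opA \<eta> v)" "eb (opB \<eta> v)"
  using \<eta> v by (auto intro!: eb_opA eb_opB simp: H_affine_def H_nonneg_def)
 note mi = this[THEN ess_bounded_mult_integrable]
 have "integrable M \<eta>" "integrable M v"
  using ess_bounded_integrable[OF finite_M] eb_H_nonneg[OF \<eta>] eb_H_affine[OF v] by blast+
 then show ?thesis unfolding mfg_F_eq using mi assms(3,4) by (simp add: right_diff_distrib)
qed

text \<open>The order of the two limits matters: once the weak limit \<open>m0\<close> of the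
  densities is fixed, the remaining inequalities are affine conditions on \<open>u\<close> alone and
  cut out nested convex sets.\<close>

lemma weak_solution_exists:
 fixes \<gamma> :: real
 assumes p: "\<gamma> > 1"
  and A1: "\<exists>C1>0. \<forall>x\<in>S. \<forall>p. - H x p + gradient (H x) p \<bullet> p \<ge> 1 / C1 * norm p powr \<gamma> - C1"
  and A2: "\<exists>C2>0. \<forall>x\<in>S. \<forall>p. H x p \<ge> 1 / C2 * norm p powr \<gamma> - C2"
  and A3: "\<exists>C3>0. \<forall>x\<in>S. \<forall>p. norm (gradient (H x) p) \<le> C3 * norm p powr (\<gamma> - 1) + C3"
  and A4: "\<forall>d>0. \<exists>Cd>0. \<forall>m\<in>L1_space M. (AE x in M. m x \<ge> 0) \<longrightarrow>
     max (ext_integral M (\<lambda>x. \<bar>g (m x)\<bar>)) (ext_integral M m)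
      \<le> ereal d * ext_integral M (\<lambda>x. m x * g (m x)) + ereal Cd"
  and A5: "\<exists>C5>0. \<forall>m\<in>L1_space M. (AE x in M. m x \<ge> 0) \<longrightarrow> ext_integral M (\<lambda>x. m x * g (m x)) \<ge> ereal (- C5)"
  and A6: "\<And>m :: nat \<Rightarrow> 'a \<Rightarrow> real. (\<And>j. m j \<in> L1_space M) ==> (\<And>j. AE x in M. m j x \<ge> 0) ==>
    (SUP j. ext_integral M (\<lambda>x. m j x * g (m j x))) < \<infinity> ==>
     \<exists>r m0. strict_mono (r :: nat \<Rightarrow> nat) \<and> weakly_converges_L1 M (\<lambda>j. m (r j)) m0"
  and A7: "\<And>\<eta>1 v1 \<eta>2 v2. \<eta>1 \<in> HN ==> v1 \<in> HA ==>
   \<eta>2 \<in> HN ==> v2 \<in> HA ==>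
   F \<eta>1 v1 (\<lambda>x. \<eta>1 x - \<eta>2 x) (\<lambda>x. v1 x - v2 x) - F \<eta>2 v2 (\<lambda>x. \<eta>1 x - \<eta>2 x) (\<lambda>x. v1 x - v2 x) \<ge> 0"
 shows "\<exists>m\<in>L1_space M. \<exists>u\<in>sobolev S 1 \<gamma>. has_trace S \<gamma> u h \<and> (AE x in M. m x \<ge> 0) \<and>
   (\<forall>\<eta>\<in>HN. \<forall>v\<in>HA.
    F \<eta> v (\<lambda>x. \<eta> x - m x) (\<lambda>x. v x - u x) \<ge> 0)"
proof -
 have p0: "\<gamma> > 0" using p by simp
 note ebi = ess_bounded_integrable[OF finite_M]
 define Z where "Z = HN \<times> HA"
 define A where "A = (\<lambda>z. opA (fst z) (snd z))"
 define B where "B = (\<lambda>z. opB (fst z) (snd z))"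
 define c where "c = (\<lambda>z. (LINT x|M. A z x * fst z x) + (LINT x|M. B z x * snd z x))"
 \<comment> \<open>The variational inequality for the test pair \<open>z\<close> as an affine
   function of the unknown, with bounded coefficients \<open>A z\<close>, \<open>B z\<close> and
   constant term \<open>c z\<close>.\<close>
 define T where "T = (\<lambda>z m u. c z - (LINT x|M. A z x * m x) - (LINT x|M. B z x * u x))"
 have eA: "eb (A z)" and eB: "eb (B z)" if "z \<in> Z" for z
  using that by (auto intro!: eb_opA eb_opB simp: A_def B_def Z_def H_affine_def H_nonneg_def)
 have T: "F (fst z) (snd z) (\<lambda>x. fst z x - m x) (\<lambda>x. snd z x - u x) = T z m u"
  if "z \<in> Z" "integrable M m" "integrable M u" for z m u
  using mfg_F_split[of "fst z" "snd z" m u] that by (auto simp: Z_def T_def A_def B_def c_def)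
 \<comment> \<open>Test pairs are sorted by a common bound on their coefficients, since only under
   such a bound does \<open>L1\<close> closeness of coefficients carry over to pairings with the
   limits \<open>m0\<close> and \<open>u\<close>.\<close>
 define ZN where "ZN = (\<lambda>N::nat. {z \<in> Z. (AE x in M. \<bar>A z x\<bar> \<le> real N) \<and> (AE x in M. \<bar>B z x\<bar> \<le> real N)})"
 define dense where "dense = (\<lambda>N Z0. Z0 \<subseteq> ZN N \<and> countable Z0 \<and> (\<forall>z\<in>ZN N. \<forall>eps>0. \<exists>y\<in>Z0.
  (LINT x|M. \<bar>A z x - A y x\<bar>) < eps \<and> (LINT x|M. \<bar>B z x - B y x\<bar>) < eps \<and> \<bar>c z - c y\<bar> < eps))"
 have "\<exists>Z0. dense N Z0" for N
  unfolding dense_def using countable_L1_dense_family[OF dom_sets, of "ZN N" A B c] ebi eA eB by (auto simp: ZN_def)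
 then obtain Z0 where Z0: "\<And>N. dense N (Z0 N)" by metis
 define ref where "ref = ((\<lambda>x. 1, h) :: ('a \<Rightarrow> real) \<times> ('a \<Rightarrow> real))"
 \<comment> \<open>The reference pair makes \<open>D\<close> nonempty, as the enumeration by
   \<open>from_nat_into\<close> requires.\<close>
 define D where "D = insert ref (\<Union>N. Z0 N)"
 have refZ: "ref \<in> Z" by (simp add: ref_def Z_def one_H_nonneg h_H_affine)
 have cD: "countable D" using Z0 by (auto simp: D_def dense_def)
 have Z0Z: "Z0 N \<subseteq> ZN N" for N using Z0[of N] by (simp add: dense_def)
 have ZNZ: "ZN N \<subseteq> Z" for N by (auto simp: ZN_def)
 have DZ: "D \<subseteq> Z" unfolding D_def using Z0Z ZNZ refZ by blast
 define zs where "zs = from_nat_into D"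
 have zs: "range zs = D" unfolding zs_def by (rule range_from_nat_into[OF _ cD]) (simp add: D_def)
 have zsZ: "zs i \<in> Z" for i using zs DZ by blast
 obtain K where K: "\<And>\<eta> v. \<eta> \<in> HN ==> v \<in> HA ==>
   F \<eta> v (\<lambda>x. 1 - \<eta> x) (\<lambda>x. h x - v x) \<ge> 0 ==>
   (LINT x|M. \<eta> x * g (\<eta> x)) \<le> K \<and> (LINT x|M. norm (grad v x) powr \<gamma>) \<le> K"
  using a_priori_estimate[OF p A1 A2 A3 A4 A5] by blast
 have Tcomb: "T z (\<lambda>x. (1 - t) * m x + t * m' x) (\<lambda>x. (1 - t) * u x + t * u' x) = (1 - t) * T z m u + t * T z m' u'"
  if z: "z \<in> Z" and "integrable M m" "integrable M m'" "integrable M u" "integrable M u'" for z t m m' u u'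
 proof -
  have lin: "(LINT x|M. f x * ((1 - t) * a x + t * b x)) = (1 - t) * (LINT x|M. f x * a x) + t * (LINT x|M. f x * b x)"
   if "eb f" "integrable M a" "integrable M b" for f a b
  proof -
   have "f x * ((1 - t) * a x + t * b x) = (1 - t) * (f x * a x) + t * (f x * b x)" for x by (simp add: algebra_simps)
   then show ?thesis
    using ess_bounded_mult_integrable[OF that(1,2)] ess_bounded_mult_integrable[OF that(1,3)] by simp
  qed
  show ?thesis unfolding T_def using lin[OF eA[OF z]] lin[OF eB[OF z]] that by (simp add: algebra_simps)
 qed
 define Q where "Q = (\<lambda>n m u. m \<in> HN \<and> u \<in> HA \<and> (\<forall>i\<le>n. T (zs i) m u \<ge> - (1 / real (Suc n))) \<and>
   (LINT x|M. m x * g (m x)) \<le> K \<and> (LINT x|M. norm (grad u x) powr \<gamma>) \<le> K)"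
 have "\<exists>m u. Q n m u" for n :: nat
 proof -
  \<comment> \<open>Vertex \<open>0\<close> is the reference pair and the vertices \<open>1\<close>
    to \<open>n + 1\<close> are the test pairs \<open>zs 0\<close> to \<open>zs n\<close>, hence
    \<open>n + 2\<close> vertices.\<close>
  define y where "y = (\<lambda>i. if i = 0 then ref else zs (i - 1))"
  have yZ: "y i \<in> Z" for i using zsZ refZ by (simp add: y_def)
  define sol where "sol = (\<lambda>m u i. F (fst (y i)) (snd (y i)) (\<lambda>x. fst (y i) x - m x) (\<lambda>x. snd (y i) x - u x) \<ge> 0 \<and> m \<in> HN \<and> u \<in> HA \<and>
   (\<forall>t. 0 < t \<longrightarrow> t \<le> 1 \<longrightarrow> (let m' = (\<lambda>x. (1 - t) * m x + t * fst (y i) x); u' = (\<lambda>x. (1 - t) * u x + t * snd (y i) x)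
    in m' \<in> HN \<and> u' \<in> HA \<and> F m' u' (\<lambda>x. fst (y i) x - m' x) (\<lambda>x. snd (y i) x - u' x) \<ge> 0)))"
  have "\<exists>m u. \<forall>i<n + 2. sol m u i"
   unfolding sol_def by (rule finite_solution[OF A7]) (use yZ in \<open>auto simp: Z_def mem_Times_iff\<close>)
  then obtain m u where "\<And>i. i < n + 2 ==> sol m u i" by blast
  note sol = this[unfolded sol_def]
  have mi: "integrable M m" "integrable M u" using ebi eb_H_nonneg eb_H_affine sol[of 0] by auto
  have ri: "integrable M (fst ref)" "integrable M (snd ref)" using ebi eb_H_nonneg eb_H_affine refZ by (auto simp: Z_def)
  have Tm: "T (zs i) m u \<ge> 0" if "i \<le> n" for i
   using sol[of "Suc i"] that T[OF zsZ mi] by (simp add: y_def)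
  define b where "b = (\<Sum>i\<le>n. \<bar>T (zs i) (fst ref) (snd ref)\<bar>)"
  have b: "\<bar>T (zs i) (fst ref) (snd ref)\<bar> \<le> b" if "i \<le> n" for i unfolding b_def using that by (intro member_le_sum) auto
  have b0: "b \<ge> 0" unfolding b_def by (intro sum_nonneg) auto
  \<comment> \<open>Moving by \<open>t\<close> towards the reference pair costs at most
    \<open>t * b\<close> in each of the inequalities. With \<open>q\<close> in place of
    \<open>b\<close> the product \<open>t * q\<close> is exactly \<open>1 / (n + 1)\<close>, and
    \<open>q \<ge> 1\<close> ensures \<open>t \<le> 1\<close>.\<close>
  define q where "q = b + 1"
  define t where "t = 1 / real (Suc n) / q"
  have q: "q \<ge> 1" using b0 by (simp add: q_def)
  then have tb: "t * q = 1 / real (Suc n)" and t0: "t > 0" by (simp_all add: t_def)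
  have "t * 1 \<le> t * q" using t0 q by (intro mult_left_mono) auto
  also have "\<dots> \<le> 1" unfolding tb by simp
  finally have t1: "t \<le> 1" by simp
  define m' where "m' = (\<lambda>x. (1 - t) * m x + t * fst ref x)"
  define u' where "u' = (\<lambda>x. (1 - t) * u x + t * snd ref x)"
  have "m' \<in> HN" "u' \<in> HA" "F m' u' (\<lambda>x. 1 - m' x) (\<lambda>x. h x - u' x) \<ge> 0"
   using sol[of 0] t0 t1 by (auto simp: Let_def y_def m'_def u'_def ref_def)
  moreover have "T (zs i) m' u' \<ge> - (1 / real (Suc n))" if i: "i \<le> n" for i
  proof -
   have "T (zs i) m' u' = (1 - t) * T (zs i) m u + t * T (zs i) (fst ref) (snd ref)"
    unfolding m'_def u'_def by (rule Tcomb[OF zsZ mi(1) ri(1) mi(2) ri(2)])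
   moreover have "(1 - t) * T (zs i) m u \<ge> 0" using Tm[OF i] t1 by simp
   moreover have "t * T (zs i) (fst ref) (snd ref) \<ge> t * (- q)" using b[OF i] t0 by (intro mult_left_mono) (auto simp: q_def)
   ultimately show ?thesis using tb by simp
  qed
  ultimately show ?thesis using K unfolding Q_def by blast
 qed
 then obtain ms us where Q: "\<And>n. Q n (ms n) (us n)" by metis
 have ms: "ms n \<in> HN" "integrable M (ms n)" "AE x in M. ms n x \<ge> 0" for n
  using Q[of n] ebi[OF eb_H_nonneg] by (auto simp: Q_def H_nonneg_def)
 have us: "us n \<in> HA" for n using Q[of n] by (simp add: Q_def)
 have "(SUP j. ext_integral M (\<lambda>x. ms j x * g (ms j x))) \<le> ereal K"
 proof (rule SUP_least)
  fix j
  have "integrable M (\<lambda>x. ms j x * g (ms j x))"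
   by (intro ebi ess_bounded_mult eb_H_nonneg g_compose_bounded ms)
  then show "ext_integral M (\<lambda>x. ms j x * g (ms j x)) \<le> ereal K"
   using Q[of j] by (simp add: ext_integral_integrable Q_def)
 qed
 then have "(SUP j. ext_integral M (\<lambda>x. ms j x * g (ms j x))) < \<infinity>" by (rule le_less_trans) simp
 then obtain r m0 where r: "strict_mono (r :: nat \<Rightarrow> nat)" and wk: "weakly_converges_L1 M (\<lambda>j. ms (r j)) m0"
  using A6[of ms] ms by (auto simp: L1_space_def)
 have m0: "integrable M m0" using wk by (simp add: weakly_converges_L1_def L1_space_def)
 have m0pos: "AE x in M. m0 x \<ge> 0" by (rule weakly_converges_nonneg[OF wk ms(3)])
 \<comment> \<open>The tolerance has numerator \<open>2\<close>: one unit is the error already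
   present in \<open>Q\<close>, the other pays for replacing the density by its weak limit
   \<open>m0\<close>.\<close>
 define C where "C = (\<lambda>n. {u \<in> HA. gradient_energy \<gamma> u \<le> real DIM('a) * K \<and> (\<forall>i\<le>n. T (zs i) m0 u \<ge> - (2 / real (Suc n)))})"
 have C_ne: "C n \<noteq> {}" for n
 proof -
  have "\<forall>\<^sub>F j in sequentially. \<forall>i\<in>{..n}. \<bar>(LINT x|M. A (zs i) x * ms (r j) x) - (LINT x|M. A (zs i) x * m0 x)\<bar> < 1 / real (Suc n)"
  proof (rule eventually_ball_finite, simp, rule ballI)
   fix i
   have "(\<lambda>j. (LINT x|M. A (zs i) x * ms (r j) x) - (LINT x|M. A (zs i) x * m0 x)) \<longlonglongrightarrow> 0"
    using weakly_converges_pairing[OF wk eA[OF zsZ]] by (simp add: LIM_zero)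
   then have "(\<lambda>j. \<bar>(LINT x|M. A (zs i) x * ms (r j) x) - (LINT x|M. A (zs i) x * m0 x)\<bar>) \<longlonglongrightarrow> 0" by (rule tendsto_rabs_zero)
   then show "\<forall>\<^sub>F j in sequentially. \<bar>(LINT x|M. A (zs i) x * ms (r j) x) - (LINT x|M. A (zs i) x * m0 x)\<bar> < 1 / real (Suc n)"
    by (rule order_tendstoD(2)) simp
  qed
  then obtain j0 where j0: "\<And>j i. j \<ge> j0 ==> i \<le> n ==> \<bar>(LINT x|M. A (zs i) x * ms (r j) x) - (LINT x|M. A (zs i) x * m0 x)\<bar> < 1 / real (Suc n)"
   by (auto simp: eventually_sequentially)
  \<comment> \<open>A strictly increasing \<open>r\<close> satisfies
    \<open>r j \<ge> j \<ge> n\<close>, so the chosen approximate solution obeys the first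
    \<open>n + 1\<close> inequalities with tolerance at most \<open>1 / (n + 1)\<close>.\<close>
  define j where "j = max j0 n"
  have j: "j \<ge> j0" "r j \<ge> n" using seq_suble[OF r, of j] by (auto simp: j_def)
  have "T (zs i) m0 (us (r j)) \<ge> - (2 / real (Suc n))" if i: "i \<le> n" for i
  proof -
   have "T (zs i) (ms (r j)) (us (r j)) \<ge> - (1 / real (Suc (r j)))" using Q[of "r j"] i j(2) by (simp add: Q_def)
   moreover have "1 / real (Suc (r j)) \<le> 1 / real (Suc n)" using j(2) by (intro divide_left_mono) auto
   moreover have "2 / real (Suc n) = 1 / real (Suc n) + 1 / real (Suc n)" by simp
   ultimately show ?thesis using j0[OF j(1) i] unfolding T_def by linarith
  qed
  moreover have "gradient_energy \<gamma> (us (r j)) \<le> real DIM('a) * K"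
  proof -
   have "us (r j) \<in> HS" using us by (simp add: H_affine_def)
   from gradient_energy_le[OF this p0]
   have "gradient_energy \<gamma> (us (r j)) \<le> real DIM('a) * (LINT x|M. norm (grad (us (r j)) x) powr \<gamma>)" .
   also have "\<dots> \<le> real DIM('a) * K" using Q[of "r j"] by (intro mult_left_mono) (auto simp: Q_def)
   finally show ?thesis .
  qed
  ultimately have "us (r j) \<in> C n" using us by (simp add: C_def)
  then show ?thesis by blast
 qed
 have "\<exists>w. (\<forall>n. w n \<in> C n) \<and> (\<forall>e>0. \<exists>N. \<forall>i\<ge>N. \<forall>j\<ge>N. gradient_energy \<gamma> (\<lambda>x. w i x - w j x) < e)"
 proof (rule near_minimisers_cauchy[OF p _ C_ne])
  show "C n \<subseteq> HS" for n by (auto simp: C_def H_affine_def)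
  show "C (Suc n) \<subseteq> C n" for n
  proof
   fix u assume u: "u \<in> C (Suc n)"
   have le: "2 / real (Suc (Suc n)) \<le> 2 / real (Suc n)" by (intro divide_left_mono) auto
   have "T (zs i) m0 u \<ge> - (2 / real (Suc n))" if "i \<le> n" for i
   proof -
    have "T (zs i) m0 u \<ge> - (2 / real (Suc (Suc n)))" using u that by (auto simp: C_def)
    then show ?thesis using le by linarith
   qed
   then show "u \<in> C n" using u by (simp add: C_def)
  qed
  show "(\<lambda>x. 1 / 2 * u x + 1 / 2 * v x) \<in> C n" if u: "u \<in> C n" and v: "v \<in> C n" for n u v
  proof -
   have uv: "u \<in> HA" "v \<in> HA" using u v by (auto simp: C_def)
   then have "u \<in> HS" "v \<in> HS" by (auto simp: H_affine_def)
   from gradient_energy_midpoint[OF p this]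
   have "gradient_energy \<gamma> (\<lambda>x. 1 / 2 * u x + 1 / 2 * v x) \<le> (gradient_energy \<gamma> u + gradient_energy \<gamma> v) / 2" .
   also have "\<dots> \<le> real DIM('a) * K" using u v by (simp add: C_def)
   finally have J: "gradient_energy \<gamma> (\<lambda>x. 1 / 2 * u x + 1 / 2 * v x) \<le> real DIM('a) * K" .
   have "T (zs i) m0 (\<lambda>x. 1 / 2 * u x + 1 / 2 * v x) \<ge> - (2 / real (Suc n))" if "i \<le> n" for i
   proof -
    have "T (zs i) m0 u \<ge> - (2 / real (Suc n))" "T (zs i) m0 v \<ge> - (2 / real (Suc n))" using u v that by (auto simp: C_def)
    moreover have "T (zs i) m0 (\<lambda>x. 1 / 2 * u x + 1 / 2 * v x) = 1 / 2 * T (zs i) m0 u + 1 / 2 * T (zs i) m0 v"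
     using Tcomb[OF zsZ[of i] m0 m0 uv[THEN eb_H_affine, THEN ebi], of "1 / 2"] by (simp add: algebra_simps)
    ultimately show ?thesis by linarith
   qed
   then show ?thesis using J H_affine_midpoint[OF uv] by (simp add: C_def)
  qed
  show "gradient_energy \<gamma> u \<le> real DIM('a) * K" if "u \<in> C n" for n u using that by (simp add: C_def)
 qed
 then obtain w where w: "\<And>n. w n \<in> C n" "\<And>e. e > 0 ==> \<exists>N. \<forall>i\<ge>N. \<forall>j\<ge>N. gradient_energy \<gamma> (\<lambda>x. w i x - w j x) < e" by blast
 have wA: "w n \<in> HA" for n using w(1)[of n] by (simp add: C_def)
 obtain u where u: "u \<in> sobolev S 1 \<gamma>" "has_trace S \<gamma> u h" "(\<lambda>n. \<integral>x. \<bar>w n x - u x\<bar> powr \<gamma> \<partial>M) \<longlonglongrightarrow> 0"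
  using gradient_cauchy_limit[OF p wA w(2)] by blast
 have uLp: "u \<in> Lp_space \<gamma> M" using u(1) by (simp add: sobolev_def)
 have ui: "integrable M u" by (rule Lp_space_L1(1)[OF finite_M p zero_less_one uLp])
 have wLp: "w n \<in> Lp_space \<gamma> M" for n by (rule ess_bounded_Lp[OF finite_M p0 eb_H_affine[OF wA]])
 have Tzs: "T (zs i) m0 u \<ge> 0" for i
 proof (rule LIMSEQ_le)
  show "(\<lambda>n. - (2 / real (Suc n))) \<longlonglongrightarrow> 0" using tendsto_mult_right[OF LIMSEQ_Suc[OF lim_1_over_n], of "- 2"] by simp
  show "(\<lambda>n. T (zs i) m0 (w n)) \<longlonglongrightarrow> T (zs i) m0 u"
   unfolding T_def by (intro tendsto_diff tendsto_const Lp_tendsto_pairing[OF finite_M p wLp uLp u(3) eB[OF zsZ]])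
  show "\<exists>N. \<forall>n\<ge>N. - (2 / real (Suc n)) \<le> T (zs i) m0 (w n)" using w(1) by (intro exI[of _ i]) (auto simp: C_def)
 qed
 have TZ: "T z m0 u \<ge> 0" if z: "z \<in> Z" for z
 proof (rule ccontr)
  assume "\<not> T z m0 u \<ge> 0"
  \<comment> \<open>Passing from \<open>z\<close> to a nearby \<open>y\<close> changes the constant
    term and the two pairings by less than \<open>eps\<close> each, which cannot lift
    \<open>- 3 * eps\<close> to the nonnegative value at \<open>y\<close>.\<close>
  define eps where "eps = - T z m0 u / 3"
  have eps: "eps > 0" "T z m0 u = - 3 * eps" using `\<not> T z m0 u \<ge> 0` by (auto simp: eps_def)
  obtain CA where CA: "CA > 0" "AE x in M. \<bar>A z x\<bar> \<le> CA" by (rule ess_boundedE[OF eA[OF z]])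
  obtain CB where CB: "CB > 0" "AE x in M. \<bar>B z x\<bar> \<le> CB" by (rule ess_boundedE[OF eB[OF z]])
  obtain N :: nat where N: "max CA CB \<le> real N" using real_arch_simple by blast
  have zN: "z \<in> ZN N"
  proof -
   have "AE x in M. \<bar>A z x\<bar> \<le> real N" using CA(2) by eventually_elim (use N in auto)
   moreover have "AE x in M. \<bar>B z x\<bar> \<le> real N" using CB(2) by eventually_elim (use N in auto)
   ultimately show ?thesis using z by (simp add: ZN_def)
  qed
  have N2: "2 * real N \<ge> 0" by simp
  obtain d1 where d1: "d1 > 0" "\<And>f. integrable M f ==> AE x in M. \<bar>f x\<bar> \<le> 2 * real N ==> (LINT x|M. \<bar>f x\<bar>) < d1 ==> \<bar>\<integral>x. f x * m0 x \<partial>M\<bar> < eps"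
   using small_L1_pairing[OF m0 eps(1) N2] by blast
  obtain d2 where d2: "d2 > 0" "\<And>f. integrable M f ==> AE x in M. \<bar>f x\<bar> \<le> 2 * real N ==> (LINT x|M. \<bar>f x\<bar>) < d2 ==> \<bar>\<integral>x. f x * u x \<partial>M\<bar> < eps"
   using small_L1_pairing[OF ui eps(1) N2] by blast
  have "min eps (min d1 d2) > 0" using eps d1 d2 by simp
  then obtain y where y: "y \<in> Z0 N" "(LINT x|M. \<bar>A z x - A y x\<bar>) < min eps (min d1 d2)"
   "(LINT x|M. \<bar>B z x - B y x\<bar>) < min eps (min d1 d2)" "\<bar>c z - c y\<bar> < min eps (min d1 d2)"
   using Z0[of N] zN unfolding dense_def by blast
  have yN: "y \<in> ZN N" using y(1) Z0[of N] by (auto simp: dense_def)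
  then have yZ: "y \<in> Z" by (simp add: ZN_def)
  have "y \<in> D" using y(1) by (auto simp: D_def)
  then have Ty: "T y m0 u \<ge> 0" using zs Tzs by (metis rangeE)
  have close: "AE x in M. \<bar>f x - f' x\<bar> \<le> 2 * real N" if "AE x in M. \<bar>f x\<bar> \<le> real N" "AE x in M. \<bar>f' x\<bar> \<le> real N" for f f'
   using that by eventually_elim linarith
  have "\<bar>\<integral>x. (A z x - A y x) * m0 x \<partial>M\<bar> < eps"
   using y(2) zN yN by (intro d1(2) close ebi ess_bounded_diff eA z yZ) (auto simp: ZN_def)
  moreover have "\<bar>\<integral>x. (B z x - B y x) * u x \<partial>M\<bar> < eps"
   using y(3) zN yN by (intro d2(2) close ebi ess_bounded_diff eB z yZ) (auto simp: ZN_def)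
  moreover have "(LINT x|M. (A z x - A y x) * m0 x) = (LINT x|M. A z x * m0 x) - (LINT x|M. A y x * m0 x)"
   using ess_bounded_mult_integrable[OF eA m0] z yZ by (simp add: left_diff_distrib)
  moreover have "(LINT x|M. (B z x - B y x) * u x) = (LINT x|M. B z x * u x) - (LINT x|M. B y x * u x)"
   using ess_bounded_mult_integrable[OF eB ui] z yZ by (simp add: left_diff_distrib)
  ultimately show False using y(4) Ty eps(2) unfolding T_def by linarith
 qed
 show ?thesis
 proof (intro bexI conjI ballI)
  show "m0 \<in> L1_space M" using m0 by (simp add: L1_space_def)
  show "F \<eta> v (\<lambda>x. \<eta> x - m0 x) (\<lambda>x. v x - u x) \<ge> 0"
   if "\<eta> \<in> HN" "v \<in> HA" for \<eta> v
   using TZ[of "(\<eta>, v)"] T[of "(\<eta>, v)" m0 u] that m0 ui by (simp add: Z_def)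
 qed (fact u(1) u(2) m0pos)+
qed

end

theorem theorem1p2:
  fixes \<Omega> :: "'a::euclidean_space set"
    and \<gamma> :: real and k :: nat
    and V \<phi> h :: "'a \<Rightarrow> real"
    and g :: "real \<Rightarrow> real"
    and H :: "'a \<Rightarrow> 'a \<Rightarrow> real"
  assumes "open \<Omega>" and "bounded \<Omega>" and "smooth_boundary \<Omega>"
    and "\<gamma> > 1"
    and "2 * real k > real DIM('a) / 2 + 2"
    and "smooth_on_closure \<Omega> V" and "smooth_on_closure \<Omega> \<phi>" and "smooth_on_closure \<Omega> h"
    and "smooth_on_closure {0<..} g"
    and "smooth_on_closure (\<Omega> \<times> UNIV) (\<lambda>(x, p). H x p)"
    and "mono_on {0..} g"
    and "\<forall>x\<in>\<Omega>. \<phi> x \<ge> 0"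
    and "(\<integral>x. \<phi> x \<partial>lebesgue_on \<Omega>) = 1"
    and A1: "\<exists>C1>0. \<forall>x\<in>\<Omega>. \<forall>p.
        - H x p + gradient (H x) p \<bullet> p \<ge> 1 / C1 * norm p powr \<gamma> - C1"
    and A2: "\<exists>C2>0. \<forall>x\<in>\<Omega>. \<forall>p. H x p \<ge> 1 / C2 * norm p powr \<gamma> - C2"
    and A3: "\<exists>C3>0. \<forall>x\<in>\<Omega>. \<forall>p. norm (gradient (H x) p) \<le> C3 * norm p powr (\<gamma> - 1) + C3"
    and A4: "\<forall>\<delta>>0. \<exists>C\<delta>>0. \<forall>m\<in>L1_space (lebesgue_on \<Omega>).
        (AE x in lebesgue_on \<Omega>. m x \<ge> 0) \<longrightarrow>
          max (ext_integral (lebesgue_on \<Omega>) (\<lambda>x. \<bar>g (m x)\<bar>)) (ext_integral (lebesgue_on \<Omega>) m)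
            \<le> ereal \<delta> * ext_integral (lebesgue_on \<Omega>) (\<lambda>x. m x * g (m x)) + ereal C\<delta>"
    and A5: "\<exists>C5>0. \<forall>m\<in>L1_space (lebesgue_on \<Omega>).
        (AE x in lebesgue_on \<Omega>. m x \<ge> 0) \<longrightarrow>
          ext_integral (lebesgue_on \<Omega>) (\<lambda>x. m x * g (m x)) \<ge> ereal (- C5)"
    and A6: "\<forall>m :: nat \<Rightarrow> 'a \<Rightarrow> real.
        (\<forall>j. m j \<in> L1_space (lebesgue_on \<Omega>) \<and> (AE x in lebesgue_on \<Omega>. m j x \<ge> 0)) \<longrightarrow>
        (SUP j. ext_integral (lebesgue_on \<Omega>) (\<lambda>x. m j x * g (m j x))) < \<infinity> \<longrightarrow>
          (\<exists>r m0. strict_mono (r :: nat \<Rightarrow> nat) \<and>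
             weakly_converges_L1 (lebesgue_on \<Omega>) (\<lambda>j. m (r j)) m0)"
    and A7: "\<forall>\<eta>1\<in>H_nonneg \<Omega> (2 * k). \<forall>v1\<in>H_affine \<Omega> (2 * k) h.
        \<forall>\<eta>2\<in>H_nonneg \<Omega> (2 * k). \<forall>v2\<in>H_affine \<Omega> (2 * k) h.
          mfg_F \<Omega> H g V \<phi> \<eta>1 v1 (\<lambda>x. \<eta>1 x - \<eta>2 x) (\<lambda>x. v1 x - v2 x)
            - mfg_F \<Omega> H g V \<phi> \<eta>2 v2 (\<lambda>x. \<eta>1 x - \<eta>2 x) (\<lambda>x. v1 x - v2 x) \<ge> 0"
  shows "\<exists>m\<in>L1_space (lebesgue_on \<Omega>). \<exists>u\<in>sobolev \<Omega> 1 \<gamma>.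
      has_trace \<Omega> \<gamma> u h \<and> (AE x in lebesgue_on \<Omega>. m x \<ge> 0) \<and>
      (\<forall>\<eta>\<in>H_nonneg \<Omega> (2 * k). \<forall>v\<in>H_affine \<Omega> (2 * k) h.
         mfg_F \<Omega> H g V \<phi> \<eta> v (\<lambda>x. \<eta> x - m x) (\<lambda>x. v x - u x) \<ge> 0)"
proof -
  interpret mfg_data \<Omega> k V \<phi> h g H
    by unfold_locales (fact assms)+
  show ?thesis
  proof (rule weak_solution_exists[OF \<open>\<gamma> > 1\<close> A1 A2 A3 A4 A5])
    fix m :: "nat \<Rightarrow> 'a \<Rightarrow> real"
    assume "\<And>j. m j \<in> L1_space (lebesgue_on \<Omega>)" "\<And>j. AE x in lebesgue_on \<Omega>. m j x \<ge> 0"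
      "(SUP j. ext_integral (lebesgue_on \<Omega>) (\<lambda>x. m j x * g (m j x))) < \<infinity>"
    then show "\<exists>r m0. strict_mono (r :: nat \<Rightarrow> nat) \<and> weakly_converges_L1 (lebesgue_on \<Omega>) (\<lambda>j. m (r j)) m0"
      using A6 by blast
  qed (use A7 in blast)
qed

end
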